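(* Let $u\in V$ be the solution of the Kirchhoff plate problem $a(u,v)=l(v)$ for all $v\in V$, and let $u_h\in V_h$ be its conforming finite element approximation, i.e. $a(u_h,v_h)=l(v_h)$ for all $v_h\in V_h$. Then there is a constant $C>0$ independent of the finite element mesh such that $$\|u-u_h\|_{2}\le C\,\eta ,$$ where $\|\cdot\|_2$ is the $H^2(\Omega)$-norm and the error estimator $\eta\ge 0$ is defined by $$\begin{aligned}\eta^2={}&\sum_{K\in\mathcal C_h}h_K^4\|\mathcal A(u_h)-f\|_{0,K}^2+\sum_{E\in\mathcal E_h^S}h_E^3\|\llbracket V_n(u_h)\rrbracket-g\|_{0,E}^2+\sum_{E\in\mathcal E_h^i\setminus\mathcal E_h^S}h_E^3\|\llbracket V_n(u_h)\rrbracket\|_{0,E}^2\\&+\sum_{E\in\mathcal E_h^i}h_E\|\llbracket M_{nn}(u_h)\rrbracket\|_{0,E}^2+\sum_{E\in\mathcal E_h^f}h_E^3\|V_n(u_h)\|_{0,E}^2+\sum_{E\in\mathcal E_h^f\cup\mathcal E_h^s}h_E\|M_{nn}(u_h)\|_{0,E}^2 .\end{aligned}$$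
   Context: **Plate model.** $\Omega\subset\mathbb R^2$ is a polygonal domain with $\partial\Omega=\Gamma_{\mathrm c}\cup\Gamma_{\mathrm s}\cup\Gamma_{\mathrm f}$ (clamped, simply supported and free parts). The plate thickness is $d>0$, Young's modulus is $E>0$ and Poisson ratio is $\nu$ (with the usual admissible range $-1<\nu\le 1/2$). For $A\in\mathbb R^{2\times2}$, $\mathbb C A=\frac{E}{1+\nu}\big(A+\frac{\nu}{1-\nu}(\operatorname{tr}A)I\big)$. For a scalar function $w$: curvature $\boldsymbol K(w)=-\boldsymbol\varepsilon(\nabla w)$, with $\boldsymbol\varepsilon(\boldsymbol v)=\frac12(\nabla\boldsymbol v+\nabla\boldsymbol v^T)$; moment tensor $\boldsymbol M(w)=\frac{d^3}{12}\mathbb C\boldsymbol K(w)$; shear force $\boldsymbol Q(w)=\operatorname{\mathbf{div}}\boldsymbol M(w)$ (row-wise divergence); $\mathcal A(w)=-\operatorname{div}\boldsymbol Q(w)=D\Delta^2w$ with $D=\frac{Ed^3}{12(1-\nu^2)}$. The expression $\mathcal A(v_h)$ for finite element functions is understood elementwise. The loads are $f\in L^2(\Omega)$, a line load $g\in L^2(S)$ along a line $S\subset\Omega$, and a point load $F\in\mathbb R$ at an interior point $x_0\in\Omega$. Set $$V=\{v\in H^2(\Omega): v|_{\Gamma_{\mathrm c}\cup\Gamma_{\mathrm s}}=0,\ \nabla v\cdot\boldsymbol n|_{\Gamma_{\mathrm c}}=0\},$$ $$a(w,v)=\int_\Omega\boldsymbol M(w):\boldsymbol K(v)\,dx,\qquad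 l(v)=\int_\Omega fv\,dx+\int_Sgv\,ds+Fv(x_0).$$ The boundary conditions are assumed to be such that $a$ is coercive on $V$ with respect to the $H^2(\Omega)$-norm. **Boundary quantities.** On the boundary of a (sub)domain with unit outward normal $\boldsymbol n$ and unit tangent $\boldsymbol s$: $Q_n(w)=\boldsymbol Q(w)\cdot\boldsymbol n$, $M_{nn}(w)=\boldsymbol n\cdot\boldsymbol M(w)\boldsymbol n$, $M_{ns}(w)=\boldsymbol s\cdot\boldsymbol M(w)\boldsymbol n$, and the Kirchhoff shear force is $V_n(w)=Q_n(w)+\frac{\partial M_{ns}(w)}{\partial s}$. **Mesh.** $\mathcal C_h$ is a shape regular (conforming) triangulation of $\Omega$, with $x_0$ a mesh node, $S$ a union of (interior) element edges, and each boundary edge contained in one of $\Gamma_{\mathrm c},\Gamma_{\mathrm s},\Gamma_{\mathrm f}$. $h_K$, $h_E$ are the sizes (diameters) of the triangle $K$ and the edge $E$. $\mathcal E_h$ is the set of all edges, $\mathcal E_h^i$ the interior edges, $\mathcal E_h^S\subset\mathcal E_h^i$ the edges on $S$, $\mathcal E_h^f$ the edges on $\Gamma_{\mathrm f}$, and $\mathcal E_h^s$ the edges on $\Gamma_{\mathrm s}$. $\|\cdot\|_{0,K}$, $\|\cdot\|_{0,E}$ are $L^2$-norms. For an interior edge $E=K\cap K'$ with outward normals $\boldsymbol n,\boldsymbol n'$ of $K,K'$, $$\llbracket M_{nn}(v)\rrbracket|_E=M_{nn}(v)-M_{n'n'}(v),\qquad \llbracket V_n(v)\rrbracket|_E=V_n(v)+V_{n'}(v),$$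 where the unprimed quantities are computed from $v|_K$ and the primed ones from $v|_{K'}$. **Finite element space.** $V_h\subset V$ is a conforming space of $C^1$ functions that are polynomials of a fixed maximal degree on each $K\in\mathcal C_h$, e.g. built from Bell triangles (polynomials in $P_5(K)$ with normal derivative in $P_3(E)$ on each edge; degrees of freedom: values, first and second derivatives at the vertices), from Argyris triangles ($P_5(K)$; the Bell degrees of freedom plus normal derivatives at edge midpoints), or from higher-order generalizations of the Argyris triangle. There is a (Girault–Scott) interpolation operator $\Pi_h:V\to V_h$ that uses the point values at the vertices (so $\Pi_hw=w$ at all mesh vertices) and satisfies, with a constant $C$ independent of the mesh, $$\sum_{K\in\mathcal C_h}h_K^{-4}\|w-\Pi_hw\|_{0,K}^2+\sum_{E\in\mathcal E_h}h_E^{-1}\|\nabla(w-\Pi_hw)\|_{0,E}^2+\sum_{E\in\mathcal E_h}h_E^{-3}\|w-\Pi_hw\|_{0,E}^2\le C\|w\|_2^2,\qquad \|\Pi_hw\|_2\le C\|w\|_2 .$$ "Independent of the mesh" means: depending only on $\Omega$, the boundary partition, the material parameters, the shape-regularity constant and the type/degree of element, and not on the loads, the functions involved, or the mesh sizes. *)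

theory Defs
  imports "HOL-Analysis.Analysis"
begin

type_synonym pt = "real^2"

section \<open>Square-integrable functions\<close>

definition L2 :: "'a measure \<Rightarrow> ('a \<Rightarrow> 'b::euclidean_space) \<Rightarrow> bool" where
  "L2 M f \<longleftrightarrow> f \<in> borel_measurable M \<and> integrable M (\<lambda>x. (norm (f x))\<^sup>2)"

definition L2norm :: "'a measure \<Rightarrow> ('a \<Rightarrow> 'b::euclidean_space) \<Rightarrow> real" where
  "L2norm M f = sqrt (LINT x|M. (norm (f x))\<^sup>2)"

text \<open>Arc length on a line segment. The end points are determined by the segment up to
  their order, which does not change the measure.\<close>

definition arc_between :: "pt \<Rightarrow> pt \<Rightarrow> pt measure" where
  "arc_between a b = distr (restrict_space lborel {0..dist a b}) borel
     (\<lambda>t. a + (t / dist a b) *\<^sub>R (b - a))"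

definition arc :: "pt set \<Rightarrow> pt measure" where
  "arc E = (let e = (SOME e. E = closed_segment (fst e) (snd e)) in arc_between (fst e) (snd e))"

section \<open>Classical derivatives, smooth functions, polynomials\<close>

definition pd :: "2 \<Rightarrow> (pt \<Rightarrow> real) \<Rightarrow> pt \<Rightarrow> real" where
  "pd i f x = frechet_derivative f (at x) (axis i 1)"

definition hess :: "(pt \<Rightarrow> real) \<Rightarrow> pt \<Rightarrow> real^2^2" where
  "hess f x = (\<chi> i j. pd j (pd i f) x)"

primrec Ck :: "nat \<Rightarrow> (pt \<Rightarrow> real) \<Rightarrow> bool" where
  "Ck 0 f \<longleftrightarrow> continuous_on UNIV f"
| "Ck (Suc k) f \<longleftrightarrow> (\<forall>x. f differentiable (at x)) \<and> (\<forall>i. Ck k (pd i f))"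

definition smooth :: "(pt \<Rightarrow> real) \<Rightarrow> bool" where
  "smooth f \<longleftrightarrow> (\<forall>k. Ck k f)"

definition test_function :: "pt set \<Rightarrow> (pt \<Rightarrow> real) \<Rightarrow> bool" where
  "test_function \<Omega> f \<longleftrightarrow> smooth f \<and> (\<exists>K. compact K \<and> K \<subseteq> \<Omega> \<and> (\<forall>x. x \<notin> K \<longrightarrow> f x = 0))"

definition C1_closure :: "pt set \<Rightarrow> (pt \<Rightarrow> real) \<Rightarrow> bool" where
  "C1_closure \<Omega> f \<longleftrightarrow> continuous_on (closure \<Omega>) f \<and>
     (\<exists>G. continuous_on (closure \<Omega>) G \<and> (\<forall>x\<in>\<Omega>. GDERIV f x :> G x))"

definition polys :: "nat \<Rightarrow> (pt \<Rightarrow> real) set" where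
  "polys k = {p. \<exists>c. \<forall>x. p x = (\<Sum>i\<le>k. \<Sum>j\<le>k - i. c i j * (x $ 1) ^ i * (x $ 2) ^ j)}"

section \<open>Sobolev spaces and traces\<close>

text \<open>Sobolev functions are represented by real functions on the plane; values outside the
  domain are irrelevant. Weak gradients are unique almost everywhere, so every use of the
  choice \<open>wgrad\<close> below is independent of the representative chosen.\<close>

definition has_weak_grad :: "pt set \<Rightarrow> (pt \<Rightarrow> real) \<Rightarrow> (pt \<Rightarrow> pt) \<Rightarrow> bool" where
  "has_weak_grad \<Omega> u G \<longleftrightarrow> L2 (lebesgue_on \<Omega>) G \<and>
     (\<forall>\<phi> i. test_function \<Omega> \<phi> \<longrightarrow>
        (LINT x|lebesgue_on \<Omega>. u x * pd i \<phi> x) = - (LINT x|lebesgue_on \<Omega>. G x $ i * \<phi> x))"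

definition wgrad :: "pt set \<Rightarrow> (pt \<Rightarrow> real) \<Rightarrow> pt \<Rightarrow> pt" where
  "wgrad \<Omega> u = (SOME G. has_weak_grad \<Omega> u G)"

definition whess :: "pt set \<Rightarrow> (pt \<Rightarrow> real) \<Rightarrow> pt \<Rightarrow> real^2^2" where
  "whess \<Omega> u x = (\<chi> i. wgrad \<Omega> (\<lambda>y. wgrad \<Omega> u y $ i) x)"

definition H1 :: "pt set \<Rightarrow> (pt \<Rightarrow> real) set" where
  "H1 \<Omega> = {u. L2 (lebesgue_on \<Omega>) u \<and> (\<exists>G. has_weak_grad \<Omega> u G)}"

definition H2 :: "pt set \<Rightarrow> (pt \<Rightarrow> real) set" where
  "H2 \<Omega> = {u \<in> H1 \<Omega>. \<forall>i. (\<lambda>x. wgrad \<Omega> u x $ i) \<in> H1 \<Omega>}"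

definition H1norm :: "pt set \<Rightarrow> (pt \<Rightarrow> real) \<Rightarrow> real" where
  "H1norm \<Omega> u = sqrt ((L2norm (lebesgue_on \<Omega>) u)\<^sup>2 + (L2norm (lebesgue_on \<Omega>) (wgrad \<Omega> u))\<^sup>2)"

definition H2norm :: "pt set \<Rightarrow> (pt \<Rightarrow> real) \<Rightarrow> real" where
  "H2norm \<Omega> u = sqrt ((L2norm (lebesgue_on \<Omega>) u)\<^sup>2 + (L2norm (lebesgue_on \<Omega>) (wgrad \<Omega> u))\<^sup>2
      + (L2norm (lebesgue_on \<Omega>) (whess \<Omega> u))\<^sup>2)"

text \<open>The trace on a segment in the closure of the domain, as the extension by density of the
  restriction of smooth functions.\<close>

definition has_trace :: "pt set \<Rightarrow> pt set \<Rightarrow> (pt \<Rightarrow> real) \<Rightarrow> (pt \<Rightarrow> real) \<Rightarrow> bool" where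
  "has_trace \<Omega> E w \<tau> \<longleftrightarrow> w \<in> H1 \<Omega> \<and> L2 (arc E) \<tau> \<and>
     (\<exists>\<phi>. (\<forall>k::nat. smooth (\<phi> k)) \<and>
          (\<lambda>k. H1norm \<Omega> (\<lambda>x. \<phi> k x - w x)) \<longlonglongrightarrow> 0 \<and>
          (\<lambda>k. L2norm (arc E) (\<lambda>x. \<phi> k x - \<tau> x)) \<longlonglongrightarrow> 0)"

definition has_grad_trace :: "pt set \<Rightarrow> pt set \<Rightarrow> (pt \<Rightarrow> real) \<Rightarrow> (pt \<Rightarrow> pt) \<Rightarrow> bool" where
  "has_grad_trace \<Omega> E v \<tau> \<longleftrightarrow> (\<forall>i. has_trace \<Omega> E (\<lambda>x. wgrad \<Omega> v x $ i) (\<lambda>x. \<tau> x $ i))"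

definition grad_trace :: "pt set \<Rightarrow> pt set \<Rightarrow> (pt \<Rightarrow> real) \<Rightarrow> pt \<Rightarrow> pt" where
  "grad_trace \<Omega> E v = (SOME \<tau>. has_grad_trace \<Omega> E v \<tau>)"

section \<open>Polygonal domains\<close>

definition rot :: "pt \<Rightarrow> pt" where
  "rot x = vector [- (x $ 2), x $ 1]"

definition union_of_segments :: "pt set \<Rightarrow> bool" where
  "union_of_segments \<Gamma> \<longleftrightarrow> (\<exists>T :: (pt \<times> pt) set. finite T \<and> (\<forall>(a, b)\<in>T. a \<noteq> b) \<and>
     \<Gamma> = (\<Union>(a, b)\<in>T. closed_segment a b))"

text \<open>Near each boundary point the domain is, in a rotated orthonormal frame, the region below
  the graph of a Lipschitz function.\<close>

definition lipschitz_domain :: "pt set \<Rightarrow> bool" where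
  "lipschitz_domain \<Omega> \<longleftrightarrow> open \<Omega> \<and> connected \<Omega> \<and> bounded \<Omega> \<and> \<Omega> \<noteq> {} \<and>
     (\<forall>z\<in>frontier \<Omega>. \<exists>U e \<phi> L. open U \<and> z \<in> U \<and> norm e = 1 \<and> L-lipschitz_on (UNIV :: real set) \<phi> \<and>
        \<Omega> \<inter> U = {x \<in> U. x \<bullet> rot e < \<phi> (x \<bullet> e)})"

definition polygonal_domain :: "pt set \<Rightarrow> bool" where
  "polygonal_domain \<Omega> \<longleftrightarrow> lipschitz_domain \<Omega> \<and> union_of_segments (frontier \<Omega>)"

section \<open>Plate model\<close>

record plate =
  Omega :: "pt set"
  GammaC :: "pt set"
  GammaS :: "pt set"
  GammaF :: "pt set"
  thickness :: real
  young :: real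
  poisson :: real

record loading =
  body_load :: "pt \<Rightarrow> real"
  line :: "pt set"
  line_load :: "pt \<Rightarrow> real"
  point_load :: real
  load_point :: pt

definition plate_model :: "plate \<Rightarrow> bool" where
  "plate_model P \<longleftrightarrow> polygonal_domain (Omega P) \<and>
     frontier (Omega P) = GammaC P \<union> GammaS P \<union> GammaF P \<and>
     union_of_segments (GammaC P) \<and> union_of_segments (GammaS P) \<and> union_of_segments (GammaF P) \<and>
     finite (GammaC P \<inter> GammaS P) \<and> finite (GammaC P \<inter> GammaF P) \<and> finite (GammaS P \<inter> GammaF P) \<and>
     thickness P > 0 \<and> young P > 0 \<and> -1 < poisson P \<and> poisson P \<le> 1/2"

definition plate_loading :: "plate \<Rightarrow> loading \<Rightarrow> bool" where
  "plate_loading P L \<longleftrightarrow> L2 (lebesgue_on (Omega P)) (body_load L) \<and>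
     (\<exists>a b. a \<noteq> b \<and> line L = closed_segment a b \<and> open_segment a b \<subseteq> Omega P) \<and>
     L2 (arc (line L)) (line_load L) \<and> load_point L \<in> Omega P"

definition elasticity :: "plate \<Rightarrow> real^2^2 \<Rightarrow> real^2^2" where
  "elasticity P A = (young P / (1 + poisson P)) *\<^sub>R
     (A + (poisson P / (1 - poisson P) * trace A) *\<^sub>R mat 1)"

text \<open>Curvature and moment as functions of the (classical or weak) Hessian. The inner product
  of \<open>real^2^2\<close> is the double contraction.\<close>

definition curvature :: "real^2^2 \<Rightarrow> real^2^2" where
  "curvature H = - ((1/2) *\<^sub>R (H + transpose H))"

definition moment :: "plate \<Rightarrow> real^2^2 \<Rightarrow> real^2^2" where
  "moment P H = (thickness P ^ 3 / 12) *\<^sub>R elasticity P (curvature H)"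

text \<open>An element of \<open>H2\<close> of a Lipschitz domain has exactly one representative that is continuous
  up to the boundary (Sobolev embedding). The space \<open>V\<close> consists of these representatives, so
  that values at points, on the line carrying the load and on the boundary are plain evaluations.
  On a segment the sign of the normal does not matter for the vanishing of the normal derivative.\<close>

definition V :: "plate \<Rightarrow> (pt \<Rightarrow> real) set" where
  "V P = {v \<in> H2 (Omega P). continuous_on (closure (Omega P)) v \<and>
     (\<forall>x \<in> GammaC P \<union> GammaS P. v x = 0) \<and>
     (\<forall>a b. a \<noteq> b \<and> closed_segment a b \<subseteq> GammaC P \<longrightarrow>
        (\<exists>\<tau>. has_grad_trace (Omega P) (closed_segment a b) v \<tau> \<and>
             (AE x in arc (closed_segment a b). \<tau> x \<bullet> rot (b - a) = 0)))}"

definition bilin :: "plate \<Rightarrow> (pt \<Rightarrow> real) \<Rightarrow> (pt \<Rightarrow> real) \<Rightarrow> real" where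
  "bilin P w v = (LINT x|lebesgue_on (Omega P).
     moment P (whess (Omega P) w x) \<bullet> curvature (whess (Omega P) v x))"

definition load_form :: "plate \<Rightarrow> loading \<Rightarrow> (pt \<Rightarrow> real) \<Rightarrow> real" where
  "load_form P L v = (LINT x|lebesgue_on (Omega P). body_load L x * v x)
     + (LINT x|arc (line L). line_load L x * v x) + point_load L * v (load_point L)"

definition coercive :: "plate \<Rightarrow> bool" where
  "coercive P \<longleftrightarrow> (\<exists>\<alpha>>0. \<forall>v\<in>V P. \<alpha> * (H2norm (Omega P) v)\<^sup>2 \<le> bilin P v v)"

section \<open>Shear force and boundary quantities of smooth functions\<close>

definition moment_of :: "plate \<Rightarrow> (pt \<Rightarrow> real) \<Rightarrow> pt \<Rightarrow> real^2^2" where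
  "moment_of P w x = moment P (hess w x)"

definition shear :: "plate \<Rightarrow> (pt \<Rightarrow> real) \<Rightarrow> pt \<Rightarrow> pt" where
  "shear P w x = (\<chi> i. \<Sum>j\<in>UNIV. pd j (\<lambda>y. moment_of P w y $ i $ j) x)"

definition plate_op :: "plate \<Rightarrow> (pt \<Rightarrow> real) \<Rightarrow> pt \<Rightarrow> real" where
  "plate_op P w x = - (\<Sum>i\<in>UNIV. pd i (\<lambda>y. shear P w y $ i) x)"

definition M_nn :: "plate \<Rightarrow> pt \<Rightarrow> (pt \<Rightarrow> real) \<Rightarrow> pt \<Rightarrow> real" where
  "M_nn P n w x = n \<bullet> (moment_of P w x *v n)"

definition M_ns :: "plate \<Rightarrow> pt \<Rightarrow> (pt \<Rightarrow> real) \<Rightarrow> pt \<Rightarrow> real" where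
  "M_ns P n w x = rot n \<bullet> (moment_of P w x *v n)"

text \<open>The normal is constant along an edge, and so is the tangent \<open>rot n\<close>.\<close>

definition V_n :: "plate \<Rightarrow> pt \<Rightarrow> (pt \<Rightarrow> real) \<Rightarrow> pt \<Rightarrow> real" where
  "V_n P n w x = shear P w x \<bullet> n + frechet_derivative (M_ns P n w) (at x) (rot n)"

section \<open>Meshes\<close>

definition edges :: "pt set set \<Rightarrow> pt set set" where
  "edges \<C> = {E. \<exists>K\<in>\<C>. E edge_of K}"

definition nodes :: "pt set set \<Rightarrow> pt set" where
  "nodes \<C> = {x. \<exists>K\<in>\<C>. x extreme_point_of K}"

definition neighbours :: "pt set set \<Rightarrow> pt set \<Rightarrow> pt set \<Rightarrow> pt set \<Rightarrow> bool" where
  "neighbours \<C> E K K' \<longleftrightarrow> K \<in> \<C> \<and> K' \<in> \<C> \<and> K \<noteq> K' \<and> E = K \<inter> K'"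

definition interior_edges :: "pt set set \<Rightarrow> pt set set" where
  "interior_edges \<C> = {E \<in> edges \<C>. \<exists>K K'. neighbours \<C> E K K'}"

definition edges_on :: "pt set \<Rightarrow> pt set set \<Rightarrow> pt set set" where
  "edges_on \<Gamma> \<C> = {E \<in> edges \<C>. E \<subseteq> \<Gamma>}"

definition line_edges :: "loading \<Rightarrow> pt set set \<Rightarrow> pt set set" where
  "line_edges L \<C> = {E \<in> interior_edges \<C>. E \<subseteq> line L}"

definition shape_regular :: "real \<Rightarrow> pt set set \<Rightarrow> bool" where
  "shape_regular \<kappa> \<C> \<longleftrightarrow> (\<forall>K\<in>\<C>. \<exists>z r. r > 0 \<and> cball z r \<subseteq> K \<and> diameter K \<le> \<kappa> * r)"

text \<open>The library's \<open>triangulation\<close> demands that any two members meet in a common face.\<close>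

definition plate_mesh :: "plate \<Rightarrow> real \<Rightarrow> pt set set \<Rightarrow> bool" where
  "plate_mesh P \<kappa> \<C> \<longleftrightarrow> triangulation \<C> \<and> (\<forall>K\<in>\<C>. 2 simplex K) \<and> \<Union>\<C> = closure (Omega P) \<and>
     shape_regular \<kappa> \<C> \<and>
     (\<forall>E \<in> edges_on (frontier (Omega P)) \<C>. E \<subseteq> GammaC P \<or> E \<subseteq> GammaS P \<or> E \<subseteq> GammaF P)"

definition mesh_fits_loading :: "loading \<Rightarrow> pt set set \<Rightarrow> bool" where
  "mesh_fits_loading L \<C> \<longleftrightarrow> load_point L \<in> nodes \<C> \<and> line L = \<Union>(line_edges L \<C>)"

definition outer_normal :: "pt set \<Rightarrow> pt set \<Rightarrow> pt" where
  "outer_normal K E = (THE n. norm n = 1 \<and> (\<forall>x\<in>E. \<forall>y\<in>E. n \<bullet> (y - x) = 0) \<and>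
     (\<forall>x\<in>E. \<forall>y\<in>K. n \<bullet> (y - x) \<le> 0))"

section \<open>Finite element spaces\<close>

definition fe_space :: "plate \<Rightarrow> nat \<Rightarrow> pt set set \<Rightarrow> (pt \<Rightarrow> real) set \<Rightarrow> bool" where
  "fe_space P k \<C> Vh \<longleftrightarrow> Vh \<subseteq> V P \<and>
     (\<lambda>x. 0) \<in> Vh \<and> (\<forall>v\<in>Vh. \<forall>w\<in>Vh. (\<lambda>x. v x + w x) \<in> Vh) \<and> (\<forall>v\<in>Vh. \<forall>c. (\<lambda>x. c * v x) \<in> Vh) \<and>
     (\<forall>v\<in>Vh. C1_closure (Omega P) v \<and> (\<forall>K\<in>\<C>. \<exists>p\<in>polys k. \<forall>x\<in>K. v x = p x))"

definition interpolates ::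
  "plate \<Rightarrow> real \<Rightarrow> pt set set \<Rightarrow> (pt \<Rightarrow> real) set \<Rightarrow> ((pt \<Rightarrow> real) \<Rightarrow> pt \<Rightarrow> real) \<Rightarrow> bool" where
  "interpolates P c \<C> Vh I \<longleftrightarrow> (\<forall>w\<in>V P. I w \<in> Vh \<and> (\<forall>x\<in>nodes \<C>. I w x = w x) \<and>
     (let e = (\<lambda>x. w x - I w x) in
        (\<Sum>K\<in>\<C>. (L2norm (lebesgue_on K) e)\<^sup>2 / diameter K ^ 4)
        + (\<Sum>E\<in>edges \<C>. (L2norm (arc E) (grad_trace (Omega P) E e))\<^sup>2 / diameter E)
        + (\<Sum>E\<in>edges \<C>. (L2norm (arc E) e)\<^sup>2 / diameter E ^ 3)
        \<le> c * (H2norm (Omega P) w)\<^sup>2) \<and>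
     H2norm (Omega P) (I w) \<le> c * H2norm (Omega P) w)"

section \<open>The error estimator\<close>

text \<open>The polynomial that coincides with \<open>v\<close> on the triangle \<open>K\<close>; its derivatives are the elementwise
  derivatives of \<open>v\<close>, including their one-sided values on the edges.\<close>

definition piece :: "(pt \<Rightarrow> real) \<Rightarrow> pt set \<Rightarrow> pt \<Rightarrow> real" where
  "piece v K = (SOME p. (\<exists>k. p \<in> polys k) \<and> (\<forall>x\<in>K. p x = v x))"

text \<open>The order of the two triangles sharing an edge affects only the sign of \<open>jump_M\<close>.\<close>

definition two_sides :: "pt set set \<Rightarrow> pt set \<Rightarrow> pt set \<times> pt set" where
  "two_sides \<C> E = (SOME (K, K'). neighbours \<C> E K K')"

definition jump_M :: "plate \<Rightarrow> pt set set \<Rightarrow> pt set \<Rightarrow> (pt \<Rightarrow> real) \<Rightarrow> pt \<Rightarrow> real" where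
  "jump_M P \<C> E v x = (case two_sides \<C> E of (K, K') \<Rightarrow>
     M_nn P (outer_normal K E) (piece v K) x - M_nn P (outer_normal K' E) (piece v K') x)"

definition jump_V :: "plate \<Rightarrow> pt set set \<Rightarrow> pt set \<Rightarrow> (pt \<Rightarrow> real) \<Rightarrow> pt \<Rightarrow> real" where
  "jump_V P \<C> E v x = (case two_sides \<C> E of (K, K') \<Rightarrow>
     V_n P (outer_normal K E) (piece v K) x + V_n P (outer_normal K' E) (piece v K') x)"

definition one_side :: "pt set set \<Rightarrow> pt set \<Rightarrow> pt set" where
  "one_side \<C> E = (THE K. K \<in> \<C> \<and> E edge_of K)"

definition bdry_M :: "plate \<Rightarrow> pt set set \<Rightarrow> pt set \<Rightarrow> (pt \<Rightarrow> real) \<Rightarrow> pt \<Rightarrow> real" where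
  "bdry_M P \<C> E v = (let K = one_side \<C> E in M_nn P (outer_normal K E) (piece v K))"

definition bdry_V :: "plate \<Rightarrow> pt set set \<Rightarrow> pt set \<Rightarrow> (pt \<Rightarrow> real) \<Rightarrow> pt \<Rightarrow> real" where
  "bdry_V P \<C> E v = (let K = one_side \<C> E in V_n P (outer_normal K E) (piece v K))"

definition estimator :: "plate \<Rightarrow> loading \<Rightarrow> pt set set \<Rightarrow> (pt \<Rightarrow> real) \<Rightarrow> real" where
  "estimator P L \<C> v = sqrt (
       (\<Sum>K\<in>\<C>. diameter K ^ 4
          * (L2norm (lebesgue_on K) (\<lambda>x. plate_op P (piece v K) x - body_load L x))\<^sup>2)
     + (\<Sum>E\<in>line_edges L \<C>. diameter E ^ 3
          * (L2norm (arc E) (\<lambda>x. jump_V P \<C> E v x - line_load L x))\<^sup>2)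
     + (\<Sum>E\<in>interior_edges \<C> - line_edges L \<C>. diameter E ^ 3 * (L2norm (arc E) (jump_V P \<C> E v))\<^sup>2)
     + (\<Sum>E\<in>interior_edges \<C>. diameter E * (L2norm (arc E) (jump_M P \<C> E v))\<^sup>2)
     + (\<Sum>E\<in>edges_on (GammaF P) \<C>. diameter E ^ 3 * (L2norm (arc E) (bdry_V P \<C> E v))\<^sup>2)
     + (\<Sum>E\<in>edges_on (GammaF P) \<C> \<union> edges_on (GammaS P) \<C>.
          diameter E * (L2norm (arc E) (bdry_M P \<C> E v))\<^sup>2))"

end

theory Submission
  imports Defs
begin

text \<open>Let \<open>w = u - u\<^sub>h\<close> and let \<open>v = w - \<Pi>\<^sub>h w\<close> be its interpolation error. By coercivity and Galerkin orthogonality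
  \<open>\<alpha> \<parallel>w\<parallel>\<^sup>2 \<le> a(w, w) = a(w, v) = l(v) - a(u\<^sub>h, v)\<close>, and the right-hand side is evaluated element by element.
  On a triangle \<open>K\<close> the finite element function is a polynomial \<open>p\<close>, and two integrations by parts, followed by
  one integration by parts along each edge that turns tangential derivatives of \<open>v\<close> into the derivative of the
  twisting moment, give
  \<open>\<integral>\<^sub>K M(p) : K(v) = \<integral>\<^sub>K A(p) v + \<Sum>\<^sub>E (\<integral>\<^sub>E V\<^sub>n(p) v - \<integral>\<^sub>E M\<^sub>n\<^sub>n(p) \<partial>\<^sub>n v)\<close>
  plus values of \<open>v\<close> at the vertices. The vertex values and the point load vanish because the interpolation is
  exact at the nodes. Collecting the edge terms of the two triangles at an interior edge produces the
  jumps; on the boundary, the essential conditions on \<open>v\<close> remove everything except the terms in the estimator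
  (\<open>element_identity_edges\<close>, \<open>interior_edge_sum\<close>, \<open>residual_bound\<close>).

  Every edge term is bounded by scaled trace inequalities (\<open>edge_bounds\<close>): if
  \<open>B\<^sub>K = h\<^sub>K\<^sup>-\<^sup>4 \<parallel>v\<parallel>\<^sup>2 + \<parallel>D\<^sup>2 v\<parallel>\<^sup>2\<close> on \<open>K\<close>, then the squared norms of \<open>v\<close> and of its gradient on an edge are at most a
  constant times \<open>h\<^sub>E\<^sup>3 B\<^sub>K\<close> and \<open>h\<^sub>E B\<^sub>K\<close>. The inequalities are derived from the divergence theorem on a triangle, and the
  gradient in the interior is absorbed by interpolation between \<open>v\<close> and its Hessian (\<open>grad_interpolation\<close>).
  Since the sum of the \<open>B\<^sub>K\<close> is at most a constant times \<open>\<parallel>w\<parallel>\<^sup>2\<close> (\<open>interpolation_error\<close>), the Cauchy-Schwarz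
  inequality over elements and edges yields \<open>\<alpha> \<parallel>w\<parallel>\<^sup>2 \<le> C \<eta> \<parallel>w\<parallel>\<close>.

  The integrations by parts concern a function that is only in \<open>H2\<close>. They are proved for smooth functions
  and carried over by density, element by element: a triangle is star-shaped with respect to an interior point, so
  contraction towards that point followed by mollification approximates \<open>v\<close> on the closed triangle together
  with its weak derivatives (\<open>H2_approx\<close>). The trace of the gradient on an edge enters through the
  functional \<open>Tr\<close>, which is an integral over the triangle. That the functionals of two neighbouring
  triangles agree (\<open>Tr_match\<close>) follows from a common approximating sequence on their union, which is star-shaped
  with respect to the midpoint of the edge.\<close>

section \<open>Square-integrable functions\<close>

lemma L2_integrable_inner:
  assumes f: "L2 M f" and g: "L2 M g"
  shows "integrable M (\<lambda>x. f x \<bullet> g x)"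
proof (rule Bochner_Integration.integrable_bound)
  show "integrable M (\<lambda>x. (norm (f x))\<^sup>2 + (norm (g x))\<^sup>2)" using f g by (auto simp: L2_def)
  show "(\<lambda>x. f x \<bullet> g x) \<in> borel_measurable M" using f g by (auto simp: L2_def)
  have "norm (a \<bullet> b) \<le> norm ((norm a)\<^sup>2 + (norm b)\<^sup>2)" for a b :: 'b
  proof -
    have "\<bar>a \<bullet> b\<bar> \<le> norm a * norm b" by (rule Cauchy_Schwarz_ineq2)
    also have "\<dots> \<le> (norm a)\<^sup>2 + (norm b)\<^sup>2"
      using sum_squares_bound[of "norm a" "norm b"] mult_nonneg_nonneg[OF norm_ge_zero norm_ge_zero, of a b]
      by linarith
    finally show ?thesis by simp
  qed
  then show "AE x in M. norm (f x \<bullet> g x) \<le> norm ((norm (f x))\<^sup>2 + (norm (g x))\<^sup>2)" by simp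
qed

lemma L2_integrable_mult:
  fixes f g :: "'a \<Rightarrow> real"
  assumes "L2 M f" and "L2 M g"
  shows "integrable M (\<lambda>x. f x * g x)"
  using L2_integrable_inner[OF assms] by simp

lemma L2_integrable_sq: "L2 M f \<Longrightarrow> integrable M (\<lambda>x. (norm (f x))\<^sup>2)"
  and L2_measurable: "L2 M f \<Longrightarrow> f \<in> borel_measurable M"
  by (auto simp: L2_def)

lemma L2_scaleR: "L2 M f \<Longrightarrow> L2 M (\<lambda>x. c *\<^sub>R f x)"
  by (auto simp: L2_def power_mult_distrib)

lemma L2_dominated:
  assumes "L2 M f" "g \<in> borel_measurable M" "AE x in M. norm (g x) \<le> norm (f x)"
  shows "L2 M g"
proof -
  have "integrable M (\<lambda>x. (norm (g x))\<^sup>2)"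
  proof (rule Bochner_Integration.integrable_bound)
    show "integrable M (\<lambda>x. (norm (f x))\<^sup>2)" using assms by (simp add: L2_def)
    show "(\<lambda>x. (norm (g x))\<^sup>2) \<in> borel_measurable M" using assms(2) by measurable
    show "AE x in M. norm ((norm (g x))\<^sup>2) \<le> norm ((norm (f x))\<^sup>2)"
      using assms(3) by (rule eventually_mono) (simp add: power_mono)
  qed
  then show ?thesis using assms by (simp add: L2_def)
qed

lemma norm_add_sq_le: "(norm (a + b))\<^sup>2 \<le> 2 * (norm a)\<^sup>2 + 2 * (norm (b :: 'a::real_normed_vector))\<^sup>2"
proof -
  have "(norm (a + b))\<^sup>2 \<le> (norm a + norm b)\<^sup>2" by (intro power_mono norm_triangle_ineq) auto
  also have "\<dots> \<le> 2 * (norm a)\<^sup>2 + 2 * (norm b)\<^sup>2"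
    using sum_squares_bound[of "norm a" "norm b"] by (simp add: power2_sum)
  finally show ?thesis .
qed

lemma L2_add: assumes "L2 M f" "L2 M g" shows "L2 M (\<lambda>x. f x + g x)"
proof -
  have "integrable M (\<lambda>x. (norm (f x + g x))\<^sup>2)"
  proof (rule Bochner_Integration.integrable_bound)
    show "integrable M (\<lambda>x. 2 * (norm (f x))\<^sup>2 + 2 * (norm (g x))\<^sup>2)" using assms by (auto simp: L2_def)
    show "(\<lambda>x. (norm (f x + g x))\<^sup>2) \<in> borel_measurable M" using assms by (auto simp: L2_def)
    show "AE x in M. norm ((norm (f x + g x))\<^sup>2) \<le> norm (2 * (norm (f x))\<^sup>2 + 2 * (norm (g x))\<^sup>2)"
      using norm_add_sq_le by (simp add: norm_add_sq_le)
  qed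
  then show ?thesis using assms by (auto simp: L2_def)
qed

lemma L2_minus: "L2 M f \<Longrightarrow> L2 M (\<lambda>x. - f x)"
  using L2_scaleR[of M f "-1"] by simp

lemma L2_diff: "L2 M f \<Longrightarrow> L2 M g \<Longrightarrow> L2 M (\<lambda>x. f x - g x)"
  using L2_add[of M f "\<lambda>x. - g x"] L2_minus[of M g] by simp

lemma L2_norm: "L2 M f \<Longrightarrow> L2 M (\<lambda>x. norm (f x))"
  by (auto simp: L2_def)

lemma L2_bounded_mult:
  fixes f :: "'a \<Rightarrow> real" and g :: "'a \<Rightarrow> 'b::euclidean_space"
  assumes "L2 M g" "f \<in> borel_measurable M" "\<And>x. x \<in> space M \<Longrightarrow> \<bar>f x\<bar> \<le> B"
  shows "L2 M (\<lambda>x. f x *\<^sub>R g x)"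
proof (rule L2_dominated[OF L2_scaleR[OF assms(1), of B]])
  show "(\<lambda>x. f x *\<^sub>R g x) \<in> borel_measurable M" using assms by (auto simp: L2_def)
  show "AE x in M. norm (f x *\<^sub>R g x) \<le> norm (B *\<^sub>R g x)"
    using assms(3) by (intro AE_I2) (auto intro!: mult_right_mono order.trans[OF _ abs_ge_self])
qed

lemma L2_bounded:
  assumes "finite_measure M" "f \<in> borel_measurable M" "\<And>x. x \<in> space M \<Longrightarrow> norm (f x) \<le> B"
  shows "L2 M f"
proof -
  have "integrable M (\<lambda>x. (norm (f x))\<^sup>2)"
    by (intro finite_measure.integrable_const_bound[OF assms(1), where B="B\<^sup>2"] AE_I2)
      (use assms in \<open>auto intro!: power_mono\<close>)
  then show ?thesis using assms by (simp add: L2_def)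
qed

lemma L2_vec_nth: "L2 M f \<Longrightarrow> L2 M (\<lambda>x. f x $ i)" for f :: "'a \<Rightarrow> 'b::euclidean_space^'n"
proof -
  assume f: "L2 M f"
  have "(\<lambda>x. f x $ i) \<in> borel_measurable M"
  proof -
    have "continuous_on UNIV (\<lambda>x :: 'b^'n. x $ i)" by (intro continuous_intros)
    then have "(\<lambda>x :: 'b^'n. x $ i) \<in> borel_measurable borel" by (rule borel_measurable_continuous_onI)
    from measurable_compose[OF L2_measurable[OF f] this] show ?thesis .
  qed
  then show ?thesis using Finite_Cartesian_Product.norm_nth_le by (intro L2_dominated[OF f]) (auto)
qed

lemma vec_measurable:
  fixes f :: "'a \<Rightarrow> 'b::euclidean_space^'n"
  assumes "\<And>i. (\<lambda>x. f x $ i) \<in> borel_measurable M"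
  shows "f \<in> borel_measurable M"
  unfolding borel_measurable_euclidean_space[of f]
proof
  fix b :: "'b^'n" assume "b \<in> Basis"
  then obtain i u where b: "b = axis i u" "u \<in> Basis" by (auto simp: Basis_vec_def)
  show "(\<lambda>x. f x \<bullet> b) \<in> borel_measurable M"
    unfolding b inner_axis using assms[of i] by measurable
qed

lemma norm_sq_vec: "(norm (x :: 'b::euclidean_space^'n))\<^sup>2 = (\<Sum>i\<in>UNIV. (norm (x $ i))\<^sup>2)"
  unfolding norm_vec_def L2_set_def by (subst real_sqrt_pow2) (auto intro: sum_nonneg)

lemma L2_vec:
  fixes f :: "'a \<Rightarrow> 'b::euclidean_space^'n"
  assumes "\<And>i. L2 M (\<lambda>x. f x $ i)"
  shows "L2 M f"
  unfolding L2_def norm_sq_vec using assms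
  by (auto intro!: vec_measurable Bochner_Integration.integrable_sum simp: L2_def)

lemma L2norm_nonneg: "0 \<le> L2norm M f"
  by (auto simp: L2norm_def)

lemma L2norm_sq: "(L2norm M f)\<^sup>2 = (LINT x|M. (norm (f x))\<^sup>2)"
  by (simp add: L2norm_def)

lemma norm_add_sq: "(norm (a + b))\<^sup>2 = (norm a)\<^sup>2 + 2 * (a \<bullet> b) + (norm (b :: 'a::real_inner))\<^sup>2"
  by (simp add: power2_norm_eq_inner inner_add_left inner_add_right inner_commute)

text \<open>The Cauchy-Schwarz inequality.\<close>

lemma L2norm_inner_le:
  assumes f: "L2 M f" and g: "L2 M g"
  shows "\<bar>LINT x|M. f x \<bullet> g x\<bar> \<le> L2norm M f * L2norm M g"
proof -
  define A where "A = (L2norm M f)\<^sup>2"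
  define B where "B = (L2norm M g)\<^sup>2"
  define I where "I = (LINT x|M. f x \<bullet> g x)"
  have fi: "integrable M (\<lambda>x. (norm (f x))\<^sup>2)" and gi: "integrable M (\<lambda>x. (norm (g x))\<^sup>2)"
    using f g by (auto simp: L2_def)
  note ii = L2_integrable_inner[OF f g]
  \<comment> \<open>Minimising the quadratic polynomial in the parameter gives the inequality.\<close>
  have quad: "0 \<le> A + 2 * s * I + s\<^sup>2 * B" for s
  proof -
    have "0 \<le> (LINT x|M. (norm (f x + s *\<^sub>R g x))\<^sup>2)" by simp
    also have "\<dots> = (LINT x|M. (norm (f x))\<^sup>2 + 2 * s * (f x \<bullet> g x) + s\<^sup>2 * (norm (g x))\<^sup>2)"
      by (simp add: norm_add_sq power_mult_distrib mult.assoc)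
    also have "\<dots> = A + 2 * s * I + s\<^sup>2 * B"
      using fi gi ii by (simp add: A_def B_def I_def L2norm_sq)
    finally show ?thesis .
  qed
  have "I\<^sup>2 \<le> A * B"
  proof (cases "B = 0")
    case True
    have "I = 0"
    proof (rule ccontr)
      assume "I \<noteq> 0"
      then have "A + 2 * (-(A + 1) / (2 * I)) * I = -1" by (simp add: field_simps)
      then show False using quad[of "-(A + 1) / (2 * I)"] True by simp
    qed
    then show ?thesis using True by simp
  next
    case False
    then have "B > 0" by (simp add: B_def)
    have "0 \<le> (A + 2 * (- I / B) * I + (- I / B)\<^sup>2 * B) * B"
      by (rule mult_nonneg_nonneg[OF quad]) (use \<open>B > 0\<close> in simp)
    also have "\<dots> = A * B - I\<^sup>2" using \<open>B > 0\<close> by (simp add: field_simps power2_eq_square)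
    finally show ?thesis by simp
  qed
  then have "I\<^sup>2 \<le> (L2norm M f * L2norm M g)\<^sup>2" by (simp add: A_def B_def power_mult_distrib)
  then show ?thesis unfolding I_def[symmetric]
    using abs_le_square_iff[of I "L2norm M f * L2norm M g"] by (simp add: L2norm_nonneg)
qed

lemma L2norm_mult_le:
  fixes f g :: "'a \<Rightarrow> real"
  shows "L2 M f \<Longrightarrow> L2 M g \<Longrightarrow> \<bar>LINT x|M. f x * g x\<bar> \<le> L2norm M f * L2norm M g"
  using L2norm_inner_le[of M f g] by simp

lemma L2norm_triangle:
  assumes f: "L2 M f" and g: "L2 M g"
  shows "L2norm M (\<lambda>x. f x + g x) \<le> L2norm M f + L2norm M g"
proof -
  have "(L2norm M (\<lambda>x. f x + g x))\<^sup>2 = (LINT x|M. (norm (f x))\<^sup>2 + 2 * (f x \<bullet> g x) + (norm (g x))\<^sup>2)"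
    unfolding L2norm_sq by (simp add: norm_add_sq)
  also have "\<dots> = (L2norm M f)\<^sup>2 + 2 * (LINT x|M. f x \<bullet> g x) + (L2norm M g)\<^sup>2"
    using L2_integrable_inner[OF f g] f g by (simp add: L2norm_sq L2_def)
  also have "\<dots> \<le> (L2norm M f + L2norm M g)\<^sup>2"
    using L2norm_inner_le[OF f g] by (simp add: power2_sum abs_le_iff)
  finally show ?thesis by (rule power2_le_imp_le) (simp add: L2norm_nonneg)
qed

lemma L2norm_minus: "L2norm M (\<lambda>x. - f x) = L2norm M f"
  by (simp add: L2norm_def)

lemma L2norm_minus_commute: "L2norm M (\<lambda>x. f x - g x) = L2norm M (\<lambda>x. g x - f x)"
  by (simp add: L2norm_def norm_minus_commute)

lemma L2norm_diff_triangle: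
  assumes f: "L2 M f" and g: "L2 M g"
  shows "L2norm M (\<lambda>x. f x - g x) \<le> L2norm M f + L2norm M g"
  using L2norm_triangle[OF f L2_minus[OF g]] by (simp add: L2norm_minus)

lemma L2norm_cong_AE:
  assumes "f \<in> borel_measurable M" "g \<in> borel_measurable M" "AE x in M. f x = g x"
  shows "L2norm M f = L2norm M g"
proof -
  have "(LINT x|M. (norm (f x))\<^sup>2) = (LINT x|M. (norm (g x))\<^sup>2)"
  proof (rule integral_cong_AE)
    show "AE x in M. (norm (f x))\<^sup>2 = (norm (g x))\<^sup>2" using assms(3) by (rule eventually_mono) simp
  qed (use assms(1,2) in measurable)
  then show ?thesis by (simp add: L2norm_def)
qed

lemma L2norm_sq_vec:
  fixes f :: "'a \<Rightarrow> 'b::euclidean_space^'n"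
  assumes "L2 M f"
  shows "(L2norm M f)\<^sup>2 = (\<Sum>i\<in>UNIV. (L2norm M (\<lambda>x. f x $ i))\<^sup>2)"
  unfolding L2norm_sq norm_sq_vec using L2_vec_nth[OF assms]
  by (subst Bochner_Integration.integral_sum) (auto simp: L2_def)

lemma L2norm_vec_nth_le:
  fixes f :: "'a \<Rightarrow> 'b::euclidean_space^'n"
  assumes "L2 M f" shows "L2norm M (\<lambda>x. f x $ i) \<le> L2norm M f"
proof (rule power2_le_imp_le)
  show "(L2norm M (\<lambda>x. f x $ i))\<^sup>2 \<le> (L2norm M f)\<^sup>2"
    unfolding L2norm_sq_vec[OF assms] by (rule member_le_sum) auto
qed (rule L2norm_nonneg)

lemma L2norm_bound:
  assumes "finite_measure M" "f \<in> borel_measurable M" "\<And>x. x \<in> space M \<Longrightarrow> norm (f x) \<le> B" "0 \<le> B"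
  shows "L2norm M f \<le> B * sqrt (measure M (space M))"
proof -
  interpret finite_measure M by fact
  have "(LINT x|M. (norm (f x))\<^sup>2) \<le> (LINT x|M. B\<^sup>2)"
    using L2_bounded[OF assms(1-3)] assms(3)
    by (intro integral_mono) (auto simp: L2_def intro: power_mono)
  also have "\<dots> = (B * sqrt (measure M (space M)))\<^sup>2" by (simp add: power_mult_distrib)
  finally have "(L2norm M f)\<^sup>2 \<le> (B * sqrt (measure M (space M)))\<^sup>2" by (simp add: L2norm_sq)
  then show ?thesis by (rule power2_le_imp_le) (use assms(4) in simp)
qed

text \<open>Strong convergence in one factor is enough to pass to the limit in a product.\<close>

lemma L2_tendsto_integral_mult:
  fixes f g :: "_ \<Rightarrow> real"
  assumes g: "L2 M g" and f: "L2 M f" and fn: "\<And>n. L2 M (fn n)"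
    and lim: "(\<lambda>n. L2norm M (\<lambda>x. fn n x - f x)) \<longlonglongrightarrow> 0"
  shows "(\<lambda>n. LINT x|M. g x * fn n x) \<longlonglongrightarrow> (LINT x|M. g x * f x)"
proof -
  have "(\<lambda>n. (LINT x|M. g x * fn n x) - (LINT x|M. g x * f x)) \<longlonglongrightarrow> 0"
  proof (rule tendsto_0_le[OF lim, where K="L2norm M g"], rule always_eventually, rule allI)
    fix n
    have "(LINT x|M. g x * fn n x) - (LINT x|M. g x * f x) = (LINT x|M. g x * (fn n x - f x))"
      using L2_integrable_mult[OF g fn[of n]] L2_integrable_mult[OF g f] by (simp add: right_diff_distrib)
    then show "norm ((LINT x|M. g x * fn n x) - (LINT x|M. g x * f x)) \<le> norm (L2norm M (\<lambda>x. fn n x - f x)) * L2norm M g"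
      using L2norm_mult_le[OF g L2_diff[OF fn[of n] f]] by (simp add: mult.commute L2norm_nonneg)
  qed
  then show ?thesis by (simp add: LIM_zero_iff)
qed

lemma L2norm_tendsto:
  assumes f: "L2 M f" and fn: "\<And>n. L2 M (fn n)"
    and lim: "(\<lambda>n. L2norm M (\<lambda>x. fn n x - f x)) \<longlonglongrightarrow> 0"
  shows "(\<lambda>n. L2norm M (fn n)) \<longlonglongrightarrow> L2norm M f"
proof -
  have "(\<lambda>n. L2norm M (fn n) - L2norm M f) \<longlonglongrightarrow> 0"
  proof (rule tendsto_0_le[OF lim, where K=1], rule always_eventually, rule allI)
    fix n
    have "L2norm M (fn n) \<le> L2norm M (\<lambda>x. fn n x - f x) + L2norm M f"
      using L2norm_triangle[OF L2_diff[OF fn[of n] f] f] by simp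
    moreover have "L2norm M f \<le> L2norm M (\<lambda>x. fn n x - f x) + L2norm M (fn n)"
      using L2norm_triangle[OF L2_diff[OF f fn[of n]] fn[of n]] by (simp add: L2norm_minus_commute[of M f])
    ultimately show "norm (L2norm M (fn n) - L2norm M f) \<le> norm (L2norm M (\<lambda>x. fn n x - f x)) * 1"
      by (simp add: L2norm_nonneg abs_le_iff)
  qed
  then show ?thesis by (simp add: LIM_zero_iff)
qed

lemma sum_mult_le_sqrt:
  fixes a b :: "'i \<Rightarrow> real"
  shows "(\<Sum>i\<in>I. a i * b i) \<le> sqrt (\<Sum>i\<in>I. (a i)\<^sup>2) * sqrt (\<Sum>i\<in>I. (b i)\<^sup>2)"
proof -
  have "(\<Sum>i\<in>I. a i * b i) \<le> (\<Sum>i\<in>I. \<bar>a i\<bar> * \<bar>b i\<bar>)"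
    by (intro sum_mono) (simp add: abs_mult[symmetric])
  also have "\<dots> \<le> L2_set a I * L2_set b I" by (rule L2_set_mult_ineq)
  finally show ?thesis by (simp add: L2_set_def)
qed

section \<open>Smooth functions and the mollifier\<close>

lemma norm_pt_le: "norm (x :: pt) \<le> \<bar>x $ 1\<bar> + \<bar>x $ 2\<bar>"
  using norm_le_l1_cart[of x] by (simp add: sum_2)

lemma pd_eqI: "(f has_derivative D) (at x) \<Longrightarrow> pd i f x = D (axis i 1)"
  by (metis pd_def frechet_derivative_at)

lemma has_derivative_pd:
  assumes "f differentiable (at x)"
  shows "(f has_derivative (\<lambda>h. \<Sum>i\<in>UNIV. h $ i * pd i f x)) (at x)"
proof -
  have D: "(f has_derivative frechet_derivative f (at x)) (at x)"
    using assms by (simp add: frechet_derivative_works)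
  then interpret bounded_linear "frechet_derivative f (at x)" by (rule has_derivative_bounded_linear)
  have "frechet_derivative f (at x) h = (\<Sum>i\<in>UNIV. h $ i * pd i f x)" for h
  proof -
    have "frechet_derivative f (at x) (\<Sum>i\<in>UNIV. (h $ i) *\<^sub>R axis i 1) = (\<Sum>i\<in>UNIV. h $ i * pd i f x)"
      by (simp add: sum scaleR pd_def)
    moreover have "(\<Sum>i\<in>UNIV. (h $ i) *\<^sub>R axis i 1) = h"
      using basis_expansion[of h] by (simp add: scalar_mult_eq_scaleR)
    ultimately show ?thesis by simp
  qed
  then show ?thesis using D by (metis (no_types, lifting) ext)
qed

lemma frechet_derivative_eq_pd:
  assumes "f differentiable (at x)"
  shows "frechet_derivative f (at x) h = (\<Sum>i\<in>UNIV. h $ i * pd i f x)"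
  using fun_cong[OF frechet_derivative_at[OF has_derivative_pd[OF assms]], of h] by simp

lemma Ck_SucI:
  assumes "\<And>x. (f has_derivative D x) (at x)" "\<And>i. Ck k (\<lambda>x. D x (axis i 1))"
  shows "Ck (Suc k) f"
proof -
  have "pd i f = (\<lambda>x. D x (axis i 1))" for i
    using pd_eqI[OF assms(1)] by auto
  then show ?thesis using assms by (auto simp: differentiable_def)
qed

lemma Ck_Suc_D: "Ck (Suc k) f \<Longrightarrow> Ck k f"
  by (induction k arbitrary: f)
    (auto intro!: continuous_at_imp_continuous_on differentiable_imp_continuous_within)

lemma Ck_derivative: "Ck (Suc k) f \<Longrightarrow> (f has_derivative (\<lambda>h. \<Sum>i\<in>UNIV. h $ i * pd i f x)) (at x)"
  by (intro has_derivative_pd) auto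

lemma Ck_const: "Ck k (\<lambda>x. c)"
proof (induction k arbitrary: c)
  case (Suc k)
  show ?case by (rule Ck_SucI[where D="\<lambda>x h. 0"]) (auto intro: Suc)
qed auto

lemma Ck_coord: "Ck k (\<lambda>x. x $ j)"
proof (cases k)
  case (Suc m)
  show ?thesis unfolding Suc
    by (rule Ck_SucI[where D="\<lambda>x h. h $ j"])
      (auto intro!: bounded_linear_imp_has_derivative bounded_linear_vec_nth Ck_const)
qed (auto intro!: continuous_intros)

lemma pd_add: "f differentiable (at x) \<Longrightarrow> g differentiable (at x) \<Longrightarrow>
    pd i (\<lambda>x. f x + g x) x = pd i f x + pd i g x"
  by (subst pd_eqI[OF has_derivative_add[OF has_derivative_pd has_derivative_pd]])
    (auto simp: axis_def if_distrib if_distribR cong: if_cong)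

lemma pd_mult: "f differentiable (at x) \<Longrightarrow> g differentiable (at x) \<Longrightarrow>
    pd i (\<lambda>x. f x * g x) x = f x * pd i g x + pd i f x * g x"
  by (subst pd_eqI[OF has_derivative_mult[OF has_derivative_pd has_derivative_pd]])
    (auto simp: axis_def if_distrib if_distribR cong: if_cong)

lemma pd_const: "pd i (\<lambda>x. c) x = 0"
  by (subst pd_eqI[OF has_derivative_const]) auto

lemma Ck_add: "Ck k f \<Longrightarrow> Ck k g \<Longrightarrow> Ck k (\<lambda>x. f x + g x)"
proof (induction k arbitrary: f g)
  case (Suc k)
  have "pd i (\<lambda>x. f x + g x) = (\<lambda>x. pd i f x + pd i g x)" for i
    using Suc.prems by (intro ext pd_add) auto
  then show ?case using Suc by auto
qed (auto intro: continuous_intros)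

lemma Ck_mult: "Ck k f \<Longrightarrow> Ck k g \<Longrightarrow> Ck k (\<lambda>x. f x * g x)"
proof (induction k arbitrary: f g)
  case (Suc k)
  have "pd i (\<lambda>x. f x * g x) = (\<lambda>x. f x * pd i g x + pd i f x * g x)" for i
    using Suc.prems by (intro ext pd_mult) auto
  moreover have "Ck k f" "Ck k g" using Suc.prems Ck_Suc_D by blast+
  ultimately show ?case using Suc by (auto intro: Ck_add)
qed (auto intro: continuous_intros)

lemma Ck_affine: "Ck k f \<Longrightarrow> Ck k (\<lambda>x. f (t *\<^sub>R x + b))"
proof (induction k arbitrary: f)
  case 0
  then show ?case by (auto intro!: continuous_on_compose2[of UNIV f] continuous_intros)
next
  case (Suc k)
  show ?case
  proof (rule Ck_SucI)
    fix x
    have "((\<lambda>x. t *\<^sub>R x + b) has_derivative (\<lambda>h. t *\<^sub>R h)) (at x)"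
      by (auto intro!: derivative_eq_intros)
    from has_derivative_compose[OF this Ck_derivative[OF Suc.prems]]
    show "((\<lambda>x. f (t *\<^sub>R x + b)) has_derivative
        (\<lambda>h. \<Sum>i\<in>UNIV. (t *\<^sub>R h) $ i * pd i f (t *\<^sub>R x + b))) (at x)" .
  next
    fix i
    have "(\<lambda>x. \<Sum>j\<in>UNIV. (t *\<^sub>R axis i 1 :: pt) $ j * pd j f (t *\<^sub>R x + b)) = (\<lambda>x. t * pd i f (t *\<^sub>R x + b))"
      by (auto simp: axis_def if_distrib if_distribR cong: if_cong)
    then show "Ck k (\<lambda>x. \<Sum>j\<in>UNIV. (t *\<^sub>R axis i 1 :: pt) $ j * pd j f (t *\<^sub>R x + b))"
      using Suc by (auto intro: Ck_mult Ck_const)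
  qed
qed

lemma smooth_const: "smooth (\<lambda>x. c)" and smooth_coord: "smooth (\<lambda>x. x $ j)"
  and smooth_add: "smooth f \<Longrightarrow> smooth g \<Longrightarrow> smooth (\<lambda>x. f x + g x)"
  and smooth_mult: "smooth f \<Longrightarrow> smooth g \<Longrightarrow> smooth (\<lambda>x. f x * g x)"
  and smooth_affine: "smooth f \<Longrightarrow> smooth (\<lambda>x. f (t *\<^sub>R x + b))"
  by (auto simp: smooth_def intro: Ck_const Ck_coord Ck_add Ck_mult Ck_affine)

lemma smooth_cmult: "smooth f \<Longrightarrow> smooth (\<lambda>x. c * f x)"
  by (intro smooth_mult smooth_const)

lemma smooth_minus: "smooth f \<Longrightarrow> smooth (\<lambda>x. - f x)"
  using smooth_cmult[of f "-1"] by simp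

lemma smooth_diff: "smooth f \<Longrightarrow> smooth g \<Longrightarrow> smooth (\<lambda>x. f x - g x)"
  using smooth_add[of f "\<lambda>x. - g x"] smooth_minus[of g] by simp

lemma smooth_sum: "(\<And>i. i \<in> I \<Longrightarrow> smooth (f i)) \<Longrightarrow> smooth (\<lambda>x. \<Sum>i\<in>I. f i x)"
  by (induction I rule: infinite_finite_induct) (auto intro: smooth_const smooth_add)

lemma smooth_power: "smooth f \<Longrightarrow> smooth (\<lambda>x. f x ^ n)"
  by (induction n) (auto intro: smooth_const smooth_mult)

lemma smooth_differentiable: "smooth f \<Longrightarrow> f differentiable (at x)"
  unfolding smooth_def using Ck.simps(2) by blast

lemma smooth_pd: "smooth f \<Longrightarrow> smooth (pd i f)"
  unfolding smooth_def using Ck.simps(2) by blast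

lemma smooth_continuous: "smooth f \<Longrightarrow> continuous_on S f"
  unfolding smooth_def using Ck.simps(1) continuous_on_subset by blast

lemma smooth_derivative: "smooth f \<Longrightarrow> (f has_derivative (\<lambda>h. \<Sum>i\<in>UNIV. h $ i * pd i f x)) (at x)"
  by (intro has_derivative_pd smooth_differentiable)

lemma polys_smooth: "p \<in> polys k \<Longrightarrow> smooth p"
proof -
  assume "p \<in> polys k"
  then obtain c where "p = (\<lambda>x. \<Sum>i\<le>k. \<Sum>j\<le>k - i. c i j * (x $ 1) ^ i * (x $ 2) ^ j)"
    by (auto simp: polys_def)
  then show ?thesis by (auto intro!: smooth_sum smooth_mult smooth_const smooth_power smooth_coord)
qed

lemma pd_affine:
  assumes "smooth f" shows "pd i (\<lambda>x. f (t *\<^sub>R x + b)) x = t * pd i f (t *\<^sub>R x + b)"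
proof -
  have "((\<lambda>x. t *\<^sub>R x + b) has_derivative (\<lambda>h. t *\<^sub>R h)) (at x)"
    by (auto intro!: derivative_eq_intros)
  from pd_eqI[OF has_derivative_compose[OF this smooth_derivative[OF assms]]]
  show ?thesis by (simp add: axis_def if_distrib if_distribR cong: if_cong)
qed

text \<open>The functions \<open>exp (-1/s) / s^n\<close>, extended by zero, are closed under differentiation up to
  linear combinations; this makes the composition of one of them with a smooth function smooth.\<close>

definition flat :: "nat \<Rightarrow> real \<Rightarrow> real" where
  "flat n s = (if s \<le> 0 then 0 else exp (- 1 / s) / s ^ n)"

lemma flat_tendsto_0: "(flat n \<longlongrightarrow> 0) (at 0)"
proof (rule filterlim_split_at)
  show "(flat n \<longlongrightarrow> 0) (at_left 0)"
    by (rule tendsto_eventually) (auto simp: flat_def eventually_at_filter)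
  have "((\<lambda>s. inverse s ^ n / exp (inverse s)) \<longlongrightarrow> 0) (at_right (0::real))"
    by (rule filterlim_compose[OF tendsto_power_div_exp_0 filterlim_inverse_at_top_right])
  then show "(flat n \<longlongrightarrow> 0) (at_right 0)"
  proof (rule Lim_transform_eventually)
    show "\<forall>\<^sub>F s in at_right 0. inverse s ^ n / exp (inverse s) = flat n s"
      by (auto simp: eventually_at_filter flat_def exp_minus field_simps inverse_eq_divide)
  qed
qed

lemma flat_deriv:
  "(flat n has_real_derivative flat (n + 2) s - real n * flat (n + 1) s) (at s)"
proof -
  consider "s < 0" | "s = 0" | "s > 0" by linarith
  then show ?thesis
  proof cases
    case 1
    have "((\<lambda>s. 0::real) has_real_derivative 0) (at s)" by simp
    then have "(flat n has_real_derivative 0) (at s)"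
      by (rule has_field_derivative_transform_within_open[where S="{..<0}"]) (use 1 in \<open>auto simp: flat_def\<close>)
    then show ?thesis using 1 by (simp add: flat_def)
  next
    case 2
    have "(\<lambda>h. (flat n (0 + h) - flat n 0) / h) = flat (n + 1)"
      by (auto simp: flat_def fun_eq_iff)
    then have "(flat n has_real_derivative 0) (at 0)"
      unfolding DERIV_def using flat_tendsto_0[of "n + 1"] by simp
    then show ?thesis using 2 by (simp add: flat_def)
  next
    case 3
    have "((\<lambda>s. exp (- 1 / s) / s ^ n) has_real_derivative
        exp (- 1 / s) / s ^ (n + 2) - real n * (exp (- 1 / s) / s ^ (n + 1))) (at s)"
    proof -
      have "((\<lambda>s. exp (- 1 / s)) has_real_derivative exp (- 1 / s) * (1 / s\<^sup>2)) (at s)"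
        using 3 by (auto intro!: derivative_eq_intros simp: power2_eq_square)
      moreover have "((\<lambda>s. s ^ n) has_real_derivative real n * s ^ (n - 1)) (at s)"
        by (auto intro!: derivative_eq_intros)
      ultimately have "((\<lambda>s. exp (- 1 / s) / s ^ n) has_real_derivative
         (exp (- 1 / s) * (1 / s\<^sup>2) * s ^ n - exp (- 1 / s) * (real n * s ^ (n - 1))) / (s ^ n * s ^ n)) (at s)"
        using 3 by (intro DERIV_divide) auto
      moreover have "(exp (- 1 / s) * (1 / s\<^sup>2) * s ^ n - exp (- 1 / s) * (real n * s ^ (n - 1))) / (s ^ n * s ^ n)
          = exp (- 1 / s) / s ^ (n + 2) - real n * (exp (- 1 / s) / s ^ (n + 1))"
        using 3 by (cases n) (simp_all add: field_simps power2_eq_square)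
      ultimately show ?thesis by simp
    qed
    then have "(flat n has_real_derivative
        exp (- 1 / s) / s ^ (n + 2) - real n * (exp (- 1 / s) / s ^ (n + 1))) (at s)"
      by (rule has_field_derivative_transform_within_open[where S="{0<..}"]) (use 3 in \<open>auto simp: flat_def\<close>)
    then show ?thesis using 3 by (simp add: flat_def)
  qed
qed

lemma Ck_flat: "smooth f \<Longrightarrow> Ck k (\<lambda>x. flat n (f x))"
proof (induction k arbitrary: n)
  case 0
  have "continuous_on UNIV (flat n)"
    using flat_deriv by (auto intro!: continuous_at_imp_continuous_on DERIV_isCont)
  then show ?case using smooth_continuous[OF 0] by (auto intro: continuous_on_compose2)
next
  case (Suc k)
  show ?case
  proof (rule Ck_SucI)
    fix x
    show "((\<lambda>x. flat n (f x)) has_derivative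
       (\<lambda>h. (\<Sum>i\<in>UNIV. h $ i * pd i f x) * (flat (n + 2) (f x) - real n * flat (n + 1) (f x)))) (at x)"
      using has_derivative_compose[OF smooth_derivative[OF Suc.prems]
          flat_deriv[THEN has_field_derivative_imp_has_derivative]] by (simp add: mult.commute)
  next
    fix i
    have "Ck k (pd i f)" using Suc.prems smooth_pd smooth_def by blast
    then have "Ck k (\<lambda>x. pd i f x * (flat (n + 2) (f x) + (- real n) * flat (n + 1) (f x)))"
      by (intro Ck_mult Ck_add Ck_const Suc)
    then show "Ck k (\<lambda>x. (\<Sum>j\<in>UNIV. (axis i 1 :: pt) $ j * pd j f x) *
         (flat (n + 2) (f x) - real n * flat (n + 1) (f x)))"
      by (simp add: axis_def if_distrib if_distribR cong: if_cong)
  qed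
qed

definition bump :: "pt \<Rightarrow> real" where
  "bump x = flat 0 (1 - ((x $ 1)\<^sup>2 + (x $ 2)\<^sup>2))"

lemma norm_pt_sq: "(norm (x :: pt))\<^sup>2 = (x $ 1)\<^sup>2 + (x $ 2)\<^sup>2"
  by (simp add: norm_sq_vec sum_2)

lemma smooth_bump: "smooth bump"
proof -
  have "smooth (\<lambda>x. 1 - ((x $ 1)\<^sup>2 + (x $ 2)\<^sup>2))"
    by (intro smooth_diff smooth_add smooth_power smooth_const smooth_coord)
  then show ?thesis unfolding smooth_def bump_def[abs_def] by (auto intro: Ck_flat simp: smooth_def)
qed

lemma bump_nonneg: "0 \<le> bump x" by (simp add: bump_def flat_def)

lemma bump_pos: "norm x < 1 \<Longrightarrow> 0 < bump x"
  using power_strict_mono[of "norm x" 1 2] by (simp add: bump_def flat_def norm_pt_sq[symmetric])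

lemma bump_zero: "1 \<le> norm x \<Longrightarrow> bump x = 0"
  using power_mono[of 1 "norm x" 2] by (simp add: bump_def flat_def norm_pt_sq[symmetric])

definition rho :: "real \<Rightarrow> pt \<Rightarrow> real" where
  "rho \<epsilon> x = bump (x /\<^sub>R \<epsilon>) / (LINT y|lborel. bump (y /\<^sub>R \<epsilon>))"

lemma smooth_rho: "smooth (rho \<epsilon>)"
  using smooth_mult[OF smooth_affine[OF smooth_bump, of "inverse \<epsilon>" 0] smooth_const]
  unfolding rho_def[abs_def] divide_inverse by simp

lemma rho_zero: "\<epsilon> > 0 \<Longrightarrow> \<epsilon> \<le> norm x \<Longrightarrow> rho \<epsilon> x = 0"
  by (simp add: rho_def bump_zero field_simps)

lemma integrable_continuous_support:
  fixes f :: "pt \<Rightarrow> real"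
  assumes "continuous_on UNIV f" "\<And>x. R \<le> norm x \<Longrightarrow> f x = 0"
  shows "integrable lborel f"
proof -
  have "set_integrable lborel (cball 0 R) f"
    unfolding set_integrable_def by (rule borel_integrable_compact) (auto intro: continuous_on_subset[OF assms(1)])
  moreover have "(\<lambda>x. indicator (cball 0 R) x *\<^sub>R f x) = f"
    using assms(2) by (auto simp: fun_eq_iff indicator_def)
  ultimately show ?thesis by (simp add: set_integrable_def)
qed

lemma bump_integral_pos: assumes "\<epsilon> > 0" shows "0 < (LINT y|lborel. bump (y /\<^sub>R \<epsilon>))"
proof -
  have c: "continuous_on UNIV (\<lambda>y. bump (y /\<^sub>R \<epsilon>))"
    using smooth_continuous[OF smooth_affine[OF smooth_bump, of "inverse \<epsilon>" 0]] by simp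
  have i: "integrable lborel (\<lambda>y. bump (y /\<^sub>R \<epsilon>))"
    by (rule integrable_continuous_support[OF c, of \<epsilon>]) (use assms in \<open>auto intro!: bump_zero simp: field_simps\<close>)
  have "(LINT y|lborel. bump (y /\<^sub>R \<epsilon>)) \<noteq> 0"
  proof
    assume "(LINT y|lborel. bump (y /\<^sub>R \<epsilon>)) = 0"
    then have "AE y in lborel. bump (y /\<^sub>R \<epsilon>) = 0"
      using integral_nonneg_eq_0_iff_AE[OF i] bump_nonneg by simp
    moreover have "AE y in lborel. bump (y /\<^sub>R \<epsilon>) = 0 \<longrightarrow> y \<notin> ball 0 \<epsilon>"
    proof (intro AE_I2 impI)
      fix y assume "bump (y /\<^sub>R \<epsilon>) = 0"
      then have "\<not> norm (y /\<^sub>R \<epsilon>) < 1" using bump_pos[of "y /\<^sub>R \<epsilon>"] by auto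
      then show "y \<notin> ball 0 \<epsilon>" using assms by (auto simp: field_simps)
    qed
    ultimately have "AE y in lborel. y \<notin> ball (0::pt) \<epsilon>" by (rule AE_mp)
    then have "emeasure lborel (ball (0::pt) \<epsilon>) = 0"
      by (subst (asm) AE_iff_measurable[OF _ refl]) (auto simp: ball_def)
    then have "ball (0::pt) \<epsilon> \<in> null_sets lborel" by (simp add: null_setsI)
    then have "negligible (ball (0::pt) \<epsilon>)"
      by (meson negligible_iff_null_sets null_sets_completionI)
    then show False using assms open_not_negligible[of "ball (0::pt) \<epsilon>"] by auto
  qed
  moreover have "0 \<le> (LINT y|lborel. bump (y /\<^sub>R \<epsilon>))" by (simp add: bump_nonneg)
  ultimately show ?thesis by simp
qed

lemma rho_nonneg: "0 \<le> rho \<epsilon> x"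
  by (auto simp: rho_def bump_nonneg intro!: divide_nonneg_nonneg)

lemma rho_integrable: "\<epsilon> > 0 \<Longrightarrow> integrable lborel (rho \<epsilon>)"
  by (rule integrable_continuous_support[OF smooth_continuous[OF smooth_rho] rho_zero])

lemma rho_integral: "\<epsilon> > 0 \<Longrightarrow> (LINT x|lborel. rho \<epsilon> x) = 1"
  using bump_integral_pos[of \<epsilon>] by (simp add: rho_def)

lemma L2norm_mono_AE:
  assumes "L2 M f" "g \<in> borel_measurable M" "AE x in M. norm (g x) \<le> norm (f x)"
  shows "L2norm M g \<le> L2norm M f"
proof -
  have "L2 M g" by (rule L2_dominated[OF assms])
  moreover have "AE x in M. (norm (g x))\<^sup>2 \<le> (norm (f x))\<^sup>2"
    using assms(3) by (rule eventually_mono) (simp add: power_mono)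
  ultimately have "(LINT x|M. (norm (g x))\<^sup>2) \<le> (LINT x|M. (norm (f x))\<^sup>2)"
    using assms(1) by (intro integral_mono_AE L2_integrable_sq)
  then show ?thesis by (simp add: L2norm_def)
qed

lemma borel_measurable_lebesgue_restrict:
  fixes f :: "pt \<Rightarrow> 'b::euclidean_space"
  assumes "S \<in> sets lebesgue"
  shows "f \<in> borel_measurable (lebesgue_on S) \<longleftrightarrow> (\<lambda>x. indicator S x *\<^sub>R f x) \<in> borel_measurable lebesgue"
  using assms by (subst borel_measurable_restrict_space_iff) auto

lemma L2_restrict_iff:
  fixes f :: "pt \<Rightarrow> 'b::euclidean_space"
  assumes S: "S \<in> sets lebesgue"
  shows "L2 (lebesgue_on S) f \<longleftrightarrow> L2 lebesgue (\<lambda>x. indicator S x *\<^sub>R f x)"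
    and "L2norm (lebesgue_on S) f = L2norm lebesgue (\<lambda>x. indicator S x *\<^sub>R f x)"
proof -
  have eq: "(norm (indicator S x *\<^sub>R f x))\<^sup>2 = indicator S x *\<^sub>R (norm (f x))\<^sup>2" for x
    by (auto simp: indicator_def)
  show "L2 (lebesgue_on S) f \<longleftrightarrow> L2 lebesgue (\<lambda>x. indicator S x *\<^sub>R f x)"
    unfolding L2_def borel_measurable_lebesgue_restrict[OF S] eq
    using S by (subst integrable_restrict_space) auto
  show "L2norm (lebesgue_on S) f = L2norm lebesgue (\<lambda>x. indicator S x *\<^sub>R f x)"
    unfolding L2norm_def eq using S by (subst integral_restrict_space) auto
qed

lemma AE_lebesgue_negligible: "negligible N \<Longrightarrow> (\<And>x. x \<notin> N \<Longrightarrow> P x) \<Longrightarrow> AE x in lebesgue. P x"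
  by (rule AE_I'[where N=N]) (auto simp: negligible_iff_null_sets)

section \<open>Convolution\<close>

definition bsupp :: "(pt \<Rightarrow> real) \<Rightarrow> bool" where
  "bsupp \<eta> \<longleftrightarrow> (\<exists>R. \<forall>x. R \<le> norm x \<longrightarrow> \<eta> x = 0)"

lemma bsupp_pd: assumes "bsupp \<eta>" shows "bsupp (pd i \<eta>)"
proof -
  obtain R where R: "\<And>x. R \<le> norm x \<Longrightarrow> \<eta> x = 0" using assms by (auto simp: bsupp_def)
  have "pd i \<eta> x = 0" if "R + 1 \<le> norm x" for x
  proof -
    have op: "open {y. R < norm (y::pt)}" by (intro open_Collect_less continuous_intros)
    have "((\<lambda>y. 0::real) has_derivative (\<lambda>h. 0)) (at x)" by simp
    then have "(\<eta> has_derivative (\<lambda>h. 0)) (at x)"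
      by (rule has_derivative_transform_within_open[OF _ op]) (use that R in auto)
    then show ?thesis by (simp add: pd_eqI)
  qed
  then show ?thesis unfolding bsupp_def by blast
qed

lemma bsupp_rho: "\<epsilon> > 0 \<Longrightarrow> bsupp (rho \<epsilon>)"
  unfolding bsupp_def using rho_zero by blast

lemma bsupp_uniform:
  assumes "bsupp \<eta>" "continuous_on UNIV \<eta>" "e > 0"
  obtains d where "d > 0" "\<And>x y. dist x y < d \<Longrightarrow> \<bar>\<eta> x - \<eta> y\<bar> < e"
proof -
  obtain R where R: "\<And>x. R \<le> norm x \<Longrightarrow> \<eta> x = 0" using assms by (auto simp: bsupp_def)
  have "uniformly_continuous_on (cball 0 (R + 1)) \<eta>"
    by (intro compact_uniformly_continuous continuous_on_subset[OF assms(2)]) auto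
  then obtain d where d: "d > 0" "\<And>x y. x \<in> cball 0 (R + 1) \<Longrightarrow> y \<in> cball 0 (R + 1) \<Longrightarrow> dist x y < d \<Longrightarrow> dist (\<eta> x) (\<eta> y) < e"
    using assms(3) unfolding uniformly_continuous_on_def by metis
  show ?thesis
  proof (rule that[of "min d 1"])
    show "min d 1 > 0" using d by simp
    fix x y :: pt assume xy: "dist x y < min d 1"
    show "\<bar>\<eta> x - \<eta> y\<bar> < e"
    proof (cases "x \<in> cball 0 (R + 1) \<and> y \<in> cball 0 (R + 1)")
      case True
      then show ?thesis using d(2)[of x y] xy by (simp add: dist_real_def)
    next
      case False
      have "norm x \<le> norm y + dist x y" "norm y \<le> norm x + dist x y"
        using norm_triangle_ineq2[of x y] norm_triangle_ineq2[of y x] by (auto simp: dist_norm norm_minus_commute)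
      then have "R \<le> norm x" "R \<le> norm y" using False xy by auto
      then show ?thesis using R assms(3) by simp
    qed
  qed
qed

lemma bsupp_bounded:
  assumes "bsupp \<eta>" "continuous_on UNIV \<eta>"
  obtains B where "B \<ge> 0" "\<And>x. \<bar>\<eta> x\<bar> \<le> B"
proof -
  obtain R where R: "\<And>x. R \<le> norm x \<Longrightarrow> \<eta> x = 0" using assms by (auto simp: bsupp_def)
  have "bounded (\<eta> ` cball 0 R)"
    by (intro compact_imp_bounded compact_continuous_image continuous_on_subset[OF assms(2)]) auto
  then obtain B where "\<forall>x\<in>cball 0 R. \<bar>\<eta> x\<bar> \<le> B" unfolding bounded_iff by auto
  then have B: "\<And>x. norm x \<le> R \<Longrightarrow> \<bar>\<eta> x\<bar> \<le> B" by simp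
  show ?thesis
  proof (rule that[of "max B 0"])
    fix x show "\<bar>\<eta> x\<bar> \<le> max B 0" using B[of x] R[of x] by (cases "norm x \<le> R") auto
  qed simp
qed

definition conv :: "(pt \<Rightarrow> real) \<Rightarrow> (pt \<Rightarrow> real) \<Rightarrow> pt \<Rightarrow> real" where
  "conv \<eta> f x = (LINT y|lebesgue. f y * \<eta> (x - y))"

lemma continuous_lebesgue_measurable:
  "continuous_on UNIV (f :: pt \<Rightarrow> 'b::euclidean_space) \<Longrightarrow> f \<in> borel_measurable lebesgue"
  by (intro measurable_completion) (simp add: borel_measurable_continuous_onI)

lemma continuous_shift: "continuous_on UNIV (\<eta> :: pt \<Rightarrow> real) \<Longrightarrow> continuous_on UNIV (\<lambda>y. \<eta> (x - y))"
  by (rule continuous_on_compose2[of UNIV \<eta>]) (auto intro!: continuous_intros)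

lemma integrable_mult_bounded:
  fixes f g :: "'a \<Rightarrow> real"
  assumes "integrable M f" "g \<in> borel_measurable M" "\<And>x. \<bar>g x\<bar> \<le> B"
  shows "integrable M (\<lambda>x. f x * g x)"
proof (rule Bochner_Integration.integrable_bound)
  show "integrable M (\<lambda>x. B * f x)" using assms by simp
  show "(\<lambda>x. f x * g x) \<in> borel_measurable M" using assms by auto
  have "norm (f x * g x) \<le> norm (B * f x)" for x
  proof -
    have "\<bar>g x\<bar> \<le> \<bar>B\<bar>" using assms(3)[of x] by linarith
    then show ?thesis using mult_left_mono[of "\<bar>g x\<bar>" "\<bar>B\<bar>" "\<bar>f x\<bar>"] by (simp add: abs_mult mult.commute)
  qed
  then show "AE x in M. norm (f x * g x) \<le> norm (B * f x)" by simp
qed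

lemma conv_integrable:
  assumes "integrable lebesgue f" "bsupp \<eta>" "continuous_on UNIV \<eta>"
  shows "integrable lebesgue (\<lambda>y. f y * \<eta> (x - y))"
proof -
  obtain B where "\<And>x. \<bar>\<eta> x\<bar> \<le> B" using bsupp_bounded assms by blast
  then show ?thesis
    by (intro integrable_mult_bounded[of _ _ _ B] assms continuous_lebesgue_measurable continuous_shift)
qed

lemma conv_diff:
  assumes "integrable lebesgue f" "integrable lebesgue g" "bsupp \<eta>" "continuous_on UNIV \<eta>"
  shows "conv \<eta> (\<lambda>y. f y - g y) x = conv \<eta> f x - conv \<eta> g x"
  using conv_integrable[OF assms(1,3,4), of x] conv_integrable[OF assms(2,3,4), of x]
  by (simp add: conv_def left_diff_distrib)

text \<open>The remainder is uniform in the base point because first derivatives with bounded support are uniformly continuous.\<close>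

lemma smooth_taylor_uniform:
  assumes "bsupp \<eta>" "smooth \<eta>" "e > 0"
  obtains d where "d > 0"
    "\<And>x h. norm h < d \<Longrightarrow> \<bar>\<eta> (x + h) - \<eta> x - (\<Sum>i\<in>UNIV. h $ i * pd i \<eta> x)\<bar> \<le> e * norm h"
proof -
  have "\<exists>d>0. \<forall>x y. dist x y < d \<longrightarrow> \<bar>pd i \<eta> x - pd i \<eta> y\<bar> < e / 2" for i
    using bsupp_uniform[OF bsupp_pd[OF assms(1)] smooth_continuous[OF smooth_pd[OF assms(2)]], of "e / 2" i] assms(3)
    by (metis half_gt_zero)
  then obtain d where d: "\<And>i. d i > 0" "\<And>i x y. dist x y < d i \<Longrightarrow> \<bar>pd i \<eta> x - pd i \<eta> y\<bar> < e / 2"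
    by metis
  show ?thesis
  proof (rule that[of "min (d 1) (d 2)"])
    show "min (d 1) (d 2) > 0" using d by auto
    fix x h :: pt assume h: "norm h < min (d 1) (d 2)"
    let ?S = "ball x (min (d 1) (d 2))"
    let ?D = "\<lambda>y h. \<Sum>i\<in>UNIV. h $ i * pd i \<eta> y"
    have "norm (\<eta> (x + h) - \<eta> x - ?D x (x + h - x)) \<le> norm (x + h - x) * e"
    proof (rule differentiable_bound_linearization[where S="?S"])
      fix t :: real assume "t \<in> {0..1}"
      then have "norm (t *\<^sub>R h) \<le> 1 * norm h" by (auto intro!: mult_left_le_one_le)
      then show "x + t *\<^sub>R (x + h - x) \<in> ?S" using h by (simp add: dist_norm)
    next
      fix y assume "y \<in> ?S"
      show "(\<eta> has_derivative ?D y) (at y within ?S)"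
        using smooth_derivative[OF assms(2)] has_derivative_at_withinI by blast
    next
      fix y assume y: "y \<in> ?S"
      have b: "\<bar>pd i \<eta> y - pd i \<eta> x\<bar> \<le> e / 2" for i
        using d(2)[of y x i] y exhaust_2[of i] by (auto simp: dist_commute less_imp_le)
      show "onorm (?D y - ?D x) \<le> e"
      proof (rule onorm_le)
        fix k :: pt
        have "norm ((?D y - ?D x) k) = \<bar>\<Sum>i\<in>UNIV. k $ i * (pd i \<eta> y - pd i \<eta> x)\<bar>"
          by (simp add: sum_subtractf[symmetric] right_diff_distrib)
        also have "\<dots> \<le> (\<Sum>i\<in>(UNIV :: 2 set). norm k * (e / 2))"
        proof (rule order.trans[OF sum_abs], rule sum_mono)
          fix i :: 2
          have "\<bar>k $ i\<bar> * \<bar>pd i \<eta> y - pd i \<eta> x\<bar> \<le> norm k * (e / 2)"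
            by (intro mult_mono b component_le_norm_cart) auto
          then show "\<bar>k $ i * (pd i \<eta> y - pd i \<eta> x)\<bar> \<le> norm k * (e / 2)" by (simp only: abs_mult)
        qed
        finally show "norm ((?D y - ?D x) k) \<le> e * norm k" by (simp add: sum_2 field_simps)
      qed
    next
      show "x \<in> ?S" using d by auto
    qed
    then show "\<bar>\<eta> (x + h) - \<eta> x - ?D x h\<bar> \<le> e * norm h" by (simp add: mult.commute)
  qed
qed

text \<open>The uniform Taylor estimate survives integration against \<open>f\<close>, so all derivatives fall on the smooth kernel.\<close>

lemma conv_has_derivative:
  assumes f: "integrable lebesgue f" and \<eta>: "bsupp \<eta>" "smooth \<eta>"
  shows "(conv \<eta> f has_derivative (\<lambda>h. \<Sum>i\<in>UNIV. h $ i * conv (pd i \<eta>) f x)) (at x)"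
  unfolding has_derivative_at_alt
proof (intro conjI allI impI)
  show "bounded_linear (\<lambda>h :: pt. \<Sum>i\<in>UNIV. h $ i * conv (pd i \<eta>) f x)"
    by (intro bounded_linear_sum bounded_linear_mult_const bounded_linear_vec_nth)
  fix e :: real assume "e > 0"
  define F where "F = (LINT y|lebesgue. \<bar>f y\<bar>)"
  have F: "F \<ge> 0" by (simp add: F_def)
  then have "e / (F + 1) > 0" using \<open>e > 0\<close> by auto
  then obtain d where d: "d > 0"
    "\<And>x h. norm h < d \<Longrightarrow> \<bar>\<eta> (x + h) - \<eta> x - (\<Sum>i\<in>UNIV. h $ i * pd i \<eta> x)\<bar> \<le> e / (F + 1) * norm h"
    by (rule smooth_taylor_uniform[OF \<eta>]) blast
  have ci: "integrable lebesgue (\<lambda>y. f y * \<eta> (z - y))" for z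
    by (intro conv_integrable f \<eta> smooth_continuous)
  have ci': "integrable lebesgue (\<lambda>y. f y * pd i \<eta> (z - y))" for z i
    by (intro conv_integrable f \<eta> smooth_continuous smooth_pd bsupp_pd)
  show "\<exists>d>0. \<forall>y. norm (y - x) < d \<longrightarrow>
      norm (conv \<eta> f y - conv \<eta> f x - (\<Sum>i\<in>UNIV. (y - x) $ i * conv (pd i \<eta>) f x)) \<le> e * norm (y - x)"
  proof (intro exI[of _ d] conjI allI impI d(1))
    fix z assume z: "norm (z - x) < d"
    let ?h = "z - x"
    let ?r = "\<lambda>y. \<eta> (z - y) - \<eta> (x - y) - (\<Sum>i\<in>UNIV. ?h $ i * pd i \<eta> (x - y))"
    have eq: "f y * \<eta> (z - y) - f y * \<eta> (x - y) - (\<Sum>i\<in>UNIV. ?h $ i * (f y * pd i \<eta> (x - y))) = f y * ?r y" for y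
      by (simp add: algebra_simps sum_distrib_left)
    have int: "integrable lebesgue (\<lambda>y. f y * ?r y)"
      unfolding eq[symmetric] using ci ci' by auto
    have "conv \<eta> f z - conv \<eta> f x - (\<Sum>i\<in>UNIV. ?h $ i * conv (pd i \<eta>) f x) = (LINT y|lebesgue. f y * ?r y)"
      unfolding eq[symmetric] conv_def using ci ci' by simp
    also have "norm \<dots> \<le> (LINT y|lebesgue. \<bar>f y\<bar> * (e / (F + 1) * norm ?h))"
    proof (rule order.trans[OF integral_norm_bound])
      have "norm (f y * ?r y) \<le> \<bar>f y\<bar> * (e / (F + 1) * norm ?h)" for y
      proof -
        have "x - y + (z - x) = z - y" by simp
        then have "\<bar>?r y\<bar> \<le> e / (F + 1) * norm ?h" using d(2)[OF z, of "x - y"] by simp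
        then show ?thesis unfolding real_norm_def abs_mult by (rule mult_left_mono) simp
      qed
      then show "(LINT y|lebesgue. norm (f y * ?r y)) \<le> (LINT y|lebesgue. \<bar>f y\<bar> * (e / (F + 1) * norm ?h))"
        using int f by (intro integral_mono) auto
    qed
    also have "\<dots> = F * (e / (F + 1) * norm ?h)" by (simp add: F_def)
    also have "\<dots> \<le> e * norm ?h"
    proof -
      have "F / (F + 1) \<le> 1" using F by simp
      then have "F / (F + 1) * (e * norm ?h) \<le> 1 * (e * norm ?h)"
        using \<open>e > 0\<close> by (intro mult_right_mono) auto
      then show ?thesis by simp
    qed
    finally show "norm (conv \<eta> f z - conv \<eta> f x - (\<Sum>i\<in>UNIV. ?h $ i * conv (pd i \<eta>) f x)) \<le> e * norm ?h" .
  qed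
qed

lemma pd_conv:
  assumes "integrable lebesgue f" "bsupp \<eta>" "smooth \<eta>"
  shows "pd i (conv \<eta> f) = conv (pd i \<eta>) f"
  using pd_eqI[OF conv_has_derivative[OF assms]]
  by (auto simp: fun_eq_iff axis_def if_distrib if_distribR cong: if_cong)

lemma smooth_conv:
  assumes f: "integrable lebesgue f"
  shows "bsupp \<eta> \<Longrightarrow> smooth \<eta> \<Longrightarrow> smooth (conv \<eta> f)"
proof -
  have "Ck k (conv \<eta> f)" if "bsupp \<eta>" "smooth \<eta>" for k \<eta>
    using that
  proof (induction k arbitrary: \<eta>)
    case 0
    have "conv \<eta> f differentiable (at x)" for x
      using conv_has_derivative[OF f 0] by (auto simp: differentiable_def)
    then show ?case
      by (auto intro!: continuous_at_imp_continuous_on differentiable_imp_continuous_within)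
  next
    case (Suc k)
    have "conv \<eta> f differentiable (at x)" for x
      using conv_has_derivative[OF f Suc.prems] by (auto simp: differentiable_def)
    then show ?case
      using Suc by (auto simp: pd_conv[OF f Suc.prems] intro!: bsupp_pd smooth_pd)
  qed
  then show "bsupp \<eta> \<Longrightarrow> smooth \<eta> \<Longrightarrow> smooth (conv \<eta> f)" by (auto simp: smooth_def)
qed

text \<open>On the part of the domain that keeps distance \<open>\<epsilon>\<close> from the boundary, the shifted mollifier is
  a test function, so mollification commutes with the weak gradient there.\<close>

lemma conv_weak_grad:
  assumes wg: "has_weak_grad \<Omega> u G" and \<Omega>: "open \<Omega>" and \<epsilon>: "\<epsilon> > 0" and x: "cball x \<epsilon> \<subseteq> \<Omega>"
  shows "conv (pd i (rho \<epsilon>)) (\<lambda>y. indicator \<Omega> y * u y) x = conv (rho \<epsilon>) (\<lambda>y. indicator \<Omega> y * G y $ i) x"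
proof -
  define \<phi> where "\<phi> = (\<lambda>y. rho \<epsilon> ((-1) *\<^sub>R y + x))"
  have \<Omega>m: "\<Omega> \<in> sets lebesgue" using \<Omega> by simp
  have "test_function \<Omega> \<phi>"
    unfolding test_function_def
  proof (intro conjI exI[of _ "cball x \<epsilon>"])
    show "smooth \<phi>" unfolding \<phi>_def by (rule smooth_affine[OF smooth_rho])
    show "\<forall>y. y \<notin> cball x \<epsilon> \<longrightarrow> \<phi> y = 0"
      unfolding \<phi>_def using rho_zero[OF \<epsilon>] by (auto simp: dist_norm)
  qed (use x in auto)
  then have "(LINT y|lebesgue_on \<Omega>. u y * pd i \<phi> y) = - (LINT y|lebesgue_on \<Omega>. G y $ i * \<phi> y)"
    using wg unfolding has_weak_grad_def by blast
  moreover have "pd i \<phi> y = - pd i (rho \<epsilon>) (x - y)" for y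
    unfolding \<phi>_def by (subst pd_affine[OF smooth_rho]) simp
  ultimately have "(LINT y|lebesgue_on \<Omega>. u y * pd i (rho \<epsilon>) (x - y)) = (LINT y|lebesgue_on \<Omega>. G y $ i * rho \<epsilon> (x - y))"
    by (simp add: \<phi>_def)
  then show ?thesis
    using \<Omega>m by (simp add: conv_def integral_restrict_space mult.assoc)
qed

lemma rho_shift:
  assumes "\<epsilon> > 0"
  shows "integrable lebesgue (\<lambda>y. rho \<epsilon> (z - y))" "(LINT y|lebesgue. rho \<epsilon> (z - y)) = 1"
proof -
  have m: "(\<lambda>y. rho \<epsilon> (z - y)) \<in> borel_measurable lborel"
    using borel_measurable_continuous_onI[OF continuous_shift[OF smooth_continuous[OF smooth_rho]]] by simp
  have m': "rho \<epsilon> \<in> borel_measurable borel"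
    by (intro borel_measurable_continuous_onI smooth_continuous smooth_rho)
  have lb: "lborel = distr lborel borel (\<lambda>y::pt. z - y)"
    using lborel_affine[of "-1" z] by (simp add: density_1)
  have "integrable lborel (\<lambda>y. rho \<epsilon> (z - y))"
    using rho_integrable[OF assms] m' by (subst (asm) lb) (simp add: integrable_distr_eq)
  then show "integrable lebesgue (\<lambda>y. rho \<epsilon> (z - y))" using m by (simp add: integrable_completion)
  have "(LINT y|lborel. rho \<epsilon> (z - y)) = 1"
    using rho_integral[OF assms] m' by (subst (asm) lb) (simp add: integral_distr)
  then show "(LINT y|lebesgue. rho \<epsilon> (z - y)) = 1" using m by (simp add: integral_completion)
qed

text \<open>A mollification is a weighted mean of the values within the mollification radius.\<close>

lemma conv_close:
  assumes f: "integrable lebesgue f" and \<epsilon>: "\<epsilon> > 0" and c: "\<And>y. dist y z \<le> \<epsilon> \<Longrightarrow> \<bar>f y - c\<bar> \<le> e"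
  shows "\<bar>conv (rho \<epsilon>) f z - c\<bar> \<le> e"
proof -
  have ci: "integrable lebesgue (\<lambda>y. f y * rho \<epsilon> (z - y))"
    by (intro conv_integrable f bsupp_rho \<epsilon> smooth_continuous smooth_rho)
  note r = rho_shift[OF \<epsilon>, of z]
  have int: "integrable lebesgue (\<lambda>y. (f y - c) * rho \<epsilon> (z - y))"
    using ci r(1) by (simp add: left_diff_distrib)
  have "conv (rho \<epsilon>) f z - c = (LINT y|lebesgue. (f y - c) * rho \<epsilon> (z - y))"
    using ci r by (simp add: conv_def left_diff_distrib)
  also have "\<bar>\<dots>\<bar> \<le> (LINT y|lebesgue. e * rho \<epsilon> (z - y))"
  proof (rule order.trans[OF integral_abs_bound])
    have "\<bar>(f y - c) * rho \<epsilon> (z - y)\<bar> \<le> e * rho \<epsilon> (z - y)" for y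
    proof (cases "dist y z \<le> \<epsilon>")
      case True
      then show ?thesis using c[OF True] rho_nonneg[of \<epsilon> "z - y"] by (simp add: abs_mult mult_right_mono)
    next
      case False
      then have "rho \<epsilon> (z - y) = 0" using rho_zero[OF \<epsilon>] by (simp add: dist_norm norm_minus_commute)
      then show ?thesis by simp
    qed
    then show "(LINT y|lebesgue. \<bar>(f y - c) * rho \<epsilon> (z - y)\<bar>) \<le> (LINT y|lebesgue. e * rho \<epsilon> (z - y))"
      using int r(1) by (intro integral_mono) auto
  qed
  also have "\<dots> = e" using r by simp
  finally show ?thesis .
qed

text \<open>Jensen's inequality for the probability density \<open>rho \<epsilon> (z - y)\<close>: the variance is nonnegative.\<close>

lemma conv_sq_le:
  assumes f: "integrable lebesgue f" "L2 lebesgue f" and \<epsilon>: "\<epsilon> > 0"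
  shows "ennreal ((conv (rho \<epsilon>) f z)\<^sup>2) \<le> (\<integral>\<^sup>+y. ennreal ((f y)\<^sup>2 * rho \<epsilon> (z - y)) \<partial>lebesgue)"
proof -
  define m where "m = conv (rho \<epsilon>) f z"
  have ci: "integrable lebesgue (\<lambda>y. f y * rho \<epsilon> (z - y))"
    by (intro conv_integrable f bsupp_rho \<epsilon> smooth_continuous smooth_rho)
  have ci2: "integrable lebesgue (\<lambda>y. (f y)\<^sup>2 * rho \<epsilon> (z - y))"
    using f(2) by (intro conv_integrable bsupp_rho \<epsilon> smooth_continuous smooth_rho) (auto simp: L2_def)
  note r = rho_shift[OF \<epsilon>, of z]
  have "0 \<le> (LINT y|lebesgue. (f y - m)\<^sup>2 * rho \<epsilon> (z - y))" by (simp add: rho_nonneg)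
  also have "\<dots> = (LINT y|lebesgue. (f y)\<^sup>2 * rho \<epsilon> (z - y) - 2 * m * (f y * rho \<epsilon> (z - y)) + m\<^sup>2 * rho \<epsilon> (z - y))"
    by (simp add: power2_diff algebra_simps)
  also have "\<dots> = (LINT y|lebesgue. (f y)\<^sup>2 * rho \<epsilon> (z - y)) - 2 * m * m + m\<^sup>2"
    using ci ci2 r by (simp add: m_def conv_def)
  finally have "m\<^sup>2 \<le> (LINT y|lebesgue. (f y)\<^sup>2 * rho \<epsilon> (z - y))" by (simp add: power2_eq_square)
  then show ?thesis unfolding m_def[symmetric]
    using ci2 by (subst nn_integral_eq_integral) (auto simp: rho_nonneg)
qed

lemma nn_integral_affine:
  fixes f :: "pt \<Rightarrow> ennreal"
  assumes [measurable]: "f \<in> borel_measurable borel" and t: "t \<noteq> 0"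
  shows "(\<integral>\<^sup>+x. f x \<partial>lborel) = ennreal (t\<^sup>2) * (\<integral>\<^sup>+x. f (b + t *\<^sub>R x) \<partial>lborel)"
  by (subst lborel_affine[OF t, of b]) (simp add: nn_integral_density nn_integral_distr nn_integral_cmult)

text \<open>Jensen's inequality and Fubini's theorem bound the mollification by the function; the contraction by \<open>t\<close> contributes
  the Jacobian \<open>t\<^sup>-\<^sup>2 \<le> 4\<close>.\<close>

lemma conv_L2_bound:
  assumes f: "integrable lebesgue f" "L2 lebesgue f" and \<epsilon>: "\<epsilon> > 0" and t: "1/2 \<le> t"
  shows "L2 lebesgue (\<lambda>x. conv (rho \<epsilon>) f (t *\<^sub>R x + b))"
    and "L2norm lebesgue (\<lambda>x. conv (rho \<epsilon>) f (t *\<^sub>R x + b)) \<le> 2 * L2norm lebesgue f"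
proof -
  let ?c = "\<lambda>x. conv (rho \<epsilon>) f (t *\<^sub>R x + b)"
  have cm: "?c \<in> borel_measurable lebesgue"
    by (intro continuous_lebesgue_measurable smooth_continuous smooth_affine smooth_conv f bsupp_rho smooth_rho \<epsilon>)
  obtain g where g[measurable]: "g \<in> borel_measurable lborel" and ae: "AE x in lborel. f x = g x"
    using completion_ex_borel_measurable_real[of f lborel] L2_measurable[OF f(2)] by blast
  have ae': "AE x in lebesgue. f x = g x" using ae by (rule AE_completion)
  have [measurable]: "rho \<epsilon> \<in> borel_measurable borel"
    by (intro borel_measurable_continuous_onI smooth_continuous smooth_rho)
  have "(\<integral>\<^sup>+x. ennreal ((?c x)\<^sup>2) \<partial>lborel)
      \<le> (\<integral>\<^sup>+x. (\<integral>\<^sup>+y. ennreal ((g y)\<^sup>2 * rho \<epsilon> (t *\<^sub>R x + b - y)) \<partial>lborel) \<partial>lborel)"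
  proof (rule nn_integral_mono)
    fix x
    have "ennreal ((?c x)\<^sup>2) \<le> (\<integral>\<^sup>+y. ennreal ((f y)\<^sup>2 * rho \<epsilon> (t *\<^sub>R x + b - y)) \<partial>lebesgue)"
      by (rule conv_sq_le[OF f \<epsilon>])
    also have "\<dots> = (\<integral>\<^sup>+y. ennreal ((f y)\<^sup>2 * rho \<epsilon> (t *\<^sub>R x + b - y)) \<partial>lborel)"
      by (rule nn_integral_completion)
    also have "\<dots> = (\<integral>\<^sup>+y. ennreal ((g y)\<^sup>2 * rho \<epsilon> (t *\<^sub>R x + b - y)) \<partial>lborel)"
      by (rule nn_integral_cong_AE, rule eventually_mono[OF ae]) simp
    finally show "ennreal ((?c x)\<^sup>2) \<le> (\<integral>\<^sup>+y. ennreal ((g y)\<^sup>2 * rho \<epsilon> (t *\<^sub>R x + b - y)) \<partial>lborel)" .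
  qed
  also have "\<dots> = (\<integral>\<^sup>+y. (\<integral>\<^sup>+x. ennreal ((g y)\<^sup>2 * rho \<epsilon> (t *\<^sub>R x + b - y)) \<partial>lborel) \<partial>lborel)"
    by (rule lborel_pair.Fubini') measurable
  also have "\<dots> = (\<integral>\<^sup>+y. ennreal ((g y)\<^sup>2) * ennreal (1 / t\<^sup>2) \<partial>lborel)"
  proof (rule nn_integral_cong)
    fix y
    have "(\<integral>\<^sup>+x. ennreal (rho \<epsilon> x) \<partial>lborel) = 1"
      using rho_integral[OF \<epsilon>] rho_integrable[OF \<epsilon>] by (subst nn_integral_eq_integral) (auto simp: rho_nonneg)
    moreover have "(\<integral>\<^sup>+x. ennreal (rho \<epsilon> x) \<partial>lborel)
        = ennreal (t\<^sup>2) * (\<integral>\<^sup>+x. ennreal (rho \<epsilon> (b - y + t *\<^sub>R x)) \<partial>lborel)"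
      by (rule nn_integral_affine) (use t in auto)
    ultimately have 1: "ennreal (t\<^sup>2) * (\<integral>\<^sup>+x. ennreal (rho \<epsilon> (b - y + t *\<^sub>R x)) \<partial>lborel) = 1" by simp
    have "(\<integral>\<^sup>+x. ennreal (rho \<epsilon> (b - y + t *\<^sub>R x)) \<partial>lborel)
       = ennreal (1 / t\<^sup>2) * (ennreal (t\<^sup>2) * (\<integral>\<^sup>+x. ennreal (rho \<epsilon> (b - y + t *\<^sub>R x)) \<partial>lborel))"
      using t by (simp add: mult.assoc[symmetric] ennreal_mult[symmetric])
    then have "(\<integral>\<^sup>+x. ennreal (rho \<epsilon> (b - y + t *\<^sub>R x)) \<partial>lborel) = ennreal (1 / t\<^sup>2)" unfolding 1 by simp
    then show "(\<integral>\<^sup>+x. ennreal ((g y)\<^sup>2 * rho \<epsilon> (t *\<^sub>R x + b - y)) \<partial>lborel) = ennreal ((g y)\<^sup>2) * ennreal (1 / t\<^sup>2)"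
      by (simp add: ennreal_mult rho_nonneg nn_integral_cmult algebra_simps)
  qed
  also have "\<dots> = (\<integral>\<^sup>+y. ennreal ((g y)\<^sup>2) \<partial>lborel) * ennreal (1 / t\<^sup>2)"
    by (rule nn_integral_multc) measurable
  also have "(\<integral>\<^sup>+y. ennreal ((g y)\<^sup>2) \<partial>lborel) = (\<integral>\<^sup>+y. ennreal ((f y)\<^sup>2) \<partial>lebesgue)"
    unfolding nn_integral_completion by (rule nn_integral_cong_AE, rule eventually_mono[OF ae]) simp
  also have "\<dots> = ennreal ((L2norm lebesgue f)\<^sup>2)"
    using f(2) by (subst nn_integral_eq_integral) (auto simp: L2_def L2norm_sq)
  also have "\<dots> * ennreal (1 / t\<^sup>2) \<le> ennreal ((2 * L2norm lebesgue f)\<^sup>2)"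
  proof -
    have "(1/2)\<^sup>2 \<le> t\<^sup>2" using t by (intro power_mono) auto
    then have "1 / t\<^sup>2 \<le> 4" using t by (simp add: field_simps power2_eq_square)
    then have "(L2norm lebesgue f)\<^sup>2 * (1 / t\<^sup>2) \<le> (L2norm lebesgue f)\<^sup>2 * 4" by (intro mult_left_mono) auto
    then show ?thesis by (subst ennreal_mult[symmetric]) (auto simp: power_mult_distrib intro!: ennreal_leI)
  qed
  finally have b: "(\<integral>\<^sup>+x. ennreal ((?c x)\<^sup>2) \<partial>lebesgue) \<le> ennreal ((2 * L2norm lebesgue f)\<^sup>2)"
    by (simp add: nn_integral_completion)
  have int: "integrable lebesgue (\<lambda>x. (?c x)\<^sup>2)"
  proof (rule integrableI_nonneg)
    show "(\<integral>\<^sup>+x. ennreal ((?c x)\<^sup>2) \<partial>lebesgue) < \<infinity>"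
      using b by (rule order.strict_trans1) (simp add: ennreal_less_top)
  qed (use cm in auto)
  then show L: "L2 lebesgue ?c" using cm by (simp add: L2_def)
  have "ennreal ((L2norm lebesgue ?c)\<^sup>2) \<le> ennreal ((2 * L2norm lebesgue f)\<^sup>2)"
    using b int by (subst (asm) nn_integral_eq_integral) (auto simp: L2norm_sq)
  then have "(L2norm lebesgue ?c)\<^sup>2 \<le> (2 * L2norm lebesgue f)\<^sup>2" by (subst (asm) ennreal_le_iff) auto
  then show "L2norm lebesgue ?c \<le> 2 * L2norm lebesgue f"
    by (rule power2_le_imp_le) (simp add: L2norm_nonneg)
qed

section \<open>Convergence of mollifications\<close>

lemma L2_indicator:
  assumes "S \<in> lmeasurable"
  shows "L2 lebesgue (\<lambda>x::pt. c * indicator S x)" "L2norm lebesgue (\<lambda>x::pt. c * indicator S x) = \<bar>c\<bar> * sqrt (measure lebesgue S)"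
proof -
  have eq: "(norm (c * indicator S x))\<^sup>2 = c\<^sup>2 * indicator S x" for x :: pt
    by (auto simp: indicator_def)
  have "S \<in> sets lebesgue" using assms by blast
  moreover have "integrable lebesgue (indicator S :: pt \<Rightarrow> real)"
    using assms lmeasurable_iff_integrable by blast
  ultimately show "L2 lebesgue (\<lambda>x::pt. c * indicator S x)" unfolding L2_def eq by auto
  show "L2norm lebesgue (\<lambda>x::pt. c * indicator S x) = \<bar>c\<bar> * sqrt (measure lebesgue S)"
    using \<open>S \<in> sets lebesgue\<close> unfolding L2norm_def eq by (simp add: real_sqrt_mult)
qed

lemma integrable_of_L2_bounded_support:
  assumes f: "L2 lebesgue f" and R: "\<And>x::pt. R \<le> norm x \<Longrightarrow> f x = (0::real)"
  shows "integrable lebesgue f"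
proof -
  have "integrable lebesgue (\<lambda>x. f x * (1 * indicator (ball 0 R) x))"
    by (intro L2_integrable_mult f L2_indicator) simp
  moreover have "(\<lambda>x. f x * (1 * indicator (ball 0 R) x)) = f" using R by (auto simp: fun_eq_iff indicator_def)
  ultimately show ?thesis by simp
qed

lemma L2norm_dominated_convergence:
  fixes s :: "nat \<Rightarrow> 'a \<Rightarrow> real"
  assumes s: "\<And>n. s n \<in> borel_measurable M" and w: "L2 M w"
    and lim: "AE x in M. (\<lambda>n. s n x) \<longlonglongrightarrow> 0" and b: "\<And>n. AE x in M. \<bar>s n x\<bar> \<le> w x"
  shows "(\<lambda>n. L2norm M (s n)) \<longlonglongrightarrow> 0"
proof -
  have "(\<lambda>n. LINT x|M. (norm (s n x))\<^sup>2) \<longlonglongrightarrow> (LINT x|M. 0)"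
  proof (rule integral_dominated_convergence)
    show "integrable M (\<lambda>x. (w x)\<^sup>2)" using w by (simp add: L2_def)
    show "AE x in M. (\<lambda>n. (norm (s n x))\<^sup>2) \<longlonglongrightarrow> 0"
      using lim by (rule eventually_mono) (auto intro!: tendsto_eq_intros)
    show "AE x in M. norm ((norm (s n x))\<^sup>2) \<le> (w x)\<^sup>2" for n
      using b[of n] by (rule eventually_mono) (metis abs_ge_zero norm_power power_mono real_norm_def abs_norm_cancel)
  qed (use s in measurable)
  then have "(\<lambda>n. sqrt (LINT x|M. (norm (s n x))\<^sup>2)) \<longlonglongrightarrow> sqrt 0" by (intro tendsto_real_sqrt) simp
  then show ?thesis by (simp add: L2norm_def)
qed

definition clip :: "real \<Rightarrow> real \<Rightarrow> real" where "clip B y = max (- B) (min B y)"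

lemma clip_bound: "0 \<le> B \<Longrightarrow> \<bar>clip B y\<bar> \<le> B" and clip_id: "\<bar>y\<bar> \<le> B \<Longrightarrow> clip B y = y"
  and clip_diff: "0 \<le> B \<Longrightarrow> \<bar>clip B y - y\<bar> \<le> \<bar>y\<bar>" and clip_0: "0 \<le> B \<Longrightarrow> clip B 0 = 0"
  by (auto simp: clip_def max_def min_def)

text \<open>Dominated convergence, with the function itself as majorant of the truncation error.\<close>

lemma L2_clip_approx:
  assumes f: "L2 lebesgue f" and "\<delta> > 0"
  shows "\<exists>n::nat. L2norm lebesgue (\<lambda>x::pt. clip (real n) (f x) - f x) < \<delta>"
proof -
  have "(\<lambda>n. L2norm lebesgue (\<lambda>x::pt. clip (real n) (f x) - f x)) \<longlonglongrightarrow> 0"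
  proof (rule L2norm_dominated_convergence)
    show "L2 lebesgue (\<lambda>x. \<bar>f x\<bar>)" using L2_norm[OF f] by simp
    show "(\<lambda>x. clip (real n) (f x) - f x) \<in> borel_measurable lebesgue" for n
      using L2_measurable[OF f] unfolding clip_def by measurable
    have "(\<lambda>n. clip (real n) (f x) - f x) \<longlonglongrightarrow> 0" for x
    proof (rule tendsto_eventually)
      obtain N where N: "\<bar>f x\<bar> \<le> real N" using real_arch_simple by blast
      show "\<forall>\<^sub>F n in sequentially. clip (real n) (f x) - f x = 0"
        using eventually_ge_at_top[of N] by eventually_elim (use N in \<open>simp add: clip_id\<close>)
    qed
    then show "AE x in lebesgue. (\<lambda>n. clip (real n) (f x) - f x) \<longlonglongrightarrow> 0" by simp
  qed (simp add: clip_diff)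
  then have "\<forall>\<^sub>F n in sequentially. L2norm lebesgue (\<lambda>x::pt. clip (real n) (f x) - f x) < \<delta>"
    using assms(2) by (rule order_tendstoD)
  then show ?thesis by (auto simp: eventually_sequentially)
qed

text \<open>A measurable function is an almost everywhere limit of continuous functions. Truncating their values and cutting them
  off outside a ball gives a bounded sequence with bounded support, to which dominated convergence applies.\<close>

lemma L2_density_continuous:
  assumes f: "L2 lebesgue f" and R: "\<And>x::pt. R \<le> norm x \<Longrightarrow> f x = (0::real)" and "\<delta> > 0"
  obtains g where "continuous_on UNIV g" "\<And>x. R + 1 \<le> norm x \<Longrightarrow> g x = 0"
    "L2 lebesgue g" "L2norm lebesgue (\<lambda>x. g x - f x) < \<delta>"
proof -
  obtain n where n: "L2norm lebesgue (\<lambda>x::pt. clip (real n) (f x) - f x) < \<delta> / 2"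
    using L2_clip_approx[OF f, of "\<delta> / 2"] assms(3) by auto
  define B where "B = real n"
  have B: "0 \<le> B" by (simp add: B_def)
  obtain N h where N: "negligible N" and h: "\<And>m::nat. continuous_on UNIV (h m)"
    and hf: "\<And>x. x \<notin> N \<Longrightarrow> (\<lambda>m. h m x) \<longlonglongrightarrow> f x"
    using lebesgue_measurable_imp_measurable_on_real[OF L2_measurable[OF f], of UNIV]
    unfolding measurable_on_def by auto
  define cut where "cut = (\<lambda>x::pt. max 0 (min 1 (R + 1 - norm x)))"
  define g where "g = (\<lambda>m x. cut x * clip B (h m x))"
  have cut01: "0 \<le> cut x" "cut x \<le> 1" and cut0: "R + 1 \<le> norm x \<Longrightarrow> cut x = 0" for x
    by (auto simp: cut_def)
  have gc: "continuous_on UNIV (g m)" for m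
    unfolding g_def cut_def clip_def using h by (intro continuous_intros) auto
  have g0: "g m x = 0" if "R + 1 \<le> norm x" for m x using cut0[OF that] by (simp add: g_def)
  have gb: "\<bar>g m x\<bar> \<le> B * indicator (ball 0 (R + 1)) x" for m x
  proof (cases "R + 1 \<le> norm x")
    case True then show ?thesis using g0 by simp
  next
    case False
    have "\<bar>cut x\<bar> * \<bar>clip B (h m x)\<bar> \<le> 1 * B" using cut01 B clip_bound by (intro mult_mono) auto
    then show ?thesis using False by (simp add: g_def abs_mult)
  qed
  have BL: "L2 lebesgue (\<lambda>x::pt. B * indicator (ball 0 (R + 1)) x)" by (rule L2_indicator) simp
  have gL: "L2 lebesgue (g m)" for m
    using gb[of m] by (intro L2_dominated[OF BL] continuous_lebesgue_measurable gc AE_I2) (auto intro: order.trans[OF _ abs_ge_self])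
  have fcL: "L2 lebesgue (\<lambda>x. clip B (f x))"
  proof (rule L2_dominated[OF f])
    show "(\<lambda>x. clip B (f x)) \<in> borel_measurable lebesgue"
      using L2_measurable[OF f] unfolding clip_def by measurable
    show "AE x in lebesgue. norm (clip B (f x)) \<le> norm (f x)" using B by (auto simp: clip_def)
  qed
  have cf: "cut x * clip B (f x) = clip B (f x)" for x
    using R[of x] clip_0[OF B] by (cases "R \<le> norm x") (auto simp: cut_def)
  have "(\<lambda>m. L2norm lebesgue (\<lambda>x. g m x - clip B (f x))) \<longlonglongrightarrow> 0"
  proof (rule L2norm_dominated_convergence)
    show "L2 lebesgue (\<lambda>x. B * indicator (ball 0 (R + 1)) x + \<bar>f x\<bar>)"
      using L2_add[OF BL L2_norm[OF f]] by simp
    show "(\<lambda>x. g m x - clip B (f x)) \<in> borel_measurable lebesgue" for m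
      by (rule L2_measurable[OF L2_diff[OF gL fcL]])
    show "AE x in lebesgue. (\<lambda>m. g m x - clip B (f x)) \<longlonglongrightarrow> 0"
    proof (rule AE_lebesgue_negligible[OF N])
      fix x assume "x \<notin> N"
      then have "(\<lambda>m. g m x) \<longlonglongrightarrow> cut x * clip B (f x)"
        unfolding g_def clip_def by (intro tendsto_intros hf)
      then show "(\<lambda>m. g m x - clip B (f x)) \<longlonglongrightarrow> 0" by (simp add: cf LIM_zero)
    qed
    have "\<bar>g m x - clip B (f x)\<bar> \<le> B * indicator (ball 0 (R + 1)) x + \<bar>f x\<bar>" for m x
    proof -
      have "\<bar>clip B (f x)\<bar> \<le> \<bar>f x\<bar>" using B by (auto simp: clip_def)
      then show ?thesis using gb[of m x] by linarith
    qed
    then show "AE x in lebesgue. \<bar>g m x - clip B (f x)\<bar> \<le> B * indicator (ball 0 (R + 1)) x + \<bar>f x\<bar>" for m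
      by simp
  qed
  then have "\<forall>\<^sub>F m in sequentially. L2norm lebesgue (\<lambda>x. g m x - clip B (f x)) < \<delta> / 2"
    using assms(3) by (intro order_tendstoD) auto
  then obtain m where m: "L2norm lebesgue (\<lambda>x. g m x - clip B (f x)) < \<delta> / 2"
    by (auto simp: eventually_sequentially)
  have "L2norm lebesgue (\<lambda>x. g m x - f x) \<le> L2norm lebesgue (\<lambda>x. g m x - clip B (f x)) + L2norm lebesgue (\<lambda>x. clip B (f x) - f x)"
    using L2norm_triangle[OF L2_diff[OF gL fcL] L2_diff[OF fcL f]] by simp
  also have "\<dots> < \<delta>" using m n by (simp add: B_def)
  finally show ?thesis using that[of "g m"] gc g0 gL by blast
qed

lemma conv_continuous_close:
  assumes g: "continuous_on UNIV g" "\<And>x::pt. R \<le> norm x \<Longrightarrow> g x = (0::real)" and R: "0 \<le> R" and e: "e > 0"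
    and \<epsilon>: "\<And>n. \<epsilon> n > 0" "\<epsilon> \<longlonglongrightarrow> 0" and t: "\<And>n. 1/2 \<le> t n" "\<And>n. t n \<le> 1" "t \<longlonglongrightarrow> 1"
  shows "\<forall>\<^sub>F n in sequentially. \<forall>x. \<bar>conv (rho (\<epsilon> n)) g (t n *\<^sub>R x + (1 - t n) *\<^sub>R z) - g x\<bar>
           \<le> e * indicator (ball 0 (2 * (R + 1 + norm z))) x"
proof -
  define R' where "R' = 2 * (R + 1 + norm z)"
  have R': "R' > 0" unfolding R'_def using add_pos_nonneg[of "R + 1" "norm z"] R by auto
  have gi: "integrable lebesgue g"
    using integrable_continuous_support[OF g] integrable_completion[of g lborel] borel_measurable_continuous_onI[OF g(1)] by auto
  have bs: "bsupp g" using g(2) by (auto simp: bsupp_def)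
  obtain d where d: "d > 0" "\<And>x y. dist x y < d \<Longrightarrow> \<bar>g x - g y\<bar> < e"
    using bsupp_uniform[OF bs g(1) e] by blast
  have "(\<lambda>n. (1 - t n) * (R' + norm z)) \<longlonglongrightarrow> (1 - 1) * (R' + norm z)" by (intro tendsto_intros t)
  then have 1: "\<forall>\<^sub>F n in sequentially. (1 - t n) * (R' + norm z) < d / 2"
    using d by (intro order_tendstoD) auto
  have 2: "\<forall>\<^sub>F n in sequentially. \<epsilon> n < min 1 (d / 2)"
    using d by (intro order_tendstoD[OF \<epsilon>(2)]) auto
  from 1 2 show ?thesis
  proof eventually_elim
    case (elim n)
    show ?case
    proof (intro allI)
      fix x
      let ?S = "t n *\<^sub>R x + (1 - t n) *\<^sub>R z"
      show "\<bar>conv (rho (\<epsilon> n)) g ?S - g x\<bar> \<le> e * indicator (ball 0 (2 * (R + 1 + norm z))) x"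
      proof (cases "norm x < R'")
        case True
        have "dist ?S x \<le> (1 - t n) * (R' + norm z)"
        proof -
          have "?S - x = (1 - t n) *\<^sub>R (z - x)" by (simp add: algebra_simps)
          then have "dist ?S x = (1 - t n) * norm (z - x)" using t(2)[of n] by (simp add: dist_norm)
          also have "\<dots> \<le> (1 - t n) * (R' + norm z)"
            using norm_triangle_ineq4[of z x] True t(2)[of n] by (intro mult_left_mono) auto
          finally show ?thesis .
        qed
        then have S: "dist ?S x < d / 2" using elim by simp
        have "\<bar>conv (rho (\<epsilon> n)) g ?S - g x\<bar> \<le> e"
        proof (rule conv_close[OF gi \<epsilon>(1)])
          fix y assume "dist y ?S \<le> \<epsilon> n"
          then have "dist y x < d" using S elim dist_triangle[of y x ?S] by simp
          then show "\<bar>g y - g x\<bar> \<le> e" using d(2) by (simp add: less_imp_le)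
        qed
        then show ?thesis using True by (simp add: R'_def)
      next
        case False
        have "norm ?S \<ge> t n * norm x - (1 - t n) * norm z"
          using norm_triangle_ineq2[of "t n *\<^sub>R x" "- ((1 - t n) *\<^sub>R z)"] t(1)[of n] t(2)[of n] by simp
        moreover have "t n * norm x \<ge> (1/2) * R'" using False t(1)[of n] R' by (intro mult_mono) auto
        moreover have "(1 - t n) * norm z \<le> 1 * norm z" using t(1)[of n] by (intro mult_right_mono) auto
        ultimately have S: "norm ?S \<ge> R + 1" by (simp add: R'_def)
        have gx: "g x = 0"
          using False R unfolding R'_def by (intro g(2)) (smt (verit) norm_ge_zero)
        have "\<bar>conv (rho (\<epsilon> n)) g ?S - 0\<bar> \<le> 0"
        proof (rule conv_close[OF gi \<epsilon>(1)])
          fix y assume "dist y ?S \<le> \<epsilon> n"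
          then have "dist y ?S \<le> 1" using elim by simp
          then have "R \<le> norm y" using S norm_triangle_ineq2[of ?S y] by (simp add: dist_norm norm_minus_commute)
          then show "\<bar>g y - 0\<bar> \<le> 0" using g(2) by simp
        qed
        then show ?thesis using gx e by (simp add: zero_le_mult_iff)
      qed
    qed
  qed
qed

text \<open>Mollification after contraction is bounded on \<open>L2\<close> uniformly in the parameters and converges uniformly for continuous
  functions with bounded support, hence converges for all functions by density.\<close>

lemma conv_L2_tendsto:
  assumes f: "L2 lebesgue f" and R: "\<And>x::pt. R \<le> norm x \<Longrightarrow> f x = (0::real)" and R0: "0 \<le> R"
    and \<epsilon>: "\<And>n. \<epsilon> n > 0" "\<epsilon> \<longlonglongrightarrow> 0" and t: "\<And>n. 1/2 \<le> t n" "\<And>n. t n \<le> 1" "t \<longlonglongrightarrow> 1"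
  shows "(\<lambda>n. L2norm lebesgue (\<lambda>x. conv (rho (\<epsilon> n)) f (t n *\<^sub>R x + (1 - t n) *\<^sub>R z) - f x)) \<longlonglongrightarrow> 0"
    (is "(\<lambda>n. L2norm lebesgue (\<lambda>x. ?A n f x - f x)) \<longlonglongrightarrow> 0")
proof (rule LIMSEQ_I)
  fix e :: real assume e: "e > 0"
  have fi: "integrable lebesgue f" by (rule integrable_of_L2_bounded_support[OF f R])
  obtain g where g: "continuous_on UNIV g" "\<And>x. R + 1 \<le> norm x \<Longrightarrow> g x = 0"
    "L2 lebesgue g" "L2norm lebesgue (\<lambda>x. g x - f x) < e / 8"
    by (rule L2_density_continuous[OF f R, where \<delta>="e / 8"]) (use e in auto)
  have gi: "integrable lebesgue g" by (rule integrable_of_L2_bounded_support[OF g(3,2)])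
  have fg: "integrable lebesgue (\<lambda>x. f x - g x)" "L2 lebesgue (\<lambda>x. f x - g x)"
    using fi gi L2_diff[OF f g(3)] by auto
  define B where "B = ball (0::pt) (2 * (R + 1 + 1 + norm z))"
  have B: "B \<in> lmeasurable" by (simp add: B_def)
  define e' where "e' = e / (4 * (sqrt (measure lebesgue B) + 1))"
  have sB: "sqrt (measure lebesgue B) \<ge> 0" by simp
  then have "4 * (sqrt (measure lebesgue B) + 1) > 0" by (intro mult_pos_pos add_nonneg_pos) simp_all
  then have e': "e' > 0" using e unfolding e'_def by (intro divide_pos_pos)
  have e'B: "e' * sqrt (measure lebesgue B) \<le> e / 4"
  proof -
    have "e' * sqrt (measure lebesgue B) \<le> e' * (sqrt (measure lebesgue B) + 1)" using e' by (intro mult_left_mono) auto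
    also have "\<dots> = e / 4"
    proof -
      have "e / (4 * (s + 1)) * (s + 1) = e / 4" if "s \<ge> 0" for s :: real using that by (simp add: field_simps)
      then show ?thesis using sB unfolding e'_def by blast
    qed
    finally show ?thesis .
  qed
  have "0 \<le> R + 1" using R0 by simp
  have "\<forall>\<^sub>F n in sequentially. \<forall>x. \<bar>?A n g x - g x\<bar> \<le> e' * indicator B x"
    unfolding B_def by (rule conv_continuous_close[OF g(1,2) \<open>0 \<le> R + 1\<close> e' \<epsilon> t])
  then have "\<forall>\<^sub>F n in sequentially. L2norm lebesgue (\<lambda>x. ?A n f x - f x) < e"
  proof eventually_elim
    case (elim n)
    have Af: "L2 lebesgue (?A n f)" and Ag: "L2 lebesgue (?A n g)"
      using conv_L2_bound(1)[OF _ _ \<epsilon>(1) t(1)] fi f gi g by blast+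
    have d1: "?A n f x - ?A n g x = ?A n (\<lambda>x. f x - g x) x" for x
      by (rule conv_diff[symmetric, OF fi gi bsupp_rho[OF \<epsilon>(1)] smooth_continuous[OF smooth_rho]])
    have "L2norm lebesgue (\<lambda>x. ?A n f x - ?A n g x) \<le> 2 * L2norm lebesgue (\<lambda>x. f x - g x)"
      unfolding d1 by (rule conv_L2_bound(2)[OF fg \<epsilon>(1) t(1)])
    then have 1: "L2norm lebesgue (\<lambda>x. ?A n f x - ?A n g x) < e / 4"
      using g(4) by (simp add: L2norm_minus_commute[of _ f])
    have "L2norm lebesgue (\<lambda>x. ?A n g x - g x) \<le> L2norm lebesgue (\<lambda>x. e' * indicator B x)"
      using elim by (intro L2norm_mono_AE L2_indicator B L2_measurable[OF L2_diff[OF Ag g(3)]] AE_I2)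
        (auto intro: order.trans[OF _ abs_ge_self])
    also have "\<dots> \<le> e / 4" using L2_indicator(2)[OF B, of e'] e' e'B by simp
    finally have 2: "L2norm lebesgue (\<lambda>x. ?A n g x - g x) \<le> e / 4" .
    have "L2norm lebesgue (\<lambda>x. ?A n f x - f x)
        \<le> L2norm lebesgue (\<lambda>x. ?A n f x - ?A n g x) + L2norm lebesgue (\<lambda>x. ?A n g x - f x)"
      using L2norm_triangle[OF L2_diff[OF Af Ag] L2_diff[OF Ag f]] by simp
    also have "L2norm lebesgue (\<lambda>x. ?A n g x - f x)
        \<le> L2norm lebesgue (\<lambda>x. ?A n g x - g x) + L2norm lebesgue (\<lambda>x. g x - f x)"
      using L2norm_triangle[OF L2_diff[OF Ag g(3)] L2_diff[OF g(3) f]] by simp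
    finally show ?case using 1 2 g(4) e by linarith
  qed
  then show "\<exists>no. \<forall>n\<ge>no. norm (L2norm lebesgue (\<lambda>x. ?A n f x - f x) - 0) < e"
    by (simp add: eventually_sequentially L2norm_nonneg)
qed

section \<open>Weak derivatives\<close>

lemma L2_ext:
  fixes f :: "pt \<Rightarrow> real"
  assumes "\<Omega> \<in> sets lebesgue"
  shows "L2 (lebesgue_on \<Omega>) f \<longleftrightarrow> L2 lebesgue (\<lambda>x. indicator \<Omega> x * f x)"
  using L2_restrict_iff(1)[OF assms, of f] by simp

lemma bounded_support_indicator:
  assumes "bounded (\<Omega> :: pt set)"
  obtains R where "0 \<le> R" "\<And>(x :: pt) (f :: pt \<Rightarrow> real). R \<le> norm x \<Longrightarrow> indicator \<Omega> x * f x = 0"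
proof -
  obtain R where R: "\<And>x. x \<in> \<Omega> \<Longrightarrow> norm x \<le> R" using assms by (auto simp: bounded_iff)
  show ?thesis
  proof (rule that[of "max 0 (R + 1)"])
    fix x :: pt and f :: "pt \<Rightarrow> real" assume "max 0 (R + 1) \<le> norm x"
    then have "x \<notin> \<Omega>" using R[of x] by auto
    then show "indicator \<Omega> x * f x = 0" by simp
  qed simp
qed

lemma AE_lebesgue_imp_negligible:
  assumes "AE x in lebesgue. P x" shows "negligible {x. \<not> P x}"
proof -
  obtain N where "N \<in> null_sets lebesgue" "{x. \<not> P x} \<subseteq> N"
    using assms unfolding eventually_ae_filter by auto
  then show ?thesis using negligible_iff_null_sets negligible_subset by blast
qed

lemma integral_ext:
  fixes f :: "pt \<Rightarrow> real"
  assumes "\<Omega> \<in> sets lebesgue"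
  shows "(LINT x|lebesgue_on \<Omega>. f x) = (LINT x|lebesgue. indicator \<Omega> x * f x)"
  using assms by (simp add: integral_restrict_space)

lemma test_function_rho_shift:
  assumes \<epsilon>: "\<epsilon> > 0" and x: "cball x \<epsilon> \<subseteq> \<Omega>"
  shows "test_function \<Omega> (\<lambda>y. rho \<epsilon> (x - y))"
  unfolding test_function_def
proof (intro conjI exI[of _ "cball x \<epsilon>"])
  show "smooth (\<lambda>y. rho \<epsilon> (x - y))"
    using smooth_affine[OF smooth_rho, of \<epsilon> "-1" x] by simp
  show "\<forall>y. y \<notin> cball x \<epsilon> \<longrightarrow> rho \<epsilon> (x - y) = 0"
    using rho_zero[OF \<epsilon>] by (auto simp: dist_norm)
qed (use x in auto)

text \<open>The fundamental lemma of the calculus of variations: mollifications of the function vanish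
  away from the boundary, and they converge to it.\<close>

lemma weak_zero_AE:
  assumes \<Omega>: "open \<Omega>" "bounded \<Omega>" and g: "L2 (lebesgue_on \<Omega>) g"
    and z: "\<And>\<phi>. test_function \<Omega> \<phi> \<Longrightarrow> (LINT x|lebesgue_on \<Omega>. g x * \<phi> x) = (0::real)"
  shows "AE x in lebesgue_on \<Omega>. g x = 0"
proof -
  have \<Omega>m: "\<Omega> \<in> sets lebesgue" using \<Omega> by simp
  define f where "f = (\<lambda>x. indicator \<Omega> x * g x)"
  have f: "L2 lebesgue f" unfolding f_def using g \<Omega>m by (simp add: L2_ext)
  obtain R where R: "0 \<le> R" "\<And>x. R \<le> norm x \<Longrightarrow> f x = 0"
    unfolding f_def using bounded_support_indicator[OF \<Omega>(2)] by metis
  have local: "negligible {x \<in> ball a r. f x \<noteq> 0}" if r: "r > 0" and ar: "cball a (2 * r) \<subseteq> \<Omega>" for a r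
  proof -
    define \<epsilon> where "\<epsilon> = (\<lambda>n::nat. r / real (Suc n))"
    have \<epsilon>: "\<epsilon> n > 0" "\<epsilon> n \<le> r" for n using r by (auto simp: \<epsilon>_def field_simps)
    have \<epsilon>0: "\<epsilon> \<longlonglongrightarrow> 0" unfolding \<epsilon>_def by (intro lim_const_over_n filterlim_compose[OF lim_const_over_n filterlim_Suc])
    define A where "A = (\<lambda>n x. conv (rho (\<epsilon> n)) f (1 *\<^sub>R x + (1 - 1) *\<^sub>R 0))"
    have lim: "(\<lambda>n. L2norm lebesgue (\<lambda>x. A n x - f x)) \<longlonglongrightarrow> 0"
      unfolding A_def by (rule conv_L2_tendsto[OF f R(2) R(1) \<epsilon>(1) \<epsilon>0]) auto
    have A0: "A n x = 0" if x: "x \<in> ball a r" for n x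
    proof -
      have "cball x (\<epsilon> n) \<subseteq> \<Omega>"
      proof
        fix y assume "y \<in> cball x (\<epsilon> n)"
        then have "dist a y \<le> 2 * r" using x \<epsilon>(2)[of n] dist_triangle[of a y x] by simp
        then show "y \<in> \<Omega>" using ar by auto
      qed
      from z[OF test_function_rho_shift[OF \<epsilon>(1) this]] show ?thesis
        by (simp add: A_def conv_def f_def integral_ext[OF \<Omega>m] mult.assoc)
    qed
    have fi: "integrable lebesgue f" by (rule integrable_of_L2_bounded_support[OF f R(2)])
    have AL: "L2 lebesgue (A n)" for n
      unfolding A_def by (rule conv_L2_bound(1)[OF fi f \<epsilon>(1)]) simp
    have fb: "L2 lebesgue (\<lambda>x. indicator (ball a r) x * f x)"
      using L2_bounded_mult[OF f, of "indicator (ball a r)" 1] borel_measurable_indicator[of "ball a r" lebesgue] by auto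
    have "L2norm lebesgue (\<lambda>x. indicator (ball a r) x * f x) \<le> L2norm lebesgue (\<lambda>x. A n x - f x)" for n
      by (rule L2norm_mono_AE[OF L2_diff[OF AL f] L2_measurable[OF fb]]) (auto simp: indicator_def A0)
    then have "L2norm lebesgue (\<lambda>x. indicator (ball a r) x * f x) \<le> 0"
      by (intro tendsto_lowerbound[OF lim]) auto
    then have "L2norm lebesgue (\<lambda>x. indicator (ball a r) x * f x) = 0"
      using L2norm_nonneg[of lebesgue "\<lambda>x. indicator (ball a r) x * f x"] by linarith
    then have "(LINT x|lebesgue. (norm (indicator (ball a r) x * f x))\<^sup>2) = 0"
      using L2norm_sq[of lebesgue "\<lambda>x. indicator (ball a r) x * f x"] by simp
    then have "AE x in lebesgue. (norm (indicator (ball a r) x * f x))\<^sup>2 = 0"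
      by (subst (asm) integral_nonneg_eq_0_iff_AE[OF L2_integrable_sq[OF fb]]) auto
    from AE_lebesgue_imp_negligible[OF this] show ?thesis
      by (rule negligible_subset) (auto simp: indicator_def)
  qed
  have "\<exists>r>0. cball a (2 * r) \<subseteq> \<Omega>" if "a \<in> \<Omega>" for a
  proof -
    obtain e where "e > 0" "cball a e \<subseteq> \<Omega>" using \<Omega>(1) \<open>a \<in> \<Omega>\<close> open_contains_cball by blast
    then show ?thesis by (intro exI[of _ "e / 2"]) auto
  qed
  then obtain r where r: "\<And>a. a \<in> \<Omega> \<Longrightarrow> r a > 0" "\<And>a. a \<in> \<Omega> \<Longrightarrow> cball a (2 * r a) \<subseteq> \<Omega>" by metis
  obtain F where F: "F \<subseteq> (\<lambda>a. ball a (r a)) ` \<Omega>" "countable F" "\<Union>F = \<Union>((\<lambda>a. ball a (r a)) ` \<Omega>)"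
    using Lindelof[of "(\<lambda>a. ball a (r a)) ` \<Omega>"] by blast
  have "negligible (\<Union>((\<lambda>B. {x \<in> B. f x \<noteq> 0}) ` F))"
  proof (rule negligible_countable_Union)
    fix T assume "T \<in> (\<lambda>B. {x \<in> B. f x \<noteq> 0}) ` F"
    then obtain a where "a \<in> \<Omega>" "T = {x \<in> ball a (r a). f x \<noteq> 0}" using F(1) by auto
    then show "negligible T" using local[OF r(1) r(2)] by auto
  qed (use F(2) in auto)
  then have N: "negligible {x \<in> \<Omega>. f x \<noteq> 0}"
  proof (rule negligible_subset)
    show "{x \<in> \<Omega>. f x \<noteq> 0} \<subseteq> \<Union>((\<lambda>B. {x \<in> B. f x \<noteq> 0}) ` F)"
    proof safe
      fix x assume x: "x \<in> \<Omega>" "f x \<noteq> 0"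
      then have "x \<in> \<Union>F" unfolding F(3) using r(1)[of x] by (auto intro!: bexI[of _ x])
      then show "x \<in> \<Union>((\<lambda>B. {x \<in> B. f x \<noteq> 0}) ` F)" using x by auto
    qed
  qed
  have "AE x in lebesgue. x \<in> \<Omega> \<longrightarrow> g x = 0"
    by (rule AE_lebesgue_negligible[OF N]) (auto simp: f_def)
  then show ?thesis using \<Omega>m by (simp add: AE_restrict_space_iff)
qed

lemma has_weak_gradD:
  "has_weak_grad \<Omega> u G \<Longrightarrow> L2 (lebesgue_on \<Omega>) G"
  "has_weak_grad \<Omega> u G \<Longrightarrow> test_function \<Omega> \<phi> \<Longrightarrow>
     (LINT x|lebesgue_on \<Omega>. u x * pd i \<phi> x) = - (LINT x|lebesgue_on \<Omega>. G x $ i * \<phi> x)"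
  unfolding has_weak_grad_def by blast+

lemma smooth_L2:
  assumes "bounded \<Omega>" "\<Omega> \<in> sets lebesgue" "smooth f"
  shows "L2 (lebesgue_on \<Omega>) f"
proof -
  have "\<Omega> \<in> lmeasurable" using assms by (simp add: bounded_set_imp_lmeasurable)
  then have fm: "finite_measure (lebesgue_on \<Omega>)" by (rule finite_measure_lebesgue_on)
  have "bounded (f ` closure \<Omega>)"
    using assms by (intro compact_imp_bounded compact_continuous_image smooth_continuous) (auto simp: compact_eq_bounded_closed bounded_closure)
  then obtain B where B: "\<forall>x\<in>closure \<Omega>. \<bar>f x\<bar> \<le> B" unfolding bounded_iff by auto
  show ?thesis
  proof (rule L2_bounded[OF fm])
    show "f \<in> borel_measurable (lebesgue_on \<Omega>)"
      using continuous_lebesgue_measurable[OF smooth_continuous[OF assms(3)]] by (simp add: measurable_restrict_space1)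
    show "norm (f x) \<le> B" if "x \<in> space (lebesgue_on \<Omega>)" for x
      using B that closure_subset[of \<Omega>] by auto
  qed
qed

lemma test_function_zero:
  assumes "test_function \<Omega> \<phi>"
  obtains K where "compact K" "K \<subseteq> \<Omega>" "\<And>x. x \<notin> K \<Longrightarrow> \<phi> x = 0" "\<And>x i. x \<notin> K \<Longrightarrow> pd i \<phi> x = 0"
proof -
  obtain K where K: "compact K" "K \<subseteq> \<Omega>" "\<And>x. x \<notin> K \<Longrightarrow> \<phi> x = 0" using assms by (auto simp: test_function_def)
  have "pd i \<phi> x = 0" if x: "x \<notin> K" for x i
  proof -
    have "((\<lambda>y. 0::real) has_derivative (\<lambda>h. 0)) (at x)" by simp
    then have "(\<phi> has_derivative (\<lambda>h. 0)) (at x)"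
      by (rule has_derivative_transform_within_open[where s="- K"])
        (use x K compact_imp_closed[OF K(1)] in auto)
    then show ?thesis by (simp add: pd_eqI)
  qed
  then show ?thesis using K that by blast
qed

lemma test_function_smooth: "test_function \<Omega> \<phi> \<Longrightarrow> smooth \<phi>"
  by (simp add: test_function_def)

lemma has_weak_grad_unique:
  assumes \<Omega>: "open \<Omega>" "bounded \<Omega>" and G: "has_weak_grad \<Omega> u G" "has_weak_grad \<Omega> u G'"
  shows "AE x in lebesgue_on \<Omega>. G x = G' x"
proof -
  have \<Omega>m: "\<Omega> \<in> sets lebesgue" using \<Omega> by simp
  have i: "AE x in lebesgue_on \<Omega>. G x $ i - G' x $ i = 0" for i
  proof (rule weak_zero_AE[OF \<Omega>])
    note L = L2_vec_nth[OF has_weak_gradD(1)[OF G(1)], of i] L2_vec_nth[OF has_weak_gradD(1)[OF G(2)], of i]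
    show "L2 (lebesgue_on \<Omega>) (\<lambda>x. G x $ i - G' x $ i)" by (intro L2_diff L)
    fix \<phi> assume t: "test_function \<Omega> \<phi>"
    have s: "L2 (lebesgue_on \<Omega>) \<phi>" by (intro smooth_L2 \<Omega> \<Omega>m test_function_smooth[OF t])
    show "(LINT x|lebesgue_on \<Omega>. (G x $ i - G' x $ i) * \<phi> x) = 0"
      using has_weak_gradD(2)[OF G(1) t, of i] has_weak_gradD(2)[OF G(2) t, of i]
        L2_integrable_mult[OF L(1) s] L2_integrable_mult[OF L(2) s]
      by (simp add: left_diff_distrib)
  qed
  have "AE x in lebesgue_on \<Omega>. \<forall>i\<in>UNIV. G x $ i - G' x $ i = 0"
    by (rule AE_finite_allI[OF finite i])
  then show ?thesis by (rule eventually_mono) (auto simp: vec_eq_iff)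
qed

lemma has_weak_grad_wgrad: "u \<in> H1 \<Omega> \<Longrightarrow> has_weak_grad \<Omega> u (wgrad \<Omega> u)"
  unfolding H1_def wgrad_def using someI_ex[of "has_weak_grad \<Omega> u"] by blast

lemma wgrad_AE:
  assumes "open \<Omega>" "bounded \<Omega>" "has_weak_grad \<Omega> u G"
  shows "AE x in lebesgue_on \<Omega>. wgrad \<Omega> u x = G x"
proof -
  have "has_weak_grad \<Omega> u (wgrad \<Omega> u)" unfolding wgrad_def using someI[of "has_weak_grad \<Omega> u", OF assms(3)] by blast
  from has_weak_grad_unique[OF assms(1,2) this assms(3)] show ?thesis .
qed

lemma borel_measurable_lebesgue_on_AE:
  fixes f g :: "pt \<Rightarrow> 'b::euclidean_space"
  assumes \<Omega>: "\<Omega> \<in> sets lebesgue" and f: "f \<in> borel_measurable (lebesgue_on \<Omega>)"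
    and ae: "AE x in lebesgue_on \<Omega>. f x = g x"
  shows "g \<in> borel_measurable (lebesgue_on \<Omega>)"
  unfolding borel_measurable_lebesgue_restrict[OF \<Omega>]
proof (rule borel_measurable_AE)
  show "(\<lambda>x. indicator \<Omega> x *\<^sub>R f x) \<in> borel_measurable lebesgue"
    using f by (simp add: borel_measurable_lebesgue_restrict[OF \<Omega>])
  have "AE x in lebesgue. x \<in> \<Omega> \<longrightarrow> f x = g x" using ae \<Omega> by (simp add: AE_restrict_space_iff)
  then show "AE x in lebesgue. indicator \<Omega> x *\<^sub>R f x = indicator \<Omega> x *\<^sub>R g x"
    by (rule eventually_mono) (auto simp: indicator_def)
qed

lemma L2_lebesgue_on_AE:
  fixes f g :: "pt \<Rightarrow> 'b::euclidean_space"
  assumes \<Omega>: "\<Omega> \<in> sets lebesgue" and f: "L2 (lebesgue_on \<Omega>) f" and ae: "AE x in lebesgue_on \<Omega>. f x = g x"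
  shows "L2 (lebesgue_on \<Omega>) g"
proof (rule L2_dominated[OF f])
  show "g \<in> borel_measurable (lebesgue_on \<Omega>)"
    by (rule borel_measurable_lebesgue_on_AE[OF \<Omega> L2_measurable[OF f] ae])
  show "AE x in lebesgue_on \<Omega>. norm (g x) \<le> norm (f x)" using ae by (rule eventually_mono) simp
qed

lemma integral_cong_AE_lebesgue_on:
  fixes f g :: "pt \<Rightarrow> real"
  assumes \<Omega>: "\<Omega> \<in> sets lebesgue" and f: "f \<in> borel_measurable (lebesgue_on \<Omega>)" and ae: "AE x in lebesgue_on \<Omega>. f x = g x"
  shows "(LINT x|lebesgue_on \<Omega>. f x) = (LINT x|lebesgue_on \<Omega>. g x)"
  by (rule integral_cong_AE[OF f borel_measurable_lebesgue_on_AE[OF \<Omega> f ae] ae])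

lemma has_weak_grad_cong_AE:
  assumes \<Omega>: "open \<Omega>" "bounded \<Omega>" and u: "L2 (lebesgue_on \<Omega>) u" "AE x in lebesgue_on \<Omega>. u x = u' x"
    and G: "has_weak_grad \<Omega> u G" "AE x in lebesgue_on \<Omega>. G x = G' x"
  shows "has_weak_grad \<Omega> u' G'"
  unfolding has_weak_grad_def
proof (intro conjI allI impI)
  have \<Omega>m: "\<Omega> \<in> sets lebesgue" using \<Omega> by simp
  note GL = has_weak_gradD(1)[OF G(1)]
  show "L2 (lebesgue_on \<Omega>) G'" by (rule L2_lebesgue_on_AE[OF \<Omega>m GL G(2)])
  fix \<phi> i assume t: "test_function \<Omega> \<phi>"
  note s = test_function_smooth[OF t]
  have m: "smooth h \<Longrightarrow> h \<in> borel_measurable (lebesgue_on \<Omega>)" for h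
    using smooth_L2[OF \<Omega>(2) \<Omega>m] L2_measurable by blast
  have "(LINT x|lebesgue_on \<Omega>. u x * pd i \<phi> x) = (LINT x|lebesgue_on \<Omega>. u' x * pd i \<phi> x)"
    using L2_measurable[OF u(1)] m[OF smooth_pd[OF s]] u(2)
    by (intro integral_cong_AE_lebesgue_on \<Omega>m) (auto elim: eventually_mono)
  moreover have "(LINT x|lebesgue_on \<Omega>. G x $ i * \<phi> x) = (LINT x|lebesgue_on \<Omega>. G' x $ i * \<phi> x)"
    using L2_measurable[OF L2_vec_nth[OF GL]] m[OF s] G(2)
    by (intro integral_cong_AE_lebesgue_on \<Omega>m) (auto elim: eventually_mono)
  ultimately show "(LINT x|lebesgue_on \<Omega>. u' x * pd i \<phi> x) = - (LINT x|lebesgue_on \<Omega>. G' x $ i * \<phi> x)"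
    using has_weak_gradD(2)[OF G(1) t, of i] by simp
qed

lemma has_weak_grad_diff:
  assumes \<Omega>: "open \<Omega>" "bounded \<Omega>" and u: "L2 (lebesgue_on \<Omega>) u" "L2 (lebesgue_on \<Omega>) v"
    and G: "has_weak_grad \<Omega> u G" "has_weak_grad \<Omega> v G'"
  shows "has_weak_grad \<Omega> (\<lambda>x. u x - v x) (\<lambda>x. G x - G' x)"
  unfolding has_weak_grad_def
proof (intro conjI allI impI)
  have \<Omega>m: "\<Omega> \<in> sets lebesgue" using \<Omega> by simp
  note GL = has_weak_gradD(1)[OF G(1)] has_weak_gradD(1)[OF G(2)]
  show "L2 (lebesgue_on \<Omega>) (\<lambda>x. G x - G' x)" by (intro L2_diff GL)
  fix \<phi> i assume t: "test_function \<Omega> \<phi>"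
  note s = test_function_smooth[OF t]
  note L = smooth_L2[OF \<Omega>(2) \<Omega>m s] smooth_L2[OF \<Omega>(2) \<Omega>m smooth_pd[OF s]]
  show "(LINT x|lebesgue_on \<Omega>. (u x - v x) * pd i \<phi> x) = - (LINT x|lebesgue_on \<Omega>. (G x - G' x) $ i * \<phi> x)"
    using has_weak_gradD(2)[OF G(1) t, of i] has_weak_gradD(2)[OF G(2) t, of i]
      L2_integrable_mult[OF u(1) L(2)] L2_integrable_mult[OF u(2) L(2)]
      L2_integrable_mult[OF L2_vec_nth[OF GL(1), of i] L(1)] L2_integrable_mult[OF L2_vec_nth[OF GL(2), of i] L(1)]
    by (simp add: left_diff_distrib)
qed

lemma has_weak_grad_subset:
  assumes U: "open U" "U \<subseteq> \<Omega>" "\<Omega> \<in> sets lebesgue" and G: "has_weak_grad \<Omega> u G"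
  shows "has_weak_grad U u G"
  unfolding has_weak_grad_def
proof (intro conjI allI impI)
  have Um: "U \<in> sets lebesgue" using U by simp
  note GL = has_weak_gradD(1)[OF G]
  have "L2 lebesgue (\<lambda>x. indicator U x *\<^sub>R (indicator \<Omega> x *\<^sub>R G x))"
  proof (rule L2_bounded_mult[where B=1])
    show "L2 lebesgue (\<lambda>x. indicator \<Omega> x *\<^sub>R G x)" using GL by (simp only: L2_restrict_iff[OF U(3)])
    show "indicator U \<in> borel_measurable lebesgue" using Um by simp
  qed simp
  moreover have "(\<lambda>x. indicator U x *\<^sub>R (indicator \<Omega> x *\<^sub>R G x)) = (\<lambda>x. indicator U x *\<^sub>R G x)"
    using U(2) by (auto simp: fun_eq_iff indicator_def)
  ultimately show "L2 (lebesgue_on U) G" by (simp add: L2_restrict_iff[OF Um])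
  fix \<phi> i assume t: "test_function U \<phi>"
  then have t': "test_function \<Omega> \<phi>" using U(2) unfolding test_function_def by blast
  obtain K where "compact K" and K: "K \<subseteq> U" "\<And>x. x \<notin> K \<Longrightarrow> \<phi> x = 0" "\<And>x i. x \<notin> K \<Longrightarrow> pd i \<phi> x = 0"
    by (rule test_function_zero[OF t], rule that)
  have "(\<lambda>x. indicator U x * (u x * pd i \<phi> x)) = (\<lambda>x. indicator \<Omega> x * (u x * pd i \<phi> x))"
    and "(\<lambda>x. indicator U x * (G x $ i * \<phi> x)) = (\<lambda>x. indicator \<Omega> x * (G x $ i * \<phi> x))"
    using K U(2) by (force simp: fun_eq_iff indicator_def)+
  then show "(LINT x|lebesgue_on U. u x * pd i \<phi> x) = - (LINT x|lebesgue_on U. G x $ i * \<phi> x)"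
    using has_weak_gradD(2)[OF G t', of i] unfolding integral_ext[OF Um] integral_ext[OF U(3)] by simp
qed

text \<open>The integral of a derivative of a compactly supported smooth function vanishes: convolution with
  the indicator of a large ball is constant near the origin, and so is its derivative zero.\<close>

lemma integral_pd_zero:
  assumes \<eta>: "bsupp \<eta>" "smooth \<eta>"
  shows "(LINT x|lebesgue. pd i \<eta> x) = 0"
proof -
  obtain R where R: "\<And>x. R \<le> norm x \<Longrightarrow> \<eta> x = 0" using \<eta>(1) by (auto simp: bsupp_def)
  define B where "B = (indicator (ball (0::pt) (\<bar>R\<bar> + 2)) :: pt \<Rightarrow> real)"
  have Bi: "integrable lebesgue B" unfolding B_def using lmeasurable_iff_integrable by (metis lmeasurable_ball)
  have lb: "lborel = distr lborel borel (\<lambda>y::pt. z - y)" for z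
    using lborel_affine[of "-1" z] by (simp add: density_1)
  have refl_int: "(LINT y|lebesgue. h (z - y)) = (LINT y|lebesgue. h y)" if h: "continuous_on UNIV h" for h :: "pt \<Rightarrow> real" and z
  proof -
    have hm: "h \<in> borel_measurable borel" using h by (rule borel_measurable_continuous_onI)
    have "(LINT y|lborel. h y) = (LINT y|lborel. h (z - y))"
      using hm by (subst lb[of z]) (simp add: integral_distr)
    then show ?thesis using hm borel_measurable_continuous_onI[OF continuous_shift[OF h]]
      by (simp add: integral_completion)
  qed
  have BR: "B y * h (x - y) = h (x - y)" if "norm x < 1" "\<And>x. R + 1 \<le> norm x \<Longrightarrow> h x = 0" for x y and h :: "pt \<Rightarrow> real"
  proof (cases "norm y < \<bar>R\<bar> + 2")
    case False
    then have "R + 1 \<le> norm (x - y)" using that(1) norm_triangle_ineq2[of y x] by (simp add: norm_minus_commute)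
    then show ?thesis using that(2) by simp
  qed (simp add: B_def)
  have const: "conv \<eta> B x = (LINT y|lebesgue. \<eta> y)" if "norm x < 1" for x
  proof -
    have "conv \<eta> B x = (LINT y|lebesgue. \<eta> (x - y))"
      unfolding conv_def by (subst BR[OF that]) (use R in auto)
    then show ?thesis by (simp add: refl_int smooth_continuous[OF \<eta>(2)])
  qed
  have "((\<lambda>x. LINT y|lebesgue. \<eta> y) has_derivative (\<lambda>h. 0)) (at (0::pt))" by simp
  then have "(conv \<eta> B has_derivative (\<lambda>h. 0)) (at 0)"
    by (rule has_derivative_transform_within_open[where s="ball 0 1"]) (auto simp: const)
  then have "pd i (conv \<eta> B) 0 = 0" by (simp add: pd_eqI)
  then have 0: "conv (pd i \<eta>) B 0 = 0" by (simp add: pd_conv[OF Bi \<eta>])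
  have pd0: "pd i \<eta> x = 0" if "R + 1 \<le> norm x" for x
  proof -
    have op: "open {y. R < norm (y::pt)}" by (intro open_Collect_less continuous_intros)
    have "((\<lambda>y. 0::real) has_derivative (\<lambda>h. 0)) (at x)" by simp
    then have "(\<eta> has_derivative (\<lambda>h. 0)) (at x)"
      by (rule has_derivative_transform_within_open[OF _ op]) (use that R in auto)
    then show ?thesis by (simp add: pd_eqI)
  qed
  have "conv (pd i \<eta>) B 0 = (LINT y|lebesgue. pd i \<eta> (0 - y))"
    unfolding conv_def by (subst BR[OF _ pd0]) auto
  then show ?thesis using 0 by (simp only: refl_int smooth_continuous[OF smooth_pd[OF \<eta>(2)]])
qed

text \<open>The product rule reduces the claim to the vanishing integral of the derivative of \<open>f \<phi>\<close>.\<close>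

lemma smooth_has_weak_grad:
  assumes \<Omega>: "open \<Omega>" "bounded \<Omega>" and f: "smooth f"
  shows "has_weak_grad \<Omega> f (\<lambda>x. \<chi> i. pd i f x)"
  unfolding has_weak_grad_def
proof (intro conjI allI impI)
  have \<Omega>m: "\<Omega> \<in> sets lebesgue" using \<Omega> by simp
  show "L2 (lebesgue_on \<Omega>) (\<lambda>x. \<chi> i. pd i f x)"
    by (rule L2_vec) (simp add: smooth_L2[OF \<Omega>(2) \<Omega>m] smooth_pd f)
  fix \<phi> i assume t: "test_function \<Omega> \<phi>"
  note s = test_function_smooth[OF t]
  obtain K where K: "compact K" "K \<subseteq> \<Omega>" "\<And>x. x \<notin> K \<Longrightarrow> \<phi> x = 0" "\<And>x i. x \<notin> K \<Longrightarrow> pd i \<phi> x = 0"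
    by (rule test_function_zero[OF t], rule that)
  have bs: "bsupp (\<lambda>x. f x * \<phi> x)"
  proof -
    obtain R where "\<And>x. x \<in> K \<Longrightarrow> norm x \<le> R" using compact_imp_bounded[OF K(1)] by (auto simp: bounded_iff)
    then have "f x * \<phi> x = 0" if "R + 1 \<le> norm x" for x using K(3)[of x] that by force
    then show ?thesis unfolding bsupp_def by blast
  qed
  have "(LINT x|lebesgue. pd i (\<lambda>x. f x * \<phi> x) x) = 0"
    by (rule integral_pd_zero[OF bs smooth_mult[OF f s]])
  moreover have "pd i (\<lambda>x. f x * \<phi> x) x = indicator \<Omega> x * (f x * pd i \<phi> x + pd i f x * \<phi> x)" for x
    using pd_mult[OF smooth_differentiable[OF f] smooth_differentiable[OF s], of i x] K(2,3,4)
    by (cases "x \<in> \<Omega>") (auto, force)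
  ultimately have "(LINT x|lebesgue_on \<Omega>. f x * pd i \<phi> x + pd i f x * \<phi> x) = 0"
    by (simp add: integral_ext[OF \<Omega>m])
  moreover note L = smooth_L2[OF \<Omega>(2) \<Omega>m]
  ultimately show "(LINT x|lebesgue_on \<Omega>. f x * pd i \<phi> x) = - (LINT x|lebesgue_on \<Omega>. (\<chi> i. pd i f x) $ i * \<phi> x)"
    using L2_integrable_mult[OF L[OF f] L[OF smooth_pd[OF s, of i]]] L2_integrable_mult[OF L[OF smooth_pd[OF f, of i]] L[OF s]]
    by simp
qed

section \<open>The space H2\<close>

lemma H2D:
  assumes "u \<in> H2 \<Omega>"
  shows "L2 (lebesgue_on \<Omega>) u" "has_weak_grad \<Omega> u (wgrad \<Omega> u)"
    "L2 (lebesgue_on \<Omega>) (\<lambda>x. wgrad \<Omega> u x $ i)"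
    "has_weak_grad \<Omega> (\<lambda>x. wgrad \<Omega> u x $ i) (\<lambda>x. whess \<Omega> u x $ i)"
    "L2 (lebesgue_on \<Omega>) (whess \<Omega> u)"
proof -
  have u: "u \<in> H1 \<Omega>" and ui: "(\<lambda>x. wgrad \<Omega> u x $ i) \<in> H1 \<Omega>" for i
    using assms by (auto simp: H2_def)
  show "L2 (lebesgue_on \<Omega>) u" using u by (simp add: H1_def)
  show "has_weak_grad \<Omega> u (wgrad \<Omega> u)" using has_weak_grad_wgrad[OF u] .
  show "L2 (lebesgue_on \<Omega>) (\<lambda>x. wgrad \<Omega> u x $ i)" using ui[of i] by (simp add: H1_def)
  have w: "has_weak_grad \<Omega> (\<lambda>x. wgrad \<Omega> u x $ i) (\<lambda>x. whess \<Omega> u x $ i)" for i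
    using has_weak_grad_wgrad[OF ui[of i]] by (simp add: whess_def)
  show "has_weak_grad \<Omega> (\<lambda>x. wgrad \<Omega> u x $ i) (\<lambda>x. whess \<Omega> u x $ i)" by (rule w)
  show "L2 (lebesgue_on \<Omega>) (whess \<Omega> u)" using has_weak_gradD(1)[OF w] by (rule L2_vec)
qed

lemma H2I:
  assumes \<Omega>: "open \<Omega>" "bounded \<Omega>" and u: "L2 (lebesgue_on \<Omega>) u" and G: "has_weak_grad \<Omega> u G"
    and H: "\<And>i. has_weak_grad \<Omega> (\<lambda>x. G x $ i) (\<lambda>x. H x $ i)"
  shows "u \<in> H2 \<Omega>" "AE x in lebesgue_on \<Omega>. wgrad \<Omega> u x = G x" "AE x in lebesgue_on \<Omega>. whess \<Omega> u x = H x"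
proof -
  have u1: "u \<in> H1 \<Omega>" using u G by (auto simp: H1_def)
  show ae: "AE x in lebesgue_on \<Omega>. wgrad \<Omega> u x = G x" by (rule wgrad_AE[OF \<Omega> G])
  have \<Omega>m: "\<Omega> \<in> sets lebesgue" using \<Omega> by simp
  have GL: "L2 (lebesgue_on \<Omega>) (\<lambda>x. G x $ i)" for i by (rule L2_vec_nth[OF has_weak_gradD(1)[OF G]])
  have aei: "AE x in lebesgue_on \<Omega>. G x $ i = wgrad \<Omega> u x $ i" for i using ae by (rule eventually_mono) simp
  have wg: "has_weak_grad \<Omega> (\<lambda>x. wgrad \<Omega> u x $ i) (\<lambda>x. H x $ i)" for i
    by (rule has_weak_grad_cong_AE[OF \<Omega> GL aei H]) simp
  have "(\<lambda>x. wgrad \<Omega> u x $ i) \<in> H1 \<Omega>" for i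
    using wg[of i] L2_lebesgue_on_AE[OF \<Omega>m GL aei] by (auto simp: H1_def)
  then show "u \<in> H2 \<Omega>" using u1 by (simp add: H2_def)
  have "AE x in lebesgue_on \<Omega>. wgrad \<Omega> (\<lambda>y. wgrad \<Omega> u y $ i) x = H x $ i" for i
    by (rule wgrad_AE[OF \<Omega> wg])
  then have "AE x in lebesgue_on \<Omega>. \<forall>i\<in>UNIV. wgrad \<Omega> (\<lambda>y. wgrad \<Omega> u y $ i) x = H x $ i"
    by (rule AE_finite_allI[OF finite])
  then show "AE x in lebesgue_on \<Omega>. whess \<Omega> u x = H x"
    by (rule eventually_mono) (simp add: whess_def vec_eq_iff)
qed

lemma H2_diff:
  assumes \<Omega>: "open \<Omega>" "bounded \<Omega>" and u: "u \<in> H2 \<Omega>" and v: "v \<in> H2 \<Omega>"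
  shows "(\<lambda>x. u x - v x) \<in> H2 \<Omega>"
    "AE x in lebesgue_on \<Omega>. wgrad \<Omega> (\<lambda>x. u x - v x) x = wgrad \<Omega> u x - wgrad \<Omega> v x"
    "AE x in lebesgue_on \<Omega>. whess \<Omega> (\<lambda>x. u x - v x) x = whess \<Omega> u x - whess \<Omega> v x"
proof -
  note uD = H2D[OF u] and vD = H2D[OF v]
  have 1: "L2 (lebesgue_on \<Omega>) (\<lambda>x. u x - v x)" by (intro L2_diff uD vD)
  have 2: "has_weak_grad \<Omega> (\<lambda>x. u x - v x) (\<lambda>x. wgrad \<Omega> u x - wgrad \<Omega> v x)"
    by (intro has_weak_grad_diff \<Omega> uD vD)
  have 3: "has_weak_grad \<Omega> (\<lambda>x. (wgrad \<Omega> u x - wgrad \<Omega> v x) $ i) (\<lambda>x. (whess \<Omega> u x - whess \<Omega> v x) $ i)" for i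
    using has_weak_grad_diff[OF \<Omega> uD(3,3)[of i] uD(4,4)[of i]]
      has_weak_grad_diff[OF \<Omega> uD(3)[of i] vD(3)[of i] uD(4)[of i] vD(4)[of i]] by simp
  from H2I[OF \<Omega> 1 2 3]
  show "(\<lambda>x. u x - v x) \<in> H2 \<Omega>"
    "AE x in lebesgue_on \<Omega>. wgrad \<Omega> (\<lambda>x. u x - v x) x = wgrad \<Omega> u x - wgrad \<Omega> v x"
    "AE x in lebesgue_on \<Omega>. whess \<Omega> (\<lambda>x. u x - v x) x = whess \<Omega> u x - whess \<Omega> v x" by auto
qed

lemma H2_cong:
  assumes \<Omega>: "open \<Omega>" "bounded \<Omega>" and u: "u \<in> H2 \<Omega>" and eq: "\<And>x. x \<in> \<Omega> \<Longrightarrow> u x = v x"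
  shows "v \<in> H2 \<Omega>"
    "AE x in lebesgue_on \<Omega>. wgrad \<Omega> v x = wgrad \<Omega> u x"
    "AE x in lebesgue_on \<Omega>. whess \<Omega> v x = whess \<Omega> u x"
proof -
  note uD = H2D[OF u]
  have \<Omega>m: "\<Omega> \<in> sets lebesgue" using \<Omega> by simp
  have ae: "AE x in lebesgue_on \<Omega>. u x = v x" using eq by (intro AE_I2) simp
  have 1: "L2 (lebesgue_on \<Omega>) v" by (rule L2_lebesgue_on_AE[OF \<Omega>m uD(1) ae])
  have 2: "has_weak_grad \<Omega> v (wgrad \<Omega> u)" by (rule has_weak_grad_cong_AE[OF \<Omega> uD(1) ae uD(2)]) simp
  from H2I[OF \<Omega> 1 2 uD(4)]
  show "v \<in> H2 \<Omega>" "AE x in lebesgue_on \<Omega>. wgrad \<Omega> v x = wgrad \<Omega> u x"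
    "AE x in lebesgue_on \<Omega>. whess \<Omega> v x = whess \<Omega> u x" by auto
qed

section \<open>Arc length\<close>

lemma arc_between_sets: "sets (arc_between a b) = sets borel" and arc_between_space: "space (arc_between a b) = UNIV"
  by (auto simp: arc_between_def)

lemma arc_param_measurable:
  fixes a b :: pt
  shows "(\<lambda>t. a + (t / dist a b) *\<^sub>R (b - a)) \<in> borel_measurable (restrict_space lborel {0..dist a b})"
proof -
  have "continuous_on UNIV (\<lambda>t. a + (t * c) *\<^sub>R (b - a))" for c by (intro continuous_intros)
  then have "(\<lambda>t. a + (t * c) *\<^sub>R (b - a)) \<in> borel_measurable lborel" for c
    using borel_measurable_continuous_onI by auto
  then show ?thesis unfolding divide_inverse by (intro measurable_restrict_space1)
qed

lemma emeasure_arc_between: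
  assumes "A \<in> sets borel"
  shows "emeasure (arc_between a b) A = emeasure lborel {t \<in> {0..dist a b}. a + (t / dist a b) *\<^sub>R (b - a) \<in> A}"
proof -
  have "emeasure (arc_between a b) A = emeasure (restrict_space lborel {0..dist a b})
      ((\<lambda>t. a + (t / dist a b) *\<^sub>R (b - a)) -` A \<inter> {0..dist a b})"
    unfolding arc_between_def using assms arc_param_measurable by (subst emeasure_distr) auto
  also have "\<dots> = emeasure lborel ((\<lambda>t. a + (t / dist a b) *\<^sub>R (b - a)) -` A \<inter> {0..dist a b})"
    by (subst emeasure_restrict_space) auto
  also have "(\<lambda>t. a + (t / dist a b) *\<^sub>R (b - a)) -` A \<inter> {0..dist a b} = {t \<in> {0..dist a b}. a + (t / dist a b) *\<^sub>R (b - a) \<in> A}"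
    by auto
  finally show ?thesis .
qed

text \<open>Reflection of the parameter interval preserves Lebesgue measure.\<close>

lemma arc_between_commute:
  assumes ab: "a \<noteq> b" shows "arc_between a b = arc_between b a"
proof (rule measure_eqI)
  show "sets (arc_between a b) = sets (arc_between b a)" by (simp add: arc_between_sets)
  fix A assume "A \<in> sets (arc_between a b)"
  then have A: "A \<in> sets borel" by (simp add: arc_between_sets)
  let ?d = "dist a b"
  have d: "?d > 0" using ab by simp
  define B where "B = {t \<in> {0..?d}. a + (t / ?d) *\<^sub>R (b - a) \<in> A}"
  have Bm: "B \<in> sets borel" unfolding B_def using A by measurable
  have lb: "lborel = distr lborel borel (\<lambda>t::real. ?d - t)"
    using lborel_affine[of "-1" "?d"] by (simp add: density_1)
  have "emeasure lborel B = emeasure lborel ((\<lambda>t. ?d - t) -` B)"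
    using Bm by (subst lb) (simp add: emeasure_distr)
  also have "(\<lambda>t. ?d - t) -` B = {t \<in> {0..dist b a}. b + (t / dist b a) *\<^sub>R (a - b) \<in> A}"
  proof -
    have "a + ((?d - t) / ?d) *\<^sub>R (b - a) = b + (t / dist b a) *\<^sub>R (a - b)" for t
    proof -
      have "(?d - t) / ?d = 1 - t / ?d" using d by (simp add: field_simps)
      moreover have "a + (1 - s) *\<^sub>R (b - a) = b + s *\<^sub>R (a - b)" for s
        by (simp add: algebra_simps)
      ultimately show ?thesis by (simp add: dist_commute[of b a] del: add_diff_cancel)
    qed
    then show ?thesis by (auto simp: B_def dist_commute)
  qed
  finally show "emeasure (arc_between a b) A = emeasure (arc_between b a) A"
    unfolding emeasure_arc_between[OF A] B_def .
qed

text \<open>A segment determines its end points up to order, and the order does not affect the measure.\<close>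

lemma arc_closed_segment:
  assumes "a \<noteq> b" shows "arc (closed_segment a b) = arc_between a b"
proof -
  define e where "e = (SOME e. closed_segment a b = closed_segment (fst e) (snd e))"
  have "closed_segment a b = closed_segment (fst e) (snd e)"
    unfolding e_def by (rule someI[of "\<lambda>e. closed_segment a b = closed_segment (fst e) (snd e)" "(a, b)"]) simp
  then have "{a, b} = {fst e, snd e}" using closed_segment_eq by blast
  then have "arc_between (fst e) (snd e) = arc_between a b"
    using arc_between_commute[OF assms] by (auto simp: doubleton_eq_iff)
  then show ?thesis unfolding arc_def e_def[symmetric] Let_def .
qed

lemma arc_sets: "a \<noteq> b \<Longrightarrow> sets (arc (closed_segment a b)) = sets borel"
  and arc_space: "a \<noteq> b \<Longrightarrow> space (arc (closed_segment a b)) = UNIV"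
  by (simp_all add: arc_closed_segment arc_between_sets arc_between_space)

lemma arc_measurable: "a \<noteq> b \<Longrightarrow> borel_measurable (arc (closed_segment a b)) = borel_measurable borel"
  by (intro measurable_cong_sets) (auto simp: arc_sets)

lemma AE_arc_in:
  assumes "a \<noteq> b" shows "AE x in arc (closed_segment a b). x \<in> closed_segment a b"
proof (rule AE_I')
  have "{t \<in> {0..dist a b}. a + (t / dist a b) *\<^sub>R (b - a) \<in> - closed_segment a b} = {}"
  proof -
    have "a + (t / dist a b) *\<^sub>R (b - a) \<in> closed_segment a b" if "t \<in> {0..dist a b}" for t
      unfolding in_segment using that assms
      by (intro exI[of _ "t / dist a b"]) (auto simp: algebra_simps divide_le_eq_1)
    then show ?thesis by auto
  qed
  then have "emeasure (arc_between a b) (- closed_segment a b) = 0"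
    by (subst emeasure_arc_between) (simp, simp only: emeasure_empty)
  then show "- closed_segment a b \<in> null_sets (arc (closed_segment a b))"
    using assms by (simp add: null_sets_def arc_closed_segment arc_between_sets)
qed auto

lemma arc_integral:
  fixes f :: "pt \<Rightarrow> real"
  assumes ab: "a \<noteq> b" and f: "f \<in> borel_measurable borel" and fc: "continuous_on (closed_segment a b) f"
  shows "(LINT x|arc (closed_segment a b). f x) = dist a b * integral {0..1} (\<lambda>s. f (a + s *\<^sub>R (b - a)))"
    and "integrable (arc (closed_segment a b)) f"
proof -
  let ?d = "dist a b"
  let ?\<gamma> = "\<lambda>t. a + (t / ?d) *\<^sub>R (b - a)"
  have d: "?d > 0" using ab by simp
  have \<gamma>: "?\<gamma> ` {0..?d} \<subseteq> closed_segment a b"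
  proof safe
    fix t assume t: "t \<in> {0..?d}"
    show "?\<gamma> t \<in> closed_segment a b"
      unfolding in_segment using t d
      by (intro exI[of _ "t / ?d"]) (auto simp: algebra_simps divide_le_eq_1)
  qed
  have c: "continuous_on {0..?d} (\<lambda>t. f (?\<gamma> t))"
    by (rule continuous_on_compose2[OF fc _ \<gamma>]) (use ab in \<open>auto intro!: continuous_intros\<close>)
  have si: "set_integrable lborel {0..?d} (\<lambda>t. f (?\<gamma> t))"
    by (rule borel_integrable_atLeastAtMost') (use c in auto)
  then have ri: "integrable (restrict_space lborel {0..?d}) (\<lambda>t. f (?\<gamma> t))"
    by (simp add: integrable_restrict_space set_integrable_def)
  show "integrable (arc (closed_segment a b)) f"
    unfolding arc_closed_segment[OF ab] arc_between_def
    using f ri arc_param_measurable[of a b] by (subst integrable_distr_eq) auto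
  have "(LINT x|arc (closed_segment a b). f x) = (LINT t|restrict_space lborel {0..?d}. f (?\<gamma> t))"
    unfolding arc_closed_segment[OF ab] arc_between_def
    using f arc_param_measurable[of a b] by (subst integral_distr) auto
  also have "\<dots> = (LINT t:{0..?d}|lborel. f (?\<gamma> t))"
    by (simp add: integral_restrict_space set_lebesgue_integral_def)
  also have "\<dots> = integral {0..?d} (\<lambda>t. f (?\<gamma> t))"
    by (rule set_borel_integral_eq_integral(2)[OF si])
  also have "\<dots> = ?d * integral {0..1} (\<lambda>s. f (a + s *\<^sub>R (b - a)))"
  proof -
    have "((\<lambda>t. f (?\<gamma> t)) has_integral integral {0..?d} (\<lambda>t. f (?\<gamma> t))) (cbox 0 ?d)"
      using integrable_continuous_real[OF c] by (simp add: has_integral_iff)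
    from has_integral_affinity'[OF this d, of 0]
    have "((\<lambda>s. f (a + s *\<^sub>R (b - a))) has_integral integral {0..?d} (\<lambda>t. f (?\<gamma> t)) / ?d) {0..1}"
      using d by (simp add: field_simps)
    then show ?thesis using d by (simp add: integral_unique)
  qed
  finally show "(LINT x|arc (closed_segment a b). f x) = ?d * integral {0..1} (\<lambda>s. f (a + s *\<^sub>R (b - a)))" .
qed

lemma L2_arc_continuous:
  assumes ab: "a \<noteq> b" and f: "f \<in> borel_measurable borel" and fc: "continuous_on (closed_segment a b) f"
  shows "L2 (arc (closed_segment a b)) (f :: pt \<Rightarrow> real)"
proof -
  have "integrable (arc (closed_segment a b)) (\<lambda>x. (norm (f x))\<^sup>2)"
    by (rule arc_integral(2)[OF ab]) (use f fc in \<open>auto intro!: continuous_intros\<close>)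
  then show ?thesis using f by (simp add: L2_def arc_measurable[OF ab])
qed

lemma L2_arc_smooth: "a \<noteq> b \<Longrightarrow> smooth f \<Longrightarrow> L2 (arc (closed_segment a b)) f"
  by (intro L2_arc_continuous borel_measurable_continuous_onI smooth_continuous)

section \<open>Traces and the space V\<close>

lemma smooth_H1: "open \<Omega> \<Longrightarrow> bounded \<Omega> \<Longrightarrow> smooth f \<Longrightarrow> f \<in> H1 \<Omega>"
  unfolding H1_def using smooth_L2[of \<Omega> f] smooth_has_weak_grad[of \<Omega> f] by auto

lemma H1D: "u \<in> H1 \<Omega> \<Longrightarrow> L2 (lebesgue_on \<Omega>) u" "u \<in> H1 \<Omega> \<Longrightarrow> has_weak_grad \<Omega> u (wgrad \<Omega> u)"
  "u \<in> H1 \<Omega> \<Longrightarrow> L2 (lebesgue_on \<Omega>) (wgrad \<Omega> u)"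
  subgoal by (simp add: H1_def)
  subgoal by (rule has_weak_grad_wgrad)
  subgoal by (rule has_weak_gradD(1)[OF has_weak_grad_wgrad])
  done

lemma H1norm_eq:
  assumes \<Omega>: "open \<Omega>" "bounded \<Omega>" and "has_weak_grad \<Omega> f G"
  shows "H1norm \<Omega> f = sqrt ((L2norm (lebesgue_on \<Omega>) f)\<^sup>2 + (L2norm (lebesgue_on \<Omega>) G)\<^sup>2)"
proof -
  have w: "has_weak_grad \<Omega> f (wgrad \<Omega> f)"
    unfolding wgrad_def using someI[of "has_weak_grad \<Omega> f", OF assms(3)] by blast
  have "L2norm (lebesgue_on \<Omega>) (wgrad \<Omega> f) = L2norm (lebesgue_on \<Omega>) G"
    by (rule L2norm_cong_AE[OF L2_measurable[OF has_weak_gradD(1)[OF w]]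
          L2_measurable[OF has_weak_gradD(1)[OF assms(3)]] wgrad_AE[OF assms]])
  then show ?thesis by (simp add: H1norm_def)
qed

lemma H1norm_diff_le:
  assumes \<Omega>: "open \<Omega>" "bounded \<Omega>" and f: "f \<in> H1 \<Omega>" "g \<in> H1 \<Omega>"
  shows "(\<lambda>x. f x - g x) \<in> H1 \<Omega>" "H1norm \<Omega> (\<lambda>x. f x - g x) \<le> H1norm \<Omega> f + H1norm \<Omega> g"
proof -
  note fD = H1D[OF f(1)] and gD = H1D[OF f(2)]
  have wg: "has_weak_grad \<Omega> (\<lambda>x. f x - g x) (\<lambda>x. wgrad \<Omega> f x - wgrad \<Omega> g x)"
    by (intro has_weak_grad_diff \<Omega> fD gD)
  then show "(\<lambda>x. f x - g x) \<in> H1 \<Omega>" using L2_diff[OF fD(1) gD(1)] by (auto simp: H1_def)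
  have "H1norm \<Omega> (\<lambda>x. f x - g x) \<le> sqrt ((L2norm (lebesgue_on \<Omega>) f + L2norm (lebesgue_on \<Omega>) g)\<^sup>2
     + (L2norm (lebesgue_on \<Omega>) (wgrad \<Omega> f) + L2norm (lebesgue_on \<Omega>) (wgrad \<Omega> g))\<^sup>2)"
    unfolding H1norm_eq[OF \<Omega> wg]
    by (intro real_sqrt_le_mono add_mono power_mono L2norm_diff_triangle L2norm_nonneg fD gD)
  also have "\<dots> \<le> H1norm \<Omega> f + H1norm \<Omega> g"
    unfolding H1norm_def by (rule real_sqrt_sum_squares_triangle_ineq)
  finally show "H1norm \<Omega> (\<lambda>x. f x - g x) \<le> H1norm \<Omega> f + H1norm \<Omega> g" .
qed

lemma H1norm_ge: "L2norm (lebesgue_on \<Omega>) f \<le> H1norm \<Omega> f" "L2norm (lebesgue_on \<Omega>) (wgrad \<Omega> f) \<le> H1norm \<Omega> f"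
  "0 \<le> H1norm \<Omega> f"
  unfolding H1norm_def by (auto intro!: real_le_rsqrt)

lemma has_trace_diff:
  assumes \<Omega>: "open \<Omega>" "bounded \<Omega>" and ab: "a \<noteq> b"
    and t1: "has_trace \<Omega> (closed_segment a b) w \<tau>" and t2: "has_trace \<Omega> (closed_segment a b) w' \<tau>'"
  shows "has_trace \<Omega> (closed_segment a b) (\<lambda>x. w x - w' x) (\<lambda>x. \<tau> x - \<tau>' x)"
proof -
  let ?A = "arc (closed_segment a b)"
  obtain \<phi> where \<phi>: "\<And>k::nat. smooth (\<phi> k)" "(\<lambda>k. H1norm \<Omega> (\<lambda>x. \<phi> k x - w x)) \<longlonglongrightarrow> 0"
     "(\<lambda>k. L2norm ?A (\<lambda>x. \<phi> k x - \<tau> x)) \<longlonglongrightarrow> 0" and w: "w \<in> H1 \<Omega>" "L2 ?A \<tau>"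
    using t1 by (auto simp: has_trace_def)
  obtain \<phi>' where \<phi>': "\<And>k::nat. smooth (\<phi>' k)" "(\<lambda>k. H1norm \<Omega> (\<lambda>x. \<phi>' k x - w' x)) \<longlonglongrightarrow> 0"
     "(\<lambda>k. L2norm ?A (\<lambda>x. \<phi>' k x - \<tau>' x)) \<longlonglongrightarrow> 0" and w': "w' \<in> H1 \<Omega>" "L2 ?A \<tau>'"
    using t2 by (auto simp: has_trace_def)
  show ?thesis
    unfolding has_trace_def
  proof (intro conjI exI[of _ "\<lambda>k x. \<phi> k x - \<phi>' k x"] allI)
    show "(\<lambda>x. w x - w' x) \<in> H1 \<Omega>" by (rule H1norm_diff_le(1)[OF \<Omega> w(1) w'(1)])
    show "L2 ?A (\<lambda>x. \<tau> x - \<tau>' x)" by (intro L2_diff w w')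
    show "smooth (\<lambda>x. \<phi> k x - \<phi>' k x)" for k by (intro smooth_diff \<phi> \<phi>')
    have h: "(\<lambda>x. \<phi> k x - w x) \<in> H1 \<Omega>" "(\<lambda>x. \<phi>' k x - w' x) \<in> H1 \<Omega>" for k
      by (intro H1norm_diff_le(1) \<Omega> w w' smooth_H1 \<phi> \<phi>')+
    have "H1norm \<Omega> (\<lambda>x. (\<phi> k x - \<phi>' k x) - (w x - w' x)) \<le> H1norm \<Omega> (\<lambda>x. \<phi> k x - w x) + H1norm \<Omega> (\<lambda>x. \<phi>' k x - w' x)" for k
      using H1norm_diff_le(2)[OF \<Omega> h(1)[of k] h(2)[of k]] by (simp add: algebra_simps)
    then have "\<forall>\<^sub>F k in sequentially. norm (H1norm \<Omega> (\<lambda>x. (\<phi> k x - \<phi>' k x) - (w x - w' x)))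
        \<le> H1norm \<Omega> (\<lambda>x. \<phi> k x - w x) + H1norm \<Omega> (\<lambda>x. \<phi>' k x - w' x)"
      by (simp add: H1norm_ge(3))
    then show "(\<lambda>k. H1norm \<Omega> (\<lambda>x. (\<phi> k x - \<phi>' k x) - (w x - w' x))) \<longlonglongrightarrow> 0"
      by (rule Lim_null_comparison) (use tendsto_add[OF \<phi>(2) \<phi>'(2)] in simp)
    have l: "L2 ?A (\<lambda>x. \<phi> k x - \<tau> x)" "L2 ?A (\<lambda>x. \<phi>' k x - \<tau>' x)" for k
      by (intro L2_diff L2_arc_smooth ab \<phi> \<phi>' w w')+
    have "L2norm ?A (\<lambda>x. (\<phi> k x - \<phi>' k x) - (\<tau> x - \<tau>' x)) \<le> L2norm ?A (\<lambda>x. \<phi> k x - \<tau> x) + L2norm ?A (\<lambda>x. \<phi>' k x - \<tau>' x)" for k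
      using L2norm_diff_triangle[OF l(1)[of k] l(2)[of k]] by (simp add: algebra_simps)
    then have "\<forall>\<^sub>F k in sequentially. norm (L2norm ?A (\<lambda>x. (\<phi> k x - \<phi>' k x) - (\<tau> x - \<tau>' x)))
        \<le> L2norm ?A (\<lambda>x. \<phi> k x - \<tau> x) + L2norm ?A (\<lambda>x. \<phi>' k x - \<tau>' x)"
      by (simp add: L2norm_nonneg)
    then show "(\<lambda>k. L2norm ?A (\<lambda>x. (\<phi> k x - \<phi>' k x) - (\<tau> x - \<tau>' x))) \<longlonglongrightarrow> 0"
      by (rule Lim_null_comparison) (use tendsto_add[OF \<phi>(3) \<phi>'(3)] in simp)
  qed
qed

lemma has_trace_cong_AE:
  assumes \<Omega>: "open \<Omega>" "bounded \<Omega>" and t: "has_trace \<Omega> E w \<tau>" and ae: "AE x in lebesgue_on \<Omega>. w x = w' x"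
  shows "has_trace \<Omega> E w' \<tau>"
proof -
  obtain \<phi> where \<phi>: "\<And>k::nat. smooth (\<phi> k)" "(\<lambda>k. H1norm \<Omega> (\<lambda>x. \<phi> k x - w x)) \<longlonglongrightarrow> 0"
     "(\<lambda>k. L2norm (arc E) (\<lambda>x. \<phi> k x - \<tau> x)) \<longlonglongrightarrow> 0" and w: "w \<in> H1 \<Omega>" "L2 (arc E) \<tau>"
    using t by (auto simp: has_trace_def)
  have \<Omega>m: "\<Omega> \<in> sets lebesgue" using \<Omega> by simp
  note wD = H1D[OF w(1)]
  have wg': "has_weak_grad \<Omega> w' (wgrad \<Omega> w)" by (rule has_weak_grad_cong_AE[OF \<Omega> wD(1) ae wD(2)]) simp
  have L': "L2 (lebesgue_on \<Omega>) w'" by (rule L2_lebesgue_on_AE[OF \<Omega>m wD(1) ae])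
  have "H1norm \<Omega> (\<lambda>x. \<phi> k x - w' x) = H1norm \<Omega> (\<lambda>x. \<phi> k x - w x)" for k
  proof -
    note p = H1D[OF smooth_H1[OF \<Omega> \<phi>(1)[of k]]]
    have aed: "AE x in lebesgue_on \<Omega>. \<phi> k x - w' x = \<phi> k x - w x" using ae by (rule eventually_mono) simp
    have "L2norm (lebesgue_on \<Omega>) (\<lambda>x. \<phi> k x - w' x) = L2norm (lebesgue_on \<Omega>) (\<lambda>x. \<phi> k x - w x)"
      by (rule L2norm_cong_AE[OF L2_measurable[OF L2_diff[OF p(1) L']] L2_measurable[OF L2_diff[OF p(1) wD(1)]] aed])
    then show ?thesis
      unfolding H1norm_eq[OF \<Omega> has_weak_grad_diff[OF \<Omega> p(1) L' p(2) wg']]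
        H1norm_eq[OF \<Omega> has_weak_grad_diff[OF \<Omega> p(1) wD(1) p(2) wD(2)]] by simp
  qed
  then show ?thesis unfolding has_trace_def using \<phi> w(2) L' wg'
    by (intro conjI exI[of _ \<phi>]) (auto simp: H1_def)
qed

lemma plate_model_domain:
  assumes "plate_model P"
  shows "open (Omega P)" "bounded (Omega P)" "Omega P \<in> sets lebesgue" "compact (closure (Omega P))"
    "connected (Omega P)" "Omega P \<noteq> {}"
  using assms by (auto simp: plate_model_def polygonal_domain_def lipschitz_domain_def)

lemma V_D:
  assumes "v \<in> V P"
  shows "v \<in> H2 (Omega P)" "continuous_on (closure (Omega P)) v" "x \<in> GammaC P \<union> GammaS P \<Longrightarrow> v x = 0"
    "a \<noteq> b \<Longrightarrow> closed_segment a b \<subseteq> GammaC P \<Longrightarrow> \<exists>\<tau>. has_grad_trace (Omega P) (closed_segment a b) v \<tau> \<and>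
             (AE x in arc (closed_segment a b). \<tau> x \<bullet> rot (b - a) = 0)"
  using assms unfolding V_def by auto

lemma V_diff:
  assumes P: "plate_model P" and u: "u \<in> V P" and v: "v \<in> V P"
  shows "(\<lambda>x. u x - v x) \<in> V P"
  unfolding V_def
proof (intro CollectI conjI ballI allI impI)
  note \<Omega> = plate_model_domain(1,2)[OF P]
  note uD = V_D[OF u] and vD = V_D[OF v]
  note d = H2_diff[OF \<Omega> uD(1) vD(1)]
  show "(\<lambda>x. u x - v x) \<in> H2 (Omega P)" by (rule d(1))
  show "continuous_on (closure (Omega P)) (\<lambda>x. u x - v x)" by (intro continuous_intros uD vD)
  show "u x - v x = 0" if "x \<in> GammaC P \<union> GammaS P" for x using uD(3)[OF that] vD(3)[OF that] by simp
  fix a b assume ab: "a \<noteq> b \<and> closed_segment a b \<subseteq> GammaC P"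
  obtain \<tau> where \<tau>: "has_grad_trace (Omega P) (closed_segment a b) u \<tau>" "AE x in arc (closed_segment a b). \<tau> x \<bullet> rot (b - a) = 0"
    using uD(4)[of a b] ab by auto
  obtain \<tau>' where \<tau>': "has_grad_trace (Omega P) (closed_segment a b) v \<tau>'" "AE x in arc (closed_segment a b). \<tau>' x \<bullet> rot (b - a) = 0"
    using vD(4)[of a b] ab by auto
  show "\<exists>\<tau>. has_grad_trace (Omega P) (closed_segment a b) (\<lambda>x. u x - v x) \<tau> \<and>
             (AE x in arc (closed_segment a b). \<tau> x \<bullet> rot (b - a) = 0)"
  proof (intro exI[of _ "\<lambda>x. \<tau> x - \<tau>' x"] conjI)
    show "has_grad_trace (Omega P) (closed_segment a b) (\<lambda>x. u x - v x) (\<lambda>x. \<tau> x - \<tau>' x)"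
      unfolding has_grad_trace_def
    proof
      fix i
      have "has_trace (Omega P) (closed_segment a b) (\<lambda>x. wgrad (Omega P) u x $ i - wgrad (Omega P) v x $ i) (\<lambda>x. \<tau> x $ i - \<tau>' x $ i)"
        using \<tau>(1) \<tau>'(1) ab by (intro has_trace_diff \<Omega>) (auto simp: has_grad_trace_def)
      moreover have "AE x in lebesgue_on (Omega P). wgrad (Omega P) u x $ i - wgrad (Omega P) v x $ i = wgrad (Omega P) (\<lambda>x. u x - v x) x $ i"
        using d(2) by (rule eventually_mono) simp
      ultimately show "has_trace (Omega P) (closed_segment a b) (\<lambda>x. wgrad (Omega P) (\<lambda>x. u x - v x) x $ i) (\<lambda>x. (\<tau> x - \<tau>' x) $ i)"
        using has_trace_cong_AE[OF \<Omega>] by auto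
    qed
    show "AE x in arc (closed_segment a b). (\<tau> x - \<tau>' x) \<bullet> rot (b - a) = 0"
      using \<tau>(2) \<tau>'(2) by eventually_elim (simp add: inner_diff_left)
  qed
qed

text \<open>Membership depends only on the values on the closed domain. In particular a function of \<open>V\<close> may be set to zero
  outside, which makes it Borel measurable on the whole plane, as the integrals over segments require.\<close>

lemma V_cong:
  assumes P: "plate_model P" and u: "u \<in> V P" and eq: "\<And>x. x \<in> closure (Omega P) \<Longrightarrow> u x = v x"
  shows "v \<in> V P"
  unfolding V_def
proof (intro CollectI conjI ballI allI impI)
  note \<Omega> = plate_model_domain(1,2)[OF P]
  note uD = V_D[OF u]
  have eq': "\<And>x. x \<in> Omega P \<Longrightarrow> u x = v x" using eq closure_subset by blast
  have d: "v \<in> H2 (Omega P)" "AE x in lebesgue_on (Omega P). wgrad (Omega P) v x = wgrad (Omega P) u x"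
    by (rule H2_cong[OF \<Omega> uD(1)], use eq' in simp)+
  show "v \<in> H2 (Omega P)" by (rule d(1))
  show "continuous_on (closure (Omega P)) v" using uD(2) eq by (simp cong: continuous_on_cong)
  have "GammaC P \<union> GammaS P \<subseteq> closure (Omega P)"
    using P by (auto simp: plate_model_def frontier_def)
  then show "v x = 0" if "x \<in> GammaC P \<union> GammaS P" for x using uD(3)[OF that] eq[of x] that by auto
  fix a b assume ab: "a \<noteq> b \<and> closed_segment a b \<subseteq> GammaC P"
  obtain \<tau> where \<tau>: "has_grad_trace (Omega P) (closed_segment a b) u \<tau>" "AE x in arc (closed_segment a b). \<tau> x \<bullet> rot (b - a) = 0"
    using uD(4)[of a b] ab by auto
  have "has_grad_trace (Omega P) (closed_segment a b) v \<tau>"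
    unfolding has_grad_trace_def
  proof
    fix i
    have "AE x in lebesgue_on (Omega P). wgrad (Omega P) u x $ i = wgrad (Omega P) v x $ i"
      using d(2) by (rule eventually_mono) simp
    moreover have "has_trace (Omega P) (closed_segment a b) (\<lambda>x. wgrad (Omega P) u x $ i) (\<lambda>x. \<tau> x $ i)"
      using \<tau>(1) by (simp add: has_grad_trace_def)
    ultimately show "has_trace (Omega P) (closed_segment a b) (\<lambda>x. wgrad (Omega P) v x $ i) (\<lambda>x. \<tau> x $ i)"
      by (rule has_trace_cong_AE[OF \<Omega>, rotated])
  qed
  then show "\<exists>\<tau>. has_grad_trace (Omega P) (closed_segment a b) v \<tau> \<and>
             (AE x in arc (closed_segment a b). \<tau> x \<bullet> rot (b - a) = 0)" using \<tau>(2) by blast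
qed

section \<open>The bilinear form\<close>

lemma linear_curvature: "linear curvature"
  by (intro linearI) (auto simp: curvature_def vec_eq_iff transpose_def algebra_simps)

lemma trace_scaleR: "trace (c *\<^sub>R A) = c * trace (A :: real^'n^'n)"
  by (simp add: trace_def sum_distrib_left)

lemma linear_moment: "linear (moment P)"
proof (rule linearI)
  show "moment P (A + B) = moment P A + moment P B" for A B
    unfolding moment_def elasticity_def linear_add[OF linear_curvature]
    by (simp add: trace_add scaleR_add_right scaleR_add_left distrib_left)
  show "moment P (r *\<^sub>R A) = r *\<^sub>R moment P A" for r A
    unfolding moment_def elasticity_def linear_scale[OF linear_curvature]
    by (simp add: trace_scaleR scaleR_add_right mult.commute mult.left_commute)
qed

lemma L2_linear:
  fixes h :: "'b::euclidean_space \<Rightarrow> 'c::euclidean_space"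
  assumes h: "linear h" and f: "L2 M f"
  shows "L2 M (\<lambda>x. h (f x))"
proof -
  have bl: "bounded_linear h" using h by (simp add: linear_conv_bounded_linear)
  obtain B where B: "\<And>x. norm (h x) \<le> norm x * B" using bounded_linear.bounded[OF bl] by blast
  have "continuous_on UNIV h" using bl by (simp add: linear_continuous_on)
  then have hm: "h \<in> borel_measurable borel" by (rule borel_measurable_continuous_onI)
  show ?thesis
  proof (rule L2_dominated[OF L2_scaleR[OF f, of B]])
    show "(\<lambda>x. h (f x)) \<in> borel_measurable M" using measurable_compose[OF L2_measurable[OF f] hm] .
    have "norm (h y) \<le> norm (B *\<^sub>R y)" for y
    proof -
      have "norm (h y) \<le> norm y * \<bar>B\<bar>" using B[of y] by (rule order.trans) (simp add: mult_left_mono)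
      then show ?thesis by (simp add: mult.commute)
    qed
    then show "AE x in M. norm (h (f x)) \<le> norm (B *\<^sub>R f x)" by simp
  qed
qed

lemma bilin_integrable:
  assumes "L2 M F" "L2 M G"
  shows "integrable M (\<lambda>x. moment P (F x) \<bullet> curvature (G x))"
  by (intro L2_integrable_inner L2_linear[OF linear_moment] L2_linear[OF linear_curvature] assms)

lemma bilin_cong:
  assumes P: "plate_model P" and u: "L2 (lebesgue_on (Omega P)) F" "AE x in lebesgue_on (Omega P). F x = whess (Omega P) u x"
    and v: "L2 (lebesgue_on (Omega P)) G" "AE x in lebesgue_on (Omega P). G x = whess (Omega P) v x"
  shows "bilin P u v = (LINT x|lebesgue_on (Omega P). moment P (F x) \<bullet> curvature (G x))"
  unfolding bilin_def
proof (rule sym, rule integral_cong_AE_lebesgue_on[OF plate_model_domain(3)[OF P]])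
  show "(\<lambda>x. moment P (F x) \<bullet> curvature (G x)) \<in> borel_measurable (lebesgue_on (Omega P))"
    using bilin_integrable[OF u(1) v(1)] by (rule borel_measurable_integrable)
  show "AE x in lebesgue_on (Omega P). moment P (F x) \<bullet> curvature (G x) = moment P (whess (Omega P) u x) \<bullet> curvature (whess (Omega P) v x)"
    using u(2) v(2) by eventually_elim simp
qed

lemma bilin_diff:
  assumes P: "plate_model P" and u: "u \<in> H2 (Omega P)" and v: "v \<in> H2 (Omega P)" and w: "w \<in> H2 (Omega P)"
  shows "bilin P (\<lambda>x. u x - v x) w = bilin P u w - bilin P v w"
    "bilin P w (\<lambda>x. u x - v x) = bilin P w u - bilin P w v"
proof -
  let ?M = "lebesgue_on (Omega P)" and ?H = "whess (Omega P)"
  note L = H2D(5)[OF u] H2D(5)[OF v] H2D(5)[OF w]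
  note i = bilin_integrable[where P=P]
  have ae: "AE x in ?M. ?H u x - ?H v x = ?H (\<lambda>x. u x - v x) x"
    using H2_diff(3)[OF plate_model_domain(1,2)[OF P] u v] by (rule eventually_mono) simp
  have "bilin P (\<lambda>x. u x - v x) w = (LINT x|?M. moment P (?H u x - ?H v x) \<bullet> curvature (?H w x))"
    by (rule bilin_cong[OF P L2_diff[OF L(1,2)] ae L(3)]) simp
  then show "bilin P (\<lambda>x. u x - v x) w = bilin P u w - bilin P v w"
    using i[OF L(1,3)] i[OF L(2,3)] by (simp add: linear_diff[OF linear_moment] inner_diff_left bilin_def)
  have "bilin P w (\<lambda>x. u x - v x) = (LINT x|?M. moment P (?H w x) \<bullet> curvature (?H u x - ?H v x))"
    by (rule bilin_cong[OF P L(3) _ L2_diff[OF L(1,2)] ae]) simp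
  then show "bilin P w (\<lambda>x. u x - v x) = bilin P w u - bilin P w v"
    using i[OF L(3,1)] i[OF L(3,2)] by (simp add: linear_diff[OF linear_curvature] inner_diff_right bilin_def)
qed

lemma bilin_cong_right:
  assumes P: "plate_model P" and u: "u \<in> H2 (Omega P)" and v: "v \<in> H2 (Omega P)" and eq: "\<And>x. x \<in> Omega P \<Longrightarrow> v x = v' x"
  shows "bilin P u v = bilin P u v'"
proof -
  note c = H2_cong[OF plate_model_domain(1,2)[OF P] v eq]
  have "bilin P u v' = (LINT x|lebesgue_on (Omega P). moment P (whess (Omega P) u x) \<bullet> curvature (whess (Omega P) v x))"
    using c(3) by (intro bilin_cong P H2D(5) u v) (auto elim: eventually_mono)
  then show ?thesis by (simp add: bilin_def)
qed

section \<open>Smooth approximation up to the boundary of a star-shaped set\<close>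

lemma UNIV_lebesgue: "UNIV \<in> sets (lebesgue :: pt measure)"
  by simp

lemma L2_subdomain:
  fixes f :: "pt \<Rightarrow> 'b::euclidean_space"
  assumes \<Omega>: "\<Omega> \<in> sets lebesgue" and K: "K \<in> sets lebesgue" "negligible (K - \<Omega>)" and f: "L2 (lebesgue_on \<Omega>) f"
  shows "L2 (lebesgue_on K) f"
proof -
  have L: "L2 lebesgue (\<lambda>x. indicator K x *\<^sub>R (indicator \<Omega> x *\<^sub>R f x))"
  proof (rule L2_bounded_mult[where B=1])
    show "L2 lebesgue (\<lambda>x. indicator \<Omega> x *\<^sub>R f x)" using f by (simp only: L2_restrict_iff[OF \<Omega>])
    show "indicator K \<in> borel_measurable lebesgue" using K by simp
  qed simp
  have "AE x in lebesgue. indicator K x *\<^sub>R (indicator \<Omega> x *\<^sub>R f x) = indicator K x *\<^sub>R f x"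
    by (rule AE_lebesgue_negligible[OF K(2)]) (auto simp: indicator_def)
  with L have "L2 lebesgue (\<lambda>x. indicator K x *\<^sub>R f x)"
    by (rule L2_lebesgue_on_AE[where \<Omega>=UNIV, unfolded lebesgue_on_UNIV_eq, OF UNIV_lebesgue])
  then show ?thesis unfolding L2_restrict_iff(1)[OF K(1)] .
qed

lemma pd_cong_open:
  assumes "open U" "x \<in> U" "\<And>y. y \<in> U \<Longrightarrow> f y = g y" "g differentiable (at x)"
  shows "pd i f x = pd i g x"
proof -
  have "(g has_derivative frechet_derivative g (at x)) (at x)" using assms(4) by (simp add: frechet_derivative_works)
  then have "(f has_derivative frechet_derivative g (at x)) (at x)"
    by (rule has_derivative_transform_within_open[OF _ assms(1,2)]) (simp add: assms(3))
  from pd_eqI[OF this, of i] show ?thesis by (simp only: pd_def)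
qed

text \<open>Mollification after a contraction towards \<open>z\<close>. If the contraction moves a compact set into the
  domain and the mollification radius is small, only values inside the domain enter.\<close>

definition moll :: "pt set \<Rightarrow> real \<Rightarrow> real \<Rightarrow> pt \<Rightarrow> (pt \<Rightarrow> real) \<Rightarrow> pt \<Rightarrow> real" where
  "moll \<Omega> \<epsilon> t z f x = conv (rho \<epsilon>) (\<lambda>y. indicator \<Omega> y * f y) (t *\<^sub>R x + (1 - t) *\<^sub>R z)"

lemma bounded_radius:
  assumes "bounded (\<Omega> :: pt set)"
  obtains R where "0 \<le> R" "\<And>x. R \<le> norm x \<Longrightarrow> x \<notin> \<Omega>"
proof -
  obtain R where R: "\<And>x. x \<in> \<Omega> \<Longrightarrow> norm x \<le> R" using assms by (auto simp: bounded_iff)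
  show ?thesis
    by (rule that[of "max 0 (R + 1)"]) (use R in force)+
qed

lemma ext_integrable:
  assumes "\<Omega> \<in> sets lebesgue" "bounded \<Omega>" "L2 (lebesgue_on \<Omega>) (f :: pt \<Rightarrow> real)"
  shows "integrable lebesgue (\<lambda>y. indicator \<Omega> y * f y)"
proof -
  obtain R where R: "0 \<le> R" "\<And>x. R \<le> norm x \<Longrightarrow> x \<notin> \<Omega>" using bounded_radius[OF assms(2)] by blast
  show ?thesis
  proof (rule integrable_of_L2_bounded_support)
    show "L2 lebesgue (\<lambda>y. indicator \<Omega> y * f y)" using assms(3) by (simp add: L2_ext[OF assms(1)])
    show "indicator \<Omega> x * f x = 0" if "R \<le> norm x" for x using R(2)[OF that] by simp
  qed
qed

lemma smooth_moll:
  assumes "\<Omega> \<in> sets lebesgue" "bounded \<Omega>" "L2 (lebesgue_on \<Omega>) f" "\<epsilon> > 0"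
  shows "smooth (moll \<Omega> \<epsilon> t z f)"
  unfolding moll_def[abs_def]
  by (intro smooth_affine smooth_conv ext_integrable bsupp_rho smooth_rho assms)

lemma pd_moll:
  assumes \<Omega>: "open \<Omega>" "bounded \<Omega>" and f: "L2 (lebesgue_on \<Omega>) f" and G: "has_weak_grad \<Omega> f G"
    and \<epsilon>: "\<epsilon> > 0" and x: "cball (t *\<^sub>R x + (1 - t) *\<^sub>R z) \<epsilon> \<subseteq> \<Omega>"
  shows "pd i (moll \<Omega> \<epsilon> t z f) x = t * moll \<Omega> \<epsilon> t z (\<lambda>x. G x $ i) x"
proof -
  have \<Omega>m: "\<Omega> \<in> sets lebesgue" using \<Omega> by simp
  note int = ext_integrable[OF \<Omega>m \<Omega>(2) f]
  show ?thesis
    unfolding moll_def[abs_def]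
    using pd_affine[OF smooth_conv[OF int bsupp_rho[OF \<epsilon>] smooth_rho], of i t "(1 - t) *\<^sub>R z" x]
      conv_weak_grad[OF G \<Omega>(1) \<epsilon> x, of i] pd_conv[OF int bsupp_rho[OF \<epsilon>] smooth_rho, of i]
    by simp
qed

text \<open>The contracted compact set has positive distance from the complement of the domain, so a radius can be chosen for each
  contraction factor. The factor two leaves room for the derivatives in a neighbourhood of each point.\<close>

lemma moll_parameters:
  fixes z :: pt
  assumes K: "compact K" and \<Omega>: "open \<Omega>"
    and star: "\<And>t x. 1/2 \<le> t \<Longrightarrow> t < 1 \<Longrightarrow> x \<in> K \<Longrightarrow> t *\<^sub>R x + (1 - t) *\<^sub>R z \<in> \<Omega>"
  obtains \<epsilon> t :: "nat \<Rightarrow> real" where "\<And>n. \<epsilon> n > 0" "\<epsilon> \<longlonglongrightarrow> 0" "\<And>n. 1/2 \<le> t n" "\<And>n. t n \<le> 1" "t \<longlonglongrightarrow> 1"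
    "\<And>n x. x \<in> K \<Longrightarrow> cball (t n *\<^sub>R x + (1 - t n) *\<^sub>R z) (2 * \<epsilon> n) \<subseteq> \<Omega>"
proof -
  define t where "t = (\<lambda>n::nat. 1 - 1 / real (Suc (Suc n)))"
  have t: "1/2 \<le> t n" "t n < 1" for n by (auto simp: t_def field_simps)
  have tl: "t \<longlonglongrightarrow> 1"
  proof -
    have "(\<lambda>n. 1 / real n) \<longlonglongrightarrow> 0" by (rule lim_const_over_n)
    then have "(\<lambda>n. 1 / real (n + 2)) \<longlonglongrightarrow> 0" by (rule LIMSEQ_ignore_initial_segment)
    then have "(\<lambda>n. 1 - 1 / real (n + 2)) \<longlonglongrightarrow> 1 - 0" by (intro tendsto_diff tendsto_const)
    then show ?thesis by (simp add: t_def)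
  qed
  have "\<exists>e>0. \<forall>x\<in>K. ball (t n *\<^sub>R x + (1 - t n) *\<^sub>R z) e \<subseteq> \<Omega>" for n
  proof -
    let ?A = "(\<lambda>x. t n *\<^sub>R x + (1 - t n) *\<^sub>R z) ` K"
    have "compact ?A" by (intro compact_continuous_image K continuous_intros)
    moreover have "?A \<subseteq> \<Omega>" using star t by auto
    ultimately obtain e where "e > 0" "(\<Union>x\<in>?A. ball x e) \<subseteq> \<Omega>"
      using compact_subset_open_imp_ball_epsilon_subset[OF _ \<Omega>] by blast
    then show ?thesis by (intro exI[of _ e]) auto
  qed
  then obtain e where e: "\<And>n. e n > 0" "\<And>n x. x \<in> K \<Longrightarrow> ball (t n *\<^sub>R x + (1 - t n) *\<^sub>R z) (e n) \<subseteq> \<Omega>" by metis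
  define \<epsilon> where "\<epsilon> = (\<lambda>n. min (e n / 4) (1 / real (Suc n)))"
  have \<epsilon>: "\<epsilon> n > 0" for n using e(1)[of n] by (simp add: \<epsilon>_def)
  have \<epsilon>l: "\<epsilon> \<longlonglongrightarrow> 0"
  proof (rule Lim_null_comparison)
    show "\<forall>\<^sub>F n in sequentially. norm (\<epsilon> n) \<le> 1 / real (Suc n)" using \<epsilon> by (intro always_eventually) (simp add: \<epsilon>_def less_imp_le)
    show "(\<lambda>n. 1 / real (Suc n)) \<longlonglongrightarrow> 0" by (intro filterlim_compose[OF lim_const_over_n filterlim_Suc])
  qed
  have "cball (t n *\<^sub>R x + (1 - t n) *\<^sub>R z) (2 * \<epsilon> n) \<subseteq> \<Omega>" if "x \<in> K" for n x
  proof -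
    have "2 * \<epsilon> n < e n" using e(1)[of n] by (simp add: \<epsilon>_def)
    then show ?thesis using e(2)[OF that, of n] by fastforce
  qed
  then show ?thesis using that[of \<epsilon> t] \<epsilon> \<epsilon>l t tl by (simp add: less_imp_le)
qed

lemma moll_L2_tendsto:
  assumes \<Omega>: "open \<Omega>" "bounded \<Omega>" and K: "K \<in> sets lebesgue" "negligible (K - \<Omega>)"
    and f: "L2 (lebesgue_on \<Omega>) f"
    and p: "\<And>n. \<epsilon> n > 0" "\<epsilon> \<longlonglongrightarrow> 0" "\<And>n. 1/2 \<le> t n" "\<And>n. t n \<le> 1" "t \<longlonglongrightarrow> 1"
  shows "L2 (lebesgue_on K) (moll \<Omega> (\<epsilon> n) (t n) z f)"
    "(\<lambda>n. L2norm (lebesgue_on K) (\<lambda>x. moll \<Omega> (\<epsilon> n) (t n) z f x - f x)) \<longlonglongrightarrow> 0"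
proof -
  have \<Omega>m: "\<Omega> \<in> sets lebesgue" using \<Omega> by simp
  define F where "F = (\<lambda>x. indicator \<Omega> x * f x)"
  obtain R where R': "0 \<le> R" "\<And>x. R \<le> norm x \<Longrightarrow> x \<notin> \<Omega>" using bounded_radius[OF \<Omega>(2)] by blast
  then have R: "0 \<le> R" "\<And>x. R \<le> norm x \<Longrightarrow> F x = 0" by (auto simp: F_def)
  have FL: "L2 lebesgue F" unfolding F_def using f by (simp add: L2_ext[OF \<Omega>m])
  have Fi: "integrable lebesgue F" unfolding F_def by (rule ext_integrable[OF \<Omega>m \<Omega>(2) f])
  let ?m = "\<lambda>n. moll \<Omega> (\<epsilon> n) (t n) z f"
  have mL: "L2 lebesgue (?m n)" for n
    unfolding moll_def[abs_def] F_def[symmetric] by (rule conv_L2_bound(1)[OF Fi FL p(1) p(3)])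
  have ind: "indicator K \<in> borel_measurable lebesgue" using K by simp
  show mK: "L2 (lebesgue_on K) (?m n)" for n
    unfolding L2_restrict_iff(1)[OF K(1)] by (rule L2_bounded_mult[OF mL ind, where B=1]) simp
  have lim: "(\<lambda>n. L2norm lebesgue (\<lambda>x. ?m n x - F x)) \<longlonglongrightarrow> 0"
    unfolding moll_def F_def[symmetric] by (rule conv_L2_tendsto[OF FL R(2) R(1) p])
  have fK: "L2 (lebesgue_on K) f" by (rule L2_subdomain[OF \<Omega>m K f])
  show "(\<lambda>n. L2norm (lebesgue_on K) (\<lambda>x. ?m n x - f x)) \<longlonglongrightarrow> 0"
  proof (rule Lim_null_comparison[OF always_eventually lim], rule allI)
    fix n
    have L: "L2 (lebesgue_on K) (\<lambda>x. ?m n x - f x)" by (rule L2_diff[OF mK fK])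
    have "L2norm (lebesgue_on K) (\<lambda>x. ?m n x - f x) = L2norm lebesgue (\<lambda>x. indicator K x *\<^sub>R (?m n x - f x))"
      by (rule L2_restrict_iff(2)[OF K(1)])
    also have "\<dots> \<le> L2norm lebesgue (\<lambda>x. ?m n x - F x)"
    proof (rule L2norm_mono_AE[OF L2_diff[OF mL FL]])
      show "(\<lambda>x. indicator K x *\<^sub>R (?m n x - f x)) \<in> borel_measurable lebesgue"
        using L unfolding L2_restrict_iff(1)[OF K(1)] by (rule L2_measurable)
      show "AE x in lebesgue. norm (indicator K x *\<^sub>R (?m n x - f x)) \<le> norm (?m n x - F x)"
        by (rule AE_lebesgue_negligible[OF K(2)]) (auto simp: F_def indicator_def)
    qed
    finally show "norm (L2norm (lebesgue_on K) (\<lambda>x. ?m n x - f x)) \<le> L2norm lebesgue (\<lambda>x. ?m n x - F x)"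
      by (simp add: L2norm_nonneg)
  qed
qed

lemma L2norm_scale: "L2norm M (\<lambda>x. c *\<^sub>R f x) = \<bar>c\<bar> * L2norm M f"
  by (simp add: L2norm_def power_mult_distrib real_sqrt_mult)

lemma L2norm_tendsto_scaled:
  fixes f :: "'a \<Rightarrow> real"
  assumes f: "L2 M f" and fn: "\<And>n. L2 M (fn n)" and lim: "(\<lambda>n. L2norm M (\<lambda>x. fn n x - f x)) \<longlonglongrightarrow> 0"
    and s: "s \<longlonglongrightarrow> 1"
  shows "(\<lambda>n. L2norm M (\<lambda>x. s n * fn n x - f x)) \<longlonglongrightarrow> 0"
proof (rule Lim_null_comparison)
  have "(\<lambda>n. \<bar>s n\<bar> * L2norm M (\<lambda>x. fn n x - f x) + \<bar>s n - 1\<bar> * L2norm M f) \<longlonglongrightarrow> \<bar>1\<bar> * 0 + \<bar>1 - 1\<bar> * L2norm M f"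
    by (intro tendsto_intros lim s)
  then show "(\<lambda>n. \<bar>s n\<bar> * L2norm M (\<lambda>x. fn n x - f x) + \<bar>s n - 1\<bar> * L2norm M f) \<longlonglongrightarrow> 0" by simp
  have "L2norm M (\<lambda>x. s n * fn n x - f x) \<le> \<bar>s n\<bar> * L2norm M (\<lambda>x. fn n x - f x) + \<bar>s n - 1\<bar> * L2norm M f" for n
  proof -
    have "(\<lambda>x. s n * fn n x - f x) = (\<lambda>x. s n *\<^sub>R (fn n x - f x) + (s n - 1) *\<^sub>R f x)" by (auto simp: algebra_simps)
    then show ?thesis
      using L2norm_triangle[OF L2_scaleR[OF L2_diff[OF fn f], of "s n"] L2_scaleR[OF f, of "s n - 1"]]
      by (simp only: L2norm_scale)
  qed
  then show "\<forall>\<^sub>F n in sequentially. norm (L2norm M (\<lambda>x. s n * fn n x - f x))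
      \<le> \<bar>s n\<bar> * L2norm M (\<lambda>x. fn n x - f x) + \<bar>s n - 1\<bar> * L2norm M f"
    by (simp add: L2norm_nonneg)
qed

lemma L2norm_cong_on:
  "(\<And>x. x \<in> K \<Longrightarrow> f x = g x) \<Longrightarrow> L2norm (lebesgue_on K) f = L2norm (lebesgue_on K) g"
  unfolding L2norm_def by (intro arg_cong[where f=sqrt] Bochner_Integration.integral_cong) auto

text \<open>The contraction multiplies the gradient by the factor \<open>t\<close>, which tends to one.\<close>

lemma H1_approx:
  assumes \<Omega>: "open \<Omega>" "bounded \<Omega>" and K: "compact K" "negligible (K - \<Omega>)"
    and star: "\<And>t x. 1/2 \<le> t \<Longrightarrow> t < 1 \<Longrightarrow> x \<in> K \<Longrightarrow> t *\<^sub>R x + (1 - t) *\<^sub>R z \<in> \<Omega>"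
    and w: "L2 (lebesgue_on \<Omega>) w" and G: "has_weak_grad \<Omega> w G"
  obtains \<phi> :: "nat \<Rightarrow> pt \<Rightarrow> real" where "\<And>n. smooth (\<phi> n)"
    "(\<lambda>n. L2norm (lebesgue_on K) (\<lambda>x. \<phi> n x - w x)) \<longlonglongrightarrow> 0"
    "\<And>i. (\<lambda>n. L2norm (lebesgue_on K) (\<lambda>x. pd i (\<phi> n) x - G x $ i)) \<longlonglongrightarrow> 0"
proof -
  have \<Omega>m: "\<Omega> \<in> sets lebesgue" using \<Omega> by simp
  have Km: "K \<in> sets lebesgue" using K(1) by (simp add: compact_imp_closed)
  obtain \<epsilon> t where p: "\<And>n. \<epsilon> n > 0" "\<epsilon> \<longlonglongrightarrow> 0" "\<And>n. 1/2 \<le> t n" "\<And>n. t n \<le> 1" "t \<longlonglongrightarrow> 1"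
    and c: "\<And>n x. x \<in> K \<Longrightarrow> cball (t n *\<^sub>R x + (1 - t n) *\<^sub>R z) (2 * \<epsilon> n) \<subseteq> \<Omega>"
    using moll_parameters[OF K(1) \<Omega>(1) star] by blast
  have GL: "L2 (lebesgue_on \<Omega>) (\<lambda>x. G x $ i)" for i by (rule L2_vec_nth[OF has_weak_gradD(1)[OF G]])
  show ?thesis
  proof (rule that[of "\<lambda>n. moll \<Omega> (\<epsilon> n) (t n) z w"])
    show "smooth (moll \<Omega> (\<epsilon> n) (t n) z w)" for n by (rule smooth_moll[OF \<Omega>m \<Omega>(2) w p(1)])
    show "(\<lambda>n. L2norm (lebesgue_on K) (\<lambda>x. moll \<Omega> (\<epsilon> n) (t n) z w x - w x)) \<longlonglongrightarrow> 0"
      by (rule moll_L2_tendsto(2)[OF \<Omega> Km K(2) w p])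
    fix i
    have "L2norm (lebesgue_on K) (\<lambda>x. pd i (moll \<Omega> (\<epsilon> n) (t n) z w) x - G x $ i)
        = L2norm (lebesgue_on K) (\<lambda>x. t n * moll \<Omega> (\<epsilon> n) (t n) z (\<lambda>x. G x $ i) x - G x $ i)" for n
    proof (rule L2norm_cong_on)
      fix x assume "x \<in> K"
      then have "cball (t n *\<^sub>R x + (1 - t n) *\<^sub>R z) (\<epsilon> n) \<subseteq> \<Omega>"
        using c[of x n] p(1)[of n] by (auto intro: order.trans)
      from pd_moll[OF \<Omega> w G p(1) this]
      show "pd i (moll \<Omega> (\<epsilon> n) (t n) z w) x - G x $ i = t n * moll \<Omega> (\<epsilon> n) (t n) z (\<lambda>x. G x $ i) x - G x $ i" by simp
    qed
    then show "(\<lambda>n. L2norm (lebesgue_on K) (\<lambda>x. pd i (moll \<Omega> (\<epsilon> n) (t n) z w) x - G x $ i)) \<longlonglongrightarrow> 0"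
      using L2norm_tendsto_scaled[OF L2_subdomain[OF \<Omega>m Km K(2) GL] moll_L2_tendsto(1)[OF \<Omega> Km K(2) GL p]
          moll_L2_tendsto(2)[OF \<Omega> Km K(2) GL p] p(5)] by simp
  qed
qed

text \<open>One sequence serves for the function, uniformly, and for its first and second weak derivatives, in \<open>L2\<close>.\<close>

lemma H2_approx:
  assumes \<Omega>: "open \<Omega>" "bounded \<Omega>" and K: "compact K" "negligible (K - \<Omega>)" "K \<subseteq> closure \<Omega>"
    and star: "\<And>t x. 1/2 \<le> t \<Longrightarrow> t < 1 \<Longrightarrow> x \<in> K \<Longrightarrow> t *\<^sub>R x + (1 - t) *\<^sub>R z \<in> \<Omega>"
    and v: "v \<in> H2 \<Omega>" and vc: "continuous_on (closure \<Omega>) v"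
  obtains \<phi> :: "nat \<Rightarrow> pt \<Rightarrow> real" where "\<And>n. smooth (\<phi> n)" "uniform_limit K \<phi> v sequentially"
    "\<And>i. (\<lambda>n. L2norm (lebesgue_on K) (\<lambda>x. pd i (\<phi> n) x - wgrad \<Omega> v x $ i)) \<longlonglongrightarrow> 0"
    "\<And>i j. (\<lambda>n. L2norm (lebesgue_on K) (\<lambda>x. pd j (pd i (\<phi> n)) x - whess \<Omega> v x $ i $ j)) \<longlonglongrightarrow> 0"
proof -
  have \<Omega>m: "\<Omega> \<in> sets lebesgue" using \<Omega> by simp
  have Km: "K \<in> sets lebesgue" using K(1) by (simp add: compact_imp_closed)
  note vD = H2D[OF v]
  obtain \<epsilon> t where p: "\<And>n. \<epsilon> n > 0" "\<epsilon> \<longlonglongrightarrow> 0" "\<And>n. 1/2 \<le> t n" "\<And>n. t n \<le> 1" "t \<longlonglongrightarrow> 1"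
    and c: "\<And>n x. x \<in> K \<Longrightarrow> cball (t n *\<^sub>R x + (1 - t n) *\<^sub>R z) (2 * \<epsilon> n) \<subseteq> \<Omega>"
    using moll_parameters[OF K(1) \<Omega>(1) star] by blast
  have c1: "cball (t n *\<^sub>R x + (1 - t n) *\<^sub>R z) (\<epsilon> n) \<subseteq> \<Omega>" if "x \<in> K" for n x
    using c[OF that, of n] p(1)[of n] by (auto intro: order.trans)
  have HL: "L2 (lebesgue_on \<Omega>) (\<lambda>x. whess \<Omega> v x $ i $ j)" for i j by (intro L2_vec_nth vD)
  let ?m = "\<lambda>n. moll \<Omega> (\<epsilon> n) (t n) z"
  show ?thesis
  proof (rule that[of "\<lambda>n. ?m n v"])
    show "smooth (?m n v)" for n by (rule smooth_moll[OF \<Omega>m \<Omega>(2) vD(1) p(1)])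
    show "(\<lambda>n. L2norm (lebesgue_on K) (\<lambda>x. pd i (?m n v) x - wgrad \<Omega> v x $ i)) \<longlonglongrightarrow> 0" for i
    proof -
      have "L2norm (lebesgue_on K) (\<lambda>x. pd i (?m n v) x - wgrad \<Omega> v x $ i)
          = L2norm (lebesgue_on K) (\<lambda>x. t n * ?m n (\<lambda>x. wgrad \<Omega> v x $ i) x - wgrad \<Omega> v x $ i)" for n
        by (rule L2norm_cong_on) (simp add: pd_moll[OF \<Omega> vD(1) vD(2) p(1) c1])
      then show ?thesis
        using L2norm_tendsto_scaled[OF L2_subdomain[OF \<Omega>m Km K(2) vD(3)] moll_L2_tendsto(1)[OF \<Omega> Km K(2) vD(3) p]
            moll_L2_tendsto(2)[OF \<Omega> Km K(2) vD(3) p] p(5)] by simp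
    qed
    show "(\<lambda>n. L2norm (lebesgue_on K) (\<lambda>x. pd j (pd i (?m n v)) x - whess \<Omega> v x $ i $ j)) \<longlonglongrightarrow> 0" for i j
    proof -
      have pd2: "pd j (pd i (?m n v)) x = (t n * t n) * ?m n (\<lambda>x. whess \<Omega> v x $ i $ j) x" if x: "x \<in> K" for n x
      proof -
        let ?U = "{y. dist (t n *\<^sub>R y + (1 - t n) *\<^sub>R z) (t n *\<^sub>R x + (1 - t n) *\<^sub>R z) < \<epsilon> n}"
        have s: "smooth (?m n (\<lambda>x. wgrad \<Omega> v x $ i))" by (rule smooth_moll[OF \<Omega>m \<Omega>(2) vD(3) p(1)])
        have "pd j (pd i (?m n v)) x = pd j (\<lambda>y. t n * ?m n (\<lambda>x. wgrad \<Omega> v x $ i) y) x"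
        proof (rule pd_cong_open[of ?U])
          show "open ?U" by (intro open_Collect_less continuous_intros)
          show "x \<in> ?U" using p(1) by simp
          show "(\<lambda>y. t n * ?m n (\<lambda>x. wgrad \<Omega> v x $ i) y) differentiable at x"
            by (intro smooth_differentiable smooth_cmult s)
          fix y assume y: "y \<in> ?U"
          have "cball (t n *\<^sub>R y + (1 - t n) *\<^sub>R z) (\<epsilon> n) \<subseteq> cball (t n *\<^sub>R x + (1 - t n) *\<^sub>R z) (2 * \<epsilon> n)"
          proof
            fix q assume "q \<in> cball (t n *\<^sub>R y + (1 - t n) *\<^sub>R z) (\<epsilon> n)"
            then show "q \<in> cball (t n *\<^sub>R x + (1 - t n) *\<^sub>R z) (2 * \<epsilon> n)"
              using y dist_triangle[of "t n *\<^sub>R x + (1 - t n) *\<^sub>R z" q "t n *\<^sub>R y + (1 - t n) *\<^sub>R z"]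
              unfolding mem_cball mem_Collect_eq
              by (simp only: dist_commute[of "t n *\<^sub>R y + (1 - t n) *\<^sub>R z" "t n *\<^sub>R x + (1 - t n) *\<^sub>R z"])
          qed
          then have "cball (t n *\<^sub>R y + (1 - t n) *\<^sub>R z) (\<epsilon> n) \<subseteq> \<Omega>" using c[OF x, of n] by blast
          then show "pd i (?m n v) y = t n * ?m n (\<lambda>x. wgrad \<Omega> v x $ i) y"
            by (rule pd_moll[OF \<Omega> vD(1) vD(2) p(1)])
        qed
        also have "\<dots> = t n * pd j (?m n (\<lambda>x. wgrad \<Omega> v x $ i)) x"
          by (subst pd_mult) (auto simp: pd_const intro: smooth_differentiable s)
        also have "pd j (?m n (\<lambda>x. wgrad \<Omega> v x $ i)) x = t n * ?m n (\<lambda>x. whess \<Omega> v x $ i $ j) x"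
          by (rule pd_moll[OF \<Omega> vD(3) vD(4) p(1) c1[OF x]])
        finally show ?thesis by simp
      qed
      have "L2norm (lebesgue_on K) (\<lambda>x. pd j (pd i (?m n v)) x - whess \<Omega> v x $ i $ j)
          = L2norm (lebesgue_on K) (\<lambda>x. (t n * t n) * ?m n (\<lambda>x. whess \<Omega> v x $ i $ j) x - whess \<Omega> v x $ i $ j)" for n
        by (rule L2norm_cong_on) (simp add: pd2)
      moreover have "(\<lambda>n. t n * t n) \<longlonglongrightarrow> 1" using tendsto_mult[OF p(5) p(5)] by simp
      ultimately show ?thesis
        using L2norm_tendsto_scaled[OF L2_subdomain[OF \<Omega>m Km K(2) HL] moll_L2_tendsto(1)[OF \<Omega> Km K(2) HL p]
            moll_L2_tendsto(2)[OF \<Omega> Km K(2) HL p], of "\<lambda>n. t n * t n"] by simp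
    qed
    show "uniform_limit K (\<lambda>n. ?m n v) v sequentially"
    proof (rule uniform_limitI)
      fix e :: real assume e: "e > 0"
      have "compact (closure \<Omega>)" using \<Omega>(2) by simp
      then have "uniformly_continuous_on (closure \<Omega>) v" using vc by (intro compact_uniformly_continuous)
      then obtain d where d: "d > 0" "\<And>x y. x \<in> closure \<Omega> \<Longrightarrow> y \<in> closure \<Omega> \<Longrightarrow> dist y x < d \<Longrightarrow> dist (v y) (v x) < e / 2"
        using half_gt_zero[OF e] unfolding uniformly_continuous_on_def by metis
      obtain B where B: "\<And>x. x \<in> K \<Longrightarrow> norm (z - x) \<le> B"
      proof -
        have "compact ((\<lambda>x. z - x) ` K)" by (intro compact_continuous_image K continuous_intros)
        then obtain B where "\<forall>x\<in>K. norm (z - x) \<le> B" by (auto dest!: compact_imp_bounded simp: bounded_iff)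
        then show ?thesis using that by blast
      qed
      have "(\<lambda>n. \<epsilon> n + (1 - t n) * B) \<longlonglongrightarrow> 0 + (1 - 1) * B" by (intro tendsto_intros p)
      then have "\<forall>\<^sub>F n in sequentially. \<epsilon> n + (1 - t n) * B < d" using d by (intro order_tendstoD) auto
      then show "\<forall>\<^sub>F n in sequentially. \<forall>x\<in>K. dist (?m n v x) (v x) < e"
      proof eventually_elim
        case (elim n)
        show ?case
        proof
          fix x assume x: "x \<in> K"
          let ?S = "t n *\<^sub>R x + (1 - t n) *\<^sub>R z"
          have "\<bar>?m n v x - v x\<bar> \<le> e / 2"
            unfolding moll_def
          proof (rule conv_close[OF ext_integrable[OF \<Omega>m \<Omega>(2) vD(1)] p(1)])
            fix y assume y: "dist y ?S \<le> \<epsilon> n"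
            then have y\<Omega>: "y \<in> \<Omega>" using c1[OF x, of n] by (auto simp: dist_commute)
            have "?S - x = (1 - t n) *\<^sub>R (z - x)" by (simp add: algebra_simps)
            then have "dist ?S x = (1 - t n) * norm (z - x)" using p(4)[of n] by (simp add: dist_norm)
            also have "\<dots> \<le> (1 - t n) * B" using p(4)[of n] B[OF x] by (intro mult_left_mono) auto
            finally have "dist y x < d" using y elim dist_triangle[of y x ?S] by linarith
            then have "dist (v y) (v x) < e / 2"
              using d(2)[of x y] x K(3) y\<Omega> closure_subset[of \<Omega>] by blast
            then show "\<bar>indicator \<Omega> y * v y - v x\<bar> \<le> e / 2" using y\<Omega> by (simp add: dist_real_def)
          qed
          then show "dist (?m n v x) (v x) < e" using e by (simp add: dist_real_def)
        qed
      qed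
    qed
  qed
qed

section \<open>Integration by parts on a triangle\<close>

definition cart2 :: "real \<times> real \<Rightarrow> pt" where "cart2 p = vector [fst p, snd p]"

lemma cart2_nth [simp]: "cart2 p $ 1 = fst p" "cart2 p $ 2 = snd p"
  by (auto simp: cart2_def)

lemma cart2_measurable [measurable]: "cart2 \<in> borel_measurable borel"
proof (rule vec_measurable)
  have "(fst :: real \<times> real \<Rightarrow> real) \<in> borel_measurable borel" "(snd :: real \<times> real \<Rightarrow> real) \<in> borel_measurable borel"
    by (intro borel_measurable_continuous_onI continuous_on_fst continuous_on_snd continuous_on_id)+
  then show "(\<lambda>x. cart2 x $ i) \<in> borel_measurable borel" for i using exhaust_2[of i] by auto
qed

lemma Basis_pt: "(Basis :: pt set) = {axis 1 1, axis 2 1}"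
  by (auto simp: Basis_vec_def) (metis exhaust_2)

lemma axis_ne: "axis (1::2) (1::real) \<noteq> axis 2 1"
  by (simp add: axis_eq_axis)

text \<open>Lebesgue measure on the plane as a product measure, so that integrals over the reference triangle can be iterated.\<close>

lemma lborel_pt: "lborel = distr (lborel \<Otimes>\<^sub>M lborel) borel cart2"
proof (rule lborel_eqI)
  fix l u :: pt assume lu: "\<And>b. b \<in> Basis \<Longrightarrow> l \<bullet> b \<le> u \<bullet> b"
  have le: "l $ 1 \<le> u $ 1" "l $ 2 \<le> u $ 2" using lu[of "axis 1 1"] lu[of "axis 2 1"] by (auto simp: Basis_pt inner_axis)
  have pre: "cart2 -` box l u \<inter> space (lborel \<Otimes>\<^sub>M lborel) = box (l $ 1) (u $ 1) \<times> box (l $ 2) (u $ 2)"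
    by (auto simp: mem_box Basis_pt inner_axis space_pair_measure)
  have "emeasure (distr (lborel \<Otimes>\<^sub>M lborel) borel cart2) (box l u)
      = emeasure (lborel \<Otimes>\<^sub>M lborel) (box (l $ 1) (u $ 1) \<times> box (l $ 2) (u $ 2))"
    unfolding pre[symmetric] by (rule emeasure_distr) (auto simp: lborel_prod)
  also have "\<dots> = emeasure lborel (box (l $ 1) (u $ 1)) * emeasure lborel (box (l $ 2) (u $ 2))"
    by (rule lborel.emeasure_pair_measure_Times) auto
  also have "\<dots> = ennreal (\<Prod>b\<in>Basis. (u - l) \<bullet> b)"
    using le by (simp add: emeasure_lborel_box_eq Basis_pt axis_ne inner_axis ennreal_mult)
  finally show "emeasure (distr (lborel \<Otimes>\<^sub>M lborel) borel cart2) (box l u) = ennreal (\<Prod>b\<in>Basis. (u - l) \<bullet> b)" .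
qed simp

lemma integral_pt_iterated:
  fixes f :: "pt \<Rightarrow> real"
  assumes f: "integrable lborel f"
  shows "(LINT x|lborel. f x) = (LINT y|lborel. LINT x|lborel. f (cart2 (x, y)))"
proof -
  have fm: "f \<in> borel_measurable borel" using borel_measurable_integrable[OF f] by simp
  have cm: "cart2 \<in> measurable (lborel \<Otimes>\<^sub>M lborel) borel"
    by (simp add: lborel_prod)
  have i: "integrable (lborel \<Otimes>\<^sub>M lborel) (\<lambda>p. f (cart2 p))"
    using f fm cm by (subst (asm) lborel_pt) (simp add: integrable_distr_eq)
  have "(LINT x|lborel. f x) = (LINT p|(lborel \<Otimes>\<^sub>M lborel). f (cart2 p))"
    using fm cm by (subst lborel_pt) (simp add: integral_distr)
  also have "\<dots> = (LINT p|(lborel \<Otimes>\<^sub>M lborel). (\<lambda>(x, y). f (cart2 (x, y))) p)" by simp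
  also have "\<dots> = (LINT y|lborel. LINT x|lborel. f (cart2 (x, y)))"
    using i by (subst lborel_pair.integral_snd) (auto simp: case_prod_beta')
  finally show ?thesis .
qed

definition ref_triangle :: "pt set" where "ref_triangle = {x. 0 \<le> x $ 1 \<and> 0 \<le> x $ 2 \<and> x $ 1 + x $ 2 \<le> 1}"

lemma compact_ref_triangle: "compact ref_triangle"
proof -
  have "closed ref_triangle" unfolding ref_triangle_def
    by (intro closed_Collect_conj closed_Collect_le continuous_intros)
  moreover have "bounded ref_triangle"
  proof (rule boundedI[of _ 2])
    fix x assume "x \<in> ref_triangle"
    then show "norm x \<le> 2" using norm_pt_le[of x] by (auto simp: ref_triangle_def)
  qed
  ultimately show ?thesis by (simp add: compact_eq_bounded_closed)
qed

definition smean :: "pt \<Rightarrow> pt \<Rightarrow> (pt \<Rightarrow> real) \<Rightarrow> real" where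
  "smean a b f = integral {0..1} (\<lambda>s. f (a + s *\<^sub>R (b - a)))"

lemma lebesgue_on_eq_lborel:
  fixes f :: "pt \<Rightarrow> real"
  assumes "compact K" "continuous_on UNIV f"
  shows "(LINT x|lebesgue_on K. f x) = (LINT x|lborel. indicator K x * f x)"
    "integrable lborel (\<lambda>x. indicator K x * f x)" "integrable (lebesgue_on K) f"
proof -
  have Km: "K \<in> sets borel" using assms(1) by (simp add: compact_imp_closed)
  show i: "integrable lborel (\<lambda>x. indicator K x * f x)"
    using borel_integrable_compact[OF assms(1) continuous_on_subset[OF assms(2)]] by simp
  have fm: "f \<in> borel_measurable borel" using assms(2) by (rule borel_measurable_continuous_onI)
  have m: "(\<lambda>x. indicator K x * f x) \<in> borel_measurable lborel"
    using borel_measurable_integrable[OF i] .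
  show "(LINT x|lebesgue_on K. f x) = (LINT x|lborel. indicator K x * f x)"
    using Km m by (simp add: integral_ext integral_completion)
  show "integrable (lebesgue_on K) f"
    using Km i m by (simp add: integrable_restrict_space integrable_completion)
qed

lemma compact_absolutely_integrable:
  fixes F :: "pt \<Rightarrow> 'b::euclidean_space"
  assumes "compact K" "continuous_on K F"
  shows "F absolutely_integrable_on K"
  unfolding set_integrable_def
  using borel_integrable_compact[OF assms] integrable_completion[OF borel_measurable_integrable] by blast

text \<open>Fubini's theorem and the fundamental theorem of calculus on horizontal sections.\<close>

lemma ref_triangle_ftc:
  assumes F: "\<And>x. F differentiable (at x)" and pc: "continuous_on UNIV (pd 1 F)"
  shows "(LINT x|lebesgue_on ref_triangle. pd 1 F x)
    = integral {0..1} (\<lambda>y. F (vector [1 - y, y]) - F (vector [0, y]))"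
proof -
  let ?T = ref_triangle
  have inner: "(LINT x|lborel. indicator ?T (cart2 (x, y)) * pd 1 F (cart2 (x, y)))
      = indicator {0..1} y * (F (vector [1 - y, y]) - F (vector [0, y]))" for y :: real
  proof (cases "y \<in> {0..1}")
    case True
    have D: "((\<lambda>x. F (cart2 (x, y))) has_real_derivative pd 1 F (cart2 (x, y))) (at x)" for x
    proof -
      have c: "((\<lambda>x. cart2 (x, y)) has_derivative (\<lambda>h. axis 1 h)) (at x)"
      proof -
        have "(\<lambda>x. cart2 (x, y)) = (\<lambda>x. x *\<^sub>R axis 1 1 + cart2 (0, y))"
          by (auto simp: vec_eq_iff forall_2 axis_def)
        moreover have "((\<lambda>x. x *\<^sub>R axis 1 1 + cart2 (0, y)) has_derivative (\<lambda>h. h *\<^sub>R axis 1 1)) (at x)"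
          by (auto intro!: derivative_eq_intros)
        moreover have "(\<lambda>h::real. h *\<^sub>R (axis 1 1 :: pt)) = (\<lambda>h. axis 1 h)"
          by (auto simp: vec_eq_iff axis_def)
        ultimately show ?thesis by simp
      qed
      have "((\<lambda>x. F (cart2 (x, y))) has_derivative (\<lambda>h. \<Sum>i\<in>UNIV. (axis 1 h :: pt) $ i * pd i F (cart2 (x, y)))) (at x)"
        by (rule has_derivative_compose[OF c has_derivative_pd[OF F]])
      then show ?thesis
        by (simp add: has_field_derivative_def sum_2 axis_def mult.commute[of _ "pd 1 F (cart2 (x, y))"])
    qed
    have ind: "indicator ?T (cart2 (x, y)) = (indicator {0..1 - y} x :: real)" for x
      using True by (auto simp: ref_triangle_def indicator_def)
    have cont: "continuous_on S (\<lambda>x. pd 1 F (cart2 (x, y)))" for S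
    proof (rule continuous_on_compose2[OF pc])
      have eq: "(\<lambda>x. cart2 (x, y)) = (\<lambda>x. x *\<^sub>R axis 1 1 + cart2 (0, y))"
        by (auto simp: vec_eq_iff forall_2 axis_def)
      show "continuous_on S (\<lambda>x. cart2 (x, y))" unfolding eq by (intro continuous_intros)
    qed auto
    have "(LINT x|lborel. pd 1 F (cart2 (x, y)) * indicator {0..1 - y} x) = F (cart2 (1 - y, y)) - F (cart2 (0, y))"
      by (rule integral_FTC_Icc_real) (use True D cont in \<open>auto simp: continuous_on_eq_continuous_within\<close>)
    then have "(LINT x|lborel. indicator ?T (cart2 (x, y)) * pd 1 F (cart2 (x, y))) = F (cart2 (1 - y, y)) - F (cart2 (0, y))"
      by (simp only: ind mult.commute)
    then show ?thesis using True by (simp add: cart2_def)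
  next
    case False
    then have "indicator ?T (cart2 (x, y)) = (0::real)" for x by (auto simp: ref_triangle_def indicator_def)
    then show ?thesis using False by simp
  qed
  have c2: "continuous_on S (\<lambda>y. F (vector [1 - y, y]) - F (vector [0, y]))" for S :: "real set"
  proof -
    have e1: "(\<lambda>y. vector [1 - y, y]) = (\<lambda>y. y *\<^sub>R vector [-1, 1] + (vector [1, 0] :: pt))"
      and e2: "(\<lambda>y. vector [0, y]) = (\<lambda>y. y *\<^sub>R (vector [0, 1] :: pt))"
      by (auto simp: vec_eq_iff forall_2)
    have v: "continuous_on S (\<lambda>y. vector [1 - y, y] :: pt)" "continuous_on S (\<lambda>y. vector [0, y] :: pt)"
      subgoal by (subst e1) (intro continuous_intros)
      subgoal by (subst e2) (intro continuous_intros)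
      done
    have Fc: "continuous_on UNIV F"
      using F by (intro continuous_at_imp_continuous_on ballI differentiable_imp_continuous_within)
    show ?thesis
      by (intro continuous_on_diff continuous_on_compose2[OF Fc v(1)] continuous_on_compose2[OF Fc v(2)]) auto
  qed
  have "(LINT x|lebesgue_on ?T. pd 1 F x) = (LINT y|lborel. LINT x|lborel. indicator ?T (cart2 (x, y)) * pd 1 F (cart2 (x, y)))"
    unfolding lebesgue_on_eq_lborel(1)[OF compact_ref_triangle pc]
    by (rule integral_pt_iterated[OF lebesgue_on_eq_lborel(2)[OF compact_ref_triangle pc]])
  also have "\<dots> = (LINT y:{0..1}|lborel. F (vector [1 - y, y]) - F (vector [0, y]))"
    unfolding inner by (simp add: set_lebesgue_integral_def)
  also have "\<dots> = integral {0..1} (\<lambda>y. F (vector [1 - y, y]) - F (vector [0, y]))"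
    by (rule set_borel_integral_eq_integral(2)) (rule borel_integrable_atLeastAtMost'[OF c2])
  finally show ?thesis .
qed

definition tdet :: "pt \<Rightarrow> pt \<Rightarrow> pt \<Rightarrow> real" where
  "tdet a b c = (b $ 1 - a $ 1) * (c $ 2 - a $ 2) - (b $ 2 - a $ 2) * (c $ 1 - a $ 1)"

definition tri_map :: "pt \<Rightarrow> pt \<Rightarrow> pt \<Rightarrow> pt \<Rightarrow> pt" where
  "tri_map a b c x = a + ((x $ 1) *\<^sub>R (b - a) + (x $ 2) *\<^sub>R (c - a))"

lemma tri_map_image: "tri_map a b c ` ref_triangle = convex hull {a, b, c}"
proof -
  have "tri_map a b c ` ref_triangle = {a + u *\<^sub>R (b - a) + v *\<^sub>R (c - a) | u v. 0 \<le> u \<and> 0 \<le> v \<and> u + v \<le> 1}"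
  proof safe
    fix x assume "x \<in> ref_triangle"
    then show "\<exists>u v. tri_map a b c x = a + u *\<^sub>R (b - a) + v *\<^sub>R (c - a) \<and> 0 \<le> u \<and> 0 \<le> v \<and> u + v \<le> 1"
      by (intro exI[of _ "x $ 1"] exI[of _ "x $ 2"]) (auto simp: tri_map_def ref_triangle_def add.assoc)
  next
    fix u v :: real assume "0 \<le> u" "0 \<le> v" "u + v \<le> 1"
    then show "a + u *\<^sub>R (b - a) + v *\<^sub>R (c - a) \<in> tri_map a b c ` ref_triangle"
      by (intro image_eqI[of _ _ "vector [u, v]"]) (auto simp: tri_map_def ref_triangle_def add.assoc)
  qed
  then show ?thesis by (simp add: convex_hull_3_alt)
qed

lemma tri_map_inj: assumes "tdet a b c \<noteq> 0" shows "inj_on (tri_map a b c) S"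
proof (rule inj_onI)
  fix x y assume "tri_map a b c x = tri_map a b c y"
  then have e: "(x $ 1 - y $ 1) * (b $ i - a $ i) + (x $ 2 - y $ 2) * (c $ i - a $ i) = 0" for i
    by (simp add: tri_map_def vec_eq_iff) (simp add: algebra_simps)
  have "(x $ 1 - y $ 1) * tdet a b c = 0"
    using e[of 1] e[of 2] unfolding tdet_def by algebra
  moreover have "(x $ 2 - y $ 2) * tdet a b c = 0"
    using e[of 1] e[of 2] unfolding tdet_def by algebra
  ultimately show "x = y" using assms by (simp add: vec_eq_iff forall_2)
qed

lemma tri_map_derivative:
  "(tri_map a b c has_derivative (\<lambda>h. (h $ 1) *\<^sub>R (b - a) + (h $ 2) *\<^sub>R (c - a))) (at x within S)"
  unfolding tri_map_def[abs_def]
  by (auto intro!: derivative_eq_intros bounded_linear_imp_has_derivative bounded_linear_vec_nth)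

lemma tri_change_of_variables:
  fixes f :: "pt \<Rightarrow> real"
  assumes D: "tdet a b c \<noteq> 0" and f: "continuous_on UNIV f"
  shows "(LINT x|lebesgue_on (convex hull {a, b, c}). f x)
    = \<bar>tdet a b c\<bar> * (LINT x|lebesgue_on ref_triangle. f (tri_map a b c x))"
proof -
  let ?K = "convex hull {a, b, c}" and ?T = ref_triangle and ?g = "tri_map a b c"
  let ?g' = "\<lambda>h. (h $ 1) *\<^sub>R (b - a) + (h $ 2) *\<^sub>R (c - a)"
  have K: "compact ?K" by (intro compact_convex_hull) auto
  have gc: "continuous_on UNIV ?g" unfolding tri_map_def[abs_def] by (intro continuous_intros)
  have fg: "continuous_on UNIV (\<lambda>x. f (?g x))" by (rule continuous_on_compose2[OF f gc]) auto
  have det: "det (matrix ?g') = tdet a b c"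
    by (simp add: det_2 matrix_def tdet_def axis_def algebra_simps)
  define F where "F = (\<lambda>x. vec (f x) :: real^1)"
  have Fc: "continuous_on S F" for S
    unfolding F_def vec_def by (intro continuous_on_vec_lambda continuous_on_subset[OF f]) auto
  have Fabs: "F absolutely_integrable_on (?g ` ?T)"
    unfolding tri_map_image by (rule compact_absolutely_integrable[OF K Fc])
  have T: "?T \<in> sets lebesgue" using compact_ref_triangle by (simp add: compact_imp_closed)
  have Km: "?K \<in> sets lebesgue" using K by (simp add: compact_imp_closed)
  have "integral (?g ` ?T) F = integral ?T (\<lambda>x. \<bar>det (matrix ?g')\<bar> *\<^sub>R F (?g x))"
    using integral_change_of_variables[OF T tri_map_derivative tri_map_inj[OF D]] Fabs by blast
  then have "integral ?K F $ 1 = (\<bar>tdet a b c\<bar> *\<^sub>R integral ?T (\<lambda>x. F (?g x))) $ 1"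
    unfolding tri_map_image det by simp
  moreover have "integral ?K F $ 1 = integral ?K f"
  proof -
    have "F integrable_on ?K" using Fabs unfolding tri_map_image by (rule set_lebesgue_integral_eq_integral(1))
    from integral_component_eq_cart[OF this, of 1] show ?thesis by (simp add: F_def)
  qed
  moreover have "integral ?T (\<lambda>x. F (?g x)) $ 1 = integral ?T (\<lambda>x. f (?g x))"
  proof -
    have "continuous_on ?T (\<lambda>x. F (?g x))"
      by (rule continuous_on_compose2[OF Fc[of UNIV] continuous_on_subset[OF gc]]) auto
    from compact_absolutely_integrable[OF compact_ref_triangle this]
    have "(\<lambda>x. F (?g x)) integrable_on ?T" by (rule set_lebesgue_integral_eq_integral(1))
    from integral_component_eq_cart[OF this, of 1] show ?thesis by (simp add: F_def)
  qed
  moreover have "(LINT x|lebesgue_on ?K. f x) = integral ?K f"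
    by (rule lebesgue_integral_eq_integral[OF lebesgue_on_eq_lborel(3)[OF K f] Km])
  moreover have "(LINT x|lebesgue_on ?T. f (?g x)) = integral ?T (\<lambda>x. f (?g x))"
    by (rule lebesgue_integral_eq_integral[OF lebesgue_on_eq_lborel(3)[OF compact_ref_triangle fg] T])
  ultimately show ?thesis by simp
qed

section \<open>Means over edges and the divergence theorem\<close>

lemma continuous_segment_map: "continuous_on UNIV (f :: pt \<Rightarrow> real) \<Longrightarrow> continuous_on S (\<lambda>s::real. f (a + s *\<^sub>R (b - a)))"
  by (rule continuous_on_compose2[of UNIV f]) (auto intro!: continuous_intros)

lemma smean_integrable: "continuous_on UNIV (f :: pt \<Rightarrow> real) \<Longrightarrow> (\<lambda>s. f (a + s *\<^sub>R (b - a))) integrable_on {0..1::real}"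
  by (intro integrable_continuous_real continuous_segment_map)

lemma smean_add: "continuous_on UNIV f \<Longrightarrow> continuous_on UNIV g \<Longrightarrow> smean a b (\<lambda>x. f x + g x) = smean a b f + smean a b g"
  unfolding smean_def by (intro integral_add smean_integrable)

lemma smean_cmult: "smean a b (\<lambda>x. c * f x) = c * smean a b f"
  unfolding smean_def by simp

lemma smean_mono: "continuous_on UNIV f \<Longrightarrow> continuous_on UNIV g \<Longrightarrow> (\<And>x. f x \<le> g x) \<Longrightarrow> smean a b f \<le> smean a b g"
  unfolding smean_def by (intro integral_le smean_integrable)

lemma smean_nonneg: "continuous_on UNIV f \<Longrightarrow> (\<And>x. 0 \<le> f x) \<Longrightarrow> 0 \<le> smean a b f"
  unfolding smean_def by (intro integral_nonneg smean_integrable)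

lemma arc_smean:
  assumes "a \<noteq> b" "continuous_on UNIV f"
  shows "(LINT x|arc (closed_segment a b). f x) = dist a b * smean a b f"
  unfolding smean_def
  by (intro arc_integral(1) assms(1) borel_measurable_continuous_onI assms(2) continuous_on_subset[OF assms(2)]) auto

lemma smean_commute: "continuous_on UNIV f \<Longrightarrow> smean a b f = smean b a f"
proof (cases "a = b")
  case False
  assume f: "continuous_on UNIV f"
  have "dist a b * smean a b f = dist b a * smean b a f"
    using arc_smean[OF False f] arc_smean[OF False[symmetric] f] by (simp add: closed_segment_commute)
  then show ?thesis using False by (simp add: dist_commute)
qed simp

text \<open>The formula on the reference triangle, transported by the affine map: the direction \<open>b - a\<close> corresponds to the
  first coordinate direction, which is parallel to the edge from \<open>a\<close> to \<open>b\<close>.\<close>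

lemma tri_div_dir:
  assumes D: "tdet a b c \<noteq> 0" and f: "smooth f"
  shows "(LINT x|lebesgue_on (convex hull {a, b, c}). (\<Sum>i\<in>UNIV. (b - a) $ i * pd i f x))
      = \<bar>tdet a b c\<bar> * (smean b c f - smean a c f)"
proof -
  let ?g = "tri_map a b c"
  let ?F = "\<lambda>x. f (?g x)"
  have DF: "(?F has_derivative (\<lambda>h. \<Sum>i\<in>UNIV. ((h $ 1) *\<^sub>R (b - a) + (h $ 2) *\<^sub>R (c - a)) $ i * pd i f (?g x))) (at x)" for x
    by (rule has_derivative_compose[OF tri_map_derivative smooth_derivative[OF f]])
  have pdF: "pd 1 ?F x = (\<Sum>i\<in>UNIV. (b - a) $ i * pd i f (?g x))" for x
    using pd_eqI[OF DF, of 1] by (simp add: axis_def)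
  have gc: "continuous_on UNIV ?g" unfolding tri_map_def[abs_def] by (intro continuous_intros)
  have dc: "continuous_on UNIV (\<lambda>x. \<Sum>i\<in>UNIV. (b - a) $ i * pd i f x)"
    by (intro continuous_intros smooth_continuous smooth_pd f)
  have "(LINT x|lebesgue_on (convex hull {a, b, c}). (\<Sum>i\<in>UNIV. (b - a) $ i * pd i f x))
     = \<bar>tdet a b c\<bar> * (LINT x|lebesgue_on ref_triangle. pd 1 ?F x)"
    unfolding pdF by (rule tri_change_of_variables[OF D dc])
  also have "(LINT x|lebesgue_on ref_triangle. pd 1 ?F x) = integral {0..1} (\<lambda>y. ?F (vector [1 - y, y]) - ?F (vector [0, y]))"
  proof (rule ref_triangle_ftc)
    show "?F differentiable at x" for x using DF by (auto simp: differentiable_def)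
    have "continuous_on UNIV (\<lambda>x. \<Sum>i\<in>UNIV. (b - a) $ i * pd i f (?g x))"
      by (rule continuous_on_compose2[OF dc gc]) auto
    then show "continuous_on UNIV (pd 1 ?F)" by (simp add: pdF[abs_def])
  qed
  also have "(\<lambda>y. ?F (vector [1 - y, y]) - ?F (vector [0, y])) = (\<lambda>y. f (b + y *\<^sub>R (c - b)) - f (a + y *\<^sub>R (c - a)))"
    by (auto simp: tri_map_def algebra_simps fun_eq_iff)
  also have "integral {0..1} \<dots> = smean b c f - smean a c f"
    unfolding smean_def by (intro integral_diff smean_integrable smooth_continuous f)
  finally show ?thesis .
qed

lemma tri_integrable:
  "continuous_on UNIV f \<Longrightarrow> integrable (lebesgue_on (convex hull {a, b, c :: pt})) (f :: pt \<Rightarrow> real)"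
  by (intro lebesgue_on_eq_lborel(3) compact_convex_hull) auto

text \<open>The divergence theorem; \<open>- sgn (tdet a b c) rot (c - b)\<close> is the outer normal of the edge from \<open>b\<close> to \<open>c\<close>
  scaled by the length of the edge.\<close>

lemma tri_divergence:
  assumes D: "tdet a b c \<noteq> 0" and f: "smooth f"
  shows "(LINT x|lebesgue_on (convex hull {a, b, c}). pd i f x)
     = - sgn (tdet a b c) * (rot (c - b) $ i * smean b c f + rot (a - c) $ i * smean c a f + rot (b - a) $ i * smean a b f)"
proof -
  let ?M = "lebesgue_on (convex hull {a, b, c})"
  have int: "integrable ?M (pd i f)" for i by (intro tri_integrable smooth_continuous smooth_pd f)
  define X1 where "X1 = (LINT x|?M. pd 1 f x)"
  define X2 where "X2 = (LINT x|?M. pd 2 f x)"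
  define m1 where "m1 = smean b c f" define m2 where "m2 = smean c a f" define m3 where "m3 = smean a b f"
  define D where "D = tdet a b c"
  have D0: "D \<noteq> 0" using assms(1) by (simp add: D_def)
  have comm: "convex hull {a, c, b} = convex hull {a, b, c}" by (simp add: insert_commute)
  have Dc: "tdet a c b = - D" by (simp add: D_def tdet_def)
  have sc: "smean a c f = m2" "smean c b f = m1"
    by (auto simp: m1_def m2_def intro!: smean_commute smooth_continuous f)
  have e1: "(b - a) $ 1 * X1 + (b - a) $ 2 * X2 = \<bar>D\<bar> * (m1 - m2)"
    using tri_div_dir[OF assms] int by (simp add: sum_2 X1_def X2_def m1_def sc D_def)
  have e2: "(c - a) $ 1 * X1 + (c - a) $ 2 * X2 = \<bar>D\<bar> * (m1 - m3)"
    using tri_div_dir[of a c b f] int D0 f by (simp add: sum_2 X1_def X2_def comm Dc sc m3_def)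
  have Dd: "D = (b $ 1 - a $ 1) * (c $ 2 - a $ 2) - (b $ 2 - a $ 2) * (c $ 1 - a $ 1)" by (simp add: D_def tdet_def)
  have sg: "\<bar>D\<bar> = sgn D * D" by (simp add: abs_sgn)
  have "D * X1 = D * (sgn D * ((c $ 2 - a $ 2) * (m1 - m2) - (b $ 2 - a $ 2) * (m1 - m3)))"
    using e1 e2 unfolding sg by (simp add: Dd) algebra
  then have x1: "X1 = sgn D * ((c $ 2 - a $ 2) * (m1 - m2) - (b $ 2 - a $ 2) * (m1 - m3))" using D0 by simp
  have "D * X2 = D * (sgn D * ((b $ 1 - a $ 1) * (m1 - m3) - (c $ 1 - a $ 1) * (m1 - m2)))"
    using e1 e2 unfolding sg by (simp add: Dd) algebra
  then have x2: "X2 = sgn D * ((b $ 1 - a $ 1) * (m1 - m3) - (c $ 1 - a $ 1) * (m1 - m2))" using D0 by simp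
  consider "i = 1" | "i = 2" using exhaust_2 by blast
  then show ?thesis
  proof cases
    case 1
    show ?thesis unfolding 1 X1_def[symmetric] x1 D_def[symmetric] m1_def[symmetric] m2_def[symmetric] m3_def[symmetric]
      by (simp add: rot_def algebra_simps)
  next
    case 2
    show ?thesis unfolding 2 X2_def[symmetric] x2 D_def[symmetric] m1_def[symmetric] m2_def[symmetric] m3_def[symmetric]
      by (simp add: rot_def algebra_simps)
  qed
qed

text \<open>The field \<open>x - a\<close> is tangential on the two edges through \<open>a\<close> and has constant normal component on the
  opposite edge, so the divergence theorem expresses the mean over that edge alone by volume integrals.\<close>

lemma tri_trace:
  assumes D: "tdet a b c \<noteq> 0" and f: "smooth f"
  shows "\<bar>tdet a b c\<bar> * smean b c f
    = (LINT x|lebesgue_on (convex hull {a, b, c}). (\<Sum>i\<in>UNIV. (x - a) $ i * pd i f x) + 2 * f x)"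
proof -
  define D where "D = tdet a b c"
  have D0: "D \<noteq> 0" using D by (simp add: D_def)
  have Dd: "D = (b $ 1 - a $ 1) * (c $ 2 - a $ 2) - (b $ 2 - a $ 2) * (c $ 1 - a $ 1)" by (simp add: D_def tdet_def)
  define p where "p = (\<lambda>x::pt. ((x $ 1 - a $ 1) * (c $ 2 - a $ 2) - (x $ 2 - a $ 2) * (c $ 1 - a $ 1)) / D)"
  define q where "q = (\<lambda>x::pt. ((b $ 1 - a $ 1) * (x $ 2 - a $ 2) - (b $ 2 - a $ 2) * (x $ 1 - a $ 1)) / D)"
  have p: "smooth p" and q: "smooth q"
    unfolding p_def q_def divide_inverse
    by (intro smooth_mult smooth_diff smooth_const smooth_coord)+
  have dp: "(p has_derivative (\<lambda>h. (h $ 1 * (c $ 2 - a $ 2) - h $ 2 * (c $ 1 - a $ 1)) / D)) (at x)"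
    and dq: "(q has_derivative (\<lambda>h. ((b $ 1 - a $ 1) * h $ 2 - (b $ 2 - a $ 2) * h $ 1) / D)) (at x)" for x
    unfolding p_def q_def divide_inverse
    by (auto intro!: derivative_eq_intros bounded_linear_imp_has_derivative bounded_linear_vec_nth)
  have pdp: "pd 1 p x = (c $ 2 - a $ 2) / D" "pd 2 p x = - (c $ 1 - a $ 1) / D"
    and pdq: "pd 1 q x = - (b $ 2 - a $ 2) / D" "pd 2 q x = (b $ 1 - a $ 1) / D" for x
    using pd_eqI[OF dp[of x]] pd_eqI[OF dq[of x]] by (simp_all add: axis_def)
  note df = smooth_differentiable[OF f] smooth_differentiable[OF p] smooth_differentiable[OF q]
  let ?M = "lebesgue_on (convex hull {a, b, c})"
  have comm: "convex hull {a, c, b} = convex hull {a, b, c}" by (simp add: insert_commute)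
  have Dc: "tdet a c b = - D" by (simp add: D_def tdet_def)
  have sp: "smooth (\<lambda>x. f x * p x)" and sq: "smooth (\<lambda>x. f x * q x)" by (intro smooth_mult f p q)+
  have p0: "p (a + s *\<^sub>R (c - a)) = 0" and q0: "q (a + s *\<^sub>R (b - a)) = 0" for s
    by (auto simp: p_def q_def algebra_simps)
  have pq1: "p (b + s *\<^sub>R (c - b)) + q (b + s *\<^sub>R (c - b)) = 1" for s
  proof -
    have "p (b + s *\<^sub>R (c - b)) + q (b + s *\<^sub>R (c - b)) = D / D"
      unfolding p_def q_def by (simp add: add_divide_distrib[symmetric] Dd algebra_simps)
    then show ?thesis using D0 by simp
  qed
  have z: "smean a c (\<lambda>x. f x * p x) = 0" "smean a b (\<lambda>x. f x * q x) = 0"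
    unfolding smean_def by (simp_all add: p0 q0)
  have P: "(LINT x|?M. (\<Sum>i\<in>UNIV. (b - a) $ i * pd i (\<lambda>x. f x * p x) x)) = \<bar>D\<bar> * smean b c (\<lambda>x. f x * p x)"
    using tri_div_dir[OF D sp] by (simp add: z D_def)
  have Q: "(LINT x|?M. (\<Sum>i\<in>UNIV. (c - a) $ i * pd i (\<lambda>x. f x * q x) x)) = \<bar>D\<bar> * smean b c (\<lambda>x. f x * q x)"
    using tri_div_dir[of a c b, OF _ sq] D0
    by (simp add: z Dc comm smean_commute[of _ c b] smooth_continuous[OF sq])
  have "smean b c (\<lambda>x. f x * p x) + smean b c (\<lambda>x. f x * q x) = smean b c (\<lambda>x. f x * p x + f x * q x)"
    by (intro smean_add[symmetric] smooth_continuous sp sq)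
  also have "\<dots> = smean b c f"
    unfolding smean_def by (intro integral_cong) (simp add: distrib_left[symmetric] pq1)
  finally have "\<bar>D\<bar> * smean b c f = (LINT x|?M. (\<Sum>i\<in>UNIV. (b - a) $ i * pd i (\<lambda>x. f x * p x) x))
      + (LINT x|?M. (\<Sum>i\<in>UNIV. (c - a) $ i * pd i (\<lambda>x. f x * q x) x))"
    unfolding P Q by (simp add: distrib_left[symmetric])
  also have "\<dots> = (LINT x|?M. (\<Sum>i\<in>UNIV. (b - a) $ i * pd i (\<lambda>x. f x * p x) x) + (\<Sum>i\<in>UNIV. (c - a) $ i * pd i (\<lambda>x. f x * q x) x))"
    by (intro Bochner_Integration.integral_add[symmetric] tri_integrable continuous_intros smooth_continuous smooth_pd sp sq)
  also have "\<dots> = (LINT x|?M. (\<Sum>i\<in>UNIV. (x - a) $ i * pd i f x) + 2 * f x)"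
  proof (intro Bochner_Integration.integral_cong refl)
    fix x
    define F1 where "F1 = pd 1 f x" define F2 where "F2 = pd 2 f x" define F where "F = f x"
    define iD where "iD = inverse D"
    have DiD: "D * iD = 1" using D0 by (simp add: iD_def)
    have "((b $ 1 - a $ 1) * (F * ((c $ 2 - a $ 2) / D) + F1 * p x) + (b $ 2 - a $ 2) * (F * (- (c $ 1 - a $ 1) / D) + F2 * p x))
      + ((c $ 1 - a $ 1) * (F * (- (b $ 2 - a $ 2) / D) + F1 * q x) + (c $ 2 - a $ 2) * (F * ((b $ 1 - a $ 1) / D) + F2 * q x))
      = F * (2 * (D * iD)) + F1 * ((b $ 1 - a $ 1) * p x + (c $ 1 - a $ 1) * q x) + F2 * ((b $ 2 - a $ 2) * p x + (c $ 2 - a $ 2) * q x)"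
      unfolding divide_inverse iD_def[symmetric] unfolding Dd by (simp add: algebra_simps)
    also note DiD
    also have "(b $ 1 - a $ 1) * p x + (c $ 1 - a $ 1) * q x = (x $ 1 - a $ 1) * (D * iD)"
      unfolding p_def q_def divide_inverse iD_def[symmetric] unfolding Dd by (simp add: algebra_simps)
    also note DiD
    also have "(b $ 2 - a $ 2) * p x + (c $ 2 - a $ 2) * q x = (x $ 2 - a $ 2) * (D * iD)"
      unfolding p_def q_def divide_inverse iD_def[symmetric] unfolding Dd by (simp add: algebra_simps)
    also note DiD
    finally have fin: "((b $ 1 - a $ 1) * (F * ((c $ 2 - a $ 2) / D) + F1 * p x) + (b $ 2 - a $ 2) * (F * (- (c $ 1 - a $ 1) / D) + F2 * p x))
      + ((c $ 1 - a $ 1) * (F * (- (b $ 2 - a $ 2) / D) + F1 * q x) + (c $ 2 - a $ 2) * (F * ((b $ 1 - a $ 1) / D) + F2 * q x))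
      = F * (2 * 1) + F1 * ((x $ 1 - a $ 1) * 1) + F2 * ((x $ 2 - a $ 2) * 1)" .
    have "(\<Sum>i\<in>UNIV. (b - a) $ i * pd i (\<lambda>x. f x * p x) x) + (\<Sum>i\<in>UNIV. (c - a) $ i * pd i (\<lambda>x. f x * q x) x)
      = F * (2 * 1) + F1 * ((x $ 1 - a $ 1) * 1) + F2 * ((x $ 2 - a $ 2) * 1)"
      unfolding fin[symmetric] unfolding sum_2 vector_minus_component pd_mult[OF df(1) df(2)] pd_mult[OF df(1) df(3)] pdp pdq F1_def F2_def F_def ..
    also have "\<dots> = (\<Sum>i\<in>UNIV. (x - a) $ i * pd i f x) + 2 * f x"
      by (simp add: sum_2 F1_def F2_def F_def mult.commute)
    finally show "(\<Sum>i\<in>UNIV. (b - a) $ i * pd i (\<lambda>x. f x * p x) x) + (\<Sum>i\<in>UNIV. (c - a) $ i * pd i (\<lambda>x. f x * q x) x)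
       = (\<Sum>i\<in>UNIV. (x - a) $ i * pd i f x) + 2 * f x" .
  qed
  finally show ?thesis by (simp add: D_def)
qed

section \<open>Shape-regular triangles\<close>

definition nice_tri :: "real \<Rightarrow> pt \<Rightarrow> pt \<Rightarrow> pt \<Rightarrow> bool" where
  "nice_tri \<kappa> a b c \<longleftrightarrow> tdet a b c \<noteq> 0 \<and> (\<exists>z r. r > 0 \<and> cball z r \<subseteq> convex hull {a, b, c} \<and>
     diameter (convex hull {a, b, c}) \<le> \<kappa> * r)"

lemma tdet_rotate: "tdet b c a = tdet a b c" by (simp add: tdet_def algebra_simps)
lemma nice_tri_rotate: "nice_tri \<kappa> a b c \<Longrightarrow> nice_tri \<kappa> b c a"
  unfolding nice_tri_def using tdet_rotate[of b c a] by (simp add: insert_commute)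

lemma norm_rot: "norm (rot x) = norm x"
proof -
  have "(norm (rot x))\<^sup>2 = (norm x)\<^sup>2" unfolding norm_pt_sq by (simp add: rot_def)
  then show ?thesis by simp
qed

lemma tdet_barycentric: "tdet (a + u *\<^sub>R (b - a) + v *\<^sub>R (c - a)) b c = (1 - u - v) * tdet a b c"
  by (simp add: tdet_def algebra_simps)

text \<open>The ball has width \<open>2 r\<close> in the direction normal to the edge from \<open>b\<close> to \<open>c\<close>, which is at most the height of the
  triangle over that edge; \<open>tdet\<close> is twice the signed area.\<close>

lemma inball_tdet:
  assumes D: "tdet a b c \<noteq> 0" and r: "r > 0" "cball z r \<subseteq> convex hull {a, b, c}"
  shows "2 * r * dist b c \<le> \<bar>tdet a b c\<bar>"
proof (cases "b = c")
  case False
  define n where "n = rot (c - b) /\<^sub>R dist b c"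
  have l: "dist b c > 0" using False by simp
  have nn: "norm n = 1" using l by (simp add: n_def norm_rot dist_norm norm_minus_commute)
  have "z + r *\<^sub>R n \<in> convex hull {a, b, c}" "z - r *\<^sub>R n \<in> convex hull {a, b, c}"
    using r nn by (auto simp: subset_iff dist_norm)
  moreover have "\<exists>t. tdet x b c = t * tdet a b c \<and> 0 \<le> t \<and> t \<le> 1" if x: "x \<in> convex hull {a, b, c}" for x
  proof -
    obtain u v where "x = a + u *\<^sub>R (b - a) + v *\<^sub>R (c - a)" "0 \<le> u" "0 \<le> v" "u + v \<le> 1"
      using x unfolding convex_hull_3_alt by blast
    then show ?thesis using tdet_barycentric by (intro exI[of _ "1 - u - v"]) auto
  qed
  ultimately obtain t t' where t: "tdet (z + r *\<^sub>R n) b c = t * tdet a b c" "0 \<le> t" "t \<le> 1"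
    "tdet (z - r *\<^sub>R n) b c = t' * tdet a b c" "0 \<le> t'" "t' \<le> 1" by metis
  have "tdet (z + r *\<^sub>R n) b c - tdet (z - r *\<^sub>R n) b c = 2 * r * (n $ 1 * (b $ 2 - c $ 2) - n $ 2 * (b $ 1 - c $ 1))"
    by (simp add: tdet_def algebra_simps)
  also have "\<dots> = 2 * r * (((b $ 1 - c $ 1)\<^sup>2 + (b $ 2 - c $ 2)\<^sup>2) / dist b c)"
    by (simp add: n_def rot_def divide_inverse power2_eq_square algebra_simps)
  also have "\<dots> = 2 * r * dist b c"
  proof -
    have "(b $ 1 - c $ 1)\<^sup>2 + (b $ 2 - c $ 2)\<^sup>2 = (dist b c)\<^sup>2" by (simp add: dist_norm norm_pt_sq)
    then show ?thesis using l by (simp add: power2_eq_square)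
  qed
  finally have "2 * r * dist b c = (t - t') * tdet a b c" using t by (simp add: algebra_simps)
  also have "\<dots> \<le> \<bar>t - t'\<bar> * \<bar>tdet a b c\<bar>" by (simp add: abs_mult[symmetric])
  also have "\<dots> \<le> 1 * \<bar>tdet a b c\<bar>" using t by (intro mult_right_mono) auto
  finally show ?thesis by simp
qed simp

lemma tdet_le: "\<bar>tdet a b c\<bar> \<le> dist a b * dist a c"
proof -
  have "tdet a b c = rot (b - a) \<bullet> (c - a)"
    by (simp add: tdet_def rot_def inner_vec_def sum_2 algebra_simps)
  then show ?thesis
    using Cauchy_Schwarz_ineq2[of "rot (b - a)" "c - a"] by (simp add: norm_rot dist_norm norm_minus_commute)
qed

text \<open>For a shape-regular triangle every edge is comparable to the diameter.\<close>

lemma nice_triD: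
  assumes "nice_tri \<kappa> a b c"
  defines "h \<equiv> diameter (convex hull {a, b, c})"
  shows "tdet a b c \<noteq> 0" "b \<noteq> c" "h > 0" "dist b c \<le> h" "h * dist b c \<le> \<kappa> / 2 * \<bar>tdet a b c\<bar>"
    "2 * h \<le> \<kappa> * dist b c" "\<And>x. x \<in> convex hull {a, b, c} \<Longrightarrow> norm (x - a) \<le> h" "2 \<le> \<kappa>"
proof -
  let ?K = "convex hull {a, b, c}"
  show D: "tdet a b c \<noteq> 0" using assms by (simp add: nice_tri_def)
  obtain z r where r: "r > 0" "cball z r \<subseteq> ?K" "h \<le> \<kappa> * r" using assms by (auto simp: nice_tri_def)
  have ne: "b \<noteq> c" "a \<noteq> c" using D by (auto simp: tdet_def)
  show "b \<noteq> c" by (rule ne)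
  have bd: "bounded ?K" by (intro bounded_convex_hull) auto
  have in_K: "a \<in> ?K" "b \<in> ?K" "c \<in> ?K" by (auto intro: hull_inc)
  show l: "dist b c \<le> h" unfolding h_def by (rule diameter_bounded_bound[OF bd in_K(2,3)])
  then show h: "h > 0" using ne by (metis dist_pos_lt less_le_trans)
  show "norm (x - a) \<le> h" if "x \<in> ?K" for x
    using diameter_bounded_bound[OF bd that in_K(1)] by (simp add: h_def dist_norm)
  note i = inball_tdet[OF D r(1,2)]
  have \<kappa>: "\<kappa> > 0" using h r by (metis less_le_trans zero_less_mult_pos2)
  have "h * dist b c \<le> \<kappa> * r * dist b c" using r(3) by (intro mult_right_mono) auto
  also have "\<dots> = \<kappa> / 2 * (2 * r * dist b c)" by simp
  also have "\<dots> \<le> \<kappa> / 2 * \<bar>tdet a b c\<bar>" using i \<kappa> by (intro mult_left_mono) auto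
  finally show "h * dist b c \<le> \<kappa> / 2 * \<bar>tdet a b c\<bar>" .
  have "2 * r * dist c a \<le> \<bar>tdet a b c\<bar>"
    using inball_tdet[of b c a r z] D r(1,2) by (simp add: tdet_rotate insert_commute)
  also have "\<dots> \<le> dist c a * dist c b" using tdet_le[of c a b] by (simp add: tdet_rotate)
  finally have rl: "2 * r \<le> dist b c" using ne by (simp add: mult.commute dist_commute)
  have "2 * h \<le> \<kappa> * (2 * r)" using r(3) by simp
  also have "\<dots> \<le> \<kappa> * dist b c" using rl \<kappa> by (intro mult_left_mono) auto
  finally show "2 * h \<le> \<kappa> * dist b c" .
  have "2 * r \<le> \<kappa> * r" using rl l r(3) by linarith
  then show "2 \<le> \<kappa>" using r(1) by simp
qed

section \<open>Trace and interpolation inequalities\<close>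

definition K3 :: "pt \<Rightarrow> pt \<Rightarrow> pt \<Rightarrow> pt set" where "K3 a b c = convex hull {a, b, c}"

lemma K3_rotate: "K3 b c a = K3 a b c" by (simp add: K3_def insert_commute)

lemma K3_facts: "compact (K3 a b c)" "a \<in> K3 a b c" "b \<in> K3 a b c" "c \<in> K3 a b c" "K3 a b c \<in> sets lebesgue"
  "closed_segment b c \<subseteq> K3 a b c"
proof -
  show k: "compact (K3 a b c)" unfolding K3_def by (intro compact_convex_hull) auto
  then show "K3 a b c \<in> sets lebesgue" by (simp add: compact_imp_closed)
  show ab: "a \<in> K3 a b c" "b \<in> K3 a b c" "c \<in> K3 a b c" by (auto simp: K3_def intro: hull_inc)
  show "closed_segment b c \<subseteq> K3 a b c"
    using closed_segment_subset[OF ab(2,3)] by (simp add: K3_def)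
qed

lemma K3_integrable: "continuous_on UNIV f \<Longrightarrow> integrable (lebesgue_on (K3 a b c)) (f :: pt \<Rightarrow> real)"
  unfolding K3_def by (rule tri_integrable)

lemma young: "0 < e \<Longrightarrow> 2 * (x * y) \<le> x\<^sup>2 / e + e * (y :: real)\<^sup>2"
proof -
  assume e: "0 < e"
  have "0 \<le> (x - e * y)\<^sup>2 / e" using e by simp
  also have "\<dots> = x\<^sup>2 / e + e * y\<^sup>2 - 2 * (x * y)" using e by (simp add: power2_eq_square field_simps)
  finally show ?thesis by simp
qed

lemma cs_pt: "(\<Sum>i\<in>UNIV. (u::pt) $ i * g i) \<le> norm u * sqrt (\<Sum>i\<in>UNIV. (g i)\<^sup>2)"
  using sum_mult_le_sqrt[of "\<lambda>i. u $ i" g UNIV] by (simp add: norm_vec_def L2_set_def)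

abbreviation "gsq w x \<equiv> (\<Sum>i\<in>(UNIV::2 set). (pd i w x)\<^sup>2)"
abbreviation "hsq w x \<equiv> (\<Sum>i\<in>(UNIV::2 set). gsq (pd i w) x)"

lemma smooth_gsq: "smooth w \<Longrightarrow> smooth (\<lambda>x. gsq w x)"
  by (intro smooth_sum smooth_power smooth_pd)

text \<open>The trace formula applied to \<open>w\<^sup>2\<close>; Young's inequality with parameter \<open>s\<close> separates \<open>w\<close> from its gradient.\<close>

lemma trace_inequality:
  assumes T: "nice_tri \<kappa> a b c" and w: "smooth w" and s: "s > 0"
  defines "h \<equiv> diameter (K3 a b c)"
  shows "dist b c * smean b c (\<lambda>x. (w x)\<^sup>2) \<le> \<kappa> * ((1 + 1 / (2 * s)) / h * (LINT x|lebesgue_on (K3 a b c). (w x)\<^sup>2)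
           + s / 2 * h * (LINT x|lebesgue_on (K3 a b c). gsq w x))"
proof -
  let ?M = "lebesgue_on (K3 a b c)"
  note TD = nice_triD[OF T, folded K3_def h_def]
  define N0 where "N0 = (LINT x|?M. (w x)\<^sup>2)"
  define N1 where "N1 = (LINT x|?M. gsq w x)"
  define m where "m = smean b c (\<lambda>x. (w x)\<^sup>2)"
  have w2: "smooth (\<lambda>x. (w x)\<^sup>2)" by (intro smooth_power w)
  have pd2: "pd i (\<lambda>x. (w x)\<^sup>2) x = 2 * w x * pd i w x" for i x
    unfolding power2_eq_square using smooth_differentiable[OF w] by (simp add: pd_mult)
  have "\<bar>tdet a b c\<bar> * m = (LINT x|?M. (\<Sum>i\<in>UNIV. (x - a) $ i * pd i (\<lambda>x. (w x)\<^sup>2) x) + 2 * (w x)\<^sup>2)"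
    unfolding m_def K3_def by (rule tri_trace[OF TD(1) w2])
  also have "\<dots> \<le> (LINT x|?M. (2 + 1 / s) * (w x)\<^sup>2 + s * h\<^sup>2 * gsq w x)"
  proof (rule integral_mono)
    show "integrable ?M (\<lambda>x. (\<Sum>i\<in>UNIV. (x - a) $ i * pd i (\<lambda>x. (w x)\<^sup>2) x) + 2 * (w x)\<^sup>2)"
      by (intro K3_integrable continuous_intros smooth_continuous smooth_pd w w2)
    show "integrable ?M (\<lambda>x. (2 + 1 / s) * (w x)\<^sup>2 + s * h\<^sup>2 * gsq w x)"
      by (intro K3_integrable continuous_intros smooth_continuous smooth_pd w)
    fix x assume "x \<in> space ?M"
    then have x: "norm (x - a) \<le> h" using TD(7) by simp
    have "(\<Sum>i\<in>UNIV. (x - a) $ i * pd i (\<lambda>x. (w x)\<^sup>2) x) = 2 * (w x * (\<Sum>i\<in>UNIV. (x - a) $ i * pd i w x))"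
      unfolding pd2 by (simp add: sum_distrib_left mult_ac)
    also have "\<dots> \<le> 2 * (\<bar>w x\<bar> * (h * sqrt (gsq w x)))"
    proof -
      let ?S = "\<Sum>i\<in>UNIV. (x - a) $ i * pd i w x"
      have "?S \<le> norm (x - a) * sqrt (gsq w x)" by (rule cs_pt)
      moreover have "- ?S \<le> norm (x - a) * sqrt (gsq w x)"
        using cs_pt[of "a - x" "\<lambda>i. pd i w x"] by (simp add: sum_negf[symmetric] left_diff_distrib norm_minus_commute)
      moreover have "norm (x - a) * sqrt (gsq w x) \<le> h * sqrt (gsq w x)" using x by (intro mult_right_mono) (auto intro: sum_nonneg)
      ultimately have "\<bar>?S\<bar> \<le> h * sqrt (gsq w x)" by linarith
      then have "\<bar>w x\<bar> * \<bar>?S\<bar> \<le> \<bar>w x\<bar> * (h * sqrt (gsq w x))" by (intro mult_left_mono) auto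
      then show ?thesis by (simp add: abs_mult[symmetric])
    qed
    also have "\<dots> \<le> \<bar>w x\<bar>\<^sup>2 / s + s * (h * sqrt (gsq w x))\<^sup>2" by (rule young[OF s])
    also have "\<dots> = (w x)\<^sup>2 / s + s * h\<^sup>2 * gsq w x" by (simp add: power_mult_distrib sum_nonneg)
    finally show "(\<Sum>i\<in>UNIV. (x - a) $ i * pd i (\<lambda>x. (w x)\<^sup>2) x) + 2 * (w x)\<^sup>2 \<le> (2 + 1 / s) * (w x)\<^sup>2 + s * h\<^sup>2 * gsq w x"
      by (simp add: distrib_right)
  qed
  also have "\<dots> = (2 + 1 / s) * N0 + s * h\<^sup>2 * N1"
  proof -
    have "integrable ?M (\<lambda>x. (w x)\<^sup>2)" "integrable ?M (\<lambda>x. gsq w x)"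
      by (intro K3_integrable smooth_continuous w2 smooth_gsq w)+
    then show ?thesis by (simp add: N0_def N1_def)
  qed
  finally have 1: "\<bar>tdet a b c\<bar> * m \<le> (2 + 1 / s) * N0 + s * h\<^sup>2 * N1" .
  have m0: "m \<ge> 0" unfolding m_def by (intro smean_nonneg smooth_continuous w2) simp
  have "h * (dist b c * m) \<le> \<kappa> / 2 * (\<bar>tdet a b c\<bar> * m)"
    using mult_right_mono[OF TD(5) m0] by (simp add: mult.assoc)
  also have "\<dots> \<le> \<kappa> / 2 * ((2 + 1 / s) * N0 + s * h\<^sup>2 * N1)" using 1 TD(8) by (intro mult_left_mono) auto
  also have "\<dots> = h * (\<kappa> * ((1 + 1 / (2 * s)) / h * N0 + s / 2 * h * N1))"
    using TD(3) s by (simp add: field_simps power2_eq_square)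
  finally have "dist b c * m \<le> \<kappa> * ((1 + 1 / (2 * s)) / h * N0 + s / 2 * h * N1)" using TD(3) by simp
  then show ?thesis by (simp only: m_def N0_def N1_def)
qed

text \<open>The trace inequality for each partial derivative.\<close>

lemma grad_trace_inequality:
  assumes T: "nice_tri \<kappa> a b c" and w: "smooth w"
  defines "h \<equiv> diameter (K3 a b c)"
  shows "dist b c * smean b c (gsq w) \<le> \<kappa> * (3 / 2 / h * (LINT x|lebesgue_on (K3 a b c). gsq w x)
           + h / 2 * (LINT x|lebesgue_on (K3 a b c). hsq w x))"
proof -
  let ?M = "lebesgue_on (K3 a b c)"
  have i: "dist b c * smean b c (\<lambda>x. (pd i w x)\<^sup>2) \<le> \<kappa> * (3 / 2 / h * (LINT x|?M. (pd i w x)\<^sup>2)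
           + h / 2 * (LINT x|?M. gsq (pd i w) x))" for i
    using trace_inequality[OF T smooth_pd[OF w], of 1 i] by (simp add: h_def)
  have s: "smooth (\<lambda>x. (pd i w x)\<^sup>2)" for i by (intro smooth_power smooth_pd w)
  have "smean b c (gsq w) = smean b c (\<lambda>x. (pd 1 w x)\<^sup>2) + smean b c (\<lambda>x. (pd 2 w x)\<^sup>2)"
    unfolding sum_2 by (intro smean_add smooth_continuous s)
  moreover have "(LINT x|?M. gsq w x) = (LINT x|?M. (pd 1 w x)\<^sup>2) + (LINT x|?M. (pd 2 w x)\<^sup>2)"
    unfolding sum_2[of "\<lambda>i. (pd i w _)\<^sup>2"] by (intro Bochner_Integration.integral_add K3_integrable smooth_continuous s)
  moreover have "(LINT x|?M. hsq w x) = (LINT x|?M. gsq (pd 1 w) x) + (LINT x|?M. gsq (pd 2 w) x)"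
    unfolding sum_2[of "\<lambda>i. gsq (pd i w) _"]
    by (intro Bochner_Integration.integral_add K3_integrable smooth_continuous smooth_gsq smooth_pd w)
  ultimately show ?thesis using i[of 1] i[of 2] by (simp add: algebra_simps add_divide_distrib)
qed

lemma edge_product_bound:
  assumes w: "smooth w" and e: "e > 0"
  shows "\<bar>\<Sum>i\<in>UNIV. rot (c - b) $ i * smean b c (\<lambda>x. w x * pd i w x)\<bar>
    \<le> dist b c * (smean b c (\<lambda>x. (w x)\<^sup>2) / (2 * e) + e / 2 * smean b c (gsq w))"
proof -
  define u where "u = rot (c - b)"
  have nu: "norm u = dist b c" by (simp add: u_def norm_rot dist_norm norm_minus_commute)
  have sm: "smooth (\<lambda>x. w x * pd i w x)" for i by (intro smooth_mult w smooth_pd)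
  define g where "g = (\<lambda>x. \<Sum>i\<in>UNIV. u $ i * (w x * pd i w x))"
  have gs: "smooth g" unfolding g_def by (intro smooth_sum smooth_mult smooth_const w smooth_pd)
  have eq: "(\<Sum>i\<in>UNIV. u $ i * smean b c (\<lambda>x. w x * pd i w x)) = smean b c g"
    unfolding g_def sum_2 by (subst smean_add) (auto simp: smean_cmult intro!: smooth_continuous smooth_cmult sm)
  define B where "B = (\<lambda>x. dist b c * ((w x)\<^sup>2 / (2 * e) + e / 2 * gsq w x))"
  have Bs: "smooth B" unfolding B_def divide_inverse
    by (intro smooth_mult smooth_add smooth_const smooth_power w smooth_gsq)
  have gB: "\<bar>g x\<bar> \<le> B x" for x
  proof -
    let ?S = "\<Sum>i\<in>UNIV. u $ i * pd i w x"
    have S1: "?S \<le> dist b c * sqrt (gsq w x)" using cs_pt[of u "\<lambda>i. pd i w x"] by (simp add: nu)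
    have S2: "- ?S \<le> dist b c * sqrt (gsq w x)"
      using cs_pt[of "- u" "\<lambda>i. pd i w x"] by (simp add: nu sum_negf)
    have "\<bar>g x\<bar> = \<bar>w x\<bar> * \<bar>?S\<bar>" unfolding g_def abs_mult[symmetric] by (simp add: sum_distrib_left mult_ac)
    also have "\<dots> \<le> \<bar>w x\<bar> * (dist b c * sqrt (gsq w x))" using S1 S2 by (intro mult_left_mono) linarith+
    also have "\<dots> = dist b c * (\<bar>w x\<bar> * sqrt (gsq w x))" by simp
    also have "\<dots> \<le> B x"
      unfolding B_def using young[OF e, of "\<bar>w x\<bar>" "sqrt (gsq w x)"]
      by (intro mult_left_mono) (auto simp: sum_nonneg field_simps)
    finally show ?thesis .
  qed
  have "smean b c g \<le> smean b c B" using gB by (intro smean_mono smooth_continuous gs Bs) (auto simp: abs_le_iff)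
  moreover have "smean b c (\<lambda>x. (-1) * g x) \<le> smean b c B"
    using gB by (intro smean_mono smooth_continuous smooth_cmult gs Bs) (auto simp: abs_le_iff)
  ultimately have "\<bar>smean b c g\<bar> \<le> smean b c B" unfolding smean_cmult by linarith
  also have "smean b c B = dist b c * (smean b c (\<lambda>x. (w x)\<^sup>2) / (2 * e) + e / 2 * smean b c (gsq w))"
  proof -
    have "smean b c B = dist b c * smean b c (\<lambda>x. 1 / (2 * e) * (w x)\<^sup>2 + e / 2 * gsq w x)"
    proof -
      have "B = (\<lambda>x. dist b c * (1 / (2 * e) * (w x)\<^sup>2 + e / 2 * gsq w x))"
        unfolding B_def by (simp only: times_divide_eq_left mult_1)
      then show ?thesis by (simp only: smean_cmult)
    qed
    also have "smean b c (\<lambda>x. 1 / (2 * e) * (w x)\<^sup>2 + e / 2 * gsq w x)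
       = smean b c (\<lambda>x. 1 / (2 * e) * (w x)\<^sup>2) + smean b c (\<lambda>x. e / 2 * gsq w x)"
      by (intro smean_add smooth_continuous smooth_cmult smooth_power smooth_gsq w)
    finally show ?thesis unfolding smean_cmult by (simp only: times_divide_eq_left mult_1)
  qed
  finally show ?thesis unfolding eq[symmetric] u_def .
qed

text \<open>The value that results from the choice of the small parameters in \<open>grad_interpolation\<close>.\<close>

definition C_grad :: "real \<Rightarrow> real" where "C_grad \<kappa> = 3 + 27 * \<kappa>\<^sup>2 * (1 + 27 * \<kappa>\<^sup>2 / 2)"

lemma C_grad_ge: "C_grad \<kappa> \<ge> 3" by (simp add: C_grad_def)

text \<open>The divergence theorem for the field \<open>w \<nabla>w\<close> expresses the integral of \<open>|\<nabla>w|\<^sup>2\<close> by \<open>w\<close> times the Laplacian and by edge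
  integrals of \<open>w\<close> times the normal derivative. The trace inequalities bound each edge integral; the parameters are chosen such
  that every edge returns at most one sixth of the left-hand side, which is then absorbed.\<close>

lemma grad_interpolation:
  assumes T: "nice_tri \<kappa> a b c" and w: "smooth w"
  defines "h \<equiv> diameter (K3 a b c)"
  shows "(LINT x|lebesgue_on (K3 a b c). gsq w x) \<le>
     C_grad \<kappa> * ((LINT x|lebesgue_on (K3 a b c). (w x)\<^sup>2) / h\<^sup>2 + h\<^sup>2 * (LINT x|lebesgue_on (K3 a b c). hsq w x))"
proof -
  let ?M = "lebesgue_on (K3 a b c)"
  note TD = nice_triD[OF T, folded K3_def h_def]
  have h: "h > 0" by (rule TD(3))
  have \<kappa>: "\<kappa> > 0" using TD(8) by simp
  define N0 where "N0 = (LINT x|?M. (w x)\<^sup>2)"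
  define N1 where "N1 = (LINT x|?M. gsq w x)"
  define N2 where "N2 = (LINT x|?M. hsq w x)"
  have N2: "0 \<le> N2" unfolding N2_def by (simp add: sum_nonneg)
  have N0: "0 \<le> N0" unfolding N0_def by simp
  \<comment> \<open>With this value and \<open>s = 1 / (27 \<kappa>\<^sup>2)\<close> below, one edge contributes \<open>N1 / 6\<close>.\<close>
  define e where "e = h / (9 * \<kappa>)"
  have e: "e > 0" using h \<kappa> by (simp add: e_def)
  define S where "S = (9 * \<kappa>\<^sup>2 / 2) * (1 + 27 * \<kappa>\<^sup>2 / 2) * N0 / h\<^sup>2 + N1 / 6 + h\<^sup>2 * N2 / 36"
  have edge: "\<bar>\<Sum>i\<in>UNIV. rot (c' - b') $ i * smean b' c' (\<lambda>x. w x * pd i w x)\<bar> \<le> S"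
    if T': "nice_tri \<kappa> a' b' c'" and K': "K3 a' b' c' = K3 a b c" for a' b' c'
  proof -
    have t1: "dist b' c' * smean b' c' (\<lambda>x. (w x)\<^sup>2) \<le> \<kappa> * ((1 + 27 * \<kappa>\<^sup>2 / 2) / h * N0 + h * N1 / (54 * \<kappa>\<^sup>2))"
      using trace_inequality[OF T' w, of "1 / (27 * \<kappa>\<^sup>2)"] \<kappa> unfolding K' h_def[symmetric] N0_def[symmetric] N1_def[symmetric]
      by (simp add: field_simps)
    have t2: "dist b' c' * smean b' c' (gsq w) \<le> \<kappa> * (3 / 2 / h * N1 + h / 2 * N2)"
      using grad_trace_inequality[OF T' w] unfolding K' h_def[symmetric] N2_def[symmetric] N1_def[symmetric] .
    have "\<bar>\<Sum>i\<in>UNIV. rot (c' - b') $ i * smean b' c' (\<lambda>x. w x * pd i w x)\<bar>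
      \<le> dist b' c' * (smean b' c' (\<lambda>x. (w x)\<^sup>2) / (2 * e) + e / 2 * smean b' c' (gsq w))"
      by (rule edge_product_bound[OF w e])
    also have "\<dots> = (dist b' c' * smean b' c' (\<lambda>x. (w x)\<^sup>2)) / (2 * e) + e / 2 * (dist b' c' * smean b' c' (gsq w))"
      by (simp add: distrib_left)
    also have "\<dots> \<le> (\<kappa> * ((1 + 27 * \<kappa>\<^sup>2 / 2) / h * N0 + h * N1 / (54 * \<kappa>\<^sup>2))) / (2 * e) + e / 2 * (\<kappa> * (3 / 2 / h * N1 + h / 2 * N2))"
      using t1 t2 e by (intro add_mono divide_right_mono mult_left_mono) auto
    also have "\<dots> = S"
      unfolding e_def S_def using h \<kappa> by (simp add: field_simps power2_eq_square)
    finally show ?thesis .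
  qed
  have s1: "smooth (\<lambda>x. w x * pd i w x)" for i by (intro smooth_mult w smooth_pd)
  have i1: "integrable ?M (\<lambda>x. pd i (\<lambda>x. w x * pd i w x) x)" for i
    by (intro K3_integrable smooth_continuous smooth_pd s1)
  have div: "(LINT x|?M. pd i (\<lambda>x. w x * pd i w x) x) = - sgn (tdet a b c) *
     (rot (c - b) $ i * smean b c (\<lambda>x. w x * pd i w x) + rot (a - c) $ i * smean c a (\<lambda>x. w x * pd i w x)
      + rot (b - a) $ i * smean a b (\<lambda>x. w x * pd i w x))" for i
    unfolding K3_def by (rule tri_divergence[OF TD(1) s1])
  let ?E = "\<lambda>b c. \<Sum>i\<in>UNIV. rot (c - b) $ i * smean b c (\<lambda>x. w x * pd i w x)"
  have "(LINT x|?M. (\<Sum>i\<in>UNIV. pd i (\<lambda>x. w x * pd i w x) x)) = - sgn (tdet a b c) * (?E b c + ?E c a + ?E a b)"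
    using i1 by (simp add: sum_2 div algebra_simps)
  also have "\<dots> \<le> \<bar>sgn (tdet a b c)\<bar> * \<bar>?E b c + ?E c a + ?E a b\<bar>"
    using abs_ge_self[of "- sgn (tdet a b c) * (?E b c + ?E c a + ?E a b)"] unfolding abs_mult abs_minus_cancel .
  also have "\<dots> \<le> 1 * (S + S + S)"
  proof (rule mult_mono)
    show "\<bar>?E b c + ?E c a + ?E a b\<bar> \<le> S + S + S"
      using edge[OF T] edge[OF nice_tri_rotate[OF T]] edge[OF nice_tri_rotate[OF nice_tri_rotate[OF T]]]
      by (simp add: K3_rotate)
  qed (auto simp: abs_sgn_eq)
  finally have I: "(LINT x|?M. (\<Sum>i\<in>UNIV. pd i (\<lambda>x. w x * pd i w x) x)) \<le> 3 * S" by simp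
  have pw: "gsq w x \<le> (\<Sum>i\<in>UNIV. pd i (\<lambda>x. w x * pd i w x) x) + (w x)\<^sup>2 / (2 * h\<^sup>2) + h\<^sup>2 * hsq w x" for x
  proof -
    let ?L = "pd 1 (pd 1 w) x + pd 2 (pd 2 w) x"
    have "(\<Sum>i\<in>UNIV. pd i (\<lambda>x. w x * pd i w x) x) = w x * ?L + gsq w x"
      using smooth_differentiable[OF w] smooth_differentiable[OF smooth_pd[OF w]]
      by (simp add: sum_2 pd_mult power2_eq_square algebra_simps)
    moreover have "- (w x * ?L) \<le> (w x)\<^sup>2 / (2 * h\<^sup>2) + h\<^sup>2 / 2 * ?L\<^sup>2"
      using young[of "h\<^sup>2" "- w x" ?L] h by simp
    moreover have "?L\<^sup>2 \<le> 2 * hsq w x"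
    proof -
      have "?L\<^sup>2 \<le> 2 * (pd 1 (pd 1 w) x)\<^sup>2 + 2 * (pd 2 (pd 2 w) x)\<^sup>2"
        using norm_add_sq_le[of "pd 1 (pd 1 w) x" "pd 2 (pd 2 w) x"] by simp
      also have "\<dots> \<le> 2 * hsq w x" by (simp add: sum_2)
      finally show ?thesis .
    qed
    then have "h\<^sup>2 / 2 * ?L\<^sup>2 \<le> h\<^sup>2 / 2 * (2 * hsq w x)" by (intro mult_left_mono) auto
    ultimately show ?thesis by simp
  qed
  have "N1 \<le> (LINT x|?M. (\<Sum>i\<in>UNIV. pd i (\<lambda>x. w x * pd i w x) x) + (w x)\<^sup>2 / (2 * h\<^sup>2) + h\<^sup>2 * hsq w x)"
    unfolding N1_def
  proof (rule integral_mono[OF _ _ pw])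
    show "integrable ?M (gsq w)" by (intro K3_integrable smooth_continuous smooth_gsq w)
    show "integrable ?M (\<lambda>x. (\<Sum>i\<in>UNIV. pd i (\<lambda>x. w x * pd i w x) x) + (w x)\<^sup>2 / (2 * h\<^sup>2) + h\<^sup>2 * hsq w x)"
      using h by (intro K3_integrable continuous_intros smooth_continuous smooth_pd w s1) auto
  qed
  also have "\<dots> = (LINT x|?M. (\<Sum>i\<in>UNIV. pd i (\<lambda>x. w x * pd i w x) x)) + N0 / (2 * h\<^sup>2) + h\<^sup>2 * N2"
  proof -
    have "integrable ?M (\<lambda>x. (\<Sum>i\<in>UNIV. pd i (\<lambda>x. w x * pd i w x) x))" "integrable ?M (\<lambda>x. (w x)\<^sup>2)" "integrable ?M (\<lambda>x. hsq w x)"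
      by (intro K3_integrable continuous_intros smooth_continuous smooth_pd w s1)+
    then show ?thesis unfolding N0_def N2_def by simp
  qed
  also have "\<dots> \<le> 3 * S + N0 / (2 * h\<^sup>2) + h\<^sup>2 * N2" using I by simp
  finally have "N1 / 2 \<le> (27 * \<kappa>\<^sup>2 / 2 * (1 + 27 * \<kappa>\<^sup>2 / 2) + 1 / 2) * (N0 / h\<^sup>2) + 13 / 12 * (h\<^sup>2 * N2)"
    unfolding S_def by (simp add: algebra_simps add_divide_distrib)
  also have "\<dots> \<le> C_grad \<kappa> / 2 * (N0 / h\<^sup>2) + C_grad \<kappa> / 2 * (h\<^sup>2 * N2)"
  proof (intro add_mono mult_right_mono)
    show "13 / 12 \<le> C_grad \<kappa> / 2" using C_grad_ge[of \<kappa>] by simp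
    show "27 * \<kappa>\<^sup>2 / 2 * (1 + 27 * \<kappa>\<^sup>2 / 2) + 1 / 2 \<le> C_grad \<kappa> / 2" by (simp add: C_grad_def)
  qed (use N0 N2 in auto)
  finally have "N1 \<le> C_grad \<kappa> * (N0 / h\<^sup>2 + h\<^sup>2 * N2)" by (simp add: distrib_left)
  then show ?thesis by (simp only: N0_def N1_def N2_def)
qed

definition C_trace :: "real \<Rightarrow> real" where "C_trace \<kappa> = 2 * \<kappa> * C_grad \<kappa>"

text \<open>Scaled trace inequalities in terms of the function and its Hessian only, the gradient having been eliminated.\<close>

lemma edge_bounds_smooth:
  assumes T: "nice_tri \<kappa> a b c" and w: "smooth w"
  defines "h \<equiv> diameter (K3 a b c)"
  defines "B \<equiv> (LINT x|lebesgue_on (K3 a b c). (w x)\<^sup>2) / h ^ 4 + (LINT x|lebesgue_on (K3 a b c). hsq w x)"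
  shows "dist b c * smean b c (\<lambda>x. (w x)\<^sup>2) \<le> C_trace \<kappa> * h ^ 3 * B"
    and "dist b c * smean b c (gsq w) \<le> C_trace \<kappa> * h * B"
proof -
  let ?M = "lebesgue_on (K3 a b c)"
  note TD = nice_triD[OF T, folded K3_def h_def]
  have h: "h > 0" by (rule TD(3))
  have \<kappa>: "\<kappa> > 0" using TD(8) by simp
  define N0 where "N0 = (LINT x|?M. (w x)\<^sup>2)"
  define N1 where "N1 = (LINT x|?M. gsq w x)"
  define N2 where "N2 = (LINT x|?M. hsq w x)"
  have N2: "0 \<le> N2" unfolding N2_def by (simp add: sum_nonneg)
  have N0: "0 \<le> N0" unfolding N0_def by simp
  have B: "B = N0 / h ^ 4 + N2" by (simp add: B_def N0_def N2_def)
  have B0: "0 \<le> B" "N0 / h ^ 4 \<le> B" "N2 \<le> B" using N0 N2 by (auto simp: B)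
  have "N1 \<le> C_grad \<kappa> * (N0 / h\<^sup>2 + h\<^sup>2 * N2)"
    using grad_interpolation[OF T w] by (simp only: N0_def N1_def N2_def h_def)
  also have "\<dots> = C_grad \<kappa> * (h\<^sup>2 * B)" using h by (simp add: B field_simps eval_nat_numeral)
  finally have N1: "N1 \<le> C_grad \<kappa> * (h\<^sup>2 * B)" .
  have h2B: "0 \<le> h\<^sup>2 * B" using B0 by simp
  have "dist b c * smean b c (\<lambda>x. (w x)\<^sup>2) \<le> \<kappa> * (3 / 2 / h * N0 + h / 2 * N1)"
    using trace_inequality[OF T w, of 1] by (simp add: h_def N0_def N1_def)
  also have "\<dots> \<le> \<kappa> * (3 / 2 * (h ^ 3 * B) + h / 2 * (C_grad \<kappa> * (h\<^sup>2 * B)))"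
  proof -
    have "N0 / h = h ^ 3 * (N0 / h ^ 4)" using h by (simp add: eval_nat_numeral)
    also have "\<dots> \<le> h ^ 3 * B" using B0 h by (intro mult_left_mono) auto
    finally have "3 / 2 / h * N0 \<le> 3 / 2 * (h ^ 3 * B)" by simp
    then show ?thesis using N1 h \<kappa> by (intro mult_left_mono add_mono) auto
  qed
  also have "\<dots> = \<kappa> * ((3 / 2 + C_grad \<kappa> / 2) * (h ^ 3 * B))" by (simp add: algebra_simps power2_eq_square power3_eq_cube)
  also have "\<dots> \<le> \<kappa> * (2 * C_grad \<kappa> * (h ^ 3 * B))"
    using C_grad_ge[of \<kappa>] \<kappa> h B0 by (intro mult_left_mono mult_right_mono) auto
  finally show "dist b c * smean b c (\<lambda>x. (w x)\<^sup>2) \<le> C_trace \<kappa> * h ^ 3 * B" by (simp add: C_trace_def mult_ac)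
  have "dist b c * smean b c (gsq w) \<le> \<kappa> * (3 / 2 / h * N1 + h / 2 * N2)"
    using grad_trace_inequality[OF T w] by (simp only: h_def N1_def N2_def)
  also have "\<dots> \<le> \<kappa> * (3 / 2 * (C_grad \<kappa> * (h * B)) + 1 / 2 * (h * B))"
  proof -
    have "N1 / h \<le> C_grad \<kappa> * (h\<^sup>2 * B) / h" using N1 h by (intro divide_right_mono) auto
    also have "\<dots> = C_grad \<kappa> * (h * B)" using h by (simp add: power2_eq_square)
    finally have "3 / 2 / h * N1 \<le> 3 / 2 * (C_grad \<kappa> * (h * B))" by simp
    moreover have "h / 2 * N2 \<le> 1 / 2 * (h * B)" using B0 h by simp
    ultimately show ?thesis using \<kappa> by (intro mult_left_mono add_mono) auto
  qed
  also have "\<dots> = \<kappa> * ((3 / 2 * C_grad \<kappa> + 1 / 2) * (h * B))" by (simp add: algebra_simps)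
  also have "\<dots> \<le> \<kappa> * (2 * C_grad \<kappa> * (h * B))"
    using C_grad_ge[of \<kappa>] \<kappa> h B0 by (intro mult_left_mono mult_right_mono) auto
  finally show "dist b c * smean b c (gsq w) \<le> C_trace \<kappa> * h * B" by (simp add: C_trace_def mult_ac)
qed

section \<open>Moments of smooth functions\<close>

lemma moment_nth:
  "moment P A $ i $ j = thickness P ^ 3 / 12 * (young P / (1 + poisson P) *
     (- ((A $ i $ j + A $ j $ i) / 2) + poisson P / (1 - poisson P) * (- (A $ 1 $ 1 + A $ 2 $ 2)) * (if i = j then 1 else 0)))"
  by (simp add: moment_def elasticity_def curvature_def transpose_def trace_def mat_def sum_2)

lemma smooth_moment_of: "smooth p \<Longrightarrow> smooth (\<lambda>x. moment_of P p x $ i $ j)"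
  unfolding moment_of_def moment_nth hess_def vec_lambda_beta divide_inverse
  by (intro smooth_mult smooth_add smooth_minus smooth_const smooth_pd)

text \<open>The moment tensor is symmetric, so the curvature may be replaced by minus the Hessian even if a weak Hessian is not symmetric.\<close>

lemma moment_inner_curvature:
  "moment P A \<bullet> curvature H = - (\<Sum>i\<in>UNIV. \<Sum>j\<in>UNIV. moment P A $ i $ j * H $ i $ j)"
proof -
  have s: "moment P A $ 2 $ 1 = moment P A $ 1 $ 2" by (simp add: moment_nth add.commute)
  show ?thesis
    by (simp add: inner_vec_def sum_2 curvature_def transpose_def s algebra_simps)
qed

lemma shear_nth: "shear P p x $ i = (\<Sum>j\<in>UNIV. pd j (\<lambda>y. moment_of P p y $ i $ j) x)"
  by (simp add: shear_def)

lemma smooth_shear: "smooth p \<Longrightarrow> smooth (\<lambda>x. shear P p x $ i)"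
  unfolding shear_nth by (intro smooth_sum smooth_pd smooth_moment_of)

lemma smooth_plate_op: "smooth p \<Longrightarrow> smooth (plate_op P p)"
  unfolding plate_op_def[abs_def] by (intro smooth_minus smooth_sum smooth_pd smooth_shear)

lemma M_nn_eq: "M_nn P n p x = (\<Sum>i\<in>UNIV. \<Sum>j\<in>UNIV. n $ i * (moment_of P p x $ i $ j * n $ j))"
  by (simp add: M_nn_def matrix_vector_mult_def inner_vec_def sum_distrib_left)

lemma M_ns_eq: "M_ns P n p x = (\<Sum>i\<in>UNIV. \<Sum>j\<in>UNIV. rot n $ i * (moment_of P p x $ i $ j * n $ j))"
  by (simp add: M_ns_def matrix_vector_mult_def inner_vec_def sum_distrib_left)

lemma smooth_M_nn: "smooth p \<Longrightarrow> smooth (M_nn P n p)"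
  unfolding M_nn_eq[abs_def] by (intro smooth_sum smooth_mult smooth_const smooth_moment_of)

lemma smooth_M_ns: "smooth p \<Longrightarrow> smooth (M_ns P n p)"
  unfolding M_ns_eq[abs_def] by (intro smooth_sum smooth_mult smooth_const smooth_moment_of)

lemma V_n_eq: "smooth p \<Longrightarrow> V_n P n p x = (\<Sum>i\<in>UNIV. shear P p x $ i * n $ i) + (\<Sum>i\<in>UNIV. rot n $ i * pd i (M_ns P n p) x)"
  unfolding V_n_def using frechet_derivative_eq_pd[OF smooth_differentiable[OF smooth_M_ns]]
  by (simp add: inner_vec_def)

lemma smooth_V_n: "smooth p \<Longrightarrow> smooth (V_n P n p)"
proof -
  assume p: "smooth p"
  have "V_n P n p = (\<lambda>x. (\<Sum>i\<in>UNIV. shear P p x $ i * n $ i) + (\<Sum>i\<in>UNIV. rot n $ i * pd i (M_ns P n p) x))"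
    using V_n_eq[OF p] by blast
  then show ?thesis using p by (auto intro!: smooth_add smooth_sum smooth_mult smooth_const smooth_pd smooth_shear smooth_M_ns)
qed

section \<open>The elementwise identity for smooth functions\<close>

lemma smean_ftc:
  assumes f: "smooth f"
  shows "smean b c (\<lambda>x. \<Sum>i\<in>UNIV. (c - b) $ i * pd i f x) = f c - f b"
proof -
  have "((\<lambda>s. \<Sum>i\<in>UNIV. (c - b) $ i * pd i f (b + s *\<^sub>R (c - b))) has_integral f (b + 1 *\<^sub>R (c - b)) - f (b + 0 *\<^sub>R (c - b))) {0..1}"
  proof (rule fundamental_theorem_of_calculus)
    fix s :: real
    have "((\<lambda>s. b + s *\<^sub>R (c - b)) has_derivative (\<lambda>h. h *\<^sub>R (c - b))) (at s within {0..1})"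
      by (auto intro!: derivative_eq_intros)
    from has_derivative_compose[OF this smooth_derivative[OF f]]
    have "((\<lambda>s. f (b + s *\<^sub>R (c - b))) has_derivative (\<lambda>h. \<Sum>i\<in>UNIV. (h *\<^sub>R (c - b)) $ i * pd i f (b + s *\<^sub>R (c - b)))) (at s within {0..1})" .
    then show "((\<lambda>s. f (b + s *\<^sub>R (c - b))) has_vector_derivative (\<Sum>i\<in>UNIV. (c - b) $ i * pd i f (b + s *\<^sub>R (c - b)))) (at s within {0..1})"
      by (simp add: has_vector_derivative_def sum_distrib_left mult.assoc)
  qed simp
  then show ?thesis unfolding smean_def by (simp add: integral_unique)
qed

definition edge_normal :: "real \<Rightarrow> pt \<Rightarrow> pt \<Rightarrow> pt" where
  "edge_normal \<sigma> b c = (- \<sigma> / dist b c) *\<^sub>R rot (c - b)"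

lemma rot_scaleR: "rot (t *\<^sub>R x) = t *\<^sub>R rot x" and rot_rot: "rot (rot x) = - x"
  by (auto simp: rot_def vec_eq_iff forall_2)

lemma rot_edge_normal: "rot (edge_normal \<sigma> b c) = (\<sigma> / dist b c) *\<^sub>R (c - b)"
  unfolding edge_normal_def rot_scaleR rot_rot by (simp add: algebra_simps)

lemma norm_edge_normal: "b \<noteq> c \<Longrightarrow> \<bar>\<sigma>\<bar> = 1 \<Longrightarrow> norm (edge_normal \<sigma> b c) = 1"
  by (simp add: edge_normal_def norm_rot dist_norm norm_minus_commute)

text \<open>A unit vector and its rotation form an orthonormal basis.\<close>

lemma frame_expansion:
  assumes "norm (n :: pt) = 1"
  shows "w \<bullet> g = (n \<bullet> w) * (n \<bullet> g) + (rot n \<bullet> w) * (rot n \<bullet> g)"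
proof -
  have 1: "n $ 1 * n $ 1 + n $ 2 * n $ 2 = 1" using assms norm_pt_sq[of n] by (simp add: power2_eq_square)
  have "(n \<bullet> w) * (n \<bullet> g) + (rot n \<bullet> w) * (rot n \<bullet> g) = (n $ 1 * n $ 1 + n $ 2 * n $ 2) * (w \<bullet> g)"
    by (simp add: inner_vec_def sum_2 rot_def algebra_simps)
  then show ?thesis using 1 by simp
qed

text \<open>The contribution of one edge: Kirchhoff shear force against \<open>w\<close> minus normal moment against the normal derivative.\<close>

definition edge_term :: "plate \<Rightarrow> pt \<Rightarrow> (pt \<Rightarrow> real) \<Rightarrow> pt \<Rightarrow> pt \<Rightarrow> (pt \<Rightarrow> real) \<Rightarrow> real" where
  "edge_term P n p b c w = dist b c * smean b c (\<lambda>x. V_n P n p x * w x)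
     - dist b c * (\<Sum>i\<in>UNIV. n $ i * smean b c (\<lambda>x. M_nn P n p x * pd i w x))"

text \<open>The gradient of \<open>w\<close> is split into normal and tangential parts. The tangential part is paired with the twisting moment
  and integrated by parts along the edge, which completes the shear force to the Kirchhoff shear force and leaves values at the end points.\<close>

lemma edge_identity:
  assumes p: "smooth p" and w: "smooth w" and bc: "b \<noteq> c" and \<sigma>: "\<bar>\<sigma>\<bar> = 1"
  defines "n \<equiv> edge_normal \<sigma> b c"
  shows "- \<sigma> * ((\<Sum>i\<in>UNIV. rot (c - b) $ i * smean b c (\<lambda>x. shear P p x $ i * w x))
           - (\<Sum>i\<in>UNIV. \<Sum>j\<in>UNIV. rot (c - b) $ j * smean b c (\<lambda>x. moment_of P p x $ i $ j * pd i w x)))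
     = edge_term P n p b c w - \<sigma> * (M_ns P n p c * w c - M_ns P n p b * w b)"
proof -
  let ?l = "dist b c"
  have l: "?l > 0" using bc by simp
  have nn: "norm n = 1" unfolding n_def by (rule norm_edge_normal[OF bc \<sigma>])
  have r: "- \<sigma> * rot (c - b) $ i = ?l * n $ i" for i using l by (simp add: n_def edge_normal_def)
  have rn: "rot n $ i = \<sigma> / ?l * (c - b) $ i" for i unfolding n_def rot_edge_normal by simp
  note sm = smooth_mult smooth_pd smooth_moment_of smooth_shear smooth_M_ns smooth_M_nn smooth_V_n smooth_const smooth_add smooth_sum p w
  note cont = smooth_continuous
  have sum_smean: "(\<Sum>i\<in>UNIV. k i * smean b c (f i)) = smean b c (\<lambda>x. \<Sum>i\<in>UNIV. k i * f i x)"
    if "\<And>i. smooth (f i)" for k :: "2 \<Rightarrow> real" and f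
    unfolding sum_2 by (subst smean_add) (auto simp: smean_cmult intro!: cont smooth_cmult that)
  define q1 where "q1 = (\<lambda>x. \<Sum>i\<in>UNIV. n $ i * (shear P p x $ i * w x))"
  define q2 where "q2 = (\<lambda>x. \<Sum>i\<in>UNIV. \<Sum>j\<in>UNIV. n $ j * (moment_of P p x $ i $ j * pd i w x))"
  define q3 where "q3 = (\<lambda>x. \<Sum>i\<in>UNIV. n $ i * (M_nn P n p x * pd i w x))"
  define q4 where "q4 = (\<lambda>x. \<Sum>i\<in>UNIV. (c - b) $ i * pd i (\<lambda>x. M_ns P n p x * w x) x)"
  have q1s: "smooth q1" and q2s: "smooth q2" and q3s: "smooth q3" and q4s: "smooth q4"
    unfolding q1_def q2_def q3_def q4_def by (intro sm)+
  have L1: "- \<sigma> * (\<Sum>i\<in>UNIV. rot (c - b) $ i * smean b c (\<lambda>x. shear P p x $ i * w x)) = ?l * smean b c q1"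
  proof -
    have "- \<sigma> * (\<Sum>i\<in>UNIV. rot (c - b) $ i * smean b c (\<lambda>x. shear P p x $ i * w x))
        = ?l * (\<Sum>i\<in>UNIV. n $ i * smean b c (\<lambda>x. shear P p x $ i * w x))"
      unfolding sum_distrib_left mult.assoc[symmetric] r ..
    also have "(\<Sum>i\<in>UNIV. n $ i * smean b c (\<lambda>x. shear P p x $ i * w x)) = smean b c q1"
      unfolding q1_def by (rule sum_smean) (intro sm)
    finally show ?thesis .
  qed
  have L2: "- \<sigma> * (\<Sum>i\<in>UNIV. \<Sum>j\<in>UNIV. rot (c - b) $ j * smean b c (\<lambda>x. moment_of P p x $ i $ j * pd i w x)) = ?l * smean b c q2"
  proof -
    have "- \<sigma> * (\<Sum>i\<in>UNIV. \<Sum>j\<in>UNIV. rot (c - b) $ j * smean b c (\<lambda>x. moment_of P p x $ i $ j * pd i w x))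
        = ?l * (\<Sum>i\<in>UNIV. \<Sum>j\<in>UNIV. n $ j * smean b c (\<lambda>x. moment_of P p x $ i $ j * pd i w x))"
      unfolding sum_distrib_left mult.assoc[symmetric] r ..
    also have "(\<Sum>i\<in>UNIV. \<Sum>j\<in>UNIV. n $ j * smean b c (\<lambda>x. moment_of P p x $ i $ j * pd i w x))
        = (\<Sum>i\<in>UNIV. 1 * smean b c (\<lambda>x. \<Sum>j\<in>UNIV. n $ j * (moment_of P p x $ i $ j * pd i w x)))"
      by (intro sum.cong refl) (simp, rule sum_smean, intro sm)
    also have "\<dots> = smean b c (\<lambda>x. \<Sum>i\<in>UNIV. 1 * (\<Sum>j\<in>UNIV. n $ j * (moment_of P p x $ i $ j * pd i w x)))"
      by (rule sum_smean) (intro sm)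
    also have "\<dots> = smean b c q2" by (simp add: q2_def)
    finally show ?thesis .
  qed
  have L3: "(\<Sum>i\<in>UNIV. n $ i * smean b c (\<lambda>x. M_nn P n p x * pd i w x)) = smean b c q3"
    unfolding q3_def by (rule sum_smean) (intro sm)
  have L4: "smean b c q4 = M_ns P n p c * w c - M_ns P n p b * w b"
    unfolding q4_def by (rule smean_ftc) (intro sm)
  have pw: "q1 x + (\<sigma> / ?l) * q4 x = V_n P n p x * w x - q3 x + q2 x" for x
  proof -
    let ?g = "\<chi> i. pd i w x" let ?m = "moment_of P p x *v n"
    have q2: "q2 x = ?m \<bullet> ?g"
      by (simp add: q2_def inner_vec_def matrix_vector_mult_def sum_2 algebra_simps)
    have q3: "q3 x = (n \<bullet> ?m) * (n \<bullet> ?g)"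
      by (simp add: q3_def M_nn_def inner_vec_def sum_2 algebra_simps)
    have q2': "q2 x = q3 x + M_ns P n p x * (rot n \<bullet> ?g)"
      unfolding q2 q3 M_ns_def by (rule frame_expansion[OF nn])
    have "(\<sigma> / ?l) * q4 x = (\<Sum>i\<in>UNIV. rot n $ i * pd i (\<lambda>x. M_ns P n p x * w x) x)"
      unfolding q4_def rn by (simp add: sum_distrib_left mult.assoc)
    also have "\<dots> = (\<Sum>i\<in>UNIV. rot n $ i * pd i (M_ns P n p) x) * w x + M_ns P n p x * (rot n \<bullet> ?g)"
      using smooth_differentiable[OF smooth_M_ns[OF p]] smooth_differentiable[OF w]
      by (simp add: pd_mult inner_vec_def sum_2 algebra_simps)
    finally show ?thesis
      unfolding V_n_eq[OF p] q2' by (simp add: q1_def sum_2 algebra_simps)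
  qed
  have eqm: "smean b c (\<lambda>x. q1 x + (\<sigma> / ?l) * q4 x) = smean b c (\<lambda>x. (V_n P n p x * w x + (-1) * q3 x) + q2 x)"
    unfolding pw by simp
  have "smean b c q1 + \<sigma> / ?l * smean b c q4 = smean b c (\<lambda>x. V_n P n p x * w x) - smean b c q3 + smean b c q2"
  proof -
    have "smean b c (\<lambda>x. q1 x + (\<sigma> / ?l) * q4 x) = smean b c q1 + smean b c (\<lambda>x. (\<sigma> / ?l) * q4 x)"
      by (intro smean_add cont smooth_cmult q1s q4s)
    moreover have Vs: "smooth (\<lambda>x. V_n P n p x * w x)" by (intro sm)
    moreover have "smean b c (\<lambda>x. (V_n P n p x * w x + (-1) * q3 x) + q2 x) = smean b c (\<lambda>x. V_n P n p x * w x + (-1) * q3 x) + smean b c q2"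
      by (intro smean_add cont smooth_add smooth_cmult Vs q2s q3s)
    moreover have "smean b c (\<lambda>x. V_n P n p x * w x + (-1) * q3 x) = smean b c (\<lambda>x. V_n P n p x * w x) + smean b c (\<lambda>x. (-1) * q3 x)"
      by (intro smean_add cont smooth_cmult Vs q3s)
    ultimately show ?thesis
      using eqm unfolding smean_cmult by linarith
  qed
  then have "?l * smean b c q1 - ?l * smean b c q2 = ?l * smean b c (\<lambda>x. V_n P n p x * w x) - ?l * smean b c q3 - \<sigma> * smean b c q4"
    using l by (simp add: field_simps)
  then show ?thesis using L1 L2 unfolding edge_term_def L3 L4 by (simp add: algebra_simps)
qed

text \<open>Two applications of the divergence theorem; the edge integrals are rewritten by \<open>edge_identity\<close>.\<close>

lemma elem_identity_smooth:
  fixes P :: plate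
  assumes D: "tdet a b c \<noteq> 0" and p: "smooth p" and w: "smooth w"
  defines "\<sigma> \<equiv> sgn (tdet a b c)"
  defines "vt \<equiv> (\<lambda>b c. M_ns P (edge_normal \<sigma> b c) p c * w c - M_ns P (edge_normal \<sigma> b c) p b * w b)"
  shows "- (\<Sum>i\<in>UNIV. \<Sum>j\<in>UNIV. LINT x|lebesgue_on (K3 a b c). moment_of P p x $ i $ j * pd j (pd i w) x)
    = (LINT x|lebesgue_on (K3 a b c). plate_op P p x * w x)
      + edge_term P (edge_normal \<sigma> b c) p b c w + edge_term P (edge_normal \<sigma> c a) p c a w + edge_term P (edge_normal \<sigma> a b) p a b w
      - \<sigma> * (vt b c + vt c a + vt a b)"
proof -
  let ?M = "lebesgue_on (K3 a b c)"
  have \<sigma>: "\<bar>\<sigma>\<bar> = 1" using D by (simp add: \<sigma>_def abs_sgn_eq)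
  have ne: "b \<noteq> c" "c \<noteq> a" "a \<noteq> b" using D by (auto simp: tdet_def)
  note sm = smooth_mult smooth_pd smooth_moment_of smooth_shear smooth_sum p w
  note df = smooth_differentiable[OF smooth_moment_of[OF p]] smooth_differentiable[OF smooth_shear[OF p]]
    smooth_differentiable[OF w] smooth_differentiable[OF smooth_pd[OF w]]
  have int: "integrable ?M f" if "smooth f" for f by (intro K3_integrable smooth_continuous that)
  let ?S = "\<lambda>b c. \<Sum>i\<in>UNIV. rot (c - b) $ i * smean b c (\<lambda>x. shear P p x $ i * w x)"
  let ?T = "\<lambda>b c. \<Sum>i\<in>UNIV. \<Sum>j\<in>UNIV. rot (c - b) $ j * smean b c (\<lambda>x. moment_of P p x $ i $ j * pd i w x)"
  have d1: "(LINT x|?M. pd j (\<lambda>x. moment_of P p x $ i $ j * pd i w x) x) = - \<sigma> *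
     (rot (c - b) $ j * smean b c (\<lambda>x. moment_of P p x $ i $ j * pd i w x)
      + rot (a - c) $ j * smean c a (\<lambda>x. moment_of P p x $ i $ j * pd i w x)
      + rot (b - a) $ j * smean a b (\<lambda>x. moment_of P p x $ i $ j * pd i w x))" for i j
    unfolding K3_def \<sigma>_def by (rule tri_divergence[OF D]) (intro sm)
  have S1: "(\<Sum>i\<in>UNIV. \<Sum>j\<in>UNIV. LINT x|?M. pd j (\<lambda>x. moment_of P p x $ i $ j * pd i w x) x) = - \<sigma> * (?T b c + ?T c a + ?T a b)"
    unfolding d1 by (simp add: sum_2 algebra_simps)
  have d2: "(LINT x|?M. pd i (\<lambda>x. shear P p x $ i * w x) x) = - \<sigma> *
     (rot (c - b) $ i * smean b c (\<lambda>x. shear P p x $ i * w x)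
      + rot (a - c) $ i * smean c a (\<lambda>x. shear P p x $ i * w x)
      + rot (b - a) $ i * smean a b (\<lambda>x. shear P p x $ i * w x))" for i
    unfolding K3_def \<sigma>_def by (rule tri_divergence[OF D]) (intro sm)
  have S2: "(\<Sum>i\<in>UNIV. LINT x|?M. pd i (\<lambda>x. shear P p x $ i * w x) x) = - \<sigma> * (?S b c + ?S c a + ?S a b)"
    unfolding d2 by (simp add: sum_2 algebra_simps)
  have "(\<Sum>i\<in>UNIV. LINT x|?M. pd i (\<lambda>x. shear P p x $ i * w x) x)
      - (\<Sum>i\<in>UNIV. \<Sum>j\<in>UNIV. LINT x|?M. pd j (\<lambda>x. moment_of P p x $ i $ j * pd i w x) x)
      = (LINT x|?M. (\<Sum>i\<in>UNIV. pd i (\<lambda>x. shear P p x $ i * w x) x)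
          - (\<Sum>i\<in>UNIV. \<Sum>j\<in>UNIV. pd j (\<lambda>x. moment_of P p x $ i $ j * pd i w x) x))"
    by (subst Bochner_Integration.integral_diff, (intro int sm)+)
       (simp add: Bochner_Integration.integral_sum int sm)
  also have "\<dots> = (LINT x|?M. - (plate_op P p x * w x) - (\<Sum>i\<in>UNIV. \<Sum>j\<in>UNIV. moment_of P p x $ i $ j * pd j (pd i w) x))"
  proof (intro Bochner_Integration.integral_cong refl)
    fix x
    have "(\<Sum>i\<in>UNIV. pd i (\<lambda>x. shear P p x $ i * w x) x) = (\<Sum>i\<in>UNIV. shear P p x $ i * pd i w x) - plate_op P p x * w x"
      by (simp add: pd_mult df plate_op_def sum_2 algebra_simps)
    moreover have "(\<Sum>i\<in>UNIV. \<Sum>j\<in>UNIV. pd j (\<lambda>x. moment_of P p x $ i $ j * pd i w x) x)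
       = (\<Sum>i\<in>UNIV. shear P p x $ i * pd i w x) + (\<Sum>i\<in>UNIV. \<Sum>j\<in>UNIV. moment_of P p x $ i $ j * pd j (pd i w) x)"
      by (simp add: pd_mult df shear_nth sum_2 algebra_simps)
    ultimately show "(\<Sum>i\<in>UNIV. pd i (\<lambda>x. shear P p x $ i * w x) x)
          - (\<Sum>i\<in>UNIV. \<Sum>j\<in>UNIV. pd j (\<lambda>x. moment_of P p x $ i $ j * pd i w x) x)
        = - (plate_op P p x * w x) - (\<Sum>i\<in>UNIV. \<Sum>j\<in>UNIV. moment_of P p x $ i $ j * pd j (pd i w) x)"
      by linarith
  qed
  also have "\<dots> = - (LINT x|?M. plate_op P p x * w x) - (\<Sum>i\<in>UNIV. \<Sum>j\<in>UNIV. LINT x|?M. moment_of P p x $ i $ j * pd j (pd i w) x)"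
  proof -
    have "integrable ?M (\<lambda>x. plate_op P p x * w x)" by (intro int sm smooth_plate_op)
    moreover have "integrable ?M (\<lambda>x. moment_of P p x $ i $ j * pd j (pd i w) x)" for i j by (intro int sm)
    ultimately show ?thesis by (simp add: sum_2)
  qed
  finally have main: "- (\<Sum>i\<in>UNIV. \<Sum>j\<in>UNIV. LINT x|?M. moment_of P p x $ i $ j * pd j (pd i w) x)
     = (LINT x|?M. plate_op P p x * w x) + - \<sigma> * (?S b c + ?S c a + ?S a b) - - \<sigma> * (?T b c + ?T c a + ?T a b)"
    unfolding S1 S2 by linarith
  have e: "- \<sigma> * (?S b c - ?T b c) = edge_term P (edge_normal \<sigma> b c) p b c w - \<sigma> * vt b c" if "b \<noteq> c" for b c
    unfolding vt_def by (rule edge_identity[OF p w that \<sigma>])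
  show ?thesis
    using main e[OF ne(1)] e[OF ne(2)] e[OF ne(3)] by (simp add: algebra_simps)
qed

section \<open>Passage to the limit on one element\<close>

lemma smean_tendsto:
  assumes u: "uniform_limit (closed_segment b c) f g sequentially" and f: "\<And>n. continuous_on UNIV (f n)"
  shows "(\<lambda>n. smean b c (f n)) \<longlonglongrightarrow> smean b c g"
proof -
  have seg: "b + s *\<^sub>R (c - b) \<in> closed_segment b c" if "s \<in> {0..1}" for s :: real
    unfolding in_segment using that by (intro exI[of _ s]) (auto simp: algebra_simps)
  have u': "uniform_limit {0..1} (\<lambda>n s. f n (b + s *\<^sub>R (c - b))) (\<lambda>s. g (b + s *\<^sub>R (c - b))) sequentially"
  proof (rule uniform_limitI)
    fix e :: real assume "e > 0"
    then have "\<forall>\<^sub>F n in sequentially. \<forall>x\<in>closed_segment b c. dist (f n x) (g x) < e" by (rule uniform_limitD[OF u])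
    then show "\<forall>\<^sub>F n in sequentially. \<forall>s\<in>{0..1}. dist (f n (b + s *\<^sub>R (c - b))) (g (b + s *\<^sub>R (c - b))) < e"
      by (rule eventually_mono) (use seg in blast)
  qed
  obtain I J where IJ: "\<And>n. ((\<lambda>s. f n (b + s *\<^sub>R (c - b))) has_integral I n) {0..1}"
    "((\<lambda>s. g (b + s *\<^sub>R (c - b))) has_integral J) {0..1}" "I \<longlonglongrightarrow> J"
    by (rule uniform_limit_integral[OF u' continuous_segment_map[OF f] sequentially_bot]) blast
  have "smean b c (f n) = I n" "smean b c g = J" for n
    unfolding smean_def by (intro integral_unique IJ)+
  then show ?thesis using IJ(3) by simp
qed

lemma L2_tendsto_uniform:
  fixes v :: "pt \<Rightarrow> real"
  assumes K: "compact K" and u: "uniform_limit K \<phi> v sequentially" and \<phi>: "\<And>n. smooth (\<phi> n)" and v: "L2 (lebesgue_on K) v"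
  shows "(\<lambda>n. L2norm (lebesgue_on K) (\<lambda>x. \<phi> n x - v x)) \<longlonglongrightarrow> 0"
proof -
  let ?M = "lebesgue_on K"
  have Km: "K \<in> sets lebesgue" using K by (simp add: compact_imp_closed)
  have fin: "finite_measure ?M"
    using K by (intro finite_measure_lebesgue_on lmeasurable_compact)
  have L: "L2 ?M (\<lambda>x. \<phi> n x - v x)" for n
    by (intro L2_diff v smooth_L2 compact_imp_bounded K Km \<phi>)
  define C where "C = sqrt (measure ?M (space ?M))"
  have C: "C \<ge> 0" by (simp add: C_def)
  show ?thesis
  proof (rule LIMSEQ_I)
    fix e :: real assume e: "e > 0"
    then have e': "e / (C + 1) > 0" using C by simp
    have "\<forall>\<^sub>F n in sequentially. \<forall>x\<in>K. dist (\<phi> n x) (v x) < e / (C + 1)" by (rule uniform_limitD[OF u e'])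
    then have "\<forall>\<^sub>F n in sequentially. L2norm ?M (\<lambda>x. \<phi> n x - v x) < e"
    proof (rule eventually_mono)
      fix n assume n: "\<forall>x\<in>K. dist (\<phi> n x) (v x) < e / (C + 1)"
      have "L2norm ?M (\<lambda>x. \<phi> n x - v x) \<le> e / (C + 1) * C"
        unfolding C_def[symmetric] using n e'
        by (subst C_def, intro L2norm_bound[OF fin L2_measurable[OF L]]) (auto simp: dist_real_def less_imp_le)
      also have "\<dots> < e" using e C by (simp add: field_simps)
      finally show "L2norm ?M (\<lambda>x. \<phi> n x - v x) < e" .
    qed
    then show "\<exists>no. \<forall>n\<ge>no. norm (L2norm ?M (\<lambda>x. \<phi> n x - v x) - 0) < e"
      by (simp add: eventually_sequentially L2norm_nonneg)
  qed
qed

text \<open>A convex set with interior is the closure of its interior and has negligible frontier; contraction towards an interior point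
  moves it into its interior.\<close>

lemma K3_domain:
  assumes T: "nice_tri \<kappa> a b c" and int: "interior (K3 a b c) \<subseteq> \<Omega>"
  shows "K3 a b c \<subseteq> closure \<Omega>" "negligible (K3 a b c - \<Omega>)"
    "\<exists>z. \<forall>t x. 1/2 \<le> t \<longrightarrow> t < 1 \<longrightarrow> x \<in> K3 a b c \<longrightarrow> t *\<^sub>R x + (1 - t) *\<^sub>R z \<in> \<Omega>"
proof -
  let ?K = "K3 a b c"
  have cv: "convex ?K" by (simp add: K3_def)
  have cl: "closed ?K" using K3_facts(1) by (rule compact_imp_closed)
  obtain z r where r: "r > 0" "cball z r \<subseteq> ?K" using T by (auto simp: nice_tri_def K3_def)
  have z: "z \<in> interior ?K" using r by (meson ball_subset_cball centre_in_ball interior_maximal open_ball order_trans subsetD)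
  have "?K = closure (interior ?K)" using convex_closure_interior[OF cv] z cl by auto
  then show "?K \<subseteq> closure \<Omega>" using closure_mono[OF int] by simp
  have "?K - \<Omega> \<subseteq> frontier ?K" using int cl by (auto simp: frontier_def)
  then show "negligible (?K - \<Omega>)" using negligible_convex_frontier[OF cv] negligible_subset by blast
  have "t *\<^sub>R x + (1 - t) *\<^sub>R z \<in> \<Omega>" if "1/2 \<le> t" "t < 1" "x \<in> ?K" for t x
  proof -
    have "x - (1 - t) *\<^sub>R (x - z) \<in> interior ?K"
      by (rule mem_interior_convex_shrink[OF cv z that(3)]) (use that in auto)
    moreover have "x - (1 - t) *\<^sub>R (x - z) = t *\<^sub>R x + (1 - t) *\<^sub>R z" by (simp add: algebra_simps)
    ultimately show ?thesis using int by auto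
  qed
  then show "\<exists>z. \<forall>t x. 1/2 \<le> t \<longrightarrow> t < 1 \<longrightarrow> x \<in> ?K \<longrightarrow> t *\<^sub>R x + (1 - t) *\<^sub>R z \<in> \<Omega>" by blast
qed

text \<open>The mean over the edge opposite to \<open>a\<close> of a function times \<open>\<psi>\<close>, expressed by the function and its
  gradient in the interior. It serves as trace functional for Sobolev functions.\<close>

definition Tr :: "pt \<Rightarrow> pt \<Rightarrow> pt \<Rightarrow> (pt \<Rightarrow> real) \<Rightarrow> (pt \<Rightarrow> real) \<Rightarrow> (pt \<Rightarrow> pt) \<Rightarrow> real" where
  "Tr a b c \<psi> w G = ((\<Sum>i\<in>UNIV. LINT x|lebesgue_on (K3 a b c). ((x - a) $ i * \<psi> x) * G x $ i)
     + (LINT x|lebesgue_on (K3 a b c). ((\<Sum>i\<in>UNIV. (x - a) $ i * pd i \<psi> x) + 2 * \<psi> x) * w x)) / \<bar>tdet a b c\<bar>"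

lemma smooth_component: "smooth (\<lambda>x. (x - a) $ i)"
  by (simp add: smooth_diff smooth_const smooth_coord)

lemma Tr_smooth:
  assumes D: "tdet a b c \<noteq> 0" and \<psi>: "smooth \<psi>" and w: "smooth w"
  shows "Tr a b c \<psi> w (\<lambda>x. \<chi> i. pd i w x) = smean b c (\<lambda>x. \<psi> x * w x)"
proof -
  let ?M = "lebesgue_on (K3 a b c)"
  note sm = smooth_mult smooth_add smooth_sum smooth_const smooth_component smooth_pd \<psi> w
  have int: "integrable ?M f" if "smooth f" for f by (intro K3_integrable smooth_continuous that)
  have "\<bar>tdet a b c\<bar> * smean b c (\<lambda>x. \<psi> x * w x)
     = (LINT x|?M. (\<Sum>i\<in>UNIV. (x - a) $ i * pd i (\<lambda>x. \<psi> x * w x) x) + 2 * (\<psi> x * w x))"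
    unfolding K3_def by (rule tri_trace[OF D]) (intro sm)
  also have "\<dots> = (LINT x|?M. (\<Sum>i\<in>UNIV. ((x - a) $ i * \<psi> x) * pd i w x) + ((\<Sum>i\<in>UNIV. (x - a) $ i * pd i \<psi> x) + 2 * \<psi> x) * w x)"
    using smooth_differentiable[OF \<psi>] smooth_differentiable[OF w]
    by (intro Bochner_Integration.integral_cong refl) (simp add: pd_mult sum_2 algebra_simps)
  also have "\<dots> = (\<Sum>i\<in>UNIV. LINT x|?M. ((x - a) $ i * \<psi> x) * pd i w x) + (LINT x|?M. ((\<Sum>i\<in>UNIV. (x - a) $ i * pd i \<psi> x) + 2 * \<psi> x) * w x)"
    by (subst Bochner_Integration.integral_add, (intro int sm)+) (simp only: Bochner_Integration.integral_sum int sm)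
  finally show ?thesis using D by (simp add: Tr_def field_simps)
qed

lemma Tr_tendsto:
  assumes \<psi>: "smooth \<psi>" and w: "L2 (lebesgue_on (K3 a b c)) w" and G: "\<And>i. L2 (lebesgue_on (K3 a b c)) (\<lambda>x. G x $ i)"
    and wn: "\<And>n. smooth (wn n)"
    and lw: "(\<lambda>n. L2norm (lebesgue_on (K3 a b c)) (\<lambda>x. wn n x - w x)) \<longlonglongrightarrow> 0"
    and lG: "\<And>i. (\<lambda>n. L2norm (lebesgue_on (K3 a b c)) (\<lambda>x. pd i (wn n) x - G x $ i)) \<longlonglongrightarrow> 0"
  shows "(\<lambda>n. Tr a b c \<psi> (wn n) (\<lambda>x. \<chi> i. pd i (wn n) x)) \<longlonglongrightarrow> Tr a b c \<psi> w G"
proof (cases "tdet a b c = 0")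
  case False
  let ?M = "lebesgue_on (K3 a b c)"
  have sL: "L2 ?M f" if "smooth f" for f by (intro smooth_L2 K3_facts compact_imp_bounded that)
  have 1: "(\<lambda>n. LINT x|?M. ((x - a) $ i * \<psi> x) * pd i (wn n) x) \<longlonglongrightarrow> (LINT x|?M. ((x - a) $ i * \<psi> x) * G x $ i)" for i
    by (rule L2_tendsto_integral_mult[OF sL G sL lG]) (intro smooth_mult smooth_component \<psi> smooth_pd wn)+
  have 2: "(\<lambda>n. LINT x|?M. ((\<Sum>i\<in>UNIV. (x - a) $ i * pd i \<psi> x) + 2 * \<psi> x) * wn n x)
      \<longlonglongrightarrow> (LINT x|?M. ((\<Sum>i\<in>UNIV. (x - a) $ i * pd i \<psi> x) + 2 * \<psi> x) * w x)"
    by (rule L2_tendsto_integral_mult[OF sL w sL lw])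
      (intro smooth_add smooth_sum smooth_const smooth_mult smooth_component \<psi> smooth_pd wn)+
  show ?thesis unfolding Tr_def using False by (intro tendsto_intros) (use 1 2 in simp_all)
qed (simp add: Tr_def)

text \<open>The integral of \<open>\<psi> \<partial>\<^sub>n v\<close> over the edge divided by its length, for \<open>v\<close> in \<open>H2\<close>.\<close>

definition NTr :: "pt set \<Rightarrow> pt \<Rightarrow> pt \<Rightarrow> pt \<Rightarrow> pt \<Rightarrow> (pt \<Rightarrow> real) \<Rightarrow> (pt \<Rightarrow> real) \<Rightarrow> real" where
  "NTr \<Omega> a b c n \<psi> v = (\<Sum>i\<in>UNIV. n $ i * Tr a b c \<psi> (\<lambda>x. wgrad \<Omega> v x $ i) (\<lambda>x. whess \<Omega> v x $ i))"

text \<open>A triangle inside the domain, a function in \<open>H2\<close>, and a sequence of smooth functions that approximates it on the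
  triangle in the sense of \<open>H2_approx\<close>. Identities and inequalities for smooth functions pass to the limit along this sequence.\<close>

locale element =
  fixes \<Omega> :: "pt set" and \<kappa> :: real and a b c :: pt and v :: "pt \<Rightarrow> real" and \<phi> :: "nat \<Rightarrow> pt \<Rightarrow> real"
  assumes \<Omega>: "open \<Omega>" "bounded \<Omega>" and T: "nice_tri \<kappa> a b c" and int: "interior (K3 a b c) \<subseteq> \<Omega>"
    and v: "v \<in> H2 \<Omega>" and vc: "continuous_on (closure \<Omega>) v"
    and \<phi>s: "\<And>n. smooth (\<phi> n)" and \<phi>u: "uniform_limit (K3 a b c) \<phi> v sequentially"
    and \<phi>1: "\<And>i. (\<lambda>n. L2norm (lebesgue_on (K3 a b c)) (\<lambda>x. pd i (\<phi> n) x - wgrad \<Omega> v x $ i)) \<longlonglongrightarrow> 0"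
    and \<phi>2: "\<And>i j. (\<lambda>n. L2norm (lebesgue_on (K3 a b c)) (\<lambda>x. pd j (pd i (\<phi> n)) x - whess \<Omega> v x $ i $ j)) \<longlonglongrightarrow> 0"
begin

abbreviation "M \<equiv> lebesgue_on (K3 a b c)"

lemma rotate: "element \<Omega> \<kappa> b c a v \<phi>"
proof -
  have "K3 b c a = K3 a b c" by (rule K3_rotate)
  then show ?thesis
    using \<Omega> nice_tri_rotate[OF T] int v vc \<phi>s \<phi>u \<phi>1 \<phi>2 by unfold_locales simp_all
qed

lemma \<Omega>m: "\<Omega> \<in> sets lebesgue" using \<Omega> by simp
lemma D: "tdet a b c \<noteq> 0" and bc: "b \<noteq> c" using nice_triD[OF T] by auto

lemma sub: "L2 (lebesgue_on \<Omega>) (f :: pt \<Rightarrow> 'b::euclidean_space) \<Longrightarrow> L2 M f"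
  by (rule L2_subdomain[OF \<Omega>m K3_facts(5) K3_domain(2)[OF T int]])

lemma smooth_L2_M: "smooth f \<Longrightarrow> L2 M f"
  by (intro smooth_L2 K3_facts compact_imp_bounded)

lemma v_L2: "L2 M v" and grad_L2: "L2 M (\<lambda>x. wgrad \<Omega> v x $ i)" and hess_L2: "L2 M (whess \<Omega> v)"
  and hess_ij: "L2 M (\<lambda>x. whess \<Omega> v x $ i $ j)"
  by (intro sub L2_vec_nth H2D[OF v])+

lemma \<phi>0: "(\<lambda>n. L2norm M (\<lambda>x. \<phi> n x - v x)) \<longlonglongrightarrow> 0"
  by (rule L2_tendsto_uniform[OF K3_facts(1) \<phi>u \<phi>s v_L2])

lemma v_cont: "continuous_on (K3 a b c) v"
  by (rule continuous_on_subset[OF vc K3_domain(1)[OF T int]])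

lemma NTr_limit:
  assumes \<psi>: "smooth \<psi>"
  shows "(\<lambda>k. \<Sum>i\<in>UNIV. n $ i * smean b c (\<lambda>x. \<psi> x * pd i (\<phi> k) x)) \<longlonglongrightarrow> NTr \<Omega> a b c n \<psi> v"
  unfolding NTr_def
proof (intro tendsto_sum tendsto_mult tendsto_const)
  fix i
  have "(\<lambda>k. Tr a b c \<psi> (pd i (\<phi> k)) (\<lambda>x. \<chi> j. pd j (pd i (\<phi> k)) x)) \<longlonglongrightarrow> Tr a b c \<psi> (\<lambda>x. wgrad \<Omega> v x $ i) (\<lambda>x. whess \<Omega> v x $ i)"
    by (rule Tr_tendsto[OF \<psi> grad_L2 hess_ij smooth_pd[OF \<phi>s] \<phi>1 \<phi>2])
  then show "(\<lambda>k. smean b c (\<lambda>x. \<psi> x * pd i (\<phi> k) x)) \<longlonglongrightarrow> Tr a b c \<psi> (\<lambda>x. wgrad \<Omega> v x $ i) (\<lambda>x. whess \<Omega> v x $ i)"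
    by (simp add: Tr_smooth[OF D \<psi> smooth_pd[OF \<phi>s]])
qed

lemma u_segment: "uniform_limit (closed_segment b c) \<phi> v sequentially"
  by (rule uniform_limit_on_subset[OF \<phi>u K3_facts(6)])

lemma bounded_segment: "continuous_on (K3 a b c) f \<Longrightarrow> bounded (f ` closed_segment b c)"
  by (intro compact_imp_bounded compact_continuous_image compact_segment continuous_on_subset[OF _ K3_facts(6)])

lemma smean_mult_limit:
  assumes \<psi>: "smooth \<psi>"
  shows "(\<lambda>k. smean b c (\<lambda>x. \<psi> x * \<phi> k x)) \<longlonglongrightarrow> smean b c (\<lambda>x. \<psi> x * v x)"
proof (rule smean_tendsto)
  show "uniform_limit (closed_segment b c) (\<lambda>k x. \<psi> x * \<phi> k x) (\<lambda>x. \<psi> x * v x) sequentially"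
    by (rule uniform_lim_mult[OF uniform_limit_const u_segment bounded_segment[OF smooth_continuous[OF \<psi>]] bounded_segment[OF v_cont]])
qed (intro smooth_continuous smooth_mult \<psi> \<phi>s)

lemma smean_square_limit: "(\<lambda>k. smean b c (\<lambda>x. (\<phi> k x)\<^sup>2)) \<longlonglongrightarrow> smean b c (\<lambda>x. (v x)\<^sup>2)"
proof (rule smean_tendsto)
  show "uniform_limit (closed_segment b c) (\<lambda>k x. (\<phi> k x)\<^sup>2) (\<lambda>x. (v x)\<^sup>2) sequentially"
    unfolding power2_eq_square
    by (rule uniform_lim_mult[OF u_segment u_segment bounded_segment[OF v_cont] bounded_segment[OF v_cont]])
qed (intro smooth_continuous smooth_power \<phi>s)

lemma edge_term_limit:
  assumes p: "smooth p"
  shows "(\<lambda>k. edge_term P n p b c (\<phi> k)) \<longlonglongrightarrow> dist b c * smean b c (\<lambda>x. V_n P n p x * v x) - dist b c * NTr \<Omega> a b c n (M_nn P n p) v"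
  unfolding edge_term_def
  by (intro tendsto_intros NTr_limit smean_mult_limit smooth_V_n smooth_M_nn p)

definition "B = (L2norm M v)\<^sup>2 / diameter (K3 a b c) ^ 4 + (L2norm M (whess \<Omega> v))\<^sup>2"

lemma B_limit:
  "(\<lambda>n. (LINT x|M. (\<phi> n x)\<^sup>2) / diameter (K3 a b c) ^ 4 + (LINT x|M. hsq (\<phi> n) x)) \<longlonglongrightarrow> B"
proof -
  have sq: "(LINT x|M. (f x)\<^sup>2) = (L2norm M f)\<^sup>2" for f :: "pt \<Rightarrow> real" by (simp add: L2norm_sq)
  have h: "(LINT x|M. hsq (\<phi> n) x) = (\<Sum>i\<in>UNIV. \<Sum>j\<in>UNIV. (L2norm M (pd j (pd i (\<phi> n))))\<^sup>2)" for n
    unfolding sq[symmetric]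
    by (subst Bochner_Integration.integral_sum, (intro K3_integrable smooth_continuous smooth_gsq smooth_pd \<phi>s))
      (simp only: Bochner_Integration.integral_sum K3_integrable smooth_continuous smooth_power smooth_pd \<phi>s)
  have w: "(L2norm M (whess \<Omega> v))\<^sup>2 = (\<Sum>i\<in>UNIV. \<Sum>j\<in>UNIV. (L2norm M (\<lambda>x. whess \<Omega> v x $ i $ j))\<^sup>2)"
    by (simp add: L2norm_sq_vec[OF hess_L2] L2norm_sq_vec[OF L2_vec_nth[OF hess_L2]])
  show ?thesis
    unfolding B_def sq h w
    by (intro tendsto_add tendsto_divide tendsto_power tendsto_sum tendsto_const
        L2norm_tendsto[OF v_L2 smooth_L2_M[OF \<phi>s] \<phi>0]
        L2norm_tendsto[OF hess_ij smooth_L2_M[OF smooth_pd[OF smooth_pd[OF \<phi>s]]] \<phi>2])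
      (use nice_triD(3)[OF T] in \<open>simp add: K3_def\<close>)
qed

lemma edge_bound: "dist b c * smean b c (\<lambda>x. (v x)\<^sup>2) \<le> C_trace \<kappa> * diameter (K3 a b c) ^ 3 * B"
  by (rule LIMSEQ_le[OF tendsto_mult[OF tendsto_const smean_square_limit] tendsto_mult[OF tendsto_const B_limit]])
    (use edge_bounds_smooth(1)[OF T \<phi>s] in auto)

lemma NTr_bound:
  assumes \<psi>: "smooth \<psi>" and n: "norm n = 1"
  shows "\<bar>dist b c * NTr \<Omega> a b c n \<psi> v\<bar> \<le> L2norm (arc (closed_segment b c)) \<psi> * sqrt (C_trace \<kappa> * diameter (K3 a b c) * B)"
proof (rule LIMSEQ_le)
  let ?A = "arc (closed_segment b c)"
  let ?Bn = "\<lambda>k. (LINT x|M. (\<phi> k x)\<^sup>2) / diameter (K3 a b c) ^ 4 + (LINT x|M. hsq (\<phi> k) x)"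
  show "(\<lambda>k. \<bar>dist b c * (\<Sum>i\<in>UNIV. n $ i * smean b c (\<lambda>x. \<psi> x * pd i (\<phi> k) x))\<bar>) \<longlonglongrightarrow> \<bar>dist b c * NTr \<Omega> a b c n \<psi> v\<bar>"
    by (intro tendsto_intros NTr_limit \<psi>)
  show "(\<lambda>k. L2norm ?A \<psi> * sqrt (C_trace \<kappa> * diameter (K3 a b c) * ?Bn k)) \<longlonglongrightarrow> L2norm ?A \<psi> * sqrt (C_trace \<kappa> * diameter (K3 a b c) * B)"
    by (intro tendsto_mult tendsto_const tendsto_real_sqrt B_limit)
  have "\<bar>dist b c * (\<Sum>i\<in>UNIV. n $ i * smean b c (\<lambda>x. \<psi> x * pd i (\<phi> k) x))\<bar>
      \<le> L2norm ?A \<psi> * sqrt (C_trace \<kappa> * diameter (K3 a b c) * ?Bn k)" for k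
  proof -
    define g where "g = (\<lambda>x. \<Sum>i\<in>UNIV. n $ i * pd i (\<phi> k) x)"
    have gs: "smooth g" unfolding g_def by (intro smooth_sum smooth_mult smooth_const smooth_pd \<phi>s)
    have "(\<Sum>i\<in>UNIV. n $ i * smean b c (\<lambda>x. \<psi> x * pd i (\<phi> k) x)) = smean b c (\<lambda>x. n $ 1 * (\<psi> x * pd 1 (\<phi> k) x) + n $ 2 * (\<psi> x * pd 2 (\<phi> k) x))"
      unfolding sum_2 smean_cmult[symmetric]
      by (rule smean_add[symmetric]) (intro smooth_continuous smooth_cmult smooth_mult \<psi> smooth_pd \<phi>s)+
    also have "\<dots> = smean b c (\<lambda>x. \<psi> x * g x)" by (simp add: g_def sum_2 algebra_simps)
    finally have "dist b c * (\<Sum>i\<in>UNIV. n $ i * smean b c (\<lambda>x. \<psi> x * pd i (\<phi> k) x)) = (LINT x|?A. \<psi> x * g x)"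
      by (simp add: arc_smean[OF bc smooth_continuous[OF smooth_mult[OF \<psi> gs]]])
    also have "\<bar>\<dots>\<bar> \<le> L2norm ?A \<psi> * L2norm ?A g"
      by (rule L2norm_mult_le[OF L2_arc_smooth[OF bc \<psi>] L2_arc_smooth[OF bc gs]])
    also have "L2norm ?A g \<le> sqrt (C_trace \<kappa> * diameter (K3 a b c) * ?Bn k)"
    proof (rule real_le_rsqrt)
      have "(L2norm ?A g)\<^sup>2 = dist b c * smean b c (\<lambda>x. (g x)\<^sup>2)"
        by (simp add: L2norm_sq arc_smean[OF bc smooth_continuous[OF smooth_power[OF gs]]])
      also have "\<dots> \<le> dist b c * smean b c (gsq (\<phi> k))"
      proof (intro mult_left_mono smean_mono smooth_continuous smooth_power gs smooth_gsq \<phi>s)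
        fix x
        have "\<bar>g x\<bar> \<le> sqrt (gsq (\<phi> k) x)"
          using cs_pt[of n "\<lambda>i. pd i (\<phi> k) x"] cs_pt[of "- n" "\<lambda>i. pd i (\<phi> k) x"] n
          by (simp add: g_def sum_negf)
        then have "\<bar>g x\<bar>\<^sup>2 \<le> (sqrt (gsq (\<phi> k) x))\<^sup>2" by (intro power_mono) auto
        then show "(g x)\<^sup>2 \<le> gsq (\<phi> k) x" by (simp add: sum_nonneg)
      qed simp
      also have "\<dots> \<le> C_trace \<kappa> * diameter (K3 a b c) * ?Bn k" by (rule edge_bounds_smooth(2)[OF T \<phi>s])
      finally show "(L2norm ?A g)\<^sup>2 \<le> C_trace \<kappa> * diameter (K3 a b c) * ?Bn k" .
    qed
    finally show ?thesis by (simp add: mult_left_mono L2norm_nonneg)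
  qed
  then show "\<exists>N. \<forall>k\<ge>N. \<bar>dist b c * (\<Sum>i\<in>UNIV. n $ i * smean b c (\<lambda>x. \<psi> x * pd i (\<phi> k) x))\<bar>
      \<le> L2norm ?A \<psi> * sqrt (C_trace \<kappa> * diameter (K3 a b c) * ?Bn k)" by blast
qed

definition edge_value :: "plate \<Rightarrow> (pt \<Rightarrow> real) \<Rightarrow> real" where
  "edge_value P p = (let n = edge_normal (sgn (tdet a b c)) b c in
     dist b c * smean b c (\<lambda>x. V_n P n p x * v x) - dist b c * NTr \<Omega> a b c n (M_nn P n p) v)"

end

text \<open>The limit of \<open>elem_identity_smooth\<close>. The vertex terms disappear in the limit because \<open>v\<close> vanishes at the vertices.\<close>

lemma element_identity:
  fixes P :: plate
  assumes E: "element \<Omega> \<kappa> a b c v \<phi>" and p: "smooth p" and v0: "v a = 0" "v b = 0" "v c = 0"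
  shows "(LINT x|lebesgue_on (K3 a b c). moment_of P p x \<bullet> curvature (whess \<Omega> v x))
    = (LINT x|lebesgue_on (K3 a b c). plate_op P p x * v x)
      + element.edge_value \<Omega> a b c v P p + element.edge_value \<Omega> b c a v P p + element.edge_value \<Omega> c a b v P p"
proof -
  interpret E: element \<Omega> \<kappa> a b c v \<phi> by (rule E)
  interpret E2: element \<Omega> \<kappa> b c a v \<phi> by (rule E.rotate)
  interpret E3: element \<Omega> \<kappa> c a b v \<phi> by (rule E2.rotate)
  let ?M = "lebesgue_on (K3 a b c)"
  let ?\<sigma> = "sgn (tdet a b c)"
  have \<sigma>: "sgn (tdet b c a) = ?\<sigma>" "sgn (tdet c a b) = ?\<sigma>"
    using tdet_rotate[of b c a] tdet_rotate[of c a b] by simp_all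
  have sL: "L2 ?M f" if "smooth f" for f by (rule E.smooth_L2_M[OF that])
  have lhs: "(LINT x|?M. moment_of P p x \<bullet> curvature (whess \<Omega> v x))
     = - (\<Sum>i\<in>UNIV. \<Sum>j\<in>UNIV. LINT x|?M. moment_of P p x $ i $ j * whess \<Omega> v x $ i $ j)"
  proof -
    have "integrable ?M (\<lambda>x. moment_of P p x $ i $ j * whess \<Omega> v x $ i $ j)" for i j
      by (intro L2_integrable_mult sL E.hess_ij smooth_moment_of p)
    then show ?thesis
      by (simp add: moment_of_def moment_inner_curvature Bochner_Integration.integral_sum)
  qed
  have l1: "(\<lambda>k. - (\<Sum>i\<in>UNIV. \<Sum>j\<in>UNIV. LINT x|?M. moment_of P p x $ i $ j * pd j (pd i (\<phi> k)) x))
      \<longlonglongrightarrow> - (\<Sum>i\<in>UNIV. \<Sum>j\<in>UNIV. LINT x|?M. moment_of P p x $ i $ j * whess \<Omega> v x $ i $ j)"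
    by (intro tendsto_minus tendsto_sum L2_tendsto_integral_mult[OF sL E.hess_ij sL E.\<phi>2] smooth_moment_of p smooth_pd E.\<phi>s)
  have l2: "(\<lambda>k. LINT x|?M. plate_op P p x * \<phi> k x) \<longlonglongrightarrow> (LINT x|?M. plate_op P p x * v x)"
    by (intro L2_tendsto_integral_mult[OF sL E.v_L2 sL E.\<phi>0] smooth_plate_op p E.\<phi>s)
  have pt: "(\<lambda>k. \<phi> k y) \<longlonglongrightarrow> 0" if "y \<in> {a, b, c}" for y
  proof -
    have "y \<in> K3 a b c" "v y = 0" using that K3_facts(2,3,4) v0 by auto
    then show ?thesis using tendsto_uniform_limitI[OF E.\<phi>u] by fastforce
  qed
  define vt where "vt = (\<lambda>k b c. M_ns P (edge_normal ?\<sigma> b c) p c * \<phi> k c - M_ns P (edge_normal ?\<sigma> b c) p b * \<phi> k b)"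
  have l3: "(\<lambda>k. vt k y z) \<longlonglongrightarrow> 0" if "y \<in> {a, b, c}" "z \<in> {a, b, c}" for y z
    unfolding vt_def using tendsto_diff[OF tendsto_mult_right_zero[OF pt[OF that(2)]] tendsto_mult_right_zero[OF pt[OF that(1)]]]
    by simp
  let ?t = "\<lambda>k. (LINT x|?M. plate_op P p x * \<phi> k x)
      + edge_term P (edge_normal ?\<sigma> b c) p b c (\<phi> k) + edge_term P (edge_normal ?\<sigma> c a) p c a (\<phi> k) + edge_term P (edge_normal ?\<sigma> a b) p a b (\<phi> k)
      - ?\<sigma> * (vt k b c + vt k c a + vt k a b)"
  have "?t \<longlonglongrightarrow> (LINT x|?M. plate_op P p x * v x)
      + E.edge_value P p + E2.edge_value P p + E3.edge_value P p - ?\<sigma> * (0 + 0 + 0)"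
    unfolding E.edge_value_def E2.edge_value_def E3.edge_value_def \<sigma> Let_def
    by (intro tendsto_add tendsto_diff tendsto_mult tendsto_const l2 l3 E.edge_term_limit E2.edge_term_limit E3.edge_term_limit p) auto
  moreover have "?t = (\<lambda>k. - (\<Sum>i\<in>UNIV. \<Sum>j\<in>UNIV. LINT x|?M. moment_of P p x $ i $ j * pd j (pd i (\<phi> k)) x))"
    unfolding vt_def using elem_identity_smooth[OF E.D p E.\<phi>s] by simp
  ultimately show ?thesis unfolding lhs using LIMSEQ_unique[OF l1] by simp
qed

lemma element_exists:
  assumes \<Omega>: "open \<Omega>" "bounded \<Omega>" and T: "nice_tri \<kappa> a b c" and int: "interior (K3 a b c) \<subseteq> \<Omega>"
    and v: "v \<in> H2 \<Omega>" "continuous_on (closure \<Omega>) v"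
  shows "\<exists>\<phi>. element \<Omega> \<kappa> a b c v \<phi>"
proof -
  note d = K3_domain[OF T int]
  obtain z where z: "\<And>t x. 1/2 \<le> t \<Longrightarrow> t < 1 \<Longrightarrow> x \<in> K3 a b c \<Longrightarrow> t *\<^sub>R x + (1 - t) *\<^sub>R z \<in> \<Omega>"
    using d(3) by blast
  obtain \<phi> where "\<And>n. smooth (\<phi> n)" "uniform_limit (K3 a b c) \<phi> v sequentially"
    "\<And>i. (\<lambda>n. L2norm (lebesgue_on (K3 a b c)) (\<lambda>x. pd i (\<phi> n) x - wgrad \<Omega> v x $ i)) \<longlonglongrightarrow> 0"
    "\<And>i j. (\<lambda>n. L2norm (lebesgue_on (K3 a b c)) (\<lambda>x. pd j (pd i (\<phi> n)) x - whess \<Omega> v x $ i $ j)) \<longlonglongrightarrow> 0"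
    by (rule H2_approx[OF \<Omega> K3_facts(1) d(2) d(1) z v]) blast+
  then have "element \<Omega> \<kappa> a b c v \<phi>" using \<Omega> T int v by unfold_locales auto
  then show ?thesis by blast
qed

section \<open>Normal derivatives on interior and clamped edges\<close>

lemma L2norm_subset:
  fixes f :: "pt \<Rightarrow> 'b::euclidean_space"
  assumes S: "S \<in> sets lebesgue" "T \<in> sets lebesgue" "negligible (S - T)" and f: "L2 (lebesgue_on T) f"
  shows "L2norm (lebesgue_on S) f \<le> L2norm (lebesgue_on T) f"
  unfolding L2_restrict_iff(2)[OF S(1)] L2_restrict_iff(2)[OF S(2)]
proof (rule L2norm_mono_AE)
  show "L2 lebesgue (\<lambda>x. indicator T x *\<^sub>R f x)" using f unfolding L2_restrict_iff(1)[OF S(2)] .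
  show "(\<lambda>x. indicator S x *\<^sub>R f x) \<in> borel_measurable lebesgue"
    using L2_subdomain[OF S(2,1,3) f] unfolding L2_restrict_iff(1)[OF S(1)] by (rule L2_measurable)
  show "AE x in lebesgue. norm (indicator S x *\<^sub>R f x) \<le> norm (indicator T x *\<^sub>R f x)"
    by (rule AE_lebesgue_negligible[OF S(3)]) (auto simp: indicator_def)
qed

lemma L2norm_tendsto_subset:
  fixes f :: "nat \<Rightarrow> pt \<Rightarrow> real"
  assumes "S \<in> sets lebesgue" "T \<in> sets lebesgue" "negligible (S - T)" "\<And>n. L2 (lebesgue_on T) (f n)"
    "(\<lambda>n. L2norm (lebesgue_on T) (f n)) \<longlonglongrightarrow> 0"
  shows "(\<lambda>n. L2norm (lebesgue_on S) (f n)) \<longlonglongrightarrow> 0"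
  using L2norm_subset[OF assms(1-3) assms(4)]
  by (intro Lim_null_comparison[OF _ assms(5)]) (simp add: L2norm_nonneg)

text \<open>Two triangles on both sides of an edge interior to the domain see the same trace, because both
  traces are the limit for one approximating sequence on the union of the triangles.\<close>

lemma Tr_match:
  assumes \<Omega>: "open \<Omega>" "bounded \<Omega>" and D: "tdet a b c \<noteq> 0" "tdet a' b c \<noteq> 0"
    and star: "\<And>t x. 1/2 \<le> t \<Longrightarrow> t < 1 \<Longrightarrow> x \<in> K3 a b c \<union> K3 a' b c \<Longrightarrow> t *\<^sub>R x + (1 - t) *\<^sub>R z \<in> \<Omega>"
    and neg: "negligible (K3 a b c - \<Omega>)" "negligible (K3 a' b c - \<Omega>)"
    and w: "L2 (lebesgue_on \<Omega>) w" and G: "has_weak_grad \<Omega> w G" and \<psi>: "smooth \<psi>"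
  shows "Tr a b c \<psi> w G = Tr a' b c \<psi> w G"
proof -
  let ?U = "K3 a b c \<union> K3 a' b c"
  have \<Omega>m: "\<Omega> \<in> sets lebesgue" using \<Omega> by simp
  have U: "compact ?U" "negligible (?U - \<Omega>)" "?U \<in> sets lebesgue"
    using K3_facts(1) K3_facts(5) neg by (auto simp: Un_Diff)
  obtain \<phi> where \<phi>: "\<And>n. smooth (\<phi> n)"
    "(\<lambda>n. L2norm (lebesgue_on ?U) (\<lambda>x. \<phi> n x - w x)) \<longlonglongrightarrow> 0"
    "\<And>i. (\<lambda>n. L2norm (lebesgue_on ?U) (\<lambda>x. pd i (\<phi> n) x - G x $ i)) \<longlonglongrightarrow> 0"
    by (rule H1_approx[OF \<Omega> U(1,2) star w G]) blast+
  have GL: "L2 (lebesgue_on \<Omega>) (\<lambda>x. G x $ i)" for i by (rule L2_vec_nth[OF has_weak_gradD(1)[OF G]])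
  have sub: "L2 (lebesgue_on S) f" if "S \<in> sets lebesgue" "negligible (S - \<Omega>)" "L2 (lebesgue_on \<Omega>) f" for S and f :: "pt \<Rightarrow> real"
    by (rule L2_subdomain[OF \<Omega>m that])
  have sU: "L2 (lebesgue_on ?U) f" if "smooth f" for f by (intro smooth_L2 compact_imp_bounded U that)
  have lim: "(\<lambda>n. smean b c (\<lambda>x. \<psi> x * \<phi> n x)) \<longlonglongrightarrow> Tr d b c \<psi> w G"
    if d: "tdet d b c \<noteq> 0" "K3 d b c \<subseteq> ?U" for d
  proof -
    have n: "negligible (K3 d b c - \<Omega>)" "negligible (K3 d b c - ?U)"
      using d(2) U(2) by (auto intro: negligible_subset)
    have "(\<lambda>n. Tr d b c \<psi> (\<phi> n) (\<lambda>x. \<chi> i. pd i (\<phi> n) x)) \<longlonglongrightarrow> Tr d b c \<psi> w G"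
    proof (rule Tr_tendsto[OF \<psi> sub[OF K3_facts(5) n(1) w] sub[OF K3_facts(5) n(1) GL] \<phi>(1)])
      show "(\<lambda>n. L2norm (lebesgue_on (K3 d b c)) (\<lambda>x. \<phi> n x - w x)) \<longlonglongrightarrow> 0"
        by (rule L2norm_tendsto_subset[OF K3_facts(5) U(3) n(2) L2_diff[OF sU[OF \<phi>(1)] sub[OF U(3,2) w]] \<phi>(2)])
      show "(\<lambda>n. L2norm (lebesgue_on (K3 d b c)) (\<lambda>x. pd i (\<phi> n) x - G x $ i)) \<longlonglongrightarrow> 0" for i
        by (rule L2norm_tendsto_subset[OF K3_facts(5) U(3) n(2) L2_diff[OF sU[OF smooth_pd[OF \<phi>(1)]] sub[OF U(3,2) GL]] \<phi>(3)])
    qed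
    then show ?thesis by (simp add: Tr_smooth[OF d(1) \<psi> \<phi>(1)])
  qed
  show ?thesis by (rule LIMSEQ_unique[OF lim[OF D(1)] lim[OF D(2)]]) auto
qed

text \<open>The trace required by the boundary condition is the limit along another approximating sequence, global on the
  domain. The functional is continuous in \<open>H1\<close>, so it agrees with the integral of \<open>\<psi>\<close> against that trace.\<close>

lemma NTr_clamped:
  assumes \<Omega>: "open \<Omega>" "bounded \<Omega>" and D: "tdet a b c \<noteq> 0" and bc: "b \<noteq> c"
    and neg: "negligible (K3 a b c - \<Omega>)" and v: "v \<in> H2 \<Omega>" and \<psi>: "smooth \<psi>"
    and tr: "has_grad_trace \<Omega> (closed_segment b c) v \<tau>" and \<tau>0: "AE x in arc (closed_segment b c). \<tau> x \<bullet> rot (c - b) = 0"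
  shows "NTr \<Omega> a b c (edge_normal \<sigma> b c) \<psi> v = 0"
proof -
  let ?A = "arc (closed_segment b c)" and ?M = "lebesgue_on (K3 a b c)"
  let ?n = "edge_normal \<sigma> b c"
  have \<Omega>m: "\<Omega> \<in> sets lebesgue" using \<Omega> by simp
  note vD = H2D[OF v]
  have \<tau>L: "L2 ?A (\<lambda>x. \<tau> x $ i)" for i using tr by (auto simp: has_grad_trace_def has_trace_def)
  have \<psi>L: "L2 ?A \<psi>" by (rule L2_arc_smooth[OF bc \<psi>])
  have Tr_eq: "dist b c * Tr a b c \<psi> (\<lambda>x. wgrad \<Omega> v x $ i) (\<lambda>x. whess \<Omega> v x $ i) = (LINT x|?A. \<psi> x * \<tau> x $ i)" for i
  proof -
    obtain \<phi> where \<phi>: "\<And>k::nat. smooth (\<phi> k)" "(\<lambda>k. H1norm \<Omega> (\<lambda>x. \<phi> k x - wgrad \<Omega> v x $ i)) \<longlonglongrightarrow> 0"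
      "(\<lambda>k. L2norm ?A (\<lambda>x. \<phi> k x - \<tau> x $ i)) \<longlonglongrightarrow> 0"
      using tr by (auto simp: has_grad_trace_def has_trace_def)
    have s\<Omega>: "L2 (lebesgue_on \<Omega>) f" if "smooth f" for f by (rule smooth_L2[OF \<Omega>(2) \<Omega>m that])
    have wg: "has_weak_grad \<Omega> (\<lambda>x. \<phi> k x - wgrad \<Omega> v x $ i) (\<lambda>x. (\<chi> j. pd j (\<phi> k) x) - whess \<Omega> v x $ i)" for k
      by (rule has_weak_grad_diff[OF \<Omega> s\<Omega>[OF \<phi>(1)] vD(3) smooth_has_weak_grad[OF \<Omega> \<phi>(1)] vD(4)])
    have L0: "L2 (lebesgue_on \<Omega>) (\<lambda>x. \<phi> k x - wgrad \<Omega> v x $ i)" for k by (intro L2_diff s\<Omega> \<phi> vD)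
    have Lj: "L2 (lebesgue_on \<Omega>) (\<lambda>x. pd j (\<phi> k) x - whess \<Omega> v x $ i $ j)" for k j
      by (intro L2_diff s\<Omega> smooth_pd \<phi> L2_vec_nth vD)
    have c0: "(\<lambda>k. L2norm (lebesgue_on \<Omega>) (\<lambda>x. \<phi> k x - wgrad \<Omega> v x $ i)) \<longlonglongrightarrow> 0"
      by (rule Lim_null_comparison[OF always_eventually \<phi>(2)]) (simp add: L2norm_nonneg H1norm_ge)
    have cj: "(\<lambda>k. L2norm (lebesgue_on \<Omega>) (\<lambda>x. pd j (\<phi> k) x - whess \<Omega> v x $ i $ j)) \<longlonglongrightarrow> 0" for j
    proof (rule Lim_null_comparison[OF always_eventually \<phi>(2)], rule allI)
      fix k
      have "L2norm (lebesgue_on \<Omega>) (\<lambda>x. ((\<chi> j. pd j (\<phi> k) x) - whess \<Omega> v x $ i) $ j)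
          \<le> L2norm (lebesgue_on \<Omega>) (\<lambda>x. (\<chi> j. pd j (\<phi> k) x) - whess \<Omega> v x $ i)"
        by (rule L2norm_vec_nth_le[OF has_weak_gradD(1)[OF wg]])
      also have "\<dots> \<le> H1norm \<Omega> (\<lambda>x. \<phi> k x - wgrad \<Omega> v x $ i)"
        unfolding H1norm_eq[OF \<Omega> wg] by (auto intro!: real_le_rsqrt)
      finally show "norm (L2norm (lebesgue_on \<Omega>) (\<lambda>x. pd j (\<phi> k) x - whess \<Omega> v x $ i $ j)) \<le> H1norm \<Omega> (\<lambda>x. \<phi> k x - wgrad \<Omega> v x $ i)"
        by (simp add: L2norm_nonneg)
    qed
    have "(\<lambda>k. Tr a b c \<psi> (\<phi> k) (\<lambda>x. \<chi> j. pd j (\<phi> k) x)) \<longlonglongrightarrow> Tr a b c \<psi> (\<lambda>x. wgrad \<Omega> v x $ i) (\<lambda>x. whess \<Omega> v x $ i)"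
      by (rule Tr_tendsto[OF \<psi> L2_subdomain[OF \<Omega>m K3_facts(5) neg vD(3)] L2_subdomain[OF \<Omega>m K3_facts(5) neg L2_vec_nth[OF L2_vec_nth[OF vD(5)]]] \<phi>(1)
           L2norm_tendsto_subset[OF K3_facts(5) \<Omega>m neg L0 c0] L2norm_tendsto_subset[OF K3_facts(5) \<Omega>m neg Lj cj]])
    then have "(\<lambda>k. dist b c * smean b c (\<lambda>x. \<psi> x * \<phi> k x)) \<longlonglongrightarrow> dist b c * Tr a b c \<psi> (\<lambda>x. wgrad \<Omega> v x $ i) (\<lambda>x. whess \<Omega> v x $ i)"
      by (intro tendsto_mult tendsto_const) (simp add: Tr_smooth[OF D \<psi> \<phi>(1)])
    moreover have "(\<lambda>k. LINT x|?A. \<psi> x * \<phi> k x) \<longlonglongrightarrow> (LINT x|?A. \<psi> x * \<tau> x $ i)"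
      by (rule L2_tendsto_integral_mult[OF \<psi>L \<tau>L L2_arc_smooth[OF bc \<phi>(1)] \<phi>(3)])
    moreover have "(LINT x|?A. \<psi> x * \<phi> k x) = dist b c * smean b c (\<lambda>x. \<psi> x * \<phi> k x)" for k
      by (rule arc_smean[OF bc smooth_continuous[OF smooth_mult[OF \<psi> \<phi>(1)]]])
    ultimately show ?thesis using LIMSEQ_unique by fastforce
  qed
  have "dist b c * NTr \<Omega> a b c ?n \<psi> v = (\<Sum>i\<in>UNIV. ?n $ i * (LINT x|?A. \<psi> x * \<tau> x $ i))"
    unfolding Tr_eq[symmetric] NTr_def by (simp add: sum_distrib_left mult_ac)
  also have "\<dots> = (LINT x|?A. (\<Sum>i\<in>UNIV. ?n $ i * (\<psi> x * \<tau> x $ i)))"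
    using L2_integrable_mult[OF \<psi>L \<tau>L] by (simp add: Bochner_Integration.integral_sum)
  also have "\<dots> = (LINT x|?A. 0)"
  proof (rule integral_cong_AE)
    show "(\<lambda>x. \<Sum>i\<in>UNIV. ?n $ i * (\<psi> x * \<tau> x $ i)) \<in> borel_measurable ?A"
      using L2_integrable_mult[OF \<psi>L \<tau>L] by (intro borel_measurable_integrable) auto
    show "AE x in ?A. (\<Sum>i\<in>UNIV. ?n $ i * (\<psi> x * \<tau> x $ i)) = 0"
    proof (rule eventually_mono[OF \<tau>0])
      fix x assume z: "\<tau> x \<bullet> rot (c - b) = 0"
      have "(\<Sum>i\<in>UNIV. ?n $ i * (\<psi> x * \<tau> x $ i)) = \<psi> x * ((- \<sigma> / dist b c) * (\<tau> x \<bullet> rot (c - b)))"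
        by (simp add: edge_normal_def inner_vec_def sum_distrib_left sum_2 algebra_simps)
      then show "(\<Sum>i\<in>UNIV. ?n $ i * (\<psi> x * \<tau> x $ i)) = 0" using z by simp
    qed
  qed simp
  finally show ?thesis using bc by simp
qed

section \<open>Geometry of the mesh\<close>

text \<open>Arbitrarily near a boundary point there are points above the graph. These have a neighbourhood without points of the
  domain, so they are not in its closure.\<close>

lemma lipschitz_domain_interior_closure:
  assumes L: "lipschitz_domain \<Omega>"
  shows "interior (closure \<Omega>) \<subseteq> \<Omega>"
proof
  fix z assume z: "z \<in> interior (closure \<Omega>)"
  show "z \<in> \<Omega>"
  proof (rule ccontr)
    assume nz: "z \<notin> \<Omega>"
    have op: "open \<Omega>" using L by (simp add: lipschitz_domain_def)
    have "z \<in> closure \<Omega>" using z interior_subset by blast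
    then have "z \<in> frontier \<Omega>" using nz op by (simp add: frontier_def interior_open)
    then obtain U e \<phi> C where U: "open U" "z \<in> U" "norm e = 1" "C-lipschitz_on (UNIV :: real set) \<phi>"
        "\<Omega> \<inter> U = {x \<in> U. x \<bullet> rot e < \<phi> (x \<bullet> e)}"
      using L unfolding lipschitz_domain_def by blast
    have "z \<notin> \<Omega> \<inter> U" using nz by simp
    then have ge: "z \<bullet> rot e \<ge> \<phi> (z \<bullet> e)" unfolding U(5) using U(2) by (simp add: not_less)
    have below: "x \<bullet> rot e < \<phi> (x \<bullet> e)" if "x \<in> \<Omega>" "x \<in> U" for x
    proof -
      have "x \<in> \<Omega> \<inter> U" using that by simp
      then show ?thesis unfolding U(5) by simp
    qed
    have e1: "rot e \<bullet> rot e = 1" using U(3) norm_rot[of e] by (simp add: dot_square_norm)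
    have e2: "rot e \<bullet> e = 0" by (simp add: rot_def inner_vec_def sum_2)
    have "open (U \<inter> interior (closure \<Omega>))" using U(1) by auto
    then obtain r where r: "r > 0" "ball z r \<subseteq> U \<inter> interior (closure \<Omega>)"
      using U(2) z open_contains_ball by (metis IntI)
    define y where "y = z + (r / 2) *\<^sub>R rot e"
    have "dist z y < r" using r(1) U(3) by (simp add: y_def dist_norm norm_rot)
    then have "y \<in> ball z r" by simp
    then have "y \<in> U \<inter> interior (closure \<Omega>)" using r(2) by blast
    then have y: "y \<in> U" "y \<in> closure \<Omega>" using interior_subset[of "closure \<Omega>"] by blast+
    have c\<phi>: "continuous_on UNIV \<phi>" using U(4) by (rule lipschitz_on_continuous_on)
    have opV: "open {x \<in> U. \<phi> (x \<bullet> e) < x \<bullet> rot e}"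
    proof -
      have "open {x. \<phi> (x \<bullet> e) < x \<bullet> rot e}"
        by (intro open_Collect_less continuous_intros continuous_on_compose2[OF c\<phi>]) auto
      moreover have "{x \<in> U. \<phi> (x \<bullet> e) < x \<bullet> rot e} = U \<inter> {x. \<phi> (x \<bullet> e) < x \<bullet> rot e}" by auto
      ultimately show ?thesis using U(1) by auto
    qed
    have "y \<bullet> e = z \<bullet> e" "y \<bullet> rot e = z \<bullet> rot e + r / 2"
      by (simp_all add: y_def inner_add_left e1 e2)
    then have "y \<in> {x \<in> U. \<phi> (x \<bullet> e) < x \<bullet> rot e}" using y(1) ge r(1) by simp
    moreover have "{x \<in> U. \<phi> (x \<bullet> e) < x \<bullet> rot e} \<inter> \<Omega> = {}" using below by fastforce
    ultimately show False using y(2) opV open_Int_closure_eq_empty[OF opV, of \<Omega>] by blast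
  qed
qed

lemma tdet_affine:
  "tdet (s *\<^sub>R x + t *\<^sub>R y) b c = s * tdet x b c + t * tdet y b c" if "s + t = 1"
proof -
  have t: "t = 1 - s" using that by simp
  show ?thesis unfolding t by (simp add: tdet_def algebra_simps)
qed

lemma K3_memI:
  assumes D: "tdet a b c \<noteq> 0" and "0 \<le> tdet x b c / tdet a b c" "0 \<le> tdet a x c / tdet a b c" "0 \<le> tdet a b x / tdet a b c"
  shows "x \<in> K3 a b c"
proof -
  define D where "D = tdet a b c"
  define u where "u = tdet a x c / D" define v where "v = tdet a b x / D"
  have D0: "D \<noteq> 0" using D by (simp add: D_def)
  have Dd: "D = (b $ 1 - a $ 1) * (c $ 2 - a $ 2) - (b $ 2 - a $ 2) * (c $ 1 - a $ 1)" by (simp add: D_def tdet_def)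
  have e1: "D * (u * (b $ 1 - a $ 1) + v * (c $ 1 - a $ 1)) = D * (x $ 1 - a $ 1)"
  proof -
    have "D * (u * (b $ 1 - a $ 1) + v * (c $ 1 - a $ 1)) = tdet a x c * (b $ 1 - a $ 1) + tdet a b x * (c $ 1 - a $ 1)"
      unfolding u_def v_def using D0 by (simp add: distrib_left)
    also have "\<dots> = D * (x $ 1 - a $ 1)" unfolding Dd tdet_def by (simp add: algebra_simps)
    finally show ?thesis .
  qed
  have e2: "D * (u * (b $ 2 - a $ 2) + v * (c $ 2 - a $ 2)) = D * (x $ 2 - a $ 2)"
  proof -
    have "D * (u * (b $ 2 - a $ 2) + v * (c $ 2 - a $ 2)) = tdet a x c * (b $ 2 - a $ 2) + tdet a b x * (c $ 2 - a $ 2)"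
      unfolding u_def v_def using D0 by (simp add: distrib_left)
    also have "\<dots> = D * (x $ 2 - a $ 2)" unfolding Dd tdet_def by (simp add: algebra_simps)
    finally show ?thesis .
  qed
  have "u * (b $ 1 - a $ 1) + v * (c $ 1 - a $ 1) = x $ 1 - a $ 1" "u * (b $ 2 - a $ 2) + v * (c $ 2 - a $ 2) = x $ 2 - a $ 2"
    using mult_left_cancel[OF D0] e1 e2 by blast+
  then have x: "x = a + u *\<^sub>R (b - a) + v *\<^sub>R (c - a)"
    by (simp add: vec_eq_iff forall_2)
  have "tdet x b c / D = 1 - u - v"
    using tdet_barycentric[of a u b v c] D0 unfolding x[symmetric] D_def[symmetric] by simp
  then have "u + v \<le> 1" "0 \<le> u" "0 \<le> v" using assms by (auto simp: u_def v_def D_def)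
  then show ?thesis unfolding K3_def convex_hull_3_alt using x by blast
qed

lemma K3_mem_iff:
  assumes "tdet a b c \<noteq> 0"
  shows "x \<in> K3 a b c \<longleftrightarrow> 0 \<le> tdet x b c / tdet a b c \<and> 0 \<le> tdet a x c / tdet a b c \<and> 0 \<le> tdet a b x / tdet a b c"
proof
  assume "x \<in> K3 a b c"
  then obtain u v where x: "x = a + u *\<^sub>R (b - a) + v *\<^sub>R (c - a)" "0 \<le> u" "0 \<le> v" "u + v \<le> 1"
    unfolding K3_def convex_hull_3_alt by blast
  have "tdet x b c = (1 - u - v) * tdet a b c" unfolding x(1) by (rule tdet_barycentric)
  moreover have "tdet a x c = u * tdet a b c" "tdet a b x = v * tdet a b c"
    unfolding x(1) by (simp_all add: tdet_def algebra_simps)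
  ultimately show "0 \<le> tdet x b c / tdet a b c \<and> 0 \<le> tdet a x c / tdet a b c \<and> 0 \<le> tdet a b x / tdet a b c"
    using x assms by simp
qed (use K3_memI[OF assms] in blast)

lemma continuous_tdet: "continuous_on UNIV (\<lambda>x. tdet x b c)" "continuous_on UNIV (\<lambda>x. tdet a x c)" "continuous_on UNIV (\<lambda>x. tdet a b x)"
  unfolding tdet_def by (intro continuous_intros)+

text \<open>The open double wedge cut out by the edge lines through the end points of the common edge lies in the
  union of the two triangles if these are on different sides of the edge.\<close>

lemma opposite_sides_interior:
  assumes D: "tdet a b c * tdet a' b c < 0"
    and y: "y \<in> K3 a b c" "tdet a y c / tdet a b c > 0" "tdet a b y / tdet a b c > 0"
  shows "y \<in> interior (K3 a b c \<union> K3 a' b c)"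
proof -
  define D1 where "D1 = tdet a b c" define D2 where "D2 = tdet a' b c"
  have D0: "D1 \<noteq> 0" "D2 \<noteq> 0" and D12: "D1 * D2 < 0" using D by (auto simp: D1_def D2_def)
  have sg: "D1 > 0 \<and> D2 < 0 \<or> D1 < 0 \<and> D2 > 0" using D12 by (auto simp: mult_less_0_iff)
  have y0: "0 \<le> tdet y b c / D1" using y(1) K3_mem_iff[of a b c y] D0 by (simp add: D1_def)
  show ?thesis
  proof (cases "tdet y b c = 0")
    case False
    let ?U = "{x. 0 < tdet x b c / D1} \<inter> {x. 0 < tdet a x c / D1} \<inter> {x. 0 < tdet a b x / D1}"
    have "open ?U" using D0 by (intro open_Int open_Collect_less continuous_intros continuous_tdet) auto
    moreover have "?U \<subseteq> K3 a b c \<union> K3 a' b c" using K3_memI[of a b c] D0 by (auto simp: D1_def)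
    moreover have "y \<in> ?U" using y y0 False D0 by (auto simp: D1_def less_le)
    ultimately show ?thesis using interior_maximal by blast
  next
    case True
    let ?U = "({x. 0 < tdet a x c / D1} \<inter> {x. 0 < tdet a b x / D1}) \<inter> ({x. 0 < tdet a' x c / D2} \<inter> {x. 0 < tdet a' b x / D2})"
    have "open ?U" using D0 by (intro open_Int open_Collect_less continuous_intros continuous_tdet) auto
    moreover have "?U \<subseteq> K3 a b c \<union> K3 a' b c"
    proof
      fix x assume x: "x \<in> ?U"
      have "0 \<le> tdet x b c / D1 \<or> 0 \<le> tdet x b c / D2" using sg by (auto simp: zero_le_divide_iff)
      then show "x \<in> K3 a b c \<union> K3 a' b c"
        using x K3_memI[of a b c x] K3_memI[of a' b c x] D0 by (auto simp: D1_def D2_def)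
    qed
    moreover have "y \<in> ?U"
    proof -
      obtain u v where uv: "y = a + u *\<^sub>R (b - a) + v *\<^sub>R (c - a)" using y(1) unfolding K3_def convex_hull_3_alt by blast
      have "(1 - u - v) * D1 = 0" using True tdet_barycentric[of a u b v c] unfolding uv D1_def by simp
      then have v: "v = 1 - u" using D0 by simp
      have ybc: "y = u *\<^sub>R b + (1 - u) *\<^sub>R c" unfolding uv v by (simp add: algebra_simps)
      have "tdet a y c = u * D1" "tdet a b y = (1 - u) * D1" "tdet a' y c = u * D2" "tdet a' b y = (1 - u) * D2"
        unfolding ybc D1_def D2_def by (simp_all add: tdet_def algebra_simps)
      then show ?thesis using y(2,3) D0 by (simp add: D1_def[symmetric])
    qed
    ultimately show ?thesis using interior_maximal by blast
  qed
qed

text \<open>Contraction towards the midpoint of the common edge moves both triangles into the open double wedge.\<close>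

lemma opposite_sides_star:
  assumes D: "tdet a b c * tdet a' b c < 0" and t: "1/2 \<le> t" "t < 1" and x: "x \<in> K3 a b c \<union> K3 a' b c"
  shows "t *\<^sub>R x + (1 - t) *\<^sub>R ((1/2) *\<^sub>R b + (1/2) *\<^sub>R c) \<in> interior (K3 a b c \<union> K3 a' b c)"
proof -
  have main: "t *\<^sub>R x + (1 - t) *\<^sub>R ((1/2) *\<^sub>R b + (1/2) *\<^sub>R c) \<in> interior (K3 a b c \<union> K3 a' b c)"
    if D: "tdet a b c * tdet a' b c < 0" and x: "x \<in> K3 a b c" for a a'
  proof (rule opposite_sides_interior[OF D])
    let ?m = "(1/2) *\<^sub>R b + (1/2) *\<^sub>R c"
    let ?y = "t *\<^sub>R x + (1 - t) *\<^sub>R ?m"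
    have D0: "tdet a b c \<noteq> 0" using D by auto
    have m: "tdet ?m b c = 0" "tdet a ?m c = tdet a b c / 2" "tdet a b ?m = tdet a b c / 2"
      by (simp_all add: tdet_def field_simps)
    have e: "tdet ?y b c = t * tdet x b c" "tdet a ?y c = t * tdet a x c + (1 - t) * (tdet a b c / 2)"
      "tdet a b ?y = t * tdet a b x + (1 - t) * (tdet a b c / 2)"
      unfolding m(2)[symmetric] m(3)[symmetric] by (simp_all add: tdet_def field_simps)
    have xm: "0 \<le> tdet x b c / tdet a b c" "0 \<le> tdet a x c / tdet a b c" "0 \<le> tdet a b x / tdet a b c"
      using x K3_mem_iff[OF D0] by auto
    have t0: "t \<ge> 0" "(1 - t) / 2 > 0" using t by auto
    have q1: "tdet ?y b c / tdet a b c = t * (tdet x b c / tdet a b c)"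
      and q2: "tdet a ?y c / tdet a b c = t * (tdet a x c / tdet a b c) + (1 - t) / 2"
      and q3: "tdet a b ?y / tdet a b c = t * (tdet a b x / tdet a b c) + (1 - t) / 2"
      unfolding e using D0 by (simp_all add: add_divide_distrib)
    show p: "tdet a ?y c / tdet a b c > 0" "tdet a b ?y / tdet a b c > 0"
      unfolding q2 q3 by (rule add_nonneg_pos[OF mult_nonneg_nonneg[OF t0(1) xm(2)] t0(2)],
          rule add_nonneg_pos[OF mult_nonneg_nonneg[OF t0(1) xm(3)] t0(2)])
    show "?y \<in> K3 a b c"
    proof (rule K3_memI[OF D0])
      show "0 \<le> tdet ?y b c / tdet a b c" unfolding q1 by (rule mult_nonneg_nonneg[OF t0(1) xm(1)])
    qed (use p in \<open>simp_all only: less_imp_le\<close>)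
  qed
  show ?thesis
    using x main[OF D] main[of a' a] D by (auto simp: Un_commute mult.commute)
qed

text \<open>Two triangles on the same side of a common edge overlap near the midpoint of the edge.\<close>

lemma same_side_overlap:
  assumes D: "tdet a b c * tdet a' b c > 0"
  shows "\<not> K3 a b c \<inter> K3 a' b c \<subseteq> closed_segment b c"
proof
  assume sub: "K3 a b c \<inter> K3 a' b c \<subseteq> closed_segment b c"
  define D1 where "D1 = tdet a b c" define D2 where "D2 = tdet a' b c"
  have D0: "D1 \<noteq> 0" "D2 \<noteq> 0" and D12: "D1 / D2 > 0" using D by (auto simp: D1_def D2_def zero_less_mult_iff zero_less_divide_iff)
  let ?m = "(1/2) *\<^sub>R b + (1/2) *\<^sub>R c"
  let ?U = "{x. 0 < tdet a' x c / D2} \<inter> {x. 0 < tdet a' b x / D2}"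
  have "open ?U" using D0 by (intro open_Int open_Collect_less continuous_intros continuous_tdet) auto
  moreover have "?m \<in> ?U"
  proof -
    have "tdet a' ?m c = D2 / 2" "tdet a' b ?m = D2 / 2" by (simp_all add: D2_def tdet_def field_simps)
    then have "tdet a' ?m c / D2 = 1/2" "tdet a' b ?m / D2 = 1/2" using D0 by (simp_all only: divide_divide_eq_left, simp_all)
    then show ?thesis by simp
  qed
  ultimately obtain r where r: "r > 0" "ball ?m r \<subseteq> ?U" by (meson open_contains_ball)
  define s where "s = min (1/2) (r / (2 * (norm (a - ?m) + 1)))"
  have n1: "norm (a - ?m) + 1 > 0" using norm_ge_zero[of "a - ?m"] by linarith
  have s: "0 < s" "s \<le> 1" using r(1) n1 by (auto simp: s_def)
  define x where "x = s *\<^sub>R a + (1 - s) *\<^sub>R ?m"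
  have "dist ?m x < r"
  proof -
    have "(s *\<^sub>R a + (1 - s) *\<^sub>R m) - m = s *\<^sub>R (a - m)" for m by (simp add: algebra_simps)
    then have "x - ?m = s *\<^sub>R (a - ?m)" unfolding x_def .
    then have "dist ?m x = s * norm (a - ?m)" using s(1) by (simp add: dist_norm norm_minus_commute)
    also have "\<dots> \<le> s * (norm (a - ?m) + 1)" using s by (intro mult_left_mono) auto
    also have "\<dots> \<le> r / (2 * (norm (a - ?m) + 1)) * (norm (a - ?m) + 1)"
      using n1 by (intro mult_right_mono) (auto simp: s_def)
    also have "\<dots> = r / 2"
    proof -
      have "r / (2 * k) * k = r / 2" if "k > 0" for k :: real using that by simp
      then show ?thesis using n1 by blast
    qed
    finally show ?thesis using r(1) by simp
  qed
  then have xU: "x \<in> ?U" using r(2) by auto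
  have m0: "tdet ?m b c = 0" by (simp add: tdet_def field_simps)
  have xb: "tdet x b c = s * D1" unfolding x_def by (subst tdet_affine) (simp_all only: m0, simp_all add: D1_def)
  have "x \<in> K3 a b c"
  proof -
    have "?m \<in> K3 a b c"
      using convexD[of "K3 a b c" b c "1/2" "1/2"] K3_facts(3,4)[of b a c] K3_facts by (simp add: K3_def)
    then show ?thesis unfolding x_def
      using convexD[of "K3 a b c" a ?m s "1 - s"] K3_facts(2) s by (simp add: K3_def)
  qed
  moreover have "x \<in> K3 a' b c"
  proof (rule K3_memI)
    have "tdet x b c / D2 = s * (D1 / D2)" unfolding xb by (rule times_divide_eq_right[symmetric])
    moreover have "0 \<le> s * (D1 / D2)" using s D12 by (intro mult_nonneg_nonneg) auto
    ultimately show "0 \<le> tdet x b c / tdet a' b c" unfolding D2_def[symmetric] by (simp only:)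
  qed (use xU D0 in \<open>auto simp: D2_def less_imp_le\<close>)
  ultimately have "x \<in> closed_segment b c" using sub by blast
  then obtain u where "x = (1 - u) *\<^sub>R b + u *\<^sub>R c" by (auto simp: in_segment)
  then have "tdet x b c = (1 - u) * tdet b b c + u * tdet c b c" by (simp only: tdet_affine)
  also have "\<dots> = 0" by (simp add: tdet_def)
  finally show False using xb s D0 by simp
qed

text \<open>The two conditions on edge and triangle determine a unit vector uniquely: it is perpendicular to the edge and points away
  from the third vertex.\<close>

lemma outer_normal_eq:
  assumes D: "tdet a b c \<noteq> 0"
  shows "outer_normal (K3 a b c) (closed_segment b c) = edge_normal (sgn (tdet a b c)) b c"
  unfolding outer_normal_def
proof (rule the_equality)
  let ?E = "closed_segment b c" and ?K = "K3 a b c"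
  let ?\<sigma> = "sgn (tdet a b c)"
  let ?n = "edge_normal ?\<sigma> b c"
  have bc: "b \<noteq> c" using D by (auto simp: tdet_def)
  have l: "dist b c > 0" using bc by simp
  have \<sigma>: "\<bar>?\<sigma>\<bar> = 1" using D by (simp add: abs_sgn_eq)
  have "rot z \<bullet> z = 0" for z by (simp add: rot_def inner_vec_def sum_2)
  then have n_bc: "?n \<bullet> (c - b) = 0" by (simp add: edge_normal_def)
  have n_a: "?n \<bullet> (a - b) = - \<bar>tdet a b c\<bar> / dist b c"
  proof -
    have "rot (c - b) \<bullet> (a - b) = tdet a b c" by (simp add: tdet_def rot_def inner_vec_def sum_2 algebra_simps)
    then show ?thesis by (simp add: edge_normal_def abs_sgn mult.commute)
  qed
  have diff_E: "\<exists>t. y - x = t *\<^sub>R (c - b)" if xy: "x \<in> ?E" "y \<in> ?E" for x y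
  proof -
    obtain u u' where u: "x = (1 - u) *\<^sub>R b + u *\<^sub>R c" "y = (1 - u') *\<^sub>R b + u' *\<^sub>R c" using xy by (auto simp: in_segment)
    have "y - x = (u' - u) *\<^sub>R (c - b)" unfolding u by (simp add: algebra_simps)
    then show ?thesis by blast
  qed
  have n_K: "?n \<bullet> (y - x) \<le> 0" if x: "x \<in> ?E" and y: "y \<in> ?K" for x y
  proof -
    obtain u where u: "x = (1 - u) *\<^sub>R b + u *\<^sub>R c" using x by (auto simp: in_segment)
    obtain s t where st: "y = a + s *\<^sub>R (b - a) + t *\<^sub>R (c - a)" "0 \<le> s" "0 \<le> t" "s + t \<le> 1"
      using y unfolding K3_def convex_hull_3_alt by blast
    have "y - x = (1 - s - t) *\<^sub>R (a - b) + (t - u) *\<^sub>R (c - b)" unfolding u st by (simp add: algebra_simps)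
    then have "?n \<bullet> (y - x) = (1 - s - t) * (- \<bar>tdet a b c\<bar> / dist b c)"
      by (simp only: inner_add_right inner_scaleR_right n_bc n_a mult_zero_right add_0_right)
    also have "\<dots> \<le> 0" using st by (intro mult_nonneg_nonpos) auto
    finally show ?thesis .
  qed
  show "norm ?n = 1 \<and> (\<forall>x\<in>?E. \<forall>y\<in>?E. ?n \<bullet> (y - x) = 0) \<and> (\<forall>x\<in>?E. \<forall>y\<in>?K. ?n \<bullet> (y - x) \<le> 0)"
  proof (intro conjI ballI)
    show "norm ?n = 1" by (rule norm_edge_normal[OF bc \<sigma>])
    fix x assume x: "x \<in> ?E"
    show "?n \<bullet> (y - x) \<le> 0" if y: "y \<in> ?K" for y by (rule n_K[OF x y])
    show "?n \<bullet> (y - x) = 0" if y: "y \<in> ?E" for y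
    proof -
      obtain t where t: "y - x = t *\<^sub>R (c - b)" using diff_E[OF x y] by blast
      show ?thesis unfolding t inner_scaleR_right n_bc by simp
    qed
  qed
  fix m assume m: "norm m = 1 \<and> (\<forall>x\<in>?E. \<forall>y\<in>?E. m \<bullet> (y - x) = 0) \<and> (\<forall>x\<in>?E. \<forall>y\<in>?K. m \<bullet> (y - x) \<le> 0)"
  have n1: "norm ?n = 1" by (rule norm_edge_normal[OF bc \<sigma>])
  have m_bc: "m \<bullet> (c - b) = 0" using m by auto
  have r: "rot ?n \<bullet> m = 0" unfolding rot_edge_normal using m_bc by (simp add: inner_commute)
  have mx: "m \<bullet> g = (?n \<bullet> m) * (?n \<bullet> g)" for g using frame_expansion[OF n1, of m g] r by simp
  have "m \<bullet> m = (?n \<bullet> m)\<^sup>2" using mx[of m] by (simp add: power2_eq_square)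
  then have sq: "(?n \<bullet> m)\<^sup>2 = 1" using m by (simp add: dot_square_norm)
  have "m \<bullet> (a - b) \<le> 0" using m K3_facts(2)[of a b c] by simp
  then have A: "(?n \<bullet> m) * (- \<bar>tdet a b c\<bar> / dist b c) \<le> 0" using mx[of "a - b"] n_a by simp
  have "\<bar>tdet a b c\<bar> / dist b c > 0" using D l by simp
  then have neg: "- \<bar>tdet a b c\<bar> / dist b c < 0" unfolding minus_divide_left[symmetric] by linarith
  have "?n \<bullet> m \<ge> 0"
  proof (rule ccontr)
    assume "\<not> 0 \<le> ?n \<bullet> m"
    then have "?n \<bullet> m < 0" by simp
    from mult_neg_neg[OF this neg] A show False by linarith
  qed
  then have "?n \<bullet> m = 1" using sq by (simp add: power2_eq_1_iff)
  then have mg: "m \<bullet> g = ?n \<bullet> g" for g using mx[of g] by simp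
  have "(m - ?n) \<bullet> (m - ?n) = 0" using mg[of "m - ?n"] by (simp only: inner_diff_left)
  then show "m = ?n" by simp
qed

lemma edge_normal_opposite:
  assumes "tdet a b c * tdet a' b c < 0"
  shows "edge_normal (sgn (tdet a' b c)) b c = - edge_normal (sgn (tdet a b c)) b c"
proof -
  have "sgn (tdet a' b c) = - sgn (tdet a b c)" using assms by (auto simp: mult_less_0_iff)
  then show ?thesis by (simp add: edge_normal_def)
qed

section \<open>Triangulations\<close>

text \<open>Unlike \<open>K = K3 a b c\<close> alone, this makes \<open>a\<close>, \<open>b\<close>, \<open>c\<close> distinct and identifies them as the extreme points of \<open>K\<close>.\<close>

definition tri :: "pt set \<Rightarrow> pt \<Rightarrow> pt \<Rightarrow> pt \<Rightarrow> bool" where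
  "tri K a b c \<longleftrightarrow> K = K3 a b c \<and> \<not> affine_dependent {a, b, c} \<and> card {a, b, c} = 3"

lemma tri_rotate: "tri K a b c \<Longrightarrow> tri K b c a"
  by (simp add: tri_def K3_def insert_commute)

lemma tri_swap: "tri K a b c \<Longrightarrow> tri K a c b"
  by (simp add: tri_def K3_def insert_commute)

lemma tri_distinct: "tri K a b c \<Longrightarrow> a \<noteq> b \<and> b \<noteq> c \<and> a \<noteq> c"
  by (auto simp: tri_def card_insert_if split: if_splits)

lemma tri_edge_iff:
  assumes T: "tri K a b c"
  shows "E edge_of K \<longleftrightarrow> E = closed_segment b c \<or> E = closed_segment c a \<or> E = closed_segment a b"
proof -
  let ?S = "{a, b, c}"
  have ind: "\<not> affine_dependent ?S" and K: "K = convex hull ?S" using T by (auto simp: tri_def K3_def)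
  note d = tri_distinct[OF T]
  have ad: "aff_dim (convex hull s) = int (card s) - 1" if s: "s \<subseteq> ?S" for s
    using aff_dim_affine_independent[OF affine_independent_subset[OF ind s]] by (simp add: aff_dim_convex_hull)
  have edge: "closed_segment x y edge_of K" if xy: "{x, y} \<subseteq> ?S" "x \<noteq> y" for x y
  proof -
    have "convex hull {x, y} face_of K"
      unfolding K face_of_convex_hull_affine_independent[OF ind] using xy(1) by blast
    moreover have "aff_dim (convex hull {x, y}) = 1" using ad[OF xy(1)] xy(2) by simp
    ultimately show ?thesis by (simp add: edge_of_def segment_convex_hull)
  qed
  show ?thesis
  proof
    assume E: "E edge_of K"
    then obtain s where s: "s \<subseteq> ?S" "E = convex hull s"
      using face_of_convex_hull_affine_independent[OF ind] unfolding edge_of_def K by blast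
    have "card s = 2" using ad[OF s(1)] s(2) E by (simp add: edge_of_def)
    then obtain x y where "s = {x, y}" "x \<noteq> y" by (auto simp: card_2_iff)
    then have "E = closed_segment x y" "x \<in> ?S" "y \<in> ?S" "x \<noteq> y" using s by (auto simp: segment_convex_hull)
    then show "E = closed_segment b c \<or> E = closed_segment c a \<or> E = closed_segment a b"
      by (auto simp: closed_segment_commute)
  qed (use edge d in auto)
qed

lemma tri_extreme: "tri K a b c \<Longrightarrow> x extreme_point_of K \<longleftrightarrow> x \<in> {a, b, c}"
  by (metis tri_def K3_def extreme_point_of_convex_hull_affine_independent)

lemma tri_edgeE:
  assumes T: "tri K a b c" and E: "E edge_of K"
  obtains a' b' c' where "tri K a' b' c'" "E = closed_segment b' c'"
proof -
  note T2 = tri_rotate[OF T]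
  note T3 = tri_rotate[OF T2]
  from E consider "E = closed_segment b c" | "E = closed_segment c a" | "E = closed_segment a b"
    unfolding tri_edge_iff[OF T] by blast
  then show ?thesis
  proof cases
    case 1 show ?thesis by (rule that[OF T 1])
  next
    case 2 show ?thesis by (rule that[OF T2 2])
  next
    case 3 show ?thesis by (rule that[OF T3 3])
  qed
qed

lemma tri_edge_unique:
  assumes T: "tri K a b c" "tri K a' b' c'" and E: "closed_segment b c = closed_segment b' c'"
  shows "a' = a \<and> (b' = b \<and> c' = c \<or> b' = c \<and> c' = b)"
proof -
  have s: "{b, c} = {b', c'}" using E by simp
  have "{a, b, c} = {a', b', c'}" using tri_extreme[OF T(1)] tri_extreme[OF T(2)] by blast
  then have "insert a {b, c} = insert a' {b, c}" using s by simp
  then have "a' = a" using tri_distinct[OF T(1)] tri_distinct[OF T(2)] s by blast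
  then show ?thesis using s by (auto simp: doubleton_eq_iff)
qed

text \<open>The properties of a mesh of the plate that concern only the domain.\<close>

locale mesh =
  fixes \<Omega> :: "pt set" and \<kappa> :: real and C :: "pt set set"
  assumes \<Omega>: "open \<Omega>" "bounded \<Omega>" and regular: "interior (closure \<Omega>) \<subseteq> \<Omega>"
    and fin: "finite C" and triangles: "\<And>K. K \<in> C \<Longrightarrow> 2 simplex K"
    and face: "\<And>K K'. K \<in> C \<Longrightarrow> K' \<in> C \<Longrightarrow> K \<inter> K' face_of K" and cover: "\<Union>C = closure \<Omega>"
    and shape: "shape_regular \<kappa> C"
begin

lemma triangle:
  assumes "K \<in> C" shows "\<exists>a b c. tri K a b c"
proof -
  obtain S where S: "\<not> affine_dependent S" "int (card S) = 2 + 1" "K = convex hull S"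
    using triangles[OF assms] unfolding Polytope.simplex_def by blast
  then have "card S = 3" by simp
  then obtain a b c where "S = {a, b, c}" unfolding card_3_iff by blast
  then have "tri K a b c" using S by (simp add: tri_def K3_def)
  then show ?thesis by blast
qed

text \<open>A triangle that contains a ball is not contained in a line.\<close>

lemma tri_nice:
  assumes K: "K \<in> C" and T: "tri K a b c"
  shows "nice_tri \<kappa> a b c"
proof -
  obtain z r where r: "r > 0" "cball z r \<subseteq> K" "diameter K \<le> \<kappa> * r"
    using shape K unfolding shape_regular_def by blast
  have K3: "K = K3 a b c" using T by (simp add: tri_def)
  have "tdet a b c \<noteq> 0"
  proof
    assume D: "tdet a b c = 0"
    have zero: "tdet x b c = 0" if "x \<in> K" for x
    proof -
      obtain s t where "x = a + s *\<^sub>R (b - a) + t *\<^sub>R (c - a)"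
        using \<open>x \<in> K\<close> unfolding K3 K3_def convex_hull_3_alt by blast
      then show ?thesis using tdet_barycentric[of a s b t c] D by simp
    qed
    have bc: "c - b \<noteq> 0" using tri_distinct[OF T] by auto
    define s where "s = r / norm (c - b)"
    have s: "s > 0" using r(1) bc by (simp add: s_def)
    have "dist z (z + s *\<^sub>R rot (c - b)) = r" using bc r(1) by (simp add: s_def dist_norm norm_rot)
    then have m: "z + s *\<^sub>R rot (c - b) \<in> K" "z \<in> K" using r by (auto simp: subset_iff)
    have "tdet (z + s *\<^sub>R rot (c - b)) b c = tdet z b c + s * (norm (c - b))\<^sup>2"
      unfolding norm_pt_sq by (simp add: tdet_def rot_def power2_eq_square algebra_simps)
    then have "s * (norm (c - b))\<^sup>2 = 0" using zero[OF m(1)] zero[OF m(2)] by simp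
    then show False using s bc by simp
  qed
  then show ?thesis using r unfolding nice_tri_def K3 K3_def by blast
qed

lemma tri_interior:
  assumes K: "K \<in> C" and T: "tri K a b c"
  shows "interior (K3 a b c) \<subseteq> \<Omega>"
proof -
  have "K3 a b c \<subseteq> closure \<Omega>" using K T cover by (auto simp: tri_def)
  then show ?thesis using regular interior_mono by blast
qed

lemma dim_K: "K \<in> C \<Longrightarrow> aff_dim K = 2"
  using aff_dim_simplex[OF triangles] .

lemma convex_K: "K \<in> C \<Longrightarrow> convex K"
  using convex_simplex[OF triangles] .

lemma common_face:
  assumes K: "K \<in> C" "K' \<in> C" "K \<noteq> K'"
  shows "K \<inter> K' \<noteq> K" "aff_dim (K \<inter> K') < 2"
proof -
  show n: "K \<inter> K' \<noteq> K"
  proof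
    assume e: "K \<inter> K' = K"
    then have "K face_of K'" using face[OF K(2,1)] by (simp add: Int_commute)
    then show False using face_of_aff_dim_lt[OF convex_K[OF K(2)]] K dim_K by force
  qed
  show "aff_dim (K \<inter> K') < 2" using face_of_aff_dim_lt[OF convex_K[OF K(1)] face[OF K(1,2)] n] dim_K[OF K(1)] by simp
qed

lemma face_sub_eq:
  assumes "convex F" "E face_of F" "aff_dim F \<le> aff_dim E"
  shows "E = F"
  using face_of_aff_dim_lt[OF assms(1,2)] assms(3) by force

text \<open>The intersection is a common face of dimension less than two that contains the edge, which has dimension one.\<close>

lemma common_edge:
  assumes K: "K \<in> C" "K' \<in> C" "K \<noteq> K'" and E: "E edge_of K" "E \<subseteq> K'"
  shows "K \<inter> K' = E"
proof -
  have Ef: "E face_of K" "aff_dim E = 1" using E by (auto simp: edge_of_def)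
  have "E \<subseteq> K \<inter> K'" using E edge_of_imp_subset by blast
  then have "E face_of (K \<inter> K')" by (rule face_of_subset[OF Ef(1)]) auto
  then show ?thesis using face_sub_eq[of "K \<inter> K'" E] common_face(2)[OF K] Ef(2) convex_K[OF K(1)] convex_K[OF K(2)] by (auto intro: convex_Int)
qed

lemma neighbours_iff:
  assumes "E \<in> edges C"
  shows "neighbours C E K K' \<longleftrightarrow> K \<in> C \<and> K' \<in> C \<and> K \<noteq> K' \<and> E edge_of K \<and> E edge_of K'"
proof
  assume n: "neighbours C E K K'"
  then have e: "K \<in> C" "K' \<in> C" "K \<noteq> K'" "E = K \<inter> K'" by (auto simp: neighbours_def)
  moreover have "aff_dim E = 1" using assms by (auto simp: edges_def edge_of_def)
  moreover have "E face_of K" "E face_of K'" using face[OF e(1,2)] face[OF e(2,1)] e(4) by (auto simp: Int_commute)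
  ultimately show "K \<in> C \<and> K' \<in> C \<and> K \<noteq> K' \<and> E edge_of K \<and> E edge_of K'" by (simp add: edge_of_def)
next
  assume a: "K \<in> C \<and> K' \<in> C \<and> K \<noteq> K' \<and> E edge_of K \<and> E edge_of K'"
  then have "K \<inter> K' = E" using common_edge[of K K' E] edge_of_imp_subset[of E K'] by blast
  then show "neighbours C E K K'" using a by (simp add: neighbours_def)
qed

lemma same_edge_tri:
  assumes K: "K \<in> C" and E: "closed_segment b c edge_of K"
  shows "\<exists>a. tri K a b c"
proof -
  obtain p q r where "tri K p q r" using triangle[OF K] by blast
  then obtain a' b' c' where T: "tri K a' b' c'" "closed_segment b c = closed_segment b' c'" using tri_edgeE[OF _ E] by metis
  then have "{b, c} = {b', c'}" by simp
  then show ?thesis using T(1) tri_swap[OF T(1)] by (auto simp: doubleton_eq_iff)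
qed

text \<open>Otherwise the triangles would overlap outside their common edge.\<close>

lemma opposite:
  assumes K: "K \<in> C" "K' \<in> C" "K \<noteq> K'" and T: "tri K a b c" "tri K' a' b c"
  shows "tdet a b c * tdet a' b c < 0"
proof -
  have E: "closed_segment b c edge_of K" "closed_segment b c edge_of K'" using tri_edge_iff[OF T(1)] tri_edge_iff[OF T(2)] by auto
  have "K3 a b c \<inter> K3 a' b c \<subseteq> closed_segment b c"
    using common_edge[OF K E(1) edge_of_imp_subset[OF E(2)]] T by (simp add: tri_def)
  then have "\<not> tdet a b c * tdet a' b c > 0" using same_side_overlap by blast
  moreover have "tdet a b c \<noteq> 0" "tdet a' b c \<noteq> 0" using tri_nice[OF K(1) T(1)] tri_nice[OF K(2) T(2)] by (auto simp: nice_tri_def)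
  ultimately show ?thesis by (metis linorder_neqE_linordered_idom mult_eq_0_iff)
qed

lemma edgeE:
  assumes "E \<in> edges C"
  obtains K a b c where "K \<in> C" "tri K a b c" "E = closed_segment b c"
proof -
  obtain K where K: "K \<in> C" "E edge_of K" using assms by (auto simp: edges_def)
  obtain p q r where "tri K p q r" using triangle[OF K(1)] by blast
  then show ?thesis using tri_edgeE[OF _ K(2)] that K(1) by metis
qed

text \<open>Of three triangles at an edge, two would lie on the same side of it.\<close>

lemma at_most_two:
  assumes "J1 \<in> C" "J2 \<in> C" "J3 \<in> C" "E edge_of J1" "E edge_of J2" "E edge_of J3"
  shows "J1 = J2 \<or> J1 = J3 \<or> J2 = J3"
proof (rule ccontr)
  assume n: "\<not> (J1 = J2 \<or> J1 = J3 \<or> J2 = J3)"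
  have "E \<in> edges C" using assms by (auto simp: edges_def)
  then obtain b c where E: "E = closed_segment b c" by (elim edgeE) blast
  obtain a1 a2 a3 where T: "tri J1 a1 b c" "tri J2 a2 b c" "tri J3 a3 b c"
    using same_edge_tri assms unfolding E by metis
  have "tdet a1 b c * tdet a2 b c < 0" by (rule opposite[OF assms(1,2) _ T(1,2)]) (use n in auto)
  moreover have "tdet a1 b c * tdet a3 b c < 0" by (rule opposite[OF assms(1,3) _ T(1,3)]) (use n in auto)
  moreover have "tdet a2 b c * tdet a3 b c < 0" by (rule opposite[OF assms(2,3) _ T(2,3)]) (use n in auto)
  ultimately show False by (auto simp: mult_less_0_iff)
qed

lemma interior_edge_sides:
  assumes E: "E \<in> interior_edges C" and s: "two_sides C E = (K, K')"
  shows "K \<noteq> K'" "{J \<in> C. E edge_of J} = {K, K'}"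
proof -
  have Ee: "E \<in> edges C" using E by (simp add: interior_edges_def)
  have "\<exists>p. case p of (K, K') \<Rightarrow> neighbours C E K K'" using E by (auto simp: interior_edges_def)
  then have "case two_sides C E of (K, K') \<Rightarrow> neighbours C E K K'" unfolding two_sides_def by (rule someI_ex)
  then have "neighbours C E K K'" using s by simp
  then have n: "K \<in> C" "K' \<in> C" "K \<noteq> K'" "E edge_of K" "E edge_of K'" using neighbours_iff[OF Ee] by auto
  show "K \<noteq> K'" by (rule n)
  show "{J \<in> C. E edge_of J} = {K, K'}" using n at_most_two[OF n(1,2) _ n(4,5)] by blast
qed

text \<open>If a relatively interior point of the edge were in the open domain, then the other triangles would have to
  cover the outer side of the edge near that point. Since finitely many closed sets are concerned, one of them contains the point, and
  conformity of the mesh makes the whole edge a face of it.\<close>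

lemma boundary_edge:
  assumes E: "E \<in> edges C" "E \<notin> interior_edges C"
  shows "{J \<in> C. E edge_of J} = {one_side C E}" "E \<subseteq> frontier \<Omega>"
proof -
  obtain K where K: "K \<in> C" "E edge_of K" using E by (auto simp: edges_def)
  have u: "J = K" if "J \<in> C" "E edge_of J" for J
    using E(2) E(1) neighbours_iff[OF E(1), of K J] K that unfolding interior_edges_def by blast
  have "one_side C E = K" unfolding one_side_def
  proof (rule the_equality)
    show "K \<in> C \<and> E edge_of K" using K by blast
    show "J = K" if "J \<in> C \<and> E edge_of J" for J using u[of J] that by blast
  qed
  moreover have "{J \<in> C. E edge_of J} = {K}" using u K by blast
  ultimately show "{J \<in> C. E edge_of J} = {one_side C E}" by simp
  have cE: "convex E" using face_of_imp_convex K(2) by (auto simp: edge_of_def)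
  have KC: "closed J" if "J \<in> C" for J using closed_simplex[OF triangles[OF that]] .
  show "E \<subseteq> frontier \<Omega>"
  proof (rule ccontr)
    assume nf: "\<not> E \<subseteq> frontier \<Omega>"
    have "E \<subseteq> closure \<Omega>" using edge_of_imp_subset[OF K(2)] K(1) cover by blast
    then obtain y where y: "y \<in> E" "y \<in> \<Omega>" using nf \<Omega>(1) by (auto simp: frontier_def interior_open)
    have "E \<subseteq> closure (rel_interior E)" using convex_closure_rel_interior[OF cE] closure_subset by blast
    then obtain x where x: "x \<in> rel_interior E" "x \<in> \<Omega>"
      using y \<Omega>(1) closure_iff_nhds_not_empty[of y "rel_interior E"] by blast
    have xE: "x \<in> E" using x(1) rel_interior_subset by blast
    have "E \<noteq> K" using K dim_K[OF K(1)] by (auto simp: edge_of_def)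
    then have nx: "x \<notin> interior K" using face_of_disjoint_interior[of E K] K(2) xE by (auto simp: edge_of_def)
    have "\<exists>J\<in>C - {K}. x \<in> J"
    proof (rule ccontr)
      assume "\<not> (\<exists>J\<in>C - {K}. x \<in> J)"
      then have xU: "x \<in> \<Omega> - \<Union>(C - {K})" using x by blast
      have "closed (\<Union>(C - {K}))" using fin KC by (intro closed_Union) auto
      then have "open (\<Omega> - \<Union>(C - {K}))" using \<Omega>(1) by blast
      moreover have "\<Omega> - \<Union>(C - {K}) \<subseteq> K" using cover closure_subset[of \<Omega>] by blast
      ultimately have "x \<in> interior K" using xU interior_maximal by blast
      then show False using nx by blast
    qed
    then obtain J where J: "J \<in> C" "J \<noteq> K" "x \<in> J" by blast
    have "(K \<inter> J) \<inter> rel_interior E \<noteq> {}" using J xE x edge_of_imp_subset[OF K(2)] by blast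
    then have "E \<subseteq> K \<inter> J" using subset_of_face_of[OF face[OF K(1) J(1)] edge_of_imp_subset[OF K(2)]] by blast
    then have "K \<inter> J = E" using common_edge[OF K(1) J(1) _ K(2)] J(2) by blast
    then have "neighbours C E K J" using K J by (auto simp: neighbours_def)
    then show False using E unfolding interior_edges_def by blast
  qed
qed

text \<open>In a conforming mesh, an edge that contains a relatively interior point of another edge contains that edge as a face.\<close>

lemma edges_disjoint:
  assumes E: "E \<in> edges C" "E' \<in> edges C" "E \<noteq> E'"
  shows "rel_interior E \<inter> E' = {}"
proof (rule ccontr)
  assume "rel_interior E \<inter> E' \<noteq> {}"
  then obtain x where x: "x \<in> rel_interior E" "x \<in> E'" by blast
  have xE: "x \<in> E" using x(1) rel_interior_subset by blast
  obtain K K' where K: "K \<in> C" "E face_of K" "aff_dim E = 1" and K': "K' \<in> C" "E' face_of K'" "aff_dim E' = 1"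
    using E by (auto simp: edges_def edge_of_def)
  have s: "E \<subseteq> K" "E' \<subseteq> K'" using K(2) K'(2) face_of_imp_subset by auto
  have "(K \<inter> K') \<inter> rel_interior E \<noteq> {}" using x xE s by blast
  then have EK: "E \<subseteq> K \<inter> K'" using subset_of_face_of[OF face[OF K(1) K'(1)] s(1)] by blast
  then have "E face_of K \<inter> K'" by (rule face_of_subset[OF K(2)]) auto
  then have "E face_of K'" using face[OF K'(1) K(1)] face_of_trans by (metis Int_commute)
  then have "E \<inter> E' face_of K'" using K'(2) by (rule face_of_Int)
  then have "E \<inter> E' face_of E" by (rule face_of_subset) (use EK in auto)
  then have sub: "E \<subseteq> E'" using subset_of_face_of[of "E \<inter> E'" E E] x xE by blast
  have "E face_of E'" by (rule face_of_subset[OF \<open>E face_of K'\<close> sub s(2)])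
  then show False using face_sub_eq[of E' E] face_of_imp_convex[OF K'(2)] K(3) K'(3) E(3) by simp
qed

lemma finite_edges: "finite (edges C)"
proof (rule finite_subset)
  show "edges C \<subseteq> (\<Union>K\<in>C. {E. E edge_of K})" by (auto simp: edges_def)
  show "finite (\<Union>K\<in>C. {E. E edge_of K})"
  proof (rule finite_UN_I[OF fin])
    fix K assume "K \<in> C"
    then obtain a b c where "tri K a b c" using triangle by blast
    then show "finite {E. E edge_of K}" by (simp add: tri_edge_iff)
  qed
qed

lemma sum_edges_of_triangle:
  fixes f :: "pt set \<Rightarrow> real"
  assumes T: "tri K a b c"
  shows "(\<Sum>E | E edge_of K. f E) = f (closed_segment b c) + f (closed_segment c a) + f (closed_segment a b)"
proof -
  have "{E. E edge_of K} = {closed_segment b c, closed_segment c a, closed_segment a b}" by (auto simp: tri_edge_iff[OF T])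
  moreover have "closed_segment b c \<noteq> closed_segment c a" "closed_segment b c \<noteq> closed_segment a b" "closed_segment c a \<noteq> closed_segment a b"
    using tri_distinct[OF T] by (auto simp: doubleton_eq_iff)
  ultimately show ?thesis by simp
qed

lemma sum_over_edges:
  fixes g :: "pt set \<Rightarrow> pt set \<Rightarrow> real"
  shows "(\<Sum>K\<in>C. \<Sum>E | E edge_of K. g K E) = (\<Sum>E\<in>edges C. \<Sum>K | K \<in> C \<and> E edge_of K. g K E)"
proof -
  have "(\<Sum>K\<in>C. \<Sum>E | E edge_of K. g K E) = (\<Sum>K\<in>C. \<Sum>E | E \<in> edges C \<and> E edge_of K. g K E)"
    by (intro sum.cong refl arg_cong[where f="sum _"]) (auto simp: edges_def)
  also have "\<dots> = (\<Sum>E\<in>edges C. \<Sum>K | K \<in> C \<and> E edge_of K. g K E)"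
    by (rule sum.swap_restrict[OF fin finite_edges])
  finally show ?thesis .
qed

end

section \<open>Splitting integrals along the mesh\<close>

lemma emeasure_arc_sub:
  fixes p q :: pt
  assumes pq: "p \<noteq> q" and t: "0 \<le> t1" "t1 < t2" "t2 \<le> dist p q" and A: "A \<in> sets borel"
    and b: "b = p + (t1 / dist p q) *\<^sub>R (q - p)" and c: "c = p + (t2 / dist p q) *\<^sub>R (q - p)"
  shows "emeasure (arc_between b c) A = emeasure (arc_between p q) (A \<inter> closed_segment b c)"
proof -
  define d where "d = dist p q"
  define \<gamma> where "\<gamma> = (\<lambda>s. p + (s / d) *\<^sub>R (q - p))"
  have d0: "d > 0" using pq by (simp add: d_def)
  have bc: "b = \<gamma> t1" "c = \<gamma> t2" using b c by (auto simp: \<gamma>_def d_def)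
  have cb: "c - b = ((t2 - t1) / d) *\<^sub>R (q - p)" unfolding bc \<gamma>_def by (simp add: algebra_simps diff_divide_distrib)
  have nqp: "norm (q - p) = d" by (simp add: d_def dist_norm norm_minus_commute)
  have "norm (c - b) = t2 - t1" unfolding cb using t d0 nqp by simp
  then have dbc: "dist b c = t2 - t1" by (simp add: dist_norm norm_minus_commute)
  have inj: "s = s'" if "\<gamma> s = \<gamma> s'" for s s'
    using that pq d0 by (simp add: \<gamma>_def)
  have comb: "(1 - u) *\<^sub>R \<gamma> s + u *\<^sub>R \<gamma> s' = \<gamma> ((1 - u) * s + u * s')" for u s s'
    unfolding \<gamma>_def by (simp add: algebra_simps add_divide_distrib diff_divide_distrib)
  have seg: "\<gamma> s \<in> closed_segment b c \<longleftrightarrow> t1 \<le> s \<and> s \<le> t2" for s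
  proof
    assume "\<gamma> s \<in> closed_segment b c"
    then obtain u where u: "0 \<le> u" "u \<le> 1" "\<gamma> s = \<gamma> ((1 - u) * t1 + u * t2)"
      unfolding in_segment bc comb by blast
    have s: "s = t1 + u * (t2 - t1)" using inj[OF u(3)] by (simp add: algebra_simps)
    have "u * (t2 - t1) \<le> 1 * (t2 - t1)" by (rule mult_right_mono) (use u t in auto)
    moreover have "0 \<le> u * (t2 - t1)" using u t by simp
    ultimately show "t1 \<le> s \<and> s \<le> t2" unfolding s by simp
  next
    assume s: "t1 \<le> s \<and> s \<le> t2"
    define u where "u = (s - t1) / (t2 - t1)"
    have "u * (t2 - t1) = s - t1" using t by (simp add: u_def)
    then have "s = (1 - u) * t1 + u * t2" by (simp add: algebra_simps)
    moreover have "0 \<le> u" "u \<le> 1" using s t by (auto simp: u_def)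
    ultimately show "\<gamma> s \<in> closed_segment b c" unfolding in_segment bc comb by metis
  qed
  define S where "S = {s \<in> {t1..t2}. \<gamma> s \<in> A}"
  have \<gamma>m: "\<gamma> \<in> borel_measurable borel" unfolding \<gamma>_def by (intro borel_measurable_continuous_onI continuous_intros) (use d0 in auto)
  have Sm: "S \<in> sets borel"
  proof -
    have "S = {t1..t2} \<inter> (\<gamma> -` A \<inter> space borel)" by (auto simp: S_def)
    then show ?thesis using measurable_sets[OF \<gamma>m A] by auto
  qed
  have "{s \<in> {0..dist b c}. b + (s / dist b c) *\<^sub>R (c - b) \<in> A} = (+) t1 -` S"
  proof -
    have "b + (s / dist b c) *\<^sub>R (c - b) = \<gamma> (t1 + s)" for s
    proof -
      have e: "(s / (t2 - t1)) *\<^sub>R (c - b) = (s / d) *\<^sub>R (q - p)" unfolding cb scaleR_scaleR using t by simp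
      show ?thesis unfolding dbc e by (simp add: bc(1) \<gamma>_def add_divide_distrib scaleR_add_left)
    qed
    then show ?thesis by (auto simp: S_def dbc)
  qed
  then have "emeasure (arc_between b c) A = emeasure lborel ((+) t1 -` S)" using emeasure_arc_between[OF A, of b c] by simp
  also have "\<dots> = emeasure (distr lborel borel ((+) t1)) S" using Sm by (subst emeasure_distr) auto
  also have "\<dots> = emeasure lborel S" by (simp only: lborel_distr_plus)
  also have "S = {s \<in> {0..dist p q}. p + (s / dist p q) *\<^sub>R (q - p) \<in> A \<inter> closed_segment b c}"
    using seg t by (auto simp: S_def \<gamma>_def d_def)
  also have "emeasure lborel \<dots> = emeasure (arc_between p q) (A \<inter> closed_segment b c)"
    by (rule emeasure_arc_between[symmetric]) (use A in simp)
  finally show ?thesis .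
qed

text \<open>Arc length on a segment restricts to arc length on its parts, so the line load can be distributed to the edges.\<close>

lemma arc_sub:
  fixes p q :: pt
  assumes pq: "p \<noteq> q" and bc: "b \<noteq> c" and sub: "closed_segment b c \<subseteq> closed_segment p q"
  shows "arc (closed_segment b c) = density (arc (closed_segment p q)) (\<lambda>x. ennreal (indicator (closed_segment b c) x))"
proof (rule measure_eqI)
  show "sets (arc (closed_segment b c)) = sets (density (arc (closed_segment p q)) (\<lambda>x. ennreal (indicator (closed_segment b c) x)))"
    using pq bc by (simp add: arc_sets)
  fix A assume "A \<in> sets (arc (closed_segment b c))"
  then have A: "A \<in> sets borel" using bc by (simp add: arc_sets)
  let ?d = "dist p q"
  have d0: "?d > 0" using pq by simp
  have par: "\<exists>t. 0 \<le> t \<and> t \<le> ?d \<and> x = p + (t / ?d) *\<^sub>R (q - p)" if x: "x \<in> closed_segment p q" for x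
  proof -
    obtain u where "0 \<le> u" "u \<le> 1" "x = (1 - u) *\<^sub>R p + u *\<^sub>R q" using x by (auto simp: in_segment)
    then show ?thesis using d0 by (intro exI[of _ "u * ?d"]) (auto simp: algebra_simps mult_left_le_one_le)
  qed
  obtain t1 t2 where t: "0 \<le> t1" "t1 \<le> ?d" "b = p + (t1 / ?d) *\<^sub>R (q - p)" "0 \<le> t2" "t2 \<le> ?d" "c = p + (t2 / ?d) *\<^sub>R (q - p)"
    using par[of b] par[of c] sub ends_in_segment by blast
  have "emeasure (arc_between b c) A = emeasure (arc_between p q) (A \<inter> closed_segment b c)"
  proof (cases "t1 < t2")
    case True show ?thesis by (rule emeasure_arc_sub[OF pq t(1) True t(5) A t(3,6)])
  next
    case False
    then have lt: "t2 < t1" using t(3,6) bc by force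
    show ?thesis using emeasure_arc_sub[OF pq t(4) lt t(2) A t(6,3)] arc_between_commute[OF bc]
      by (simp add: closed_segment_commute)
  qed
  moreover have "emeasure (density (arc (closed_segment p q)) (\<lambda>x. ennreal (indicator (closed_segment b c) x))) A
    = emeasure (arc (closed_segment p q)) (A \<inter> closed_segment b c)"
  proof -
    have "emeasure (density (arc (closed_segment p q)) (\<lambda>x. ennreal (indicator (closed_segment b c) x))) A
      = (\<integral>\<^sup>+x. indicator (A \<inter> closed_segment b c) x \<partial>arc (closed_segment p q))"
    proof (subst emeasure_density)
      show "(\<lambda>x. ennreal (indicator (closed_segment b c) x)) \<in> borel_measurable (arc (closed_segment p q))"
        using pq by (simp add: arc_measurable)
      show "A \<in> sets (arc (closed_segment p q))" using A pq by (simp add: arc_sets)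
      show "(\<integral>\<^sup>+x\<in>A. ennreal (indicator (closed_segment b c) x) \<partial>arc (closed_segment p q))
        = (\<integral>\<^sup>+x. indicator (A \<inter> closed_segment b c) x \<partial>arc (closed_segment p q))"
        by (rule nn_integral_cong) (simp split: split_indicator)
    qed
    also have "\<dots> = emeasure (arc (closed_segment p q)) (A \<inter> closed_segment b c)"
      by (rule nn_integral_indicator) (use A pq in \<open>simp add: arc_sets\<close>)
    finally show ?thesis .
  qed
  ultimately show "emeasure (arc (closed_segment b c)) A
      = emeasure (density (arc (closed_segment p q)) (\<lambda>x. ennreal (indicator (closed_segment b c) x))) A"
    using pq bc by (simp add: arc_closed_segment)
qed

lemma AE_arc_neq:
  fixes p q :: pt
  assumes pq: "p \<noteq> q" shows "AE x in arc (closed_segment p q). x \<noteq> y"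
proof (rule AE_I')
  let ?S = "{t \<in> {0..dist p q}. p + (t / dist p q) *\<^sub>R (q - p) \<in> {y}}"
  have "?S \<subseteq> {t}" if "t \<in> ?S" for t using that pq by auto
  then have "finite ?S" by (metis (no_types, lifting) finite.emptyI finite_insert finite_subset subset_emptyI)
  then have "emeasure lborel ?S = 0" by (intro emeasure_lborel_countable countable_finite)
  then have "emeasure (arc_between p q) {y} = 0" by (subst emeasure_arc_between) auto
  then show "{y} \<in> null_sets (arc (closed_segment p q))" using pq by (simp add: null_sets_def arc_closed_segment arc_between_sets)
qed auto

lemma arc_sub_integral:
  fixes p q :: pt and h :: "pt \<Rightarrow> real"
  assumes pq: "p \<noteq> q" and bc: "b \<noteq> c" and sub: "closed_segment b c \<subseteq> closed_segment p q"
    and h: "integrable (arc (closed_segment p q)) h"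
  shows "integrable (arc (closed_segment p q)) (\<lambda>x. indicator (closed_segment b c) x * h x)"
    "integrable (arc (closed_segment b c)) h"
    "(LINT x|arc (closed_segment b c). h x) = (LINT x|arc (closed_segment p q). indicator (closed_segment b c) x * h x)"
proof -
  let ?A = "arc (closed_segment p q)" and ?i = "\<lambda>x. indicator (closed_segment b c) x :: real"
  have i: "?i \<in> borel_measurable ?A" using pq by (simp add: arc_measurable)
  show 1: "integrable ?A (\<lambda>x. ?i x * h x)"
    using integrable_mult_indicator[OF _ h, of "closed_segment b c"] pq by (simp add: arc_sets)
  have nn: "AE x in ?A. 0 \<le> ?i x" by simp
  have hm: "h \<in> borel_measurable ?A" using h by simp
  show "integrable (arc (closed_segment b c)) h"
    unfolding arc_sub[OF pq bc sub] integrable_density[OF hm i nn] using 1 by simp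
  show "(LINT x|arc (closed_segment b c). h x) = (LINT x|?A. ?i x * h x)"
    unfolding arc_sub[OF pq bc sub] integral_density[OF hm i nn] by simp
qed

lemma L2_arc_sub:
  fixes p q :: pt and g :: "pt \<Rightarrow> real"
  assumes "p \<noteq> q" "b \<noteq> c" "closed_segment b c \<subseteq> closed_segment p q" and g: "L2 (arc (closed_segment p q)) g"
  shows "L2 (arc (closed_segment b c)) g"
  using arc_sub_integral(2)[OF assms(1-3), of "\<lambda>x. (norm (g x))\<^sup>2"] g assms(1,2) by (simp add: L2_def arc_measurable)

context mesh
begin

text \<open>Edges meet only in end points, which have measure zero.\<close>

lemma line_integral:
  fixes h :: "pt \<Rightarrow> real"
  assumes pq: "p \<noteq> q" and LE: "LE \<subseteq> edges C" "closed_segment p q = \<Union>LE"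
    and h: "integrable (arc (closed_segment p q)) h"
  shows "(LINT x|arc (closed_segment p q). h x) = (\<Sum>E\<in>LE. LINT x|arc E. h x)"
proof -
  let ?A = "arc (closed_segment p q)"
  have finLE: "finite LE" using LE(1) finite_edges finite_subset by blast
  have ends: "\<exists>b c. E = closed_segment b c \<and> b \<noteq> c" if "E \<in> LE" for E
  proof -
    have "E \<in> edges C" using that LE(1) by blast
    then show ?thesis by (rule edgeE) (use tri_distinct in blast)
  qed
  have each: "integrable ?A (\<lambda>x. indicator E x * h x)" "(LINT x|arc E. h x) = (LINT x|?A. indicator E x * h x)" if E: "E \<in> LE" for E
  proof -
    obtain b c where bc: "E = closed_segment b c" "b \<noteq> c" using ends[OF E] by blast
    have "closed_segment b c \<subseteq> closed_segment p q" using LE(2) E bc(1) by blast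
    from arc_sub_integral(1,3)[OF pq bc(2) this h]
    show "integrable ?A (\<lambda>x. indicator E x * h x)" "(LINT x|arc E. h x) = (LINT x|?A. indicator E x * h x)"
      unfolding bc(1) .
  qed
  \<comment> \<open>the end points of the edges\<close>
  define N where "N = (\<Union>E\<in>LE. E - rel_interior E)"
  have finN: "finite N" unfolding N_def
  proof (rule finite_UN_I[OF finLE])
    fix E assume "E \<in> LE"
    then obtain b c where "E = closed_segment b c" "b \<noteq> c" using ends by blast
    then have "E - rel_interior E \<subseteq> {b, c}" by (auto simp: rel_interior_closed_segment open_segment_def)
    then show "finite (E - rel_interior E)" by (rule finite_subset) simp
  qed
  have aeN: "AE x in ?A. x \<notin> N"
  proof -
    have "AE x in ?A. \<forall>y\<in>N. x \<noteq> y" by (rule AE_finite_allI[OF finN AE_arc_neq[OF pq]])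
    then show ?thesis by (rule eventually_mono) blast
  qed
  have one: "(\<Sum>E\<in>LE. indicator E x * h x) = h x" if x: "x \<in> closed_segment p q" "x \<notin> N" for x
  proof -
    obtain E0 where E0: "E0 \<in> LE" "x \<in> E0" using x(1) LE(2) by blast
    have r: "x \<in> rel_interior E0" using x(2) E0 by (auto simp: N_def)
    have "indicator E x * h x = (if E = E0 then h x else 0)" if E: "E \<in> LE" for E
    proof (cases "E = E0")
      case False
      have "rel_interior E0 \<inter> E = {}" by (rule edges_disjoint) (use E E0 LE(1) False in auto)
      then show ?thesis using r False by (auto simp: indicator_def)
    qed (use E0 in simp)
    then have "(\<Sum>E\<in>LE. indicator E x * h x) = (\<Sum>E\<in>LE. if E = E0 then h x else 0)" by (rule sum.cong[OF refl])
    then show ?thesis using finLE E0 by (simp add: sum.delta)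
  qed
  have "(\<Sum>E\<in>LE. LINT x|arc E. h x) = (\<Sum>E\<in>LE. LINT x|?A. indicator E x * h x)" using each(2) by (rule sum.cong[OF refl])
  also have "\<dots> = (LINT x|?A. (\<Sum>E\<in>LE. indicator E x * h x))" by (rule Bochner_Integration.integral_sum[symmetric]) (rule each(1))
  also have "\<dots> = (LINT x|?A. h x)"
  proof (rule integral_cong_AE)
    show "(\<lambda>x. \<Sum>E\<in>LE. indicator E x * h x) \<in> borel_measurable ?A"
      by (rule borel_measurable_integrable, rule Bochner_Integration.integrable_sum, rule each(1))
    show "h \<in> borel_measurable ?A" using h by simp
    show "AE x in ?A. (\<Sum>E\<in>LE. indicator E x * h x) = h x"
      using AE_arc_in[OF pq] aeN by (rule eventually_elim2) (rule one)
  qed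
  finally show ?thesis by simp
qed

lemma K_lebesgue: "K \<in> C \<Longrightarrow> K \<in> sets lebesgue"
  using compact_simplex[OF triangles] by (simp add: compact_imp_closed)

lemma K_interior: "K \<in> C \<Longrightarrow> interior K \<subseteq> \<Omega>"
  using interior_mono[of K "closure \<Omega>"] cover regular by blast

lemma K_frontier: "K \<in> C \<Longrightarrow> negligible (K - interior K)"
  using negligible_convex_frontier[OF convex_K] compact_simplex[OF triangles]
  by (simp add: frontier_def compact_imp_closed)

lemma K_negligible: "K \<in> C \<Longrightarrow> negligible (K - \<Omega>)"
  by (rule negligible_subset[OF K_frontier]) (use K_interior in auto)

lemma AE_on_K:
  assumes K: "K \<in> C" and P: "\<And>x. x \<in> interior K \<Longrightarrow> P x"
  shows "AE x in lebesgue_on K. P x"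
proof -
  have "AE x in lebesgue. x \<in> K \<longrightarrow> P x"
    by (rule AE_lebesgue_negligible[OF K_frontier[OF K]]) (use P in auto)
  then show ?thesis using K_lebesgue[OF K] by (simp add: AE_restrict_space_iff)
qed

text \<open>Two triangles meet in a face without interior points, and frontiers of convex sets are negligible.\<close>

lemma integral_split:
  fixes f :: "pt \<Rightarrow> real"
  assumes f: "integrable (lebesgue_on \<Omega>) f"
  shows "(LINT x|lebesgue_on \<Omega>. f x) = (\<Sum>K\<in>C. LINT x|lebesgue_on K. f x)"
proof -
  have \<Omega>m: "\<Omega> \<in> sets lebesgue" using \<Omega> by simp
  define F where "F = (\<lambda>x. indicator \<Omega> x * f x)"
  have F: "integrable lebesgue F" using f \<Omega>m by (simp add: F_def integrable_restrict_space)
  have K: "(LINT x|lebesgue_on K. f x) = (LINT x|lebesgue. indicator K x * F x)"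
    "integrable lebesgue (\<lambda>x. indicator K x * F x)" if K: "K \<in> C" for K
  proof -
    have "(LINT x|lebesgue_on K. F x) = (LINT x|lebesgue_on K. f x)"
    proof (rule integral_cong_AE_lebesgue_on[OF K_lebesgue[OF K]])
      show "F \<in> borel_measurable (lebesgue_on K)" by (rule measurable_restrict_space1) (use F in simp)
      show "AE x in lebesgue_on K. F x = f x" by (rule AE_on_K[OF K]) (use K_interior[OF K] in \<open>auto simp: F_def\<close>)
    qed
    then show "(LINT x|lebesgue_on K. f x) = (LINT x|lebesgue. indicator K x * F x)"
      using integral_ext[OF K_lebesgue[OF K], of F] by simp
    show "integrable lebesgue (\<lambda>x. indicator K x * F x)"
      using integrable_mult_indicator[OF K_lebesgue[OF K] F] by simp
  qed
  define N where "N = (\<Union>K\<in>C. K - interior K)"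
  have N: "negligible N" unfolding N_def by (intro negligible_Union) (use fin K_frontier in auto)
  have one: "(\<Sum>K\<in>C. indicator K x * F x) = F x" if x: "x \<notin> N" for x
  proof (cases "x \<in> \<Omega>")
    case True
    then obtain K0 where K0: "K0 \<in> C" "x \<in> K0" using cover closure_subset[of \<Omega>] by blast
    have r: "x \<in> interior K0" using x K0 by (auto simp: N_def)
    have "indicator K x * F x = (if K = K0 then F x else 0)" if K: "K \<in> C" for K
    proof (cases "K = K0")
      case False
      have "(K0 \<inter> K) \<inter> interior K0 = {}"
        by (rule face_of_disjoint_interior[OF face[OF K0(1) K]]) (use common_face(1)[OF K0(1) K] False in auto)
      then show ?thesis using r K0 False by (auto simp: indicator_def)
    qed (use K0 in simp)
    then have "(\<Sum>K\<in>C. indicator K x * F x) = (\<Sum>K\<in>C. if K = K0 then F x else 0)" by (rule sum.cong[OF refl])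
    then show ?thesis using fin K0 by (simp add: sum.delta)
  qed (simp add: F_def)
  have "(\<Sum>K\<in>C. LINT x|lebesgue_on K. f x) = (\<Sum>K\<in>C. LINT x|lebesgue. indicator K x * F x)" using K(1) by (rule sum.cong[OF refl])
  also have "\<dots> = (LINT x|lebesgue. (\<Sum>K\<in>C. indicator K x * F x))" by (rule Bochner_Integration.integral_sum[symmetric]) (rule K(2))
  also have "\<dots> = (LINT x|lebesgue. F x)"
  proof (rule integral_cong_AE)
    show "(\<lambda>x. \<Sum>K\<in>C. indicator K x * F x) \<in> borel_measurable lebesgue"
      by (rule borel_measurable_integrable, rule Bochner_Integration.integrable_sum, rule K(2))
    show "F \<in> borel_measurable lebesgue" using F by simp
    show "AE x in lebesgue. (\<Sum>K\<in>C. indicator K x * F x) = F x" by (rule AE_lebesgue_negligible[OF N one])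
  qed
  also have "\<dots> = (LINT x|lebesgue_on \<Omega>. f x)" using integral_ext[OF \<Omega>m, of f] by (simp add: F_def)
  finally show ?thesis by simp
qed

lemma L2norm_split:
  fixes f :: "pt \<Rightarrow> 'b::euclidean_space"
  assumes f: "L2 (lebesgue_on \<Omega>) f"
  shows "(\<Sum>K\<in>C. (L2norm (lebesgue_on K) f)\<^sup>2) = (L2norm (lebesgue_on \<Omega>) f)\<^sup>2"
proof -
  have sq: "(L2norm M f)\<^sup>2 = (LINT x|M. (norm (f x))\<^sup>2)" for M :: "pt measure" by (simp add: L2norm_def)
  show ?thesis unfolding sq by (rule integral_split[symmetric]) (use f in \<open>simp add: L2_def\<close>)
qed

text \<open>Weak derivatives restrict to the interior of the triangle, where they coincide with the classical ones by uniqueness.\<close>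

lemma whess_piecewise:
  assumes u: "u \<in> H2 \<Omega>" and K: "K \<in> C" and p: "smooth p" "\<And>x. x \<in> K \<Longrightarrow> u x = p x"
  shows "AE x in lebesgue_on K. whess \<Omega> u x = hess p x"
proof -
  let ?U = "interior K"
  have U: "open ?U" "bounded ?U" "?U \<subseteq> \<Omega>"
    using K_interior[OF K] compact_imp_bounded[OF compact_simplex[OF triangles[OF K]]] bounded_subset[OF _ interior_subset] by auto
  have \<Omega>m: "\<Omega> \<in> sets lebesgue" using \<Omega> by simp
  have Um: "?U \<in> sets lebesgue" using U by simp
  note uD = H2D[OF u]
  have g: "has_weak_grad ?U u (wgrad \<Omega> u)" by (rule has_weak_grad_subset[OF U(1,3) \<Omega>m uD(2)])
  have up: "AE x in lebesgue_on ?U. u x = p x"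
    using p(2) interior_subset[of K] Um by (intro AE_I2) auto
  have "has_weak_grad ?U p (\<lambda>x. \<chi> i. pd i p x)" by (rule smooth_has_weak_grad[OF U(1,2) p(1)])
  moreover have "has_weak_grad ?U p (wgrad \<Omega> u)"
  proof -
    have "L2 (lebesgue_on ?U) u" by (rule L2_subdomain[OF \<Omega>m Um _ uD(1)]) (use U(3) in \<open>simp add: Diff_eq_empty_iff[THEN iffD2]\<close>)
    then show ?thesis by (rule has_weak_grad_cong_AE[OF U(1,2) _ up g]) simp
  qed
  ultimately have w1: "AE x in lebesgue_on ?U. wgrad \<Omega> u x = (\<chi> i. pd i p x)"
    using has_weak_grad_unique[OF U(1,2)] by blast
  have w2: "AE x in lebesgue_on ?U. whess \<Omega> u x $ i = (\<chi> j. pd j (pd i p) x)" for i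
  proof -
    have g: "has_weak_grad ?U (\<lambda>x. wgrad \<Omega> u x $ i) (\<lambda>x. whess \<Omega> u x $ i)" by (rule has_weak_grad_subset[OF U(1,3) \<Omega>m uD(4)])
    have ae: "AE x in lebesgue_on ?U. wgrad \<Omega> u x $ i = pd i p x" using w1 by (rule eventually_mono) simp
    have "L2 (lebesgue_on ?U) (\<lambda>x. wgrad \<Omega> u x $ i)" by (rule L2_subdomain[OF \<Omega>m Um _ uD(3)]) (use U(3) in \<open>simp add: Diff_eq_empty_iff[THEN iffD2]\<close>)
    then have "has_weak_grad ?U (pd i p) (\<lambda>x. whess \<Omega> u x $ i)"
      by (rule has_weak_grad_cong_AE[OF U(1,2) _ ae g]) simp
    moreover have "has_weak_grad ?U (pd i p) (\<lambda>x. \<chi> j. pd j (pd i p) x)" by (rule smooth_has_weak_grad[OF U(1,2) smooth_pd[OF p(1)]])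
    ultimately show ?thesis using has_weak_grad_unique[OF U(1,2)] by blast
  qed
  have "AE x in lebesgue_on ?U. whess \<Omega> u x = hess p x"
    using AE_finite_allI[of "UNIV :: 2 set", OF finite w2] by (rule eventually_mono) (simp add: hess_def vec_eq_iff)
  then have "AE x in lebesgue. x \<in> ?U \<longrightarrow> whess \<Omega> u x = hess p x" using Um by (simp add: AE_restrict_space_iff)
  moreover have "AE x in lebesgue. x \<in> K \<longrightarrow> x \<in> ?U" by (rule AE_lebesgue_negligible[OF K_frontier[OF K]]) auto
  ultimately have "AE x in lebesgue. x \<in> K \<longrightarrow> whess \<Omega> u x = hess p x" by (rule eventually_elim2) blast
  then show ?thesis using K_lebesgue[OF K] by (simp add: AE_restrict_space_iff)
qed

end

section \<open>Edge terms of the residual\<close>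

text \<open>A chosen enumeration of the vertices of \<open>K\<close> starting with the one opposite to \<open>E\<close>; it is unique up to the order of the other two.\<close>

definition side :: "pt set \<Rightarrow> pt set \<Rightarrow> pt \<times> pt \<times> pt" where
  "side K E = (SOME (a, b, c). tri K a b c \<and> E = closed_segment b c)"

text \<open>The integral of \<open>\<psi> \<partial>\<^sub>n v\<close> over the edge \<open>E\<close>, seen from \<open>K\<close>.\<close>

definition normal_trace :: "pt set \<Rightarrow> (pt \<Rightarrow> real) \<Rightarrow> pt set \<Rightarrow> pt set \<Rightarrow> pt \<Rightarrow> (pt \<Rightarrow> real) \<Rightarrow> real" where
  "normal_trace \<Omega> v K E n \<psi> = (case side K E of (a, b, c) \<Rightarrow> dist b c * NTr \<Omega> a b c n \<psi> v)"

lemma Tr_swap: "Tr a c b \<psi> w G = Tr a b c \<psi> w G"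
proof -
  have "tdet a c b = - tdet a b c" by (simp add: tdet_def algebra_simps)
  moreover have "K3 a c b = K3 a b c" by (simp add: K3_def insert_commute)
  ultimately show ?thesis by (simp add: Tr_def)
qed

lemma normal_trace_eq:
  assumes T: "tri K a b c"
  shows "normal_trace \<Omega> v K (closed_segment b c) n \<psi> = dist b c * NTr \<Omega> a b c n \<psi> v"
proof -
  let ?P = "\<lambda>p. case p of (a', b', c') \<Rightarrow> tri K a' b' c' \<and> closed_segment b c = closed_segment b' c'"
  obtain a' b' c' where s: "side K (closed_segment b c) = (a', b', c')" by (cases "side K (closed_segment b c)") auto
  have "?P (a, b, c)" using T by simp
  then have "?P (side K (closed_segment b c))" unfolding side_def by (rule someI)
  then have *: "tri K a' b' c'" "closed_segment b c = closed_segment b' c'" unfolding s by auto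
  have "a' = a \<and> (b' = b \<and> c' = c \<or> b' = c \<and> c' = b)" by (rule tri_edge_unique[OF T *])
  then show ?thesis
  proof (elim conjE disjE)
    assume e: "a' = a" "b' = c" "c' = b"
    have "NTr \<Omega> a c b n \<psi> v = NTr \<Omega> a b c n \<psi> v" unfolding NTr_def Tr_swap[of a c b] ..
    then show ?thesis by (simp add: normal_trace_def s e dist_commute)
  qed (simp add: normal_trace_def s)
qed

lemma normal_trace_minus: "normal_trace \<Omega> v K E (- n) \<psi> = - normal_trace \<Omega> v K E n \<psi>"
  by (simp add: normal_trace_def NTr_def sum_negf split: prod.split)

lemma M_nn_minus: "M_nn P (- n) p = M_nn P n p"
  by (rule ext) (simp add: M_nn_eq)

lemma diameter_closed_segment: "diameter (closed_segment b c) = dist b (c :: pt)"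
proof (rule antisym)
  show "diameter (closed_segment b c) \<le> dist b c"
  proof (rule diameter_le)
    show "norm (x - y) \<le> dist b c" if xy: "x \<in> closed_segment b c" "y \<in> closed_segment b c" for x y
    proof -
      obtain s t where st: "0 \<le> s" "s \<le> 1" "x = (1 - s) *\<^sub>R b + s *\<^sub>R c" "0 \<le> t" "t \<le> 1" "y = (1 - t) *\<^sub>R b + t *\<^sub>R c"
        using xy unfolding in_segment by blast
      have "x - y = (t - s) *\<^sub>R (b - c)" unfolding st by (simp add: algebra_simps)
      moreover have "\<bar>t - s\<bar> \<le> 1" using st by auto
      ultimately show ?thesis by (simp add: dist_norm mult_left_le_one_le)
    qed
  qed simp
  show "dist b c \<le> diameter (closed_segment b c)"
    by (rule diameter_bounded_bound[OF bounded_closed_segment]) auto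
qed

text \<open>The factor \<open>(\<kappa> / 2)\<^sup>3\<close> replaces the diameter of the triangle by that of the edge.\<close>

definition C_edge :: "real \<Rightarrow> real" where "C_edge \<kappa> = C_trace \<kappa> * (\<kappa> / 2) ^ 3"

text \<open>The interpolation error, reduced to the properties used for the edge terms.\<close>

locale mesh_function = mesh +
  fixes v :: "pt \<Rightarrow> real"
  assumes v: "v \<in> H2 \<Omega>" "continuous_on (closure \<Omega>) v" and vm: "v \<in> borel_measurable borel"
    and v0: "\<And>x. x \<in> nodes C \<Longrightarrow> v x = 0"
begin

lemma element:
  assumes "K \<in> C" "tri K a b c" shows "\<exists>\<phi>. element \<Omega> \<kappa> a b c v \<phi>"
  by (rule element_exists[OF \<Omega> tri_nice[OF assms] tri_interior[OF assms] v])

definition B :: "pt set \<Rightarrow> real" where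
  "B K = (L2norm (lebesgue_on K) v)\<^sup>2 / diameter K ^ 4 + (L2norm (lebesgue_on K) (whess \<Omega> v))\<^sup>2"

definition edge_part :: "plate \<Rightarrow> pt set \<Rightarrow> pt set \<Rightarrow> (pt \<Rightarrow> real) \<Rightarrow> real" where
  "edge_part P K E p = (LINT x|arc E. V_n P (outer_normal K E) p x * v x)
     - normal_trace \<Omega> v K E (outer_normal K E) (M_nn P (outer_normal K E) p)"

lemma edge_cases:
  assumes K: "K \<in> C" and E: "E edge_of K"
  obtains a b c where "tri K a b c" "E = closed_segment b c" "b \<noteq> c" "K = K3 a b c" "nice_tri \<kappa> a b c"
proof -
  obtain p q r where T: "tri K p q r" using triangle[OF K] by blast
  obtain a b c where *: "tri K a b c" "E = closed_segment b c" by (rule tri_edgeE[OF T E])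
  show ?thesis by (rule that[OF *]) (use * tri_distinct[OF *(1)] tri_nice[OF K *(1)] in \<open>auto simp: tri_def\<close>)
qed

lemma v_edge: "K \<in> C \<Longrightarrow> E edge_of K \<Longrightarrow> continuous_on E v"
  by (rule continuous_on_subset[OF v(2)]) (use edge_of_imp_subset cover in blast)

lemma edge_integrable:
  assumes K: "K \<in> C" and E: "E edge_of K" and \<psi>: "smooth \<psi>"
  shows "integrable (arc E) (\<lambda>x. \<psi> x * v x)"
proof -
  obtain a b c where *: "tri K a b c" "E = closed_segment b c" "b \<noteq> c" by (rule edge_cases[OF K E])
  have "v \<in> borel_measurable borel" by (rule vm)
  then have "L2 (arc E) v" unfolding *(2) by (rule L2_arc_continuous[OF *(3)]) (use v_edge[OF K E] *(2) in simp)
  then show ?thesis using L2_arc_smooth[OF *(3) \<psi>] unfolding *(2) by (intro L2_integrable_mult)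
qed

lemma edge_value_eq:
  assumes K: "K \<in> C" and T: "tri K a b c" and E: "element \<Omega> \<kappa> a b c v \<phi>" and p: "smooth p"
  shows "element.edge_value \<Omega> a b c v P p = edge_part P K (closed_segment b c) p"
proof -
  have D: "tdet a b c \<noteq> 0" "K = K3 a b c" using tri_nice[OF K T] T by (auto simp: nice_tri_def tri_def)
  have bc: "b \<noteq> c" using tri_distinct[OF T] by simp
  have e: "closed_segment b c edge_of K" using tri_edge_iff[OF T] by simp
  define n where "n = edge_normal (sgn (tdet a b c)) b c"
  have n: "outer_normal K (closed_segment b c) = n" unfolding D(2) n_def by (rule outer_normal_eq[OF D(1)])
  have sm: "smooth (V_n P n p)" by (rule smooth_V_n[OF p])
  have "(LINT x|arc (closed_segment b c). V_n P n p x * v x) = dist b c * smean b c (\<lambda>x. V_n P n p x * v x)"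
    unfolding smean_def
  proof (rule arc_integral(1)[OF bc])
    show "(\<lambda>x. V_n P n p x * v x) \<in> borel_measurable borel"
      using vm borel_measurable_continuous_onI[OF smooth_continuous[OF sm]] by simp
    show "continuous_on (closed_segment b c) (\<lambda>x. V_n P n p x * v x)"
      using v_edge[OF K e] smooth_continuous[OF sm] by (auto intro!: continuous_intros intro: continuous_on_subset)
  qed
  then show ?thesis
    unfolding element.edge_value_def[OF E] edge_part_def n normal_trace_eq[OF T] n_def[symmetric] Let_def by simp
qed

lemma element_identity_edges:
  assumes K: "K \<in> C" and p: "smooth p"
  shows "(LINT x|lebesgue_on K. moment_of P p x \<bullet> curvature (whess \<Omega> v x))
    = (LINT x|lebesgue_on K. plate_op P p x * v x) + (\<Sum>E | E edge_of K. edge_part P K E p)"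
proof -
  obtain a b c where T: "tri K a b c" using triangle[OF K] by blast
  obtain \<phi> where E: "element \<Omega> \<kappa> a b c v \<phi>" using element[OF K T] by blast
  note T2 = tri_rotate[OF T] and E2 = element.rotate[OF E]
  note T3 = tri_rotate[OF T2] and E3 = element.rotate[OF E2]
  have K3: "K = K3 a b c" using T by (simp add: tri_def)
  have z: "v x = 0" if "x \<in> {a, b, c}" for x
    by (rule v0) (use that tri_extreme[OF T, of x] K in \<open>auto simp: nodes_def\<close>)
  have "(LINT x|lebesgue_on (K3 a b c). moment_of P p x \<bullet> curvature (whess \<Omega> v x))
    = (LINT x|lebesgue_on (K3 a b c). plate_op P p x * v x)
      + element.edge_value \<Omega> a b c v P p + element.edge_value \<Omega> b c a v P p + element.edge_value \<Omega> c a b v P p"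
    by (rule element_identity[OF E p]) (use z in auto)
  then show ?thesis
    unfolding edge_value_eq[OF K T E p] edge_value_eq[OF K T2 E2 p] edge_value_eq[OF K T3 E3 p] sum_edges_of_triangle[OF T] K3[symmetric]
    by simp
qed

lemma B_nonneg: "0 \<le> B K"
  by (simp add: B_def)

lemma edge_bounds:
  assumes K: "K \<in> C" and E: "E edge_of K"
  shows "L2 (arc E) \<psi> \<Longrightarrow> \<bar>LINT x|arc E. \<psi> x * v x\<bar> \<le> L2norm (arc E) \<psi> * sqrt (diameter E ^ 3) * sqrt (C_edge \<kappa> * B K)"
    and "smooth \<psi> \<Longrightarrow> norm n = 1 \<Longrightarrow> \<bar>normal_trace \<Omega> v K E n \<psi>\<bar> \<le> L2norm (arc E) \<psi> * sqrt (diameter E) * sqrt (C_edge \<kappa> * B K)"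
    and "0 \<le> C_edge \<kappa>"
proof -
  obtain a b c where T: "tri K a b c" "E = closed_segment b c" "b \<noteq> c" "K = K3 a b c" "nice_tri \<kappa> a b c" by (rule edge_cases[OF K E])
  obtain \<phi> where El: "element \<Omega> \<kappa> a b c v \<phi>" using element[OF K T(1)] by blast
  define h where "h = diameter K"
  have hE: "diameter E = dist b c" unfolding T(2) by (simp add: diameter_closed_segment)
  have nt: "h > 0" "2 * h \<le> \<kappa> * diameter E" "2 \<le> \<kappa>"
    using nice_triD(3,6,8)[OF T(5)] unfolding h_def hE T(4) K3_def by auto
  have hk: "h \<le> \<kappa> / 2 * diameter E" using nt by simp
  have hE0: "0 \<le> diameter E" using hE by simp
  have B: "element.B \<Omega> a b c v = B K" unfolding element.B_def[OF El] B_def T(4) ..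
  have CE0: "0 \<le> C_trace \<kappa>" using nt(3) C_grad_ge[of \<kappa>] by (simp add: C_trace_def)
  show CC0: "0 \<le> C_edge \<kappa>" using CE0 nt(3) by (simp add: C_edge_def)
  have h3: "h ^ 3 \<le> (\<kappa> / 2) ^ 3 * diameter E ^ 3" using power_mono[OF hk less_imp_le[OF nt(1)], of 3] unfolding power_mult_distrib .
  have h1: "h \<le> (\<kappa> / 2) ^ 3 * diameter E"
  proof -
    have "\<kappa> / 2 \<le> (\<kappa> / 2) ^ 3" using nt(3) self_le_power[of "\<kappa> / 2" 3] by simp
    then show ?thesis using hk mult_right_mono[OF _ hE0] by fastforce
  qed
  have c1: "C_trace \<kappa> * h ^ 3 * B K \<le> diameter E ^ 3 * (C_edge \<kappa> * B K)"
    using mult_right_mono[OF mult_left_mono[OF h3 CE0] B_nonneg[of K]] by (simp add: C_edge_def mult_ac)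
  have c2: "C_trace \<kappa> * h * B K \<le> diameter E * (C_edge \<kappa> * B K)"
    using mult_right_mono[OF mult_left_mono[OF h1 CE0] B_nonneg[of K]] by (simp add: C_edge_def mult_ac)
  have vc: "continuous_on (closed_segment b c) v" using v_edge[OF K E] T(2) by simp
  have vL: "L2 (arc E) v" unfolding T(2) by (rule L2_arc_continuous[OF T(3) vm vc])
  have "(L2norm (arc E) v)\<^sup>2 = dist b c * smean b c (\<lambda>x. (v x)\<^sup>2)"
    unfolding L2norm_sq T(2) smean_def real_norm_def power2_abs
    by (rule arc_integral(1)[OF T(3)]) (use vm vc in \<open>auto intro!: continuous_intros\<close>)
  also have "\<dots> \<le> C_trace \<kappa> * h ^ 3 * B K" using element.edge_bound[OF El] unfolding B h_def T(4) .
  also note c1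
  finally have "L2norm (arc E) v \<le> sqrt (diameter E ^ 3 * (C_edge \<kappa> * B K))" by (rule real_le_rsqrt)
  then have vb: "L2norm (arc E) v \<le> sqrt (diameter E ^ 3) * sqrt (C_edge \<kappa> * B K)" unfolding real_sqrt_mult[of "diameter E ^ 3" "C_edge \<kappa> * B K"] .
  show "\<bar>LINT x|arc E. \<psi> x * v x\<bar> \<le> L2norm (arc E) \<psi> * sqrt (diameter E ^ 3) * sqrt (C_edge \<kappa> * B K)" if "L2 (arc E) \<psi>"
    using L2norm_mult_le[OF that vL] mult_left_mono[OF vb L2norm_nonneg[of "arc E" \<psi>]] by (simp only: mult.assoc)
  show "\<bar>normal_trace \<Omega> v K E n \<psi>\<bar> \<le> L2norm (arc E) \<psi> * sqrt (diameter E) * sqrt (C_edge \<kappa> * B K)" if \<psi>: "smooth \<psi>" and n: "norm n = 1"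
  proof -
    have "\<bar>normal_trace \<Omega> v K E n \<psi>\<bar> \<le> L2norm (arc E) \<psi> * sqrt (C_trace \<kappa> * h * B K)"
      unfolding T(2) normal_trace_eq[OF T(1)] using element.NTr_bound[OF El \<psi> n] unfolding B h_def T(4) .
    also have "\<dots> \<le> L2norm (arc E) \<psi> * sqrt (diameter E * (C_edge \<kappa> * B K))"
      by (intro mult_left_mono real_sqrt_le_mono c2 L2norm_nonneg)
    finally show ?thesis unfolding real_sqrt_mult[of "diameter E" "C_edge \<kappa> * B K"] by (simp only: mult.assoc)
  qed
qed

text \<open>The smooth case is linear in \<open>\<psi>\<close> by inspection, and limits are unique.\<close>

lemma normal_trace_diff:
  assumes K: "K \<in> C" and E: "E edge_of K" and \<psi>: "smooth \<psi>1" "smooth \<psi>2"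
  shows "normal_trace \<Omega> v K E n (\<lambda>x. \<psi>1 x - \<psi>2 x) = normal_trace \<Omega> v K E n \<psi>1 - normal_trace \<Omega> v K E n \<psi>2"
proof -
  obtain a b c where T: "tri K a b c" "E = closed_segment b c" by (rule edge_cases[OF K E])
  obtain \<phi> where El: "element \<Omega> \<kappa> a b c v \<phi>" using element[OF K T(1)] by blast
  have \<phi>s: "smooth (pd i (\<phi> k))" for i k using El by (auto simp: element_def intro: smooth_pd)
  let ?s = "\<lambda>\<psi> k. \<Sum>i\<in>UNIV. n $ i * smean b c (\<lambda>x. \<psi> x * pd i (\<phi> k) x)"
  have lin: "?s (\<lambda>x. \<psi>1 x - \<psi>2 x) k = ?s \<psi>1 k - ?s \<psi>2 k" for k
  proof -
    have "smean b c (\<lambda>x. (\<psi>1 x - \<psi>2 x) * pd i (\<phi> k) x) + smean b c (\<lambda>x. \<psi>2 x * pd i (\<phi> k) x) = smean b c (\<lambda>x. \<psi>1 x * pd i (\<phi> k) x)" for i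
      by (subst smean_add[symmetric])
        (auto intro!: smooth_continuous smooth_mult smooth_diff \<psi> \<phi>s simp: algebra_simps)
    then have "smean b c (\<lambda>x. (\<psi>1 x - \<psi>2 x) * pd i (\<phi> k) x) = smean b c (\<lambda>x. \<psi>1 x * pd i (\<phi> k) x) - smean b c (\<lambda>x. \<psi>2 x * pd i (\<phi> k) x)" for i
      by (simp add: eq_diff_eq)
    then show ?thesis by (simp add: right_diff_distrib sum_subtractf)
  qed
  have "(\<lambda>k. ?s \<psi>1 k - ?s \<psi>2 k) \<longlonglongrightarrow> NTr \<Omega> a b c n \<psi>1 v - NTr \<Omega> a b c n \<psi>2 v"
    by (intro tendsto_diff element.NTr_limit[OF El] \<psi>)
  moreover have "(\<lambda>k. ?s \<psi>1 k - ?s \<psi>2 k) \<longlonglongrightarrow> NTr \<Omega> a b c n (\<lambda>x. \<psi>1 x - \<psi>2 x) v"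
    unfolding lin[symmetric] by (rule element.NTr_limit[OF El smooth_diff[OF \<psi>]])
  ultimately have "NTr \<Omega> a b c n (\<lambda>x. \<psi>1 x - \<psi>2 x) v = NTr \<Omega> a b c n \<psi>1 v - NTr \<Omega> a b c n \<psi>2 v" by (rule LIMSEQ_unique[rotated])
  then show ?thesis unfolding T(2) normal_trace_eq[OF T(1)] by (simp add: right_diff_distrib)
qed

lemma common_edge_cases:
  assumes K: "K \<in> C" "K' \<in> C" "K \<noteq> K'" and E: "E edge_of K" "E edge_of K'"
  obtains a a' b c where "tri K a b c" "tri K' a' b c" "E = closed_segment b c" "tdet a b c * tdet a' b c < 0"
proof -
  obtain a b c where T: "tri K a b c" "E = closed_segment b c" by (rule edge_cases[OF K(1) E(1)])
  obtain a' where T': "tri K' a' b c" using same_edge_tri[OF K(2)] E(2) unfolding T(2) by blast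
  show ?thesis by (rule that[OF T(1) T' T(2) opposite[OF K T(1) T']])
qed

lemma normal_trace_match:
  assumes K: "K \<in> C" "K' \<in> C" "K \<noteq> K'" and E: "E edge_of K" "E edge_of K'" and \<psi>: "smooth \<psi>"
  shows "normal_trace \<Omega> v K' E n \<psi> = normal_trace \<Omega> v K E n \<psi>"
proof -
  obtain a a' b c where T: "tri K a b c" "tri K' a' b c" "E = closed_segment b c" "tdet a b c * tdet a' b c < 0"
    by (rule common_edge_cases[OF K E])
  have KK: "K = K3 a b c" "K' = K3 a' b c" using T by (auto simp: tri_def)
  have D: "tdet a b c \<noteq> 0" "tdet a' b c \<noteq> 0" using T(4) by auto
  have sub: "interior (K3 a b c \<union> K3 a' b c) \<subseteq> \<Omega>"
  proof -
    have "K3 a b c \<union> K3 a' b c \<subseteq> closure \<Omega>" using K cover unfolding KK by blast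
    then show ?thesis using interior_mono regular by blast
  qed
  have star: "t *\<^sub>R x + (1 - t) *\<^sub>R ((1/2) *\<^sub>R b + (1/2) *\<^sub>R c) \<in> \<Omega>" if "1/2 \<le> t" "t < 1" "x \<in> K3 a b c \<union> K3 a' b c" for t x
    using opposite_sides_star[OF T(4) that] sub by blast
  have neg: "negligible (K3 a b c - \<Omega>)" "negligible (K3 a' b c - \<Omega>)" using K_negligible K unfolding KK by auto
  have "NTr \<Omega> a' b c n \<psi> v = NTr \<Omega> a b c n \<psi> v" unfolding NTr_def
    by (intro sum.cong refl arg_cong2[where f="(*)"] Tr_match[OF \<Omega> D star neg H2D(3,4)[OF v(1)] \<psi>, symmetric])
  then show ?thesis unfolding T(3) normal_trace_eq[OF T(1)] normal_trace_eq[OF T(2)] by simp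
qed

lemma outer_normal_facts:
  assumes K: "K \<in> C" and E: "E edge_of K"
  shows "norm (outer_normal K E) = 1"
    and "K' \<in> C \<Longrightarrow> K \<noteq> K' \<Longrightarrow> E edge_of K' \<Longrightarrow> outer_normal K' E = - outer_normal K E"
proof -
  obtain a b c where T: "tri K a b c" "E = closed_segment b c" "b \<noteq> c" "K = K3 a b c" "nice_tri \<kappa> a b c" by (rule edge_cases[OF K E])
  have D: "tdet a b c \<noteq> 0" using nice_triD(1)[OF T(5)] .
  show "norm (outer_normal K E) = 1" unfolding T(2,4) outer_normal_eq[OF D]
    by (rule norm_edge_normal[OF T(3)]) (use D in \<open>simp add: abs_sgn_eq\<close>)
  show "outer_normal K' E = - outer_normal K E" if K': "K' \<in> C" "K \<noteq> K'" "E edge_of K'"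
  proof -
    obtain a a' b c where S: "tri K a b c" "tri K' a' b c" "E = closed_segment b c" "tdet a b c * tdet a' b c < 0"
      by (rule common_edge_cases[OF K K'(1,2) E K'(3)])
    have D: "tdet a b c \<noteq> 0" "tdet a' b c \<noteq> 0" "K = K3 a b c" "K' = K3 a' b c" using S by (auto simp: tri_def)
    show ?thesis unfolding S(3) D(3,4) outer_normal_eq[OF D(1)] outer_normal_eq[OF D(2)] by (rule edge_normal_opposite[OF S(4)])
  qed
qed

text \<open>The normals of the two triangles are opposite and the normal moment is even in the normal. Since both triangles see the same
  trace of \<open>v\<close> and of its normal derivative, the contributions combine to jumps.\<close>

lemma interior_edge_sum:
  assumes K: "K \<in> C" "K' \<in> C" "K \<noteq> K'" and E: "E edge_of K" "E edge_of K'" and p: "smooth p" "smooth p'"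
  shows "edge_part P K E p + edge_part P K' E p'
    = (LINT x|arc E. (V_n P (outer_normal K E) p x + V_n P (outer_normal K' E) p' x) * v x)
      - normal_trace \<Omega> v K E (outer_normal K E) (\<lambda>x. M_nn P (outer_normal K E) p x - M_nn P (outer_normal K' E) p' x)"
proof -
  let ?n = "outer_normal K E"
  have n': "outer_normal K' E = - ?n" by (rule outer_normal_facts(2)[OF K(1) E(1) K(2,3) E(2)])
  have "(LINT x|arc E. (V_n P ?n p x + V_n P (outer_normal K' E) p' x) * v x)
    = (LINT x|arc E. V_n P ?n p x * v x) + (LINT x|arc E. V_n P (outer_normal K' E) p' x * v x)"
    unfolding distrib_right
    by (intro Bochner_Integration.integral_add edge_integrable[OF K(1) E(1)] smooth_V_n p)
  moreover have "normal_trace \<Omega> v K' E (- ?n) (M_nn P (- ?n) p') = - normal_trace \<Omega> v K E ?n (M_nn P ?n p')"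
    unfolding normal_trace_minus M_nn_minus normal_trace_match[OF K E smooth_M_nn[OF p(2)]] ..
  moreover have "normal_trace \<Omega> v K E ?n (\<lambda>x. M_nn P ?n p x - M_nn P (- ?n) p' x)
      = normal_trace \<Omega> v K E ?n (M_nn P ?n p) - normal_trace \<Omega> v K E ?n (M_nn P ?n p')"
    unfolding M_nn_minus by (rule normal_trace_diff[OF K(1) E(1) smooth_M_nn[OF p(1)] smooth_M_nn[OF p(2)]])
  ultimately show ?thesis unfolding edge_part_def n' by simp
qed

lemma normal_trace_clamped:
  assumes K: "K \<in> C" and E: "E edge_of K" and \<psi>: "smooth \<psi>"
    and clamped: "\<And>a b. a \<noteq> b \<Longrightarrow> E = closed_segment a b \<Longrightarrow>
      \<exists>\<tau>. has_grad_trace \<Omega> (closed_segment a b) v \<tau> \<and> (AE x in arc (closed_segment a b). \<tau> x \<bullet> rot (b - a) = 0)"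
  shows "normal_trace \<Omega> v K E (outer_normal K E) \<psi> = 0"
proof -
  obtain a b c where T: "tri K a b c" "E = closed_segment b c" "b \<noteq> c" "K = K3 a b c" "nice_tri \<kappa> a b c" by (rule edge_cases[OF K E])
  have D: "tdet a b c \<noteq> 0" using nice_triD(1)[OF T(5)] .
  obtain \<tau> where \<tau>: "has_grad_trace \<Omega> (closed_segment b c) v \<tau>" "AE x in arc (closed_segment b c). \<tau> x \<bullet> rot (c - b) = 0"
    using clamped[OF T(3,2)] by blast
  have "NTr \<Omega> a b c (edge_normal (sgn (tdet a b c)) b c) \<psi> v = 0"
    by (rule NTr_clamped[OF \<Omega> D T(3) _ v(1) \<psi> \<tau>]) (use K_negligible[OF K] T(4) in simp)
  then show ?thesis unfolding T(2) normal_trace_eq[OF T(1)] unfolding T(4) outer_normal_eq[OF D] by simp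
qed

lemma integral_zero_edge:
  assumes K: "K \<in> C" and E: "E edge_of K" and z: "\<And>x. x \<in> E \<Longrightarrow> v x = 0"
  shows "(LINT x|arc E. \<psi> x * v x) = 0"
proof -
  obtain a b c where T: "E = closed_segment b c" "b \<noteq> c" by (rule edge_cases[OF K E])
  have "AE x in arc E. \<psi> x * v x = 0"
    using AE_arc_in[OF T(2)] unfolding T(1)[symmetric] by (rule eventually_mono) (simp add: z)
  then show ?thesis by (rule integral_eq_zero_AE)
qed

end

section \<open>The reliability estimate\<close>

lemma sum_if_eq:
  fixes x :: "'i \<Rightarrow> real"
  assumes "finite S" "A \<subseteq> S"
  shows "(\<Sum>i\<in>S. if i \<in> A then x i else 0) = (\<Sum>i\<in>A. x i)"
  using assms by (simp add: sum.If_cases Int_absorb1)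

lemma sum_if_le:
  fixes x r :: "'i \<Rightarrow> real"
  assumes "finite S" "A \<subseteq> S" and r: "\<And>i. i \<in> S \<Longrightarrow> 0 \<le> r i"
  shows "(\<Sum>i\<in>S. if i \<in> A then x i else r i) \<le> (\<Sum>i\<in>A. x i) + (\<Sum>i\<in>S. r i)"
proof -
  have "(\<Sum>i\<in>S. if i \<in> A then x i else r i) \<le> (\<Sum>i\<in>S. (if i \<in> A then x i else 0) + r i)"
    by (rule sum_mono) (use r in auto)
  then show ?thesis unfolding sum.distrib sum_if_eq[OF assms(1,2)] .
qed

context mesh_function
begin

text \<open>The one or two elements at an edge; every edge term is charged to this sum, and every element is charged three times in total.\<close>

definition edge_weight :: "pt set \<Rightarrow> real" where
  "edge_weight E = (\<Sum>K | K \<in> C \<and> E edge_of K. B K)"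

lemma B_le_edge_weight: "K \<in> C \<Longrightarrow> E edge_of K \<Longrightarrow> B K \<le> edge_weight E"
  unfolding edge_weight_def by (rule member_le_sum) (use fin B_nonneg in auto)

lemma edge_weight_nonneg: "0 \<le> edge_weight E"
  unfolding edge_weight_def by (intro sum_nonneg B_nonneg)

lemma sum_edge_weight: "(\<Sum>E\<in>edges C. edge_weight E) = 3 * (\<Sum>K\<in>C. B K)"
proof -
  have "(\<Sum>E\<in>edges C. edge_weight E) = (\<Sum>K\<in>C. \<Sum>E | E edge_of K. B K)" unfolding edge_weight_def by (rule sum_over_edges[symmetric])
  also have "\<dots> = (\<Sum>K\<in>C. 3 * B K)"
  proof (rule sum.cong[OF refl])
    fix K assume "K \<in> C"
    then obtain a b c where T: "tri K a b c" using triangle by blast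
    show "(\<Sum>E | E edge_of K. B K) = 3 * B K" unfolding sum_edges_of_triangle[OF T] by simp
  qed
  finally show ?thesis by (simp add: sum_distrib_left)
qed

lemma edge_bounds_weight:
  assumes K: "K \<in> C" and E: "E edge_of K"
  shows "L2 (arc E) \<psi> \<Longrightarrow> \<bar>LINT x|arc E. \<psi> x * v x\<bar> \<le> sqrt (diameter E ^ 3 * (L2norm (arc E) \<psi>)\<^sup>2) * sqrt (C_edge \<kappa> * edge_weight E)"
    and "smooth \<psi> \<Longrightarrow> norm n = 1 \<Longrightarrow> \<bar>normal_trace \<Omega> v K E n \<psi>\<bar> \<le> sqrt (diameter E * (L2norm (arc E) \<psi>)\<^sup>2) * sqrt (C_edge \<kappa> * edge_weight E)"
proof -
  have s: "sqrt (d * (L2norm (arc E) \<psi>)\<^sup>2) = L2norm (arc E) \<psi> * sqrt d" for d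
    by (simp add: real_sqrt_mult L2norm_nonneg mult.commute)
  have m: "sqrt (C_edge \<kappa> * B K) \<le> sqrt (C_edge \<kappa> * edge_weight E)"
    by (intro real_sqrt_le_mono mult_left_mono B_le_edge_weight K E edge_bounds(3)[OF K E])
  have d: "0 \<le> diameter E"
  proof -
    obtain b c where "E = closed_segment b c" by (rule edge_cases[OF K E])
    then show ?thesis by (simp add: diameter_closed_segment)
  qed
  have m2: "L2norm (arc E) \<psi> * sqrt t * sqrt (C_edge \<kappa> * B K) \<le> L2norm (arc E) \<psi> * sqrt t * sqrt (C_edge \<kappa> * edge_weight E)" if "0 \<le> t" for t
    by (intro mult_left_mono[OF m] mult_nonneg_nonneg L2norm_nonneg real_sqrt_ge_zero that)
  show "\<bar>LINT x|arc E. \<psi> x * v x\<bar> \<le> sqrt (diameter E ^ 3 * (L2norm (arc E) \<psi>)\<^sup>2) * sqrt (C_edge \<kappa> * edge_weight E)" if "L2 (arc E) \<psi>"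
    unfolding s by (rule order_trans[OF edge_bounds(1)[OF K E that] m2]) (use d in simp)
  show "\<bar>normal_trace \<Omega> v K E n \<psi>\<bar> \<le> sqrt (diameter E * (L2norm (arc E) \<psi>)\<^sup>2) * sqrt (C_edge \<kappa> * edge_weight E)" if "smooth \<psi>" "norm n = 1"
    unfolding s by (rule order_trans[OF edge_bounds(2)[OF K E that] m2[OF d]])
qed

text \<open>The load and the bilinear form are split over elements and edges. The edge remainder \<open>R E\<close> is bounded by the corresponding
  terms of the estimator: jumps on interior edges, Kirchhoff shear force and normal moment on free edges, the normal moment on
  simply supported edges, and nothing on clamped edges.\<close>

lemma residual_bound:
  fixes P :: plate and L :: loading
  assumes P: "plate_model P" and P\<Omega>: "\<Omega> = Omega P" and mesh: "plate_mesh P \<kappa> C" and vV: "v \<in> V P" and uh: "uh \<in> V P"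
    and piece: "\<And>K. K \<in> C \<Longrightarrow> smooth (piece uh K)" "\<And>K x. K \<in> C \<Longrightarrow> x \<in> K \<Longrightarrow> piece uh K x = uh x"
    and L: "plate_loading P L" and fits: "mesh_fits_loading L C"
  shows "\<bar>load_form P L v - bilin P uh v\<bar> \<le> (1 + 2 * sqrt (3 * C_edge \<kappa>)) * (estimator P L C uh * sqrt (\<Sum>K\<in>C. B K))"
proof -
  define p where "p = piece uh"
  define LE where "LE = line_edges L C"
  define f where "f = body_load L"
  define g where "g = line_load L"
  define \<eta> where "\<eta> = estimator P L C uh"
  have ps: "smooth (p K)" if "K \<in> C" for K using piece(1)[OF that] by (simp add: p_def)
  have LE: "LE \<subseteq> edges C" "LE \<subseteq> interior_edges C" "line L = \<Union>LE"
    using fits by (auto simp: LE_def line_edges_def interior_edges_def mesh_fits_loading_def)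
  obtain a b where ab: "a \<noteq> b" "line L = closed_segment a b" using L unfolding plate_loading_def by blast
  have gL: "L2 (arc (closed_segment a b)) g" and fL: "L2 (lebesgue_on \<Omega>) f"
    using L ab P\<Omega> by (auto simp: plate_loading_def g_def f_def)
  have line_sub: "closed_segment a b \<subseteq> closure \<Omega>"
  proof -
    have "E \<subseteq> closure \<Omega>" if "E \<in> edges C" for E using that edge_of_imp_subset cover unfolding edges_def by blast
    then show ?thesis using LE(1,3) ab(2) by blast
  qed
  have vL: "L2 (lebesgue_on \<Omega>) v" and hL: "L2 (lebesgue_on \<Omega>) (whess \<Omega> v)" using H2D[OF v(1)] by auto
  have vline: "L2 (arc (closed_segment a b)) v"
    by (rule L2_arc_continuous[OF ab(1) vm continuous_on_subset[OF v(2) line_sub]])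
  have gE: "L2 (arc E) g" if "E \<in> LE" for E
  proof -
    have "E \<in> edges C" "E \<subseteq> closed_segment a b" using that LE ab(2) by auto
    then obtain K a' b' c' where "tri K a' b' c'" "E = closed_segment b' c'" by (metis edgeE)
    then show ?thesis using L2_arc_sub[OF ab(1) _ _ gL, of b' c'] tri_distinct \<open>E \<subseteq> closed_segment a b\<close> by blast
  qed
  have load: "load_form P L v = (\<Sum>K\<in>C. LINT x|lebesgue_on K. f x * v x) + (\<Sum>E\<in>LE. LINT x|arc E. g x * v x)"
  proof -
    have "v (load_point L) = 0" using fits v0 by (simp add: mesh_fits_loading_def)
    then have "load_form P L v = (LINT x|lebesgue_on \<Omega>. f x * v x) + (LINT x|arc (closed_segment a b). g x * v x)"
      by (simp add: load_form_def P\<Omega> ab(2) f_def g_def)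
    moreover have "(LINT x|lebesgue_on \<Omega>. f x * v x) = (\<Sum>K\<in>C. LINT x|lebesgue_on K. f x * v x)"
      by (rule integral_split[OF L2_integrable_mult[OF fL vL]])
    moreover have "(LINT x|arc (closed_segment a b). g x * v x) = (\<Sum>E\<in>LE. LINT x|arc E. g x * v x)"
      by (rule line_integral[OF ab(1) LE(1) _ L2_integrable_mult[OF gL vline]]) (use LE(3) ab(2) in simp)
    ultimately show ?thesis by simp
  qed
  define G where "G = (\<lambda>E. \<Sum>K | K \<in> C \<and> E edge_of K. edge_part P K E (p K))"
  have uhL: "L2 (lebesgue_on \<Omega>) (whess \<Omega> uh)" and uhH: "uh \<in> H2 \<Omega>" using V_D(1)[OF uh] H2D(5) P\<Omega> by auto
  have K_L2: "L2 (lebesgue_on K) F" if "K \<in> C" "L2 (lebesgue_on \<Omega>) F" for K and F :: "pt \<Rightarrow> 'b::euclidean_space"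
    by (rule L2_subdomain[OF _ K_lebesgue[OF that(1)] K_negligible[OF that(1)] that(2)]) (use \<Omega> in simp)
  have bil: "bilin P uh v = (\<Sum>K\<in>C. LINT x|lebesgue_on K. plate_op P (p K) x * v x) + (\<Sum>E\<in>edges C. G E)"
  proof -
    have "bilin P uh v = (\<Sum>K\<in>C. LINT x|lebesgue_on K. moment P (whess \<Omega> uh x) \<bullet> curvature (whess \<Omega> v x))"
      unfolding bilin_def P\<Omega>[symmetric] by (rule integral_split[OF bilin_integrable[OF uhL hL]])
    also have "\<dots> = (\<Sum>K\<in>C. (LINT x|lebesgue_on K. plate_op P (p K) x * v x) + (\<Sum>E | E edge_of K. edge_part P K E (p K)))"
    proof (rule sum.cong[OF refl])
      fix K assume K: "K \<in> C"
      have "AE x in lebesgue_on K. whess \<Omega> uh x = hess (p K) x"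
        by (rule whess_piecewise[OF uhH K ps[OF K]]) (use piece(2)[OF K] in \<open>simp add: p_def\<close>)
      then have ae: "AE x in lebesgue_on K. moment P (whess \<Omega> uh x) \<bullet> curvature (whess \<Omega> v x) = moment_of P (p K) x \<bullet> curvature (whess \<Omega> v x)"
        by (rule eventually_mono) (simp add: moment_of_def)
      have "(LINT x|lebesgue_on K. moment P (whess \<Omega> uh x) \<bullet> curvature (whess \<Omega> v x))
        = (LINT x|lebesgue_on K. moment_of P (p K) x \<bullet> curvature (whess \<Omega> v x))"
        by (rule integral_cong_AE_lebesgue_on[OF K_lebesgue[OF K] borel_measurable_integrable[OF bilin_integrable[OF K_L2[OF K uhL] K_L2[OF K hL]]] ae])
      also have "\<dots> = (LINT x|lebesgue_on K. plate_op P (p K) x * v x) + (\<Sum>E | E edge_of K. edge_part P K E (p K))"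
        by (rule element_identity_edges[OF K ps[OF K]])
      finally show "(LINT x|lebesgue_on K. moment P (whess \<Omega> uh x) \<bullet> curvature (whess \<Omega> v x))
        = (LINT x|lebesgue_on K. plate_op P (p K) x * v x) + (\<Sum>E | E edge_of K. edge_part P K E (p K))" .
    qed
    finally show ?thesis unfolding sum.distrib sum_over_edges G_def .
  qed
  define R where "R = (\<lambda>E. (if E \<in> LE then LINT x|arc E. g x * v x else 0) - G E)"
  define T where "T = (\<lambda>K. (LINT x|lebesgue_on K. f x * v x) - (LINT x|lebesgue_on K. plate_op P (p K) x * v x))"
  have diff: "load_form P L v - bilin P uh v = (\<Sum>K\<in>C. T K) + (\<Sum>E\<in>edges C. R E)"
    unfolding load bil R_def T_def sum_subtractf sum_if_eq[OF finite_edges LE(1)] by simp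

  define rK where "rK = (\<lambda>K. diameter K ^ 4 * (L2norm (lebesgue_on K) (\<lambda>x. plate_op P (p K) x - f x))\<^sup>2)"
  have hK: "diameter K > 0" if "K \<in> C" for K
  proof -
    obtain a b c where t: "tri K a b c" using triangle[OF \<open>K \<in> C\<close>] by blast
    then show ?thesis using nice_triD(3)[OF tri_nice[OF \<open>K \<in> C\<close> t]] by (simp add: tri_def K3_def)
  qed
  have T_bound: "\<bar>T K\<bar> \<le> sqrt (rK K) * sqrt (B K)" if K: "K \<in> C" for K
  proof -
    let ?M = "lebesgue_on K" and ?h = "diameter K"
    have AL: "L2 ?M (plate_op P (p K))"
      by (rule smooth_L2[OF compact_imp_bounded[OF compact_simplex[OF triangles[OF K]]] K_lebesgue[OF K] smooth_plate_op[OF ps[OF K]]])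
    note fK = K_L2[OF K fL] and vK = K_L2[OF K vL]
    have "T K = - (LINT x|?M. (plate_op P (p K) x - f x) * v x)"
      unfolding T_def left_diff_distrib using L2_integrable_mult[OF AL vK] L2_integrable_mult[OF fK vK] by simp
    then have "\<bar>T K\<bar> \<le> L2norm ?M (\<lambda>x. plate_op P (p K) x - f x) * L2norm ?M v"
      using L2norm_mult_le[OF L2_diff[OF AL fK] vK] by simp
    also have "\<dots> = sqrt (rK K) * sqrt ((L2norm ?M v)\<^sup>2 / ?h ^ 4)"
    proof -
      have "?h ^ 4 = (?h\<^sup>2)\<^sup>2" by (simp flip: power_mult)
      then have "sqrt (?h ^ 4) = sqrt ((?h\<^sup>2)\<^sup>2)" by (simp only:)
      also have "\<dots> = ?h\<^sup>2" unfolding real_sqrt_abs by simp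
      finally have s4: "sqrt (?h ^ 4) = ?h\<^sup>2" .
      show ?thesis unfolding rK_def real_sqrt_mult real_sqrt_divide s4 real_sqrt_abs abs_of_nonneg[OF L2norm_nonneg] using hK[OF K] by simp
    qed
    also have "\<dots> \<le> sqrt (rK K) * sqrt (B K)"
      by (intro mult_left_mono real_sqrt_le_mono) (auto simp: B_def rK_def)
    finally show ?thesis .
  qed

  \<comment> \<open>The terms of the estimator that belong to one edge; every edge gets both, possibly zero.\<close>
  define wV where "wV = (\<lambda>E. if E \<in> LE then diameter E ^ 3 * (L2norm (arc E) (\<lambda>x. jump_V P C E uh x - g x))\<^sup>2
     else if E \<in> interior_edges C - LE then diameter E ^ 3 * (L2norm (arc E) (jump_V P C E uh))\<^sup>2
     else if E \<in> edges_on (GammaF P) C then diameter E ^ 3 * (L2norm (arc E) (bdry_V P C E uh))\<^sup>2 else 0)"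
  define wM where "wM = (\<lambda>E. if E \<in> interior_edges C then diameter E * (L2norm (arc E) (jump_M P C E uh))\<^sup>2
     else if E \<in> edges_on (GammaF P) C \<union> edges_on (GammaS P) C then diameter E * (L2norm (arc E) (bdry_M P C E uh))\<^sup>2 else 0)"
  have dE: "0 \<le> diameter E" if "E \<in> edges C" for E
    using that by (elim edgeE) (simp add: diameter_closed_segment)
  have dL: "0 \<le> diameter E ^ 3 * (L2norm (arc E) \<psi>)\<^sup>2" "0 \<le> diameter E * (L2norm (arc E) \<psi>)\<^sup>2" if "E \<in> edges C" for E and \<psi> :: "pt \<Rightarrow> real"
    using dE[OF that] by auto
  have R_bound: "\<bar>R E\<bar> \<le> sqrt (wV E) * sqrt (C_edge \<kappa> * edge_weight E) + sqrt (wM E) * sqrt (C_edge \<kappa> * edge_weight E)" if E: "E \<in> edges C" for E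
  proof (cases "E \<in> interior_edges C")
    case True
    obtain K K' where two: "two_sides C E = (K, K')" by (cases "two_sides C E") auto
    note s = interior_edge_sides[OF True two]
    have KK: "K \<in> C" "K' \<in> C" "E edge_of K" "E edge_of K'" using s(2) by auto
    let ?n = "outer_normal K E" and ?n' = "outer_normal K' E"
    define \<psi>V where "\<psi>V = (\<lambda>x. V_n P ?n (p K) x + V_n P ?n' (p K') x)"
    define \<psi>M where "\<psi>M = (\<lambda>x. M_nn P ?n (p K) x - M_nn P ?n' (p K') x)"
    have jV: "jump_V P C E uh = \<psi>V" and jM: "jump_M P C E uh = \<psi>M"
      by (rule ext, simp add: jump_V_def two \<psi>V_def p_def) (rule ext, simp add: jump_M_def two \<psi>M_def p_def)
    have Vs: "smooth \<psi>V" and Ms: "smooth \<psi>M" unfolding \<psi>V_def \<psi>M_def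
      by (intro smooth_add smooth_diff smooth_V_n smooth_M_nn ps KK)+
    have G: "G E = (LINT x|arc E. \<psi>V x * v x) - normal_trace \<Omega> v K E ?n \<psi>M"
      unfolding G_def s(2) using s(1) interior_edge_sum[OF KK(1,2) s(1) KK(3,4) ps[OF KK(1)] ps[OF KK(2)]]
      by (simp add: \<psi>V_def \<psi>M_def)
    obtain b' c' where bc: "E = closed_segment b' c'" "b' \<noteq> c'" by (rule edge_cases[OF KK(1,3)])
    have VL: "L2 (arc E) \<psi>V" unfolding bc(1) by (rule L2_arc_smooth[OF bc(2) Vs])
    have vE: "L2 (arc E) v" unfolding bc(1) by (rule L2_arc_continuous[OF bc(2) vm]) (use v_edge[OF KK(1,3)] bc(1) in simp)
    have M: "\<bar>normal_trace \<Omega> v K E ?n \<psi>M\<bar> \<le> sqrt (wM E) * sqrt (C_edge \<kappa> * edge_weight E)"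
      using edge_bounds_weight(2)[OF KK(1,3) Ms outer_normal_facts(1)[OF KK(1,3)]] True by (simp add: wM_def jM)
    show ?thesis
    proof (cases "E \<in> LE")
      case T: True
      have "R E = - (LINT x|arc E. (\<psi>V x - g x) * v x) + normal_trace \<Omega> v K E ?n \<psi>M"
        unfolding R_def G left_diff_distrib using T L2_integrable_mult[OF VL vE] L2_integrable_mult[OF gE[OF T] vE] by simp
      moreover have "\<bar>LINT x|arc E. (\<psi>V x - g x) * v x\<bar> \<le> sqrt (wV E) * sqrt (C_edge \<kappa> * edge_weight E)"
        using edge_bounds_weight(1)[OF KK(1,3) L2_diff[OF VL gE[OF T]]] T by (simp add: wV_def jV)
      ultimately show ?thesis using M by linarith
    next
      case F: False
      have "R E = - (LINT x|arc E. \<psi>V x * v x) + normal_trace \<Omega> v K E ?n \<psi>M" unfolding R_def G using F by simp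
      moreover have "\<bar>LINT x|arc E. \<psi>V x * v x\<bar> \<le> sqrt (wV E) * sqrt (C_edge \<kappa> * edge_weight E)"
        using edge_bounds_weight(1)[OF KK(1,3) VL] F True by (simp add: wV_def jV)
      ultimately show ?thesis using M by linarith
    qed
  next
    case False
    define K where "K = one_side C E"
    have K1: "{J \<in> C. E edge_of J} = {K}" using boundary_edge(1)[OF E False] by (simp add: K_def)
    then have K: "K \<in> C" "E edge_of K" by auto
    let ?n = "outer_normal K E"
    have nLE: "E \<notin> LE" using False LE(2) by blast
    have R: "R E = - (LINT x|arc E. V_n P ?n (p K) x * v x) + normal_trace \<Omega> v K E ?n (M_nn P ?n (p K))"
      unfolding R_def G_def K1 using nLE by (simp add: edge_part_def)
    have bV: "bdry_V P C E uh = V_n P ?n (p K)" and bM: "bdry_M P C E uh = M_nn P ?n (p K)"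
      by (simp_all add: bdry_V_def bdry_M_def Let_def K_def p_def)
    note Vs = smooth_V_n[OF ps[OF K(1)], of P ?n] and Ms = smooth_M_nn[OF ps[OF K(1)], of P ?n]
    obtain b' c' where bc: "E = closed_segment b' c'" "b' \<noteq> c'" by (rule edge_cases[OF K])
    have VL: "L2 (arc E) (V_n P ?n (p K))" unfolding bc(1) by (rule L2_arc_smooth[OF bc(2)]) (use Vs bc(1) in simp)
    have wV0: "0 \<le> wV E" "0 \<le> wM E" unfolding wV_def wM_def using dL[OF E] by auto
    have nn: "0 \<le> sqrt (wV E) * sqrt (C_edge \<kappa> * edge_weight E)" "0 \<le> sqrt (wM E) * sqrt (C_edge \<kappa> * edge_weight E)"
      using wV0 edge_weight_nonneg edge_bounds(3)[OF K] by auto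
    have zero: "(LINT x|arc E. V_n P ?n (p K) x * v x) = 0" if "E \<subseteq> GammaC P \<union> GammaS P"
      by (rule integral_zero_edge[OF K]) (use that V_D(3)[OF vV] in blast)
    have M: "\<bar>normal_trace \<Omega> v K E ?n (M_nn P ?n (p K))\<bar> \<le> sqrt (wM E) * sqrt (C_edge \<kappa> * edge_weight E)" if "E \<subseteq> GammaF P \<or> E \<subseteq> GammaS P"
      using edge_bounds_weight(2)[OF K Ms outer_normal_facts(1)[OF K]] False that E by (auto simp: wM_def bM edges_on_def)
    have "E \<in> edges_on (frontier (Omega P)) C" using boundary_edge(2)[OF E False] E P\<Omega> by (simp add: edges_on_def)
    then consider "E \<subseteq> GammaF P" | "E \<subseteq> GammaS P" | "E \<subseteq> GammaC P" using mesh unfolding plate_mesh_def by blast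
    then show ?thesis
    proof cases
      case 1
      have "\<bar>LINT x|arc E. V_n P ?n (p K) x * v x\<bar> \<le> sqrt (wV E) * sqrt (C_edge \<kappa> * edge_weight E)"
        using edge_bounds_weight(1)[OF K VL] 1 E nLE False by (simp add: wV_def bV edges_on_def)
      then show ?thesis unfolding R using M 1 by fastforce
    next
      case 2
      then show ?thesis unfolding R using zero M nn by fastforce
    next
      case 3
      have "normal_trace \<Omega> v K E ?n (M_nn P ?n (p K)) = 0"
        by (rule normal_trace_clamped[OF K Ms]) (use V_D(4)[OF vV] 3 P\<Omega> in auto)
      moreover have "(LINT x|arc E. V_n P ?n (p K) x * v x) = 0" using zero 3 by blast
      ultimately show ?thesis unfolding R using nn by simp
    qed
  qed

  let ?S = "\<Sum>K\<in>C. B K"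
  have S0: "0 \<le> ?S" by (intro sum_nonneg B_nonneg)
  have int_sub: "interior_edges C \<subseteq> edges C" by (auto simp: interior_edges_def)
  have on_sub: "edges_on \<Gamma> C \<subseteq> edges C" for \<Gamma> by (auto simp: edges_on_def)
  define s1 where "s1 = (\<Sum>K\<in>C. rK K)"
  define s2 where "s2 = (\<Sum>E\<in>LE. diameter E ^ 3 * (L2norm (arc E) (\<lambda>x. jump_V P C E uh x - g x))\<^sup>2)"
  define s3 where "s3 = (\<Sum>E\<in>interior_edges C - LE. diameter E ^ 3 * (L2norm (arc E) (jump_V P C E uh))\<^sup>2)"
  define s4 where "s4 = (\<Sum>E\<in>interior_edges C. diameter E * (L2norm (arc E) (jump_M P C E uh))\<^sup>2)"
  define s5 where "s5 = (\<Sum>E\<in>edges_on (GammaF P) C. diameter E ^ 3 * (L2norm (arc E) (bdry_V P C E uh))\<^sup>2)"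
  define s6 where "s6 = (\<Sum>E\<in>edges_on (GammaF P) C \<union> edges_on (GammaS P) C. diameter E * (L2norm (arc E) (bdry_M P C E uh))\<^sup>2)"
  have \<eta>: "\<eta> = sqrt (s1 + s2 + s3 + s4 + s5 + s6)"
    unfolding \<eta>_def estimator_def s1_def s2_def s3_def s4_def s5_def s6_def rK_def p_def f_def g_def LE_def ..
  have nonneg: "0 \<le> s1" "0 \<le> s2" "0 \<le> s3" "0 \<le> s4" "0 \<le> s5" "0 \<le> s6"
    unfolding s1_def s2_def s3_def s4_def s5_def s6_def rK_def using LE(1) int_sub on_sub
    by (intro sum_nonneg dL zero_le_mult_iff[THEN iffD2] disjI1 conjI zero_le_even_power zero_le_power2; force)+
  have s1: "sqrt s1 \<le> \<eta>" unfolding \<eta> by (rule real_sqrt_le_mono) (use nonneg in linarith)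
  have "(\<Sum>E\<in>edges C. wV E) \<le> s2 + (s3 + s5)"
  proof -
    let ?r3 = "\<lambda>E. if E \<in> edges_on (GammaF P) C then diameter E ^ 3 * (L2norm (arc E) (bdry_V P C E uh))\<^sup>2 else 0"
    let ?r2 = "\<lambda>E. if E \<in> interior_edges C - LE then diameter E ^ 3 * (L2norm (arc E) (jump_V P C E uh))\<^sup>2 else ?r3 E"
    have r: "0 \<le> ?r3 E" "0 \<le> ?r2 E" if "E \<in> edges C" for E using dL[OF that] by auto
    have "(\<Sum>E\<in>edges C. wV E) \<le> s2 + (\<Sum>E\<in>edges C. ?r2 E)"
      unfolding wV_def s2_def by (rule sum_if_le[OF finite_edges LE(1) r(2)])
    also have "(\<Sum>E\<in>edges C. ?r2 E) \<le> s3 + (\<Sum>E\<in>edges C. ?r3 E)"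
      unfolding s3_def by (rule sum_if_le[OF finite_edges _ r(1)]) (use int_sub in auto)
    also have "(\<Sum>E\<in>edges C. ?r3 E) = s5" unfolding s5_def by (rule sum_if_eq[OF finite_edges on_sub])
    finally show ?thesis by simp
  qed
  then have sV: "sqrt (\<Sum>E\<in>edges C. wV E) \<le> \<eta>" unfolding \<eta> by (intro real_sqrt_le_mono) (use nonneg in linarith)
  have "(\<Sum>E\<in>edges C. wM E) \<le> s4 + s6"
  proof -
    let ?r = "\<lambda>E. if E \<in> edges_on (GammaF P) C \<union> edges_on (GammaS P) C then diameter E * (L2norm (arc E) (bdry_M P C E uh))\<^sup>2 else 0"
    have r: "0 \<le> ?r E" if "E \<in> edges C" for E using dL[OF that] by auto
    have "(\<Sum>E\<in>edges C. wM E) \<le> s4 + (\<Sum>E\<in>edges C. ?r E)"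
      unfolding wM_def s4_def by (rule sum_if_le[OF finite_edges int_sub r])
    also have "(\<Sum>E\<in>edges C. ?r E) = s6" unfolding s6_def by (rule sum_if_eq[OF finite_edges]) (use on_sub in auto)
    finally show ?thesis by simp
  qed
  then have sM: "sqrt (\<Sum>E\<in>edges C. wM E) \<le> \<eta>" unfolding \<eta> by (intro real_sqrt_le_mono) (use nonneg in linarith)
  have \<eta>0: "0 \<le> \<eta>" unfolding \<eta> using nonneg by simp
  have T_sum: "\<bar>\<Sum>K\<in>C. T K\<bar> \<le> \<eta> * sqrt ?S"
  proof -
    have "\<bar>\<Sum>K\<in>C. T K\<bar> \<le> (\<Sum>K\<in>C. sqrt (rK K) * sqrt (B K))"
      by (rule order_trans[OF sum_abs sum_mono[OF T_bound]])
    also have "\<dots> \<le> sqrt (\<Sum>K\<in>C. (sqrt (rK K))\<^sup>2) * sqrt (\<Sum>K\<in>C. (sqrt (B K))\<^sup>2)" by (rule sum_mult_le_sqrt)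
    also have "\<dots> = sqrt s1 * sqrt ?S" using B_nonneg by (simp add: s1_def rK_def)
    also have "\<dots> \<le> \<eta> * sqrt ?S" by (rule mult_right_mono[OF s1]) (use S0 in simp)
    finally show ?thesis .
  qed
  have w0: "0 \<le> wV E" "0 \<le> wM E" if "E \<in> edges C" for E unfolding wV_def wM_def using dL[OF that] by auto
  have CC0: "0 \<le> C_edge \<kappa> * edge_weight E" if "E \<in> edges C" for E
    using that edge_bounds(3) edge_weight_nonneg unfolding edges_def by (auto intro!: mult_nonneg_nonneg)
  have w_sum: "(\<Sum>E\<in>edges C. sqrt (w E) * sqrt (C_edge \<kappa> * edge_weight E)) \<le> \<eta> * (sqrt (3 * C_edge \<kappa>) * sqrt ?S)"
    if w: "\<And>E. E \<in> edges C \<Longrightarrow> 0 \<le> w E" "sqrt (\<Sum>E\<in>edges C. w E) \<le> \<eta>" for w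
  proof -
    have "(\<Sum>E\<in>edges C. sqrt (w E) * sqrt (C_edge \<kappa> * edge_weight E)) \<le> sqrt (\<Sum>E\<in>edges C. (sqrt (w E))\<^sup>2) * sqrt (\<Sum>E\<in>edges C. (sqrt (C_edge \<kappa> * edge_weight E))\<^sup>2)"
      by (rule sum_mult_le_sqrt)
    also have "(\<Sum>E\<in>edges C. (sqrt (w E))\<^sup>2) = (\<Sum>E\<in>edges C. w E)" by (rule sum.cong) (use w(1) in auto)
    also have "(\<Sum>E\<in>edges C. (sqrt (C_edge \<kappa> * edge_weight E))\<^sup>2) = (\<Sum>E\<in>edges C. C_edge \<kappa> * edge_weight E)"
      by (rule sum.cong) (use CC0 in auto)
    also have "(\<Sum>E\<in>edges C. C_edge \<kappa> * edge_weight E) = 3 * C_edge \<kappa> * ?S" unfolding sum_distrib_left[symmetric] sum_edge_weight by simp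
    also have "sqrt (3 * C_edge \<kappa> * ?S) = sqrt (3 * C_edge \<kappa>) * sqrt ?S" by (rule real_sqrt_mult)
    also have "sqrt (\<Sum>E\<in>edges C. w E) * (sqrt (3 * C_edge \<kappa>) * sqrt ?S) \<le> \<eta> * (sqrt (3 * C_edge \<kappa>) * sqrt ?S)"
    proof (cases "C = {}")
      case False
      then obtain K where K: "K \<in> C" by blast
      obtain a b c where "tri K a b c" using triangle[OF K] by blast
      then have "0 \<le> C_edge \<kappa>" using edge_bounds(3)[OF K] tri_edge_iff by blast
      then show ?thesis using S0 by (intro mult_right_mono w(2)) auto
    qed simp
    finally show ?thesis .
  qed
  have R_sum: "\<bar>\<Sum>E\<in>edges C. R E\<bar> \<le> 2 * (\<eta> * (sqrt (3 * C_edge \<kappa>) * sqrt ?S))"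
  proof -
    have "\<bar>\<Sum>E\<in>edges C. R E\<bar> \<le> (\<Sum>E\<in>edges C. sqrt (wV E) * sqrt (C_edge \<kappa> * edge_weight E) + sqrt (wM E) * sqrt (C_edge \<kappa> * edge_weight E))"
      by (rule order_trans[OF sum_abs sum_mono[OF R_bound]])
    then show ?thesis unfolding sum.distrib using w_sum[OF w0(1) sV] w_sum[OF w0(2) sM] by linarith
  qed
  have "\<bar>load_form P L v - bilin P uh v\<bar> \<le> \<eta> * sqrt ?S + 2 * (\<eta> * (sqrt (3 * C_edge \<kappa>) * sqrt ?S))"
    unfolding diff using T_sum R_sum by linarith
  also have "\<dots> = (1 + 2 * sqrt (3 * C_edge \<kappa>)) * (\<eta> * sqrt ?S)" by (simp add: algebra_simps)
  finally show ?thesis unfolding \<eta>_def .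
qed

end

lemma plate_mesh_mesh:
  assumes P: "plate_model P" and M: "plate_mesh P \<kappa> C"
  shows "mesh (Omega P) \<kappa> C"
proof
  show "open (Omega P)" "bounded (Omega P)" using plate_model_domain[OF P] by auto
  show "interior (closure (Omega P)) \<subseteq> Omega P"
    using lipschitz_domain_interior_closure P by (simp add: plate_model_def polygonal_domain_def)
  show "finite C" "\<Union>C = closure (Omega P)" "shape_regular \<kappa> C" using M by (auto simp: plate_mesh_def triangulation_def)
  show "2 simplex K" if "K \<in> C" for K using M that by (auto simp: plate_mesh_def)
  show "K \<inter> K' face_of K" if "K \<in> C" "K' \<in> C" for K K' using M that unfolding plate_mesh_def triangulation_def by blast
qed

lemma H2norm_bounds:
  "0 \<le> H2norm \<Omega> w" "L2norm (lebesgue_on \<Omega>) (whess \<Omega> w) \<le> H2norm \<Omega> w"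
proof -
  show "0 \<le> H2norm \<Omega> w" by (simp add: H2norm_def)
  show "L2norm (lebesgue_on \<Omega>) (whess \<Omega> w) \<le> H2norm \<Omega> w" unfolding H2norm_def by (rule real_le_rsqrt) simp
qed

lemma estimator_nonneg:
  assumes "mesh \<Omega> \<kappa> C" shows "0 \<le> estimator P L C uh"
proof -
  interpret mesh \<Omega> \<kappa> C by (rule assms)
  have d: "0 \<le> diameter E" if "E \<in> edges C" for E using that by (elim edgeE) (simp add: diameter_closed_segment)
  have "0 \<le> diameter E * (q E)\<^sup>2" "0 \<le> diameter E ^ 3 * (q E)\<^sup>2" if "E \<in> edges C" for E and q :: "pt set \<Rightarrow> real"
    using d[OF that] by auto
  then have s: "0 \<le> (\<Sum>E\<in>A. diameter E * (q E)\<^sup>2)" "0 \<le> (\<Sum>E\<in>A. diameter E ^ 3 * (q E)\<^sup>2)"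
    if "A \<subseteq> edges C" for A and q :: "pt set \<Rightarrow> real"
    using that by (meson sum_nonneg subsetD)+
  have K: "0 \<le> (\<Sum>K\<in>C. diameter K ^ 4 * (q K)\<^sup>2)" for q :: "pt set \<Rightarrow> real" by (intro sum_nonneg) simp
  have sub: "interior_edges C \<subseteq> edges C" "line_edges L C \<subseteq> edges C" "interior_edges C - line_edges L C \<subseteq> edges C"
    "edges_on (GammaF P) C \<subseteq> edges C" "edges_on (GammaF P) C \<union> edges_on (GammaS P) C \<subseteq> edges C"
    by (auto simp: line_edges_def interior_edges_def edges_on_def)
  show ?thesis unfolding estimator_def
    by (rule real_sqrt_ge_zero) (rule add_nonneg_nonneg K s sub)+
qed

text \<open>The elementwise \<open>L2\<close> part is the interpolation estimate; the Hessian is controlled by the stability of the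
  interpolation.\<close>

lemma interpolation_error:
  assumes P: "plate_model P" and M: "plate_mesh P \<kappa> C" and I: "interpolates P c C Vh I" and Vh: "Vh \<subseteq> V P" and w: "w \<in> V P"
  defines "v \<equiv> \<lambda>x. indicator (closure (Omega P)) x * (w x - I w x)"
  shows "mesh_function (Omega P) \<kappa> C v" "v \<in> V P"
    "(\<Sum>K\<in>C. mesh_function.B (Omega P) v K) \<le> (\<bar>c\<bar> + (1 + \<bar>c\<bar>)\<^sup>2) * (H2norm (Omega P) w)\<^sup>2"
proof -
  let ?\<Omega> = "Omega P" and ?X = "H2norm (Omega P) w"
  interpret mesh ?\<Omega> \<kappa> C by (rule plate_mesh_mesh[OF P M])
  let ?e = "\<lambda>x. w x - I w x"
  have Iw: "I w \<in> V P" "\<And>x. x \<in> nodes C \<Longrightarrow> I w x = w x" "H2norm ?\<Omega> (I w) \<le> c * ?X" and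
    sums: "(\<Sum>K\<in>C. (L2norm (lebesgue_on K) ?e)\<^sup>2 / diameter K ^ 4)
        + (\<Sum>E\<in>edges C. (L2norm (arc E) (grad_trace ?\<Omega> E ?e))\<^sup>2 / diameter E)
        + (\<Sum>E\<in>edges C. (L2norm (arc E) ?e)\<^sup>2 / diameter E ^ 3) \<le> c * ?X\<^sup>2"
    using I w Vh unfolding interpolates_def Let_def by blast+
  have e: "?e \<in> V P" by (rule V_diff[OF P w Iw(1)])
  have ev: "v x = ?e x" if "x \<in> closure ?\<Omega>" for x using that by (simp add: v_def)
  show vV: "v \<in> V P" by (rule V_cong[OF P e]) (use ev in simp)
  have vm: "v \<in> borel_measurable borel"
    using borel_measurable_continuous_on_indicator[OF _ V_D(2)[OF e]] by (simp add: v_def closure_subset)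
  show mf: "mesh_function ?\<Omega> \<kappa> C v"
  proof
    show "v \<in> H2 ?\<Omega>" "continuous_on (closure ?\<Omega>) v" using V_D(1,2)[OF vV] by auto
    show "v \<in> borel_measurable borel" by (rule vm)
    show "v x = 0" if "x \<in> nodes C" for x using Iw(2)[OF that] by (simp add: v_def)
  qed
  interpret mesh_function ?\<Omega> \<kappa> C v by (rule mf)
  have d: "0 \<le> diameter E" if "E \<in> edges C" for E using that by (elim edgeE) (simp add: diameter_closed_segment)
  have Kv: "L2norm (lebesgue_on K) v = L2norm (lebesgue_on K) ?e" if "K \<in> C" for K
    by (rule L2norm_cong_on) (use that cover ev in blast)
  have "(\<Sum>K\<in>C. (L2norm (lebesgue_on K) v)\<^sup>2 / diameter K ^ 4) = (\<Sum>K\<in>C. (L2norm (lebesgue_on K) ?e)\<^sup>2 / diameter K ^ 4)"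
    by (rule sum.cong) (use Kv in auto)
  moreover have "0 \<le> (\<Sum>E\<in>edges C. (L2norm (arc E) (grad_trace ?\<Omega> E ?e))\<^sup>2 / diameter E)"
    "0 \<le> (\<Sum>E\<in>edges C. (L2norm (arc E) ?e)\<^sup>2 / diameter E ^ 3)"
    by (intro sum_nonneg divide_nonneg_nonneg zero_le_power2 zero_le_power d; assumption)+
  moreover have "c * ?X\<^sup>2 \<le> \<bar>c\<bar> * ?X\<^sup>2" by (rule mult_right_mono) auto
  ultimately have 1: "(\<Sum>K\<in>C. (L2norm (lebesgue_on K) v)\<^sup>2 / diameter K ^ 4) \<le> \<bar>c\<bar> * ?X\<^sup>2" using sums by linarith
  let ?M = "lebesgue_on ?\<Omega>"
  note H = H2D(5)[OF V_D(1)[OF w]] H2D(5)[OF V_D(1)[OF Iw(1)]] H2D(5)[OF V_D(1)[OF vV]]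
  have ae: "AE x in ?M. whess ?\<Omega> v x = whess ?\<Omega> w x - whess ?\<Omega> (I w) x"
  proof -
    have "AE x in ?M. whess ?\<Omega> v x = whess ?\<Omega> ?e x"
      by (rule H2_cong(3)[OF \<Omega> V_D(1)[OF e]]) (use ev closure_subset[of ?\<Omega>] in auto)
    then show ?thesis using H2_diff(3)[OF \<Omega> V_D(1)[OF w] V_D(1)[OF Iw(1)]] by eventually_elim simp
  qed
  have "L2norm ?M (whess ?\<Omega> v) = L2norm ?M (\<lambda>x. whess ?\<Omega> w x - whess ?\<Omega> (I w) x)"
    by (rule L2norm_cong_AE[OF L2_measurable[OF H(3)] L2_measurable[OF L2_diff[OF H(1,2)]] ae])
  also have "\<dots> \<le> L2norm ?M (whess ?\<Omega> w) + L2norm ?M (whess ?\<Omega> (I w))" by (rule L2norm_diff_triangle[OF H(1,2)])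
  also have "\<dots> \<le> ?X + \<bar>c\<bar> * ?X"
  proof (rule add_mono[OF H2norm_bounds(2)])
    have "c * ?X \<le> \<bar>c\<bar> * ?X" using H2norm_bounds(1) by (intro mult_right_mono) auto
    then show "L2norm ?M (whess ?\<Omega> (I w)) \<le> \<bar>c\<bar> * ?X" using H2norm_bounds(2)[of ?\<Omega> "I w"] Iw(3) by linarith
  qed
  finally have "(L2norm ?M (whess ?\<Omega> v))\<^sup>2 \<le> (?X + \<bar>c\<bar> * ?X)\<^sup>2" by (rule power_mono[OF _ L2norm_nonneg])
  also have "\<dots> = (1 + \<bar>c\<bar>)\<^sup>2 * ?X\<^sup>2" by (simp add: power2_eq_square algebra_simps)
  finally have 2: "(\<Sum>K\<in>C. (L2norm (lebesgue_on K) (whess ?\<Omega> v))\<^sup>2) \<le> (1 + \<bar>c\<bar>)\<^sup>2 * ?X\<^sup>2"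
    unfolding L2norm_split[OF H(3)] .
  show "(\<Sum>K\<in>C. B K) \<le> (\<bar>c\<bar> + (1 + \<bar>c\<bar>)\<^sup>2) * ?X\<^sup>2"
    unfolding B_def sum.distrib distrib_right using 1 2 by linarith
qed

theorem theorem3p1:
  fixes P :: plate and \<kappa> c :: real and k :: nat
  assumes "plate_model P" and "coercive P"
  shows "\<exists>C>0. \<forall>\<C> Vh L u uh.
    plate_mesh P \<kappa> \<C> \<and> fe_space P k \<C> Vh \<and> (\<exists>I. interpolates P c \<C> Vh I) \<and>
    plate_loading P L \<and> mesh_fits_loading L \<C> \<and>
    u \<in> V P \<and> (\<forall>v\<in>V P. bilin P u v = load_form P L v) \<and>
    uh \<in> Vh \<and> (\<forall>v\<in>Vh. bilin P uh v = load_form P L v) \<longrightarrow>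
    H2norm (Omega P) (\<lambda>x. u x - uh x) \<le> C * estimator P L \<C> uh"
proof -
  note P = assms(1)
  obtain \<alpha> where \<alpha>: "\<alpha> > 0" "\<And>v. v \<in> V P \<Longrightarrow> \<alpha> * (H2norm (Omega P) v)\<^sup>2 \<le> bilin P v v"
    using assms(2) unfolding coercive_def by blast
  define s where "s = sqrt (\<bar>c\<bar> + (1 + \<bar>c\<bar>)\<^sup>2)"
  define D where "D = (1 + 2 * sqrt (3 * C_edge \<kappa>)) * s / \<alpha>"
  have main: "H2norm (Omega P) (\<lambda>x. u x - uh x) \<le> (\<bar>D\<bar> + 1) * estimator P L \<C> uh"
    if M: "plate_mesh P \<kappa> \<C>" and fe: "fe_space P k \<C> Vh" and I: "interpolates P c \<C> Vh I"
      and L: "plate_loading P L" "mesh_fits_loading L \<C>"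
      and u: "u \<in> V P" "\<And>v. v \<in> V P \<Longrightarrow> bilin P u v = load_form P L v"
      and uh: "uh \<in> Vh" "\<And>v. v \<in> Vh \<Longrightarrow> bilin P uh v = load_form P L v"
    for \<C> Vh L u uh I
  proof -
    let ?\<Omega> = "Omega P"
    define w where "w = (\<lambda>x. u x - uh x)"
    define X where "X = H2norm ?\<Omega> w"
    define \<eta> where "\<eta> = estimator P L \<C> uh"
    have Vh: "Vh \<subseteq> V P" using fe by (simp add: fe_space_def)
    have uhV: "uh \<in> V P" using uh(1) Vh by blast
    have w: "w \<in> V P" unfolding w_def by (rule V_diff[OF P u(1) uhV])
    define v where "v = (\<lambda>x. indicator (closure ?\<Omega>) x * (w x - I w x))"
    have ie: "mesh_function ?\<Omega> \<kappa> \<C> v" "v \<in> V P"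
      "(\<Sum>K\<in>\<C>. mesh_function.B ?\<Omega> v K) \<le> (\<bar>c\<bar> + (1 + \<bar>c\<bar>)\<^sup>2) * (H2norm ?\<Omega> w)\<^sup>2"
      unfolding v_def by (fact interpolation_error[OF P M I Vh w])+
    interpret mesh_function ?\<Omega> \<kappa> \<C> v by (rule ie(1))
    have piece: "smooth (piece uh K) \<and> (\<forall>x\<in>K. piece uh K x = uh x)" if K: "K \<in> \<C>" for K
    proof -
      have "\<forall>v\<in>Vh. C1_closure ?\<Omega> v \<and> (\<forall>K\<in>\<C>. \<exists>p\<in>polys k. \<forall>x\<in>K. v x = p x)"
        using fe unfolding fe_space_def by (elim conjE)
      then have "\<forall>K\<in>\<C>. \<exists>p\<in>polys k. \<forall>x\<in>K. uh x = p x" using uh(1) by simp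
      then obtain p where p: "p \<in> polys k" "\<forall>x\<in>K. uh x = p x" using K by blast
      then have "\<exists>p. (\<exists>k. p \<in> polys k) \<and> (\<forall>x\<in>K. p x = uh x)" by (intro exI[of _ p] conjI exI[of _ k]) auto
      then have "(\<exists>k. piece uh K \<in> polys k) \<and> (\<forall>x\<in>K. piece uh K x = uh x)" unfolding piece_def by (rule someI_ex)
      then show ?thesis by (auto dest: polys_smooth)
    qed
    have IwVh: "I w \<in> Vh" using bspec[OF I[unfolded interpolates_def] w] by simp
    then have Iw: "I w \<in> V P" using Vh by blast
    note H = V_D(1)[OF u(1)] V_D(1)[OF uhV] V_D(1)[OF w] V_D(1)[OF Iw] V_D(1)[OF ie(2)]
    have bw: "bilin P w z = bilin P u z - bilin P uh z" if "z \<in> H2 ?\<Omega>" for z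
      unfolding w_def by (rule bilin_diff(1)[OF P H(1,2) that])
    have orth: "bilin P w (I w) = 0" using bw[OF H(4)] u(2)[OF Iw] uh(2)[OF IwVh] by simp
    have "bilin P w w = bilin P w (\<lambda>x. w x - I w x)" using bilin_diff(2)[OF P H(3,4,3)] orth by simp
    also have "\<dots> = bilin P w v"
      by (rule bilin_cong_right[OF P H(3)])
        (rule V_D(1)[OF V_diff[OF P w Iw]], use closure_subset[of ?\<Omega>] in \<open>auto simp: v_def\<close>)
    also have "\<dots> = load_form P L v - bilin P uh v"
      unfolding bw[OF H(5)] u(2)[OF ie(2)] ..
    also have "\<dots> \<le> (1 + 2 * sqrt (3 * C_edge \<kappa>)) * (\<eta> * sqrt (\<Sum>K\<in>\<C>. B K))"
    proof -
      have "\<bar>load_form P L v - bilin P uh v\<bar> \<le> (1 + 2 * sqrt (3 * C_edge \<kappa>)) * (\<eta> * sqrt (\<Sum>K\<in>\<C>. B K))"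
        unfolding \<eta>_def by (rule residual_bound[OF P refl M ie(2) uhV _ _ L]) (use piece in blast)+
      then show ?thesis by (rule order_trans[OF abs_ge_self])
    qed
    finally have 1: "\<alpha> * X\<^sup>2 \<le> (1 + 2 * sqrt (3 * C_edge \<kappa>)) * (\<eta> * sqrt (\<Sum>K\<in>\<C>. B K))"
      using \<alpha>(2)[OF w] unfolding X_def by linarith
    have \<eta>0: "0 \<le> \<eta>" unfolding \<eta>_def by (rule estimator_nonneg[OF mesh_axioms])
    have X0: "0 \<le> X" unfolding X_def by (rule H2norm_bounds(1))
    have "sqrt (\<Sum>K\<in>\<C>. B K) \<le> sqrt ((\<bar>c\<bar> + (1 + \<bar>c\<bar>)\<^sup>2) * X\<^sup>2)"
      using ie(3) unfolding X_def by (rule real_sqrt_le_mono)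
    also have "\<dots> = s * X" using X0 by (simp add: s_def real_sqrt_mult)
    finally have 2: "sqrt (\<Sum>K\<in>\<C>. B K) \<le> s * X" .
    show ?thesis
    proof (cases "X = 0")
      case True
      then show ?thesis using \<eta>0 unfolding X_def w_def \<eta>_def by simp
    next
      case False
      then have Xp: "0 < X" using X0 by simp
      have "\<C> \<noteq> {}"
      proof
        assume "\<C> = {}"
        then have "closure ?\<Omega> = {}" using cover by simp
        then show False using plate_model_domain(6)[OF P] by simp
      qed
      then obtain K where K: "K \<in> \<C>" by blast
      obtain a b c' where "tri K a b c'" using triangle[OF K] by blast
      then have "0 \<le> C_edge \<kappa>" using edge_bounds(3)[OF K] tri_edge_iff by blast
      then have "(1 + 2 * sqrt (3 * C_edge \<kappa>)) * (\<eta> * sqrt (\<Sum>K\<in>\<C>. B K)) \<le> (1 + 2 * sqrt (3 * C_edge \<kappa>)) * (\<eta> * (s * X))"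
        by (intro mult_left_mono 2 \<eta>0) auto
      then have "(\<alpha> * X) * X \<le> ((1 + 2 * sqrt (3 * C_edge \<kappa>)) * s * \<eta>) * X"
        using 1 by (simp add: power2_eq_square mult_ac)
      then have "\<alpha> * X \<le> (1 + 2 * sqrt (3 * C_edge \<kappa>)) * s * \<eta>" using Xp by (rule mult_right_le_imp_le)
      then have "X \<le> D * \<eta>" using \<alpha>(1) by (simp add: D_def field_simps)
      also have "\<dots> \<le> (\<bar>D\<bar> + 1) * \<eta>" by (rule mult_right_mono[OF _ \<eta>0]) simp
      finally show ?thesis unfolding X_def w_def \<eta>_def .
    qed
  qed
  show ?thesis
  proof (intro exI[of _ "\<bar>D\<bar> + 1"] conjI allI impI)
    show "0 < \<bar>D\<bar> + 1" by simp
    fix \<C> Vh L u uh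
    assume A: "plate_mesh P \<kappa> \<C> \<and> fe_space P k \<C> Vh \<and> (\<exists>I. interpolates P c \<C> Vh I) \<and>
      plate_loading P L \<and> mesh_fits_loading L \<C> \<and>
      u \<in> V P \<and> (\<forall>v\<in>V P. bilin P u v = load_form P L v) \<and>
      uh \<in> Vh \<and> (\<forall>v\<in>Vh. bilin P uh v = load_form P L v)"
    then obtain I where I: "interpolates P c \<C> Vh I" by blast
    show "H2norm (Omega P) (\<lambda>x. u x - uh x) \<le> (\<bar>D\<bar> + 1) * estimator P L \<C> uh"
      by (rule main[OF _ _ I]) (use A in blast)+
  qed
qed

end
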